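(* Suppose that one of the following holds: (a) $H = \mathrm{SO}(f,\mathbb{R})$ and $\Delta = \mathrm{SO}(f,\mathbb{Z})$, where $f$ is a non-degenerate quadratic form with rational coefficients in $n \geq 5$ variables, of $\mathbb{R}$-rank $\geq 2$ and of $\mathbb{Q}$-rank $\geq 1$; (b) $H = \mathrm{SL}(n,\mathbb{R})$, $\Delta = \mathrm{SL}(n,\mathbb{Z})$ and $n \geq 4$. Let $T$ be a maximal $\mathbb{R}$-split torus of $H$ acting on $H/\Delta$ by left multiplication and let $\pi_{\circ}: H \to H/\Delta$, $g \mapsto g\Delta$. Then there exist orbits $T\pi_{\circ}(g)$, $g \in H$, such that $$\overline{T\pi_{\circ}(g)} \setminus T\pi_{\circ}(g) = \bigcup_{i=1}^{4} T\pi_{\circ}(h_i),$$ where $h_i \in H$ and $T\pi_{\circ}(h_i)$, $1 \leq i \leq 4$, are pairwise different, closed, non-compact orbits.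
   Context: For a field $k \in \{\mathbb{Q},\mathbb{R}\}$, the $k$-rank of a non-degenerate quadratic form $f$ is the dimension of a maximal totally isotropic subspace defined over $k$ (equivalently, the $k$-rank of the algebraic group $\mathrm{SO}(f)$). Tori are taken to be connected: a maximal $\mathbb{R}$-split torus of $H$ is understood as the connected component of the identity of the group of real points of a maximal $\mathbb{R}$-split algebraic torus. *)

theory Defs
  imports "HOL-Analysis.Analysis"
begin

subsection \<open>Rational quadratic forms\<close>

text \<open>A quadratic form with rational coefficients is given by an arbitrary (not necessarily
  symmetric) coefficient matrix, and can be evaluated over every field of characteristic zero.
  Fixing the field by a type constraint on the vectors, \<open>quad_form A\<close> is
  the given form over the rationals, the reals or the complex numbers.\<close>

definition quad_form :: "rat^'n^'n \<Rightarrow> ('a::field_char_0)^'n \<Rightarrow> 'a" where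
  "quad_form A x = (\<Sum>i\<in>UNIV. \<Sum>j\<in>UNIV. of_rat (A $ i $ j) * x $ i * x $ j)"

text \<open>The radical of the polar form \<open>f (x + y) - f x - f y\<close> is trivial.\<close>

definition nondegenerate_form :: "(('a::field)^'n \<Rightarrow> 'a) \<Rightarrow> bool" where
  "nondegenerate_form f \<longleftrightarrow> (\<forall>x. (\<forall>y. f (x + y) - f x - f y = 0) \<longrightarrow> x = 0)"

definition totally_isotropic :: "(('a::field)^'n \<Rightarrow> 'a) \<Rightarrow> ('a^'n) set \<Rightarrow> bool" where
  "totally_isotropic f W \<longleftrightarrow> vec.subspace W \<and> (\<forall>x\<in>W. f x = 0)"

text \<open>The rank over the field \<open>'a\<close>: subspaces of \<open>k\<^sup>n\<close> are the subspaces defined over \<open>k\<close>, and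
  by Witt's theorem all maximal totally isotropic ones have the same dimension.\<close>

definition form_rank :: "(('a::field)^'n \<Rightarrow> 'a) \<Rightarrow> nat" where
  "form_rank f = Max (vec.dim ` {W. totally_isotropic f W})"


subsection \<open>Matrix groups\<close>

definition SL :: "(('a::comm_ring_1)^'n^'n) set" where
  "SL = {g. det g = 1}"

definition SO :: "rat^'n^'n \<Rightarrow> (('a::field_char_0)^'n^'n) set" where
  "SO A = {g. det g = 1 \<and> (\<forall>x. quad_form A (g *v x) = quad_form A x)}"

definition integer_points :: "(real^'n^'n) set \<Rightarrow> (real^'n^'n) set" where
  "integer_points H = {g \<in> H. \<forall>i j. g $ i $ j \<in> \<int>}"

definition real_points :: "(complex^'n^'n) set \<Rightarrow> (real^'n^'n) set" where
  "real_points S = {g. map_matrix complex_of_real g \<in> S}"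


subsection \<open>Real algebraic groups and split tori\<close>

text \<open>Algebraic groups are identified with their groups of complex points.
  \<open>matrix_poly K\<close> is the set of polynomial functions in the matrix entries with coefficients
  in \<open>K\<close>.\<close>

inductive_set matrix_poly :: "complex set \<Rightarrow> (complex^'n^'n \<Rightarrow> complex) set"
  for K :: "complex set" where
  const: "c \<in> K \<Longrightarrow> (\<lambda>g. c) \<in> matrix_poly K"
| entry: "(\<lambda>g. g $ i $ j) \<in> matrix_poly K"
| add: "p \<in> matrix_poly K \<Longrightarrow> q \<in> matrix_poly K \<Longrightarrow> (\<lambda>g. p g + q g) \<in> matrix_poly K"
| mult: "p \<in> matrix_poly K \<Longrightarrow> q \<in> matrix_poly K \<Longrightarrow> (\<lambda>g. p g * q g) \<in> matrix_poly K"

definition zariski_topology :: "(complex^'n^'n) topology" where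
  "zariski_topology = topology_generated_by {{g. p g \<noteq> 0} | p. p \<in> matrix_poly UNIV}"

text \<open>An algebraic subgroup of \<open>GL\<^sub>n\<close> defined over the reals. Here \<open>\<real>\<close> is the
  set of real numbers inside the complex numbers.\<close>

definition real_algebraic_group :: "(complex^'n^'n) set \<Rightarrow> bool" where
  "real_algebraic_group S \<longleftrightarrow>
     (\<exists>P \<subseteq> matrix_poly \<real>. S = {g. invertible g \<and> (\<forall>p\<in>P. p g = 0)}) \<and>
     mat 1 \<in> S \<and> (\<forall>g\<in>S. \<forall>h\<in>S. g ** h \<in> S) \<and> (\<forall>g\<in>S. matrix_inv g \<in> S)"

definition real_diagonalizable :: "(complex^'n^'n) set \<Rightarrow> bool" where
  "real_diagonalizable S \<longleftrightarrow>
     (\<exists>q :: real^'n^'n. invertible q \<and>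
        (\<forall>g\<in>S. \<forall>i j. i \<noteq> j \<longrightarrow>
           (map_matrix complex_of_real q ** g ** map_matrix complex_of_real (matrix_inv q)) $ i $ j
             = 0))"

text \<open>An \<open>\<real>\<close>-split algebraic torus is a connected algebraic group over the reals that is
  diagonalizable over the reals.\<close>

definition real_split_torus :: "(complex^'n^'n) set \<Rightarrow> bool" where
  "real_split_torus S \<longleftrightarrow>
     real_algebraic_group S \<and> connectedin zariski_topology S \<and> real_diagonalizable S"

definition maximal_real_split_algebraic_torus ::
    "(complex^'n^'n) set \<Rightarrow> (complex^'n^'n) set \<Rightarrow> bool" where
  "maximal_real_split_algebraic_torus G S \<longleftrightarrow>
     real_split_torus S \<and> S \<subseteq> G \<and> (\<forall>S'. real_split_torus S' \<and> S \<subseteq> S' \<and> S' \<subseteq> G \<longrightarrow> S' = S)"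

text \<open>\<open>G\<close> is the complex algebraic group; the torus itself is the identity component, in the
  usual topology, of the real points of an algebraic torus.\<close>

definition maximal_real_split_torus :: "(complex^'n^'n) set \<Rightarrow> (real^'n^'n) set \<Rightarrow> bool" where
  "maximal_real_split_torus G T \<longleftrightarrow>
     (\<exists>S. maximal_real_split_algebraic_torus G S \<and>
          T = connected_component_set (real_points S) (mat 1))"


subsection \<open>The quotient space and its orbits\<close>

definition coset :: "(real^'n^'n) set \<Rightarrow> real^'n^'n \<Rightarrow> (real^'n^'n) set" where
  "coset \<Delta> g = (\<lambda>d. g ** d) ` \<Delta>"

definition quotient_space :: "(real^'n^'n) set \<Rightarrow> (real^'n^'n) set \<Rightarrow> (real^'n^'n) set topology" where
  "quotient_space H \<Delta> =
     topology (\<lambda>U. U \<subseteq> coset \<Delta> ` H \<and> openin (top_of_set H) {g \<in> H. coset \<Delta> g \<in> U})"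

lemma openin_quotient_space:
  "openin (quotient_space H \<Delta>) U \<longleftrightarrow>
     U \<subseteq> coset \<Delta> ` H \<and> openin (top_of_set H) {g \<in> H. coset \<Delta> g \<in> U}"
proof -
  let ?L = "\<lambda>U. U \<subseteq> coset \<Delta> ` H \<and> openin (top_of_set H) {g \<in> H. coset \<Delta> g \<in> U}"
  have "istopology ?L"
    unfolding istopology_def
  proof (intro conjI allI impI)
    fix U V assume U: "?L U" and V: "?L V"
    have "{g \<in> H. coset \<Delta> g \<in> U \<inter> V} = {g \<in> H. coset \<Delta> g \<in> U} \<inter> {g \<in> H. coset \<Delta> g \<in> V}"
      by blast
    with U V show "openin (top_of_set H) {g \<in> H. coset \<Delta> g \<in> U \<inter> V}"
      by (simp add: openin_Int)
    from U show "U \<inter> V \<subseteq> coset \<Delta> ` H" by blast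
  next
    fix \<U> assume \<U>: "\<forall>U\<in>\<U>. ?L U"
    have "{g \<in> H. coset \<Delta> g \<in> \<Union>\<U>} = \<Union>((\<lambda>U. {g \<in> H. coset \<Delta> g \<in> U}) ` \<U>)"
      by blast
    moreover have "openin (top_of_set H) (\<Union>((\<lambda>U. {g \<in> H. coset \<Delta> g \<in> U}) ` \<U>))"
      using \<U> by (intro openin_Union) auto
    ultimately show "openin (top_of_set H) {g \<in> H. coset \<Delta> g \<in> \<Union>\<U>}" by simp
    from \<U> show "\<Union>\<U> \<subseteq> coset \<Delta> ` H" by blast
  qed
  then show ?thesis by (simp add: quotient_space_def)
qed

lemma topspace_quotient_space: "topspace (quotient_space H \<Delta>) = coset \<Delta> ` H"
proof
  show "topspace (quotient_space H \<Delta>) \<subseteq> coset \<Delta> ` H"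
    using openin_topspace openin_quotient_space by blast
  have "{g \<in> H. coset \<Delta> g \<in> coset \<Delta> ` H} = H" by blast
  then have "openin (quotient_space H \<Delta>) (coset \<Delta> ` H)"
    by (simp add: openin_quotient_space)
  then show "coset \<Delta> ` H \<subseteq> topspace (quotient_space H \<Delta>)"
    by (rule openin_subset)
qed

lemma quotient_map_coset: "quotient_map (top_of_set H) (quotient_space H \<Delta>) (coset \<Delta>)"
  by (auto simp: quotient_map_def topspace_quotient_space openin_quotient_space)

text \<open>As \<open>t (g \<Delta>) = (t g) \<Delta>\<close>, the orbit of \<open>g \<Delta>\<close> under left multiplication by \<open>T\<close> is:\<close>

definition torus_orbit ::
    "(real^'n^'n) set \<Rightarrow> (real^'n^'n) set \<Rightarrow> real^'n^'n \<Rightarrow> (real^'n^'n) set set" where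
  "torus_orbit T \<Delta> g = {coset \<Delta> (t ** g) | t. t \<in> T}"

end

theory Submission
  imports Defs
begin

text \<open>
  Both groups contain a homomorphic image of \<open>SL\<^sub>2 \<times> SL\<^sub>2\<close> in which the integral elements are, up to
  finite index, pairs consisting of a matrix over a real quadratic order and its Galois conjugate. For
  the special linear group this is the restriction of scalars of \<open>SL\<^sub>2\<close> to four-dimensional space. For
  the orthogonal group it is the spin group of a four-dimensional rational subspace of signature
  \<open>(2, 2)\<close> whose discriminant is not a square; the assumptions on the two ranks and on the number of
  variables guarantee that there is one (\<open>rational_basis\<close>). There is a maximal split torus \<open>T\<close> that is
  the product of the diagonal groups of both factors and a part that commutes with both factors.

  An orbit of \<open>T\<close> through a rational point is closed, because \<open>T\<close> is defined by rational equations and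
  the lattice is discrete (\<open>orbit_limit\<close>), and it is stabilized by the diagonal pairs coming from units,
  which Pell's equation provides. Now let \<open>g\<close> be a point which is moved away from a rational
  one by unipotent matrices in the first factor. If one of the two diagonal parameters stays bounded,
  translates of \<open>g\<close> accumulate only on the orbit of \<open>g\<close>. If both degenerate, then according to the
  directions in which they do, one of four decompositions of \<open>g\<close> applies, in each of which a unipotent
  factor is contracted to the identity and what remains lies on a closed orbit. Conversely the
  unit stabilizing that closed orbit can be used to go to infinity in the corresponding direction, so
  that all of it is in the closure. The four closed orbits so obtained are distinct for arithmetic
  reasons: elements of the lattice are pairs of Galois conjugates, and an entry vanishes only together
  with its conjugate. This is \<open>four_boundary_orbits\<close>.

  It remains to pass to an arbitrary maximal split torus. Such a torus is diagonal in a
  basis of eigenvectors, and by maximality it is the full diagonal group in that basis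
  (\<open>maximal_split_torus_SL\<close>, \<open>maximal_split_torus_SO\<close>); for the orthogonal group the basis can be taken
  to consist of hyperbolic pairs and a definite part. By Sylvester's law of inertia any two such bases
  are exchanged by an element of the group, so all maximal split tori are conjugate, and conjugating
  the torus amounts to translating the points.
\<close>

section \<open>Conjugate pairs in a real quadratic field\<close>

text \<open>Up to the denominator \<open>N\<close>, the two numbers are conjugate integers of the order generated by the square root of \<open>d\<close>. The denominator is carried as a parameter because only its boundedness matters.\<close>

definition conj_pair :: "nat => nat => real => real => bool" where
  "conj_pair d N z z' \<longleftrightarrow>
     (\<exists>x y :: int. real N * z = of_int x + of_int y * sqrt (real d) &
           real N * z' = of_int x - of_int y * sqrt (real d))"

lemma conj_pair_int: "conj_pair d N (of_int k) (of_int k)"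
  unfolding conj_pair_def by (rule exI[of _ "int N * k"], rule exI[of _ 0]) simp

lemma conj_pair_0 [simp]: "conj_pair d N 0 0"
  using conj_pair_int[of d N 0] by simp

lemma conj_pair_add:
  assumes "conj_pair d N z z'" "conj_pair d N w w'"
  shows "conj_pair d N (z + w) (z' + w')"
proof -
  obtain x y where "real N * z = of_int x + of_int y * sqrt (real d)"
    "real N * z' = of_int x - of_int y * sqrt (real d)"
    using assms(1) unfolding conj_pair_def by blast
  moreover obtain a b where "real N * w = of_int a + of_int b * sqrt (real d)"
    "real N * w' = of_int a - of_int b * sqrt (real d)"
    using assms(2) unfolding conj_pair_def by blast
  ultimately show ?thesis
    unfolding conj_pair_def
    by (intro exI[of _ "x + a"] exI[of _ "y + b"]) (simp add: algebra_simps)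
qed

lemma conj_pair_mult:
  assumes "conj_pair d N z z'" "conj_pair d M w w'"
  shows "conj_pair d (N * M) (z * w) (z' * w')"
proof -
  obtain x y where 1: "real N * z = of_int x + of_int y * sqrt (real d)"
    "real N * z' = of_int x - of_int y * sqrt (real d)"
    using assms(1) unfolding conj_pair_def by blast
  obtain a b where 2: "real M * w = of_int a + of_int b * sqrt (real d)"
    "real M * w' = of_int a - of_int b * sqrt (real d)"
    using assms(2) unfolding conj_pair_def by blast
  have s: "sqrt (real d) * sqrt (real d) = real d" by simp
  have e1: "real (N * M) * (z * w) = (real N * z) * (real M * w)"
    and e2: "real (N * M) * (z' * w') = (real N * z') * (real M * w')" by simp_all
  have "(of_int x + of_int y * sqrt (real d)) * (of_int a + of_int b * sqrt (real d))
     = of_int x * of_int a + of_int y * of_int b * (sqrt (real d) * sqrt (real d))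
      + (of_int x * of_int b + of_int y * of_int a) * sqrt (real d)"
    by (simp only: algebra_simps)
  moreover have "(of_int x - of_int y * sqrt (real d)) * (of_int a - of_int b * sqrt (real d))
     = of_int x * of_int a + of_int y * of_int b * (sqrt (real d) * sqrt (real d))
      - (of_int x * of_int b + of_int y * of_int a) * sqrt (real d)"
    by (simp only: algebra_simps)
  ultimately show ?thesis
    unfolding conj_pair_def e1 e2 1 2
    by (intro exI[of _ "x * a + y * b * int d"] exI[of _ "x * b + y * a"]) (simp add: s)
qed

lemma conj_pair_mono:
  assumes "conj_pair d N z z'" "N dvd M"
  shows "conj_pair d M z z'"
proof -
  obtain k where M: "M = N * k" using assms(2) by (elim dvdE)
  obtain x y where 1: "real N * z = of_int x + of_int y * sqrt (real d)"
    "real N * z' = of_int x - of_int y * sqrt (real d)"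
    using assms(1) unfolding conj_pair_def by blast
  have e: "real M * z = real k * (real N * z)" "real M * z' = real k * (real N * z')"
    using M by simp_all
  show ?thesis
    unfolding conj_pair_def e 1
    by (intro exI[of _ "int k * x"] exI[of _ "int k * y"]) (simp add: algebra_simps)
qed

lemma conj_pair_sum:
  assumes "!!i. i \<in> A ==> conj_pair d N (f i) (g i)"
  shows "conj_pair d N (sum f A) (sum g A)"
  using assms
proof (induction A rule: infinite_finite_induct)
  case (insert x F)
  then show ?case by (auto intro!: conj_pair_add)
qed auto

lemma conj_pair_sym: "conj_pair d N z z' ==> conj_pair d N z' z"
  unfolding conj_pair_def
proof (elim exE conjE)
  fix x y assume "real N * z = of_int x + of_int y * sqrt (real d)"
    "real N * z' = of_int x - of_int y * sqrt (real d)"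
  then show "\<exists>x y. real N * z' = of_int x + of_int y * sqrt (real d) &
     real N * z = of_int x - of_int y * sqrt (real d)"
    by (intro exI[of _ x] exI[of _ "-y"]) simp
qed

lemma irrational_combination:
  assumes "sqrt (real d) \<notin> \<rat>" "of_int x + of_int y * sqrt (real d) = of_int u + of_int v * sqrt (real d)"
  shows "x = u" "y = v"
proof -
  have "y = v"
  proof (rule ccontr)
    assume "y ~= v"
    have "of_int (y - v) * sqrt (real d) = of_int (u - x)" using assms(2) by (simp add: algebra_simps)
    then have "sqrt (real d) = of_int (u - x) / of_int (y - v)" using \<open>y ~= v\<close> by (simp add: field_simps)
    then show False using assms(1) by (metis Rats_divide Rats_of_int)
  qed
  then show "y = v" "x = u" using assms(2) by auto
qed

lemma conj_pair_self:
  assumes "sqrt (real d) \<notin> \<rat>" "conj_pair d N z z"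
  shows "real N * z \<in> \<int>"
proof -
  obtain x y where 1: "real N * z = of_int x + of_int y * sqrt (real d)"
    "real N * z = of_int x - of_int y * sqrt (real d)"
    using assms(2) unfolding conj_pair_def by blast
  then have "of_int y * sqrt (real d) = 0" by linarith
  then have "real N * z = of_int x" using 1(1) by linarith
  then show ?thesis by simp
qed

lemma conj_pair_zero:
  assumes "sqrt (real d) \<notin> \<rat>" "conj_pair d N 0 z" "N > 0"
  shows "z = 0"
proof -
  obtain x y :: int where 1: "0 = of_int x + of_int y * sqrt (real d)"
    "real N * z = of_int x - of_int y * sqrt (real d)"
    using assms(2) unfolding conj_pair_def by auto
  then have "x = 0" "y = 0" using irrational_combination[OF assms(1), of 0 0 x y] by auto
  then show ?thesis using 1 assms(3) by simp
qed

text \<open>The trace of an element of the order is an integer.\<close>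

lemma conj_pair_trace: 
  assumes "conj_pair d N z z'"
  shows "real N * (z + z') \<in> \<int>"
proof -
  obtain x y where 1: "real N * z = of_int x + of_int y * sqrt (real d)"
    "real N * z' = of_int x - of_int y * sqrt (real d)"
    using assms unfolding conj_pair_def by blast
  then have "real N * (z + z') = of_int (2 * x)" by (simp add: algebra_simps)
  then show ?thesis by (metis Ints_of_int)
qed

text \<open>The Pell equation. It is what makes the closed orbits recur: its powers give infinitely many units in the quadratic order.\<close>

lemma pell_solution:
  fixes D :: nat
  assumes irr: "sqrt (real D) \<notin> \<rat>"
  shows "\<exists>x y :: int. x > 0 & y > 0 & x\<^sup>2 - int D * y\<^sup>2 = 1"
proof -
  define \<theta> where "\<theta> = sqrt (real D)"
  have \<theta>2: "\<theta> * \<theta> = real D" by (simp add: \<theta>_def)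
  have "D ~= 0" using irr by (intro notI) simp
  then have \<theta>1: "\<theta> \<ge> 1" by (simp add: \<theta>_def)
  have nz: "of_int q * \<theta> - of_int p ~= 0" if "q > 0" for p q :: int
  proof
    assume "of_int q * \<theta> - of_int p = 0"
    then have "\<theta> = of_int p / of_int q" using that by (simp add: field_simps)
    then show False using irr by (metis \<theta>_def Rats_divide Rats_of_int)
  qed
  define S where "S = {(p :: int, q :: int). p > 0 & q > 0 & \<bar>of_int q * \<theta> - of_int p\<bar> < 1 / of_int q}"
  have ex: "\<exists>(p, q) \<in> S. \<bar>of_int q * \<theta> - of_int p\<bar> < 1 / real N" if N: "N > 0" for N :: nat
  proof -
    obtain h k where hk: "0 < k" "k \<le> int N" "\<bar>of_int k * \<theta> - of_int h\<bar> < 1 / real N"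
     using Dirichlet_approx[OF N] by metis
    have "1 / real N \<le> 1 / of_int k" using hk N by (simp add: field_simps of_int_le_iff[symmetric, where 'a=real] del: of_int_le_iff)
    moreover have "h > 0"
    proof -
     have "of_int k * \<theta> \<ge> 1" using hk(1) \<theta>1 by (metis mult_mono' mult_1 of_int_1_le_iff int_one_le_iff_zero_less zero_le_one)
     moreover have "1 / real N \<le> 1" using N by simp
     ultimately have "real_of_int h > 0" using hk(3) by linarith
     then show ?thesis by simp
    qed
    ultimately have "(h, k) \<in> S" using hk by (auto simp: S_def)
    with hk(3) show ?thesis by blast
  qed
  have infS: "infinite S"
  proof
    assume fin: "finite S"
    define \<delta> where "\<delta> = Min ((\<lambda>(p, q). \<bar>of_int q * \<theta> - of_int p\<bar>) ` S)"
    have ne: "S ~= {}" using ex[of 1] by auto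
    have "\<delta> \<in> (\<lambda>(p, q). \<bar>of_int q * \<theta> - of_int p\<bar>) ` S"
     unfolding \<delta>_def using fin ne by (intro Min_in) auto
    then have "\<delta> > 0" using nz by (auto simp: S_def)
    then obtain N :: nat where N: "N > 0" "1 / real N < \<delta>"
     by (metis inverse_eq_divide reals_Archimedean zero_less_Suc)
    obtain p q where pq: "(p, q) \<in> S" "\<bar>of_int q * \<theta> - of_int p\<bar> < 1 / real N" using ex[OF N(1)] by auto
    have "\<delta> \<le> \<bar>of_int q * \<theta> - of_int p\<bar>"
     unfolding \<delta>_def using fin pq(1) by (intro Min_le) force+
    with pq N show False by linarith
  qed
  define n where "n = (\<lambda>(p :: int, q :: int). p\<^sup>2 - int D * q\<^sup>2)"
  define B where "B = \<lceil>2 * \<theta> + 1\<rceil>"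
  have real_n: "real_of_int (n (p, q)) = (of_int p - of_int q * \<theta>) * (of_int p + of_int q * \<theta>)" for p q
    by (simp add: n_def algebra_simps power2_eq_square \<theta>2[symmetric])
  have n_nz: "n x ~= 0" and n_bd: "\<bar>n x\<bar> \<le> B" if "x \<in> S" for x
  proof -
    obtain p q where x: "x = (p, q)" by (cases x)
    have pq: "p > 0" "q > 0" "\<bar>of_int q * \<theta> - of_int p\<bar> < 1 / of_int q" using that by (auto simp: S_def x)
    have pos: "of_int p + of_int q * \<theta> > 0" using pq \<theta>1 by (intro add_pos_pos) auto
    have "real_of_int (n x) ~= 0" unfolding x real_n using nz[OF pq(2), of p] pos by simp
    then show "n x ~= 0" by simp
    have q1: "real_of_int q \<ge> 1" using pq(2) by simp
    have "1 / real_of_int q \<le> 1" using q1 by simp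
    then have "of_int p + of_int q * \<theta> \<le> 2 * of_int q * \<theta> + 1" using pq(3) by linarith
    also have "\<dots> \<le> of_int q * (2 * \<theta> + 1)" using q1 by (simp add: algebra_simps)
    finally have le: "of_int p + of_int q * \<theta> \<le> of_int q * (2 * \<theta> + 1)" .
    have "\<bar>real_of_int (n x)\<bar> = \<bar>of_int q * \<theta> - of_int p\<bar> * (of_int p + of_int q * \<theta>)"
     unfolding x real_n using pos by (simp add: abs_mult abs_minus_commute)
    also have "\<dots> \<le> 1 / of_int q * (of_int q * (2 * \<theta> + 1))"
     using pq le pos \<theta>1 by (intro mult_mono) auto
    also have "\<dots> = 2 * \<theta> + 1" using pq by simp
    finally show "\<bar>n x\<bar> \<le> B" unfolding B_def by linarith
  qed
  define F where "F = (\<lambda>x. (n x, fst x mod n x, snd x mod n x))"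
  have "F ` S \<subseteq> {-B..B} \<times> {-B..B} \<times> {-B..B}"
  proof
    fix y assume "y \<in> F ` S"
    then obtain x where x: "x \<in> S" "y = F x" by blast
    have "\<bar>a mod n x\<bar> \<le> B" for a
     using abs_mod_less[OF n_nz[OF x(1)], of a] n_bd[OF x(1)] by linarith
    then have "\<bar>fst x mod n x\<bar> \<le> B" "\<bar>snd x mod n x\<bar> \<le> B" by blast+
    with n_bd[OF x(1)] show "y \<in> {-B..B} \<times> {-B..B} \<times> {-B..B}" by (auto simp: x(2) F_def abs_le_iff)
  qed
  then have "finite (F ` S)" by (rule finite_subset) auto
  from pigeonhole_infinite[OF infS this] obtain x1 where x1: "x1 \<in> S" "infinite {x \<in> S. F x = F x1}" by auto
  have "\<not> {x \<in> S. F x = F x1} \<subseteq> {x1}" using x1(2) finite_subset by blast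
  then obtain x2 where x2: "x2 \<in> S" "F x2 = F x1" "x2 ~= x1" by blast
  obtain p1 q1 where e1: "x1 = (p1, q1)" by (cases x1)
  obtain p2 q2 where e2: "x2 = (p2, q2)" by (cases x2)
  define m where "m = n x1"
  have m0: "m ~= 0" using n_nz[OF x1(1)] by (simp add: m_def)
  have m1: "m = p1\<^sup>2 - int D * q1\<^sup>2" by (simp add: m_def n_def e1)
  have m2: "m = p2\<^sup>2 - int D * q2\<^sup>2" and cp: "p2 mod m = p1 mod m" and cq: "q2 mod m = q1 mod m"
    using x2(2) by (auto simp: m_def n_def e1 e2 F_def)
  obtain a b where a: "p2 = p1 + m * a" and b: "q2 = q1 + m * b"
    using cp cq by (metis mod_eqE add_diff_cancel_left' diff_add_cancel mod_eq_dvd_iff dvdE add.commute)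
  define x y where "x = 1 + a * p1 - int D * q1 * b" and "y = a * q1 - b * p1"
  have X: "p1 * p2 - int D * q1 * q2 = m * x"
    by (subst a, subst b) (simp add: x_def m1 algebra_simps power2_eq_square)
  have Y: "p2 * q1 - p1 * q2 = m * y"
    by (subst a, subst b) (simp add: y_def algebra_simps)
  have "m\<^sup>2 * (x\<^sup>2 - int D * y\<^sup>2) = (p1 * p2 - int D * q1 * q2)\<^sup>2 - int D * (p2 * q1 - p1 * q2)\<^sup>2"
    unfolding X Y by (simp add: algebra_simps power2_eq_square)
  also have "\<dots> = (p1\<^sup>2 - int D * q1\<^sup>2) * (p2\<^sup>2 - int D * q2\<^sup>2)" by (simp add: algebra_simps power2_eq_square)
  also have "\<dots> = m\<^sup>2" by (metis m1 m2 power2_eq_square)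
  finally have sol: "x\<^sup>2 - int D * y\<^sup>2 = 1" using m0 by simp
  have y0: "y ~= 0"
  proof
    assume "y = 0"
    then have eq: "p1 * q2 = p2 * q1" using Y by simp
    have "m * q2\<^sup>2 = (p1 * q2)\<^sup>2 - int D * q1\<^sup>2 * q2\<^sup>2" unfolding m1 by (simp add: algebra_simps power2_eq_square)
    also have "\<dots> = m * q1\<^sup>2" unfolding eq by (subst m2) (simp add: algebra_simps power2_eq_square)
    finally have "q2\<^sup>2 = q1\<^sup>2" using m0 by simp
    moreover have pos: "q1 > 0" "q2 > 0" using x1(1) x2(1) by (auto simp: S_def e1 e2)
    ultimately have "q2 = q1" by (simp add: power2_eq_iff_nonneg)
    with eq pos have "p1 = p2" by simp
    with \<open>q2 = q1\<close> x2(3) show False by (simp add: e1 e2)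
  qed
  have "x ~= 0"
  proof
    assume "x = 0"
    then have "int D * y\<^sup>2 = -1" using sol by simp
    moreover have "int D * y\<^sup>2 \<ge> 0" by simp
    ultimately show False by linarith
  qed
  with sol y0 show ?thesis by (intro exI[of _ "\<bar>x\<bar>"] exI[of _ "\<bar>y\<bar>"]) simp
qed

section \<open>Matrix groups\<close>

named_theorems group_simps

lemma matrix_inv_mult_left [group_simps]: "invertible A ==> matrix_inv A ** A = mat 1"
  and matrix_inv_mult_right [group_simps]: "invertible A ==> A ** matrix_inv A = mat 1"
  for A :: "'a::semiring_1^'n^'n"
  unfolding matrix_inv_def invertible_def by (metis (mono_tags, lifting) someI_ex)+

lemma matrix_inv_unique:
  fixes A :: "'a::field^'n^'n"
  assumes "A ** B = mat 1"
  shows "matrix_inv A = B"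
proof -
  have "invertible A" using assms by (metis invertible_def matrix_left_right_inverse)
  then have "matrix_inv A ** (A ** B) = B" by (simp add: matrix_mul_assoc matrix_inv_mult_left)
  then show ?thesis using assms by simp
qed

lemma matrix_cancel [group_simps]:
  assumes "invertible (A :: 'a::field^'n^'n)"
  shows "matrix_inv A ** (A ** B) = B" "A ** (matrix_inv A ** B) = B"
  using assms by (simp_all add: matrix_mul_assoc group_simps)

lemma invertible_matrix_inv [group_simps]: "invertible A ==> invertible (matrix_inv A)"
  for A :: "'a::field^'n^'n"
  by (metis invertible_def matrix_inv_mult_left matrix_inv_mult_right)

lemma matrix_inv_matrix_inv [group_simps]: "invertible A ==> matrix_inv (matrix_inv A) = A"
  for A :: "'a::field^'n^'n"
  by (rule matrix_inv_unique) (simp add: group_simps)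

lemma matrix_inv_mult [group_simps]:
  fixes A B :: "'a::field^'n^'n"
  assumes "invertible A" "invertible B"
  shows "matrix_inv (A ** B) = matrix_inv B ** matrix_inv A"
  by (rule matrix_inv_unique) (use assms in \<open>simp add: matrix_mul_assoc[symmetric] group_simps\<close>)

lemma invertible_mat_1 [group_simps]: "invertible (mat 1 :: 'a::field^'n^'n)"
  unfolding invertible_def by (rule exI[of _ "mat 1"]) simp

lemma matrix_inv_mat_1 [simp]: "matrix_inv (mat 1 :: 'a::field^'n^'n) = mat 1"
  by (rule matrix_inv_unique) simp

lemmas invertible_mult' [group_simps] = invertible_mult
lemmas matrix_mul_assoc_right [group_simps] = matrix_mul_assoc[symmetric]

lemma matrix_mult_scaleR:
  fixes A B :: "real^'n^'n"
  shows "A ** (c *\<^sub>R B) = c *\<^sub>R (A ** B)" "(c *\<^sub>R A) ** B = c *\<^sub>R (A ** B)"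
  by (simp_all add: matrix_matrix_mult_def vec_eq_iff sum_distrib_left mult_ac)

lemma matrix_inv_component:
  fixes A :: "'a::field^'n^'n"
  assumes "det A ~= 0"
  shows "matrix_inv A $ k $ j = det (\<chi> i l. if l = k then axis j 1 $ i else A $ i $ l) / det A"
proof -
  have "invertible A" using assms by (simp add: invertible_det_nz)
  then have "A *v (matrix_inv A *v axis j 1) = axis j 1"
    by (simp add: matrix_vector_mul_assoc matrix_inv_mult_right)
  then have "matrix_inv A *v axis j 1 = (\<chi> k. det (\<chi> i l. if l = k then axis j 1 $ i else A $ i $ l) / det A)"
    using cramer[OF assms] by blast
  then have "(matrix_inv A *v axis j 1) $ k = (\<chi> k. det (\<chi> i l. if l = k then axis j 1 $ i else A $ i $ l) / det A) $ k"
    by (rule arg_cong)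
  then show ?thesis by (simp add: matrix_vector_mult_def axis_def if_distrib cong: if_cong)
qed

lemma tendsto_det:
  fixes f :: "'b => real^'n^'n"
  assumes "(f \<longlongrightarrow> A) F"
  shows "((\<lambda>x. det (f x)) \<longlongrightarrow> det A) F"
  unfolding det_def
  by (intro tendsto_sum tendsto_mult tendsto_prod tendsto_vec_nth assms tendsto_const)

lemma tendsto_matrix_mult:
  fixes f g :: "'b => real^'n^'n"
  assumes "(f \<longlongrightarrow> A) F" "(g \<longlongrightarrow> B) F"
  shows "((\<lambda>x. f x ** g x) \<longlongrightarrow> A ** B) F"
proof (intro vec_tendstoI)
  fix i j
  show "((\<lambda>x. (f x ** g x) $ i $ j) \<longlongrightarrow> (A ** B) $ i $ j) F"
    unfolding matrix_matrix_mult_def vec_lambda_beta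
    by (intro tendsto_sum tendsto_mult tendsto_vec_nth assms)
qed

lemma tendsto_matrix_vector_mult:
  fixes f :: "'b => real^'n^'n"
  assumes "(f \<longlongrightarrow> A) F"
  shows "((\<lambda>x. f x *v v) \<longlongrightarrow> A *v v) F"
proof (intro vec_tendstoI)
  fix i
  show "((\<lambda>x. (f x *v v) $ i) \<longlongrightarrow> (A *v v) $ i) F"
    unfolding matrix_vector_mult_def vec_lambda_beta
    by (intro tendsto_sum tendsto_mult tendsto_vec_nth assms tendsto_const)
qed

lemma tendsto_matrix_inv:
  fixes f :: "'b => real^'n^'n"
  assumes "(f \<longlongrightarrow> A) F" "det A ~= 0" "!!x. det (f x) ~= 0"
  shows "((\<lambda>x. matrix_inv (f x)) \<longlongrightarrow> matrix_inv A) F"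
proof (intro vec_tendstoI)
  fix k j
  have "((\<lambda>x. (\<chi> i l. if l = k then axis j 1 $ i else f x $ i $ l) :: real^'n^'n) \<longlongrightarrow>
     (\<chi> i l. if l = k then axis j 1 $ i else A $ i $ l)) F"
    by (intro vec_tendstoI) (auto intro!: tendsto_intros assms)
  then show "((\<lambda>x. matrix_inv (f x) $ k $ j) \<longlongrightarrow> matrix_inv A $ k $ j) F"
    unfolding matrix_inv_component[OF assms(2)] matrix_inv_component[OF assms(3)]
    by (intro tendsto_divide tendsto_det assms)
qed

lemma continuous_on_matrix_mult [continuous_intros]:
  fixes f g :: "'b::topological_space => real^'n^'n"
  assumes "continuous_on S f" "continuous_on S g"
  shows "continuous_on S (\<lambda>x. f x ** g x)"
  using assms unfolding continuous_on_def by (auto intro: tendsto_matrix_mult)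

lemma det_in_Ints: "(!!i j. A $ i $ j \<in> \<int>) ==> det A \<in> \<int>" for A :: "real^'n^'n"
  unfolding det_def by (intro Ints_sum Ints_mult Ints_prod) auto

lemma det_in_Rats: "(!!i j. A $ i $ j \<in> \<rat>) ==> det A \<in> \<rat>" for A :: "real^'n^'n"
  unfolding det_def
  by (intro Rats_sum Rats_mult) (auto intro: Rats_prod)

definition integer_matrix :: "real^'n^'n => bool" where
  "integer_matrix A \<longleftrightarrow> (\<forall>i j. A $ i $ j \<in> \<int>)"

definition rational_matrix :: "real^'n^'n => bool" where
  "rational_matrix A \<longleftrightarrow> (\<forall>i j. A $ i $ j \<in> \<rat>)"

lemma integer_matrix_mult: "integer_matrix A ==> integer_matrix B ==> integer_matrix (A ** B)"
  unfolding integer_matrix_def matrix_matrix_mult_def by (auto intro!: Ints_sum Ints_mult)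

lemma rational_matrix_mult: "rational_matrix A ==> rational_matrix B ==> rational_matrix (A ** B)"
  unfolding rational_matrix_def matrix_matrix_mult_def by (auto intro!: Rats_sum Rats_mult)

lemma integer_matrix_inv:
  assumes "integer_matrix A" "det A = 1"
  shows "integer_matrix (matrix_inv A)"
  unfolding integer_matrix_def
proof (intro allI)
  fix k j
  have "det A ~= 0" using assms by simp
  from matrix_inv_component[OF this, of k j] assms
  have "matrix_inv A $ k $ j = det (\<chi> i l. if l = k then axis j 1 $ i else A $ i $ l)" by simp
  also have "\<dots> \<in> \<int>"
    by (rule det_in_Ints) (use assms in \<open>auto simp: integer_matrix_def axis_def\<close>)
  finally show "matrix_inv A $ k $ j \<in> \<int>" .
qed

lemma rational_matrix_inv:
  assumes "rational_matrix A" "invertible A"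
  shows "rational_matrix (matrix_inv A)"
  unfolding rational_matrix_def
proof (intro allI)
  fix k j
  have "det A ~= 0" using assms by (simp add: invertible_det_nz)
  from matrix_inv_component[OF this, of k j] assms
  have "matrix_inv A $ k $ j = det (\<chi> i l. if l = k then axis j 1 $ i else A $ i $ l) / det A" by simp
  also have "\<dots> \<in> \<rat>"
    by (intro Rats_divide det_in_Rats) (use assms in \<open>auto simp: rational_matrix_def axis_def\<close>)
  finally show "matrix_inv A $ k $ j \<in> \<rat>" .
qed

lemma common_denominator:
  assumes "finite I" "!!i. i \<in> I ==> f i \<in> \<rat>"
  shows "\<exists>N::nat. N > 0 & (\<forall>i\<in>I. real N * f i \<in> \<int>)"
  using assms
proof (induction I)
  case empty
  then show ?case by (intro exI[of _ 1]) simp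
next
  case (insert x F)
  then obtain N where N: "N > 0" "!!i. i \<in> F ==> real N * f i \<in> \<int>" by auto
  have "f x \<in> \<rat>" using insert by simp
  then obtain a b where ab: "b > 0" "f x = of_int a / of_int b" by (rule Rats_cases') auto
  then have b: "real (nat b) * f x = of_int a" by simp
  have "real (N * nat b) * f x = real N * (real (nat b) * f x)" by simp
  then have "real (N * nat b) * f x \<in> \<int>" unfolding b by (metis Ints_mult Ints_of_int Ints_of_nat)
  moreover have "real (N * nat b) * f i \<in> \<int>" if "i \<in> F" for i
  proof -
    have "real (N * nat b) * f i = real (nat b) * (real N * f i)" by simp
    then show ?thesis using N(2)[OF that] by (metis Ints_mult Ints_of_nat)
  qed
  ultimately show ?case using N ab by (intro exI[of _ "N * nat b"]) auto
qed

lemma rational_matrix_denominator: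
  assumes "rational_matrix A"
  obtains N :: nat where "N > 0" "!!i j. real N * A $ i $ j \<in> \<int>"
proof -
  have "\<exists>N::nat. N > 0 & (\<forall>p\<in>UNIV. real N * (\<lambda>(i, j). A $ i $ j) p \<in> \<int>)"
    using assms by (intro common_denominator) (auto simp: rational_matrix_def)
  then show ?thesis using that by auto
qed

text \<open>Convergent sequences in a lattice are eventually constant.\<close>

lemma Ints_tendsto_eventually:
  fixes f :: "nat => real"
  assumes "f \<longlonglongrightarrow> l" "!!k. real N * f k \<in> \<int>" "N > 0"
  shows "\<forall>\<^sub>F k in sequentially. f k = l"
proof -
  have "(\<lambda>k. real N * f k) \<longlonglongrightarrow> real N * l" using assms by (intro tendsto_intros)
  then have "\<forall>\<^sub>F k in sequentially. dist (real N * f k) (real N * l) < 1/2" by (rule tendstoD) simp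
  then obtain K where K: "!!k. k \<ge> K ==> dist (real N * f k) (real N * l) < 1/2"
    by (auto simp: eventually_sequentially)
  have "f k = f K" if "k \<ge> K" for k
  proof -
    have "dist (real N * f k) (real N * f K) < 1"
     using dist_triangle_half_r[of "real N * l" "real N * f k" 1 "real N * f K"] K[OF that] K[of K]
     by (simp add: dist_commute)
    moreover obtain a b where "real N * f k = of_int a" "real N * f K = of_int b"
     using assms(2) by (metis Ints_cases)
    ultimately have "real N * f k = real N * f K" by (simp add: dist_real_def)
    then show ?thesis using assms(3) by simp
  qed
  then have ev: "\<forall>\<^sub>F k in sequentially. f k = f K" by (rule eventually_sequentiallyI)
  then have "f \<longlonglongrightarrow> f K" by (rule tendsto_eventually)
  then have "l = f K" using assms(1) LIMSEQ_unique by blast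
  with ev show ?thesis by simp
qed

lemma integral_vectors_tendsto_eventually:
  fixes f :: "nat => real^'n"
  assumes "f \<longlonglongrightarrow> l" "!!k i. real N * f k $ i \<in> \<int>" "N > 0"
  shows "\<forall>\<^sub>F k in sequentially. f k = l"
proof -
  have "\<forall>\<^sub>F k in sequentially. \<forall>i. f k $ i = l $ i"
    by (intro eventually_all_finite allI Ints_tendsto_eventually[where N=N]
      tendsto_vec_nth assms)
  then show ?thesis by (simp add: vec_eq_iff)
qed

lemma integral_matrices_tendsto_eventually:
  fixes f :: "nat => real^'n^'n"
  assumes "f \<longlonglongrightarrow> l" "!!k i j. real N * f k $ i $ j \<in> \<int>" "N > 0"
  shows "\<forall>\<^sub>F k in sequentially. f k = l"
proof -
  have "\<forall>\<^sub>F k in sequentially. f k $ i = l $ i" for i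
    using integral_vectors_tendsto_eventually[OF tendsto_vec_nth[OF assms(1)] assms(2,3)] .
  then have "\<forall>\<^sub>F k in sequentially. \<forall>i. f k $ i = l $ i" by (rule eventually_all_finite)
  then show ?thesis by (simp add: vec_eq_iff)
qed

section \<open>Orbits of tori defined over the rationals\<close>

locale matrix_group =
  fixes H :: "(real^'n^'n) set"
  assumes one_H: "mat 1 \<in> H"
    and mult_H: "g \<in> H ==> h \<in> H ==> g ** h \<in> H"
    and det_H: "g \<in> H ==> det g = 1"
    and inv_H: "g \<in> H ==> matrix_inv g \<in> H"
begin

lemma invertible_H: "g \<in> H ==> invertible g"
  using det_H by (simp add: invertible_det_nz)

abbreviation "\<Delta> \<equiv> integer_points H"

lemma Delta_iff: "\<delta> \<in> \<Delta> \<longleftrightarrow> \<delta> \<in> H & integer_matrix \<delta>"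
  by (auto simp: integer_points_def integer_matrix_def)

lemma one_Delta: "mat 1 \<in> \<Delta>"
  using one_H by (simp add: Delta_iff integer_matrix_def) (simp add: mat_def)

lemma mult_Delta: "\<delta> \<in> \<Delta> ==> \<delta>' \<in> \<Delta> ==> \<delta> ** \<delta>' \<in> \<Delta>"
  by (simp add: Delta_iff mult_H integer_matrix_mult)

lemma inv_Delta: "\<delta> \<in> \<Delta> ==> matrix_inv \<delta> \<in> \<Delta>"
  by (simp add: Delta_iff inv_H integer_matrix_inv det_H)

lemma Delta_H: "\<delta> \<in> \<Delta> ==> \<delta> \<in> H" by (simp add: Delta_iff)

lemma invertible_Delta: "\<delta> \<in> \<Delta> ==> invertible \<delta>" by (simp add: Delta_iff invertible_H)

end

text \<open>\<open>T\<close> is, near the identity, the set of elements of \<open>H\<close> commuting with the rational matrices in \<open>XS\<close> and fixing the rational vectors in \<open>WS\<close>. This is how rationality of a torus enters.\<close>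

locale rational_torus = matrix_group H
  for H :: "(real^'n^'n) set" +
  fixes T :: "(real^'n^'n) set" and XS :: "(real^'n^'n) set" and WS :: "(real^'n) set"
  assumes T_H: "T \<subseteq> H"
    and one_T: "mat 1 \<in> T"
    and mult_T: "s \<in> T ==> t \<in> T ==> s ** t \<in> T"
    and inv_T: "t \<in> T ==> matrix_inv t \<in> T"
    and finite_XS: "finite XS" and rational_XS: "X \<in> XS ==> rational_matrix X"
    and finite_WS: "finite WS" and rational_WS: "w \<in> WS ==> w $ i \<in> \<rat>"
    and XS_T: "t \<in> T ==> X \<in> XS ==> t ** X = X ** t"
    and WS_T: "t \<in> T ==> w \<in> WS ==> t *v w = w"
    and T_local: "\<exists>e>0. \<forall>z\<in>H. dist z (mat 1) < e --> (\<forall>X\<in>XS. z ** X = X ** z) -->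
            (\<forall>w\<in>WS. z *v w = w) --> z \<in> T"
begin

lemma inH: "t \<in> T ==> t \<in> H" using T_H by blast

text \<open>Why an orbit through a rational point is closed. If \<open>t k ** \<gamma> ** \<delta> k\<close> converges, the conjugates of the rational matrices by the lattice elements converge and have bounded denominators, so they are eventually constant; hence quotients of the \<open>\<delta> k\<close> centralize \<open>XS\<close> and lie in a conjugate of \<open>T\<close>.\<close>

lemma orbit_limit:
  assumes g: "\<gamma> \<in> H" "rational_matrix \<gamma>"
    and t: "!!k. t k \<in> T" and \<delta>: "!!k. \<delta> k \<in> \<Delta>"
    and lim: "(\<lambda>k::nat. t k ** \<gamma> ** \<delta> k) \<longlonglongrightarrow> h" and h: "h \<in> H"
  obtains z \<delta>' where "z \<in> T" "\<delta>' \<in> \<Delta>" "h = z ** \<gamma> ** \<delta>'"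
    "\<forall>\<^sub>F k in sequentially. \<gamma> ** \<delta> k ** matrix_inv \<delta>' ** matrix_inv \<gamma> \<in> T"
proof -
  define hk where "hk k = t k ** \<gamma> ** \<delta> k" for k
  have hkH: "hk k \<in> H" for k unfolding hk_def using t \<delta> g inH Delta_H by (intro mult_H) auto
  note inv = invertible_H[OF g(1)] invertible_Delta[OF \<delta>] invertible_H[OF inH[OF t]]
    invertible_H[OF h] invertible_H[OF hkH]
  have hk: "hk \<longlonglongrightarrow> h" using lim unfolding hk_def[abs_def] .
  have hki: "(\<lambda>k. matrix_inv (hk k)) \<longlonglongrightarrow> matrix_inv h"
    by (rule tendsto_matrix_inv[OF hk]) (use det_H h hkH in auto)
  have Xconst: "\<forall>\<^sub>F k in sequentially. \<forall>X\<in>XS. matrix_inv (\<delta> k) ** (matrix_inv \<gamma> ** X ** \<gamma>) ** \<delta> k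
     = matrix_inv h ** X ** h"
  proof (intro eventually_ball_finite finite_XS ballI)
    fix X assume X: "X \<in> XS"
    define X' where "X' = matrix_inv \<gamma> ** X ** \<gamma>"
    have "rational_matrix X'"
     unfolding X'_def using X g rational_XS inv by (intro rational_matrix_mult rational_matrix_inv) auto
    then obtain N where N: "N > 0" "!!i j. real N * X' $ i $ j \<in> \<int>" using rational_matrix_denominator by blast
    have tX: "matrix_inv (t k) ** (X ** (t k ** Y)) = X ** Y"
     for k and Y :: "real^'n^'n"
    proof -
     have "X ** (t k ** Y) = t k ** (X ** Y)" by (metis XS_T[OF t X] matrix_mul_assoc)
     then show ?thesis using inv by (simp add: group_simps)
    qed
    have e: "matrix_inv (hk k) ** X ** hk k = matrix_inv (\<delta> k) ** X' ** \<delta> k" for k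
     unfolding hk_def X'_def using inv tX by (simp add: group_simps)
    have "(\<lambda>k. matrix_inv (hk k) ** X ** hk k) \<longlonglongrightarrow> matrix_inv h ** X ** h"
     by (intro tendsto_matrix_mult hk hki tendsto_const)
    then have "(\<lambda>k. matrix_inv (\<delta> k) ** X' ** \<delta> k) \<longlonglongrightarrow> matrix_inv h ** X ** h" by (simp add: e)
    moreover have "real N * (matrix_inv (\<delta> k) ** X' ** \<delta> k) $ i $ j \<in> \<int>" for k i j
    proof -
     have "integer_matrix (real N *\<^sub>R X')" using N by (simp add: integer_matrix_def)
     then have "integer_matrix (matrix_inv (\<delta> k) ** (real N *\<^sub>R X') ** \<delta> k)"
      using \<delta>[of k] inv_Delta[OF \<delta>[of k]] by (intro integer_matrix_mult) (auto simp: Delta_iff)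
     moreover have "matrix_inv (\<delta> k) ** (real N *\<^sub>R X') ** \<delta> k = real N *\<^sub>R (matrix_inv (\<delta> k) ** X' ** \<delta> k)"
      by (simp add: matrix_mult_scaleR)
     ultimately show ?thesis by (simp add: integer_matrix_def)
    qed
    ultimately show "\<forall>\<^sub>F k in sequentially. matrix_inv (\<delta> k) ** (matrix_inv \<gamma> ** X ** \<gamma>) ** \<delta> k
      = matrix_inv h ** X ** h"
     unfolding X'_def[symmetric] using N(1) by (rule integral_matrices_tendsto_eventually)
  qed
  have Wconst: "\<forall>\<^sub>F k in sequentially. \<forall>w\<in>WS. matrix_inv (\<delta> k) *v (matrix_inv \<gamma> *v w) = matrix_inv h *v w"
  proof (intro eventually_ball_finite finite_WS ballI)
    fix w assume w: "w \<in> WS"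
    define w' where "w' = matrix_inv \<gamma> *v w"
    have "\<exists>N::nat. N > 0 & (\<forall>i\<in>UNIV. real N * w' $ i \<in> \<int>)"
     unfolding w'_def matrix_vector_mult_def
     using rational_matrix_inv[OF g(2) inv(1)] rational_WS[OF w]
     by (intro common_denominator) (auto intro!: Rats_sum Rats_mult simp: rational_matrix_def)
    then obtain N where N: "N > 0" "!!i. real N * w' $ i \<in> \<int>" by auto
    have tw: "matrix_inv (t k) *v w = w" for k
     using WS_T[OF inv_T[OF t] w] .
    have e: "matrix_inv (hk k) *v w = matrix_inv (\<delta> k) *v w'" for k
     unfolding hk_def w'_def using inv tw
     by (simp add: matrix_inv_mult invertible_mult' matrix_vector_mul_assoc[symmetric])
    have "(\<lambda>k. matrix_inv (hk k) *v w) \<longlonglongrightarrow> matrix_inv h *v w"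
     by (intro tendsto_matrix_vector_mult hki)
    then have "(\<lambda>k. matrix_inv (\<delta> k) *v w') \<longlonglongrightarrow> matrix_inv h *v w" by (simp add: e)
    moreover have "real N * (matrix_inv (\<delta> k) *v w') $ i \<in> \<int>" for k i
    proof -
     have "real N * (matrix_inv (\<delta> k) *v w') $ i = (\<Sum>j\<in>UNIV. matrix_inv (\<delta> k) $ i $ j * (real N * w' $ j))"
      by (simp add: matrix_vector_mult_def sum_distrib_left mult_ac)
     also have "\<dots> \<in> \<int>"
      by (rule Ints_sum, rule Ints_mult)
       (use inv_Delta[OF \<delta>[of k]] N in \<open>auto simp: Delta_iff integer_matrix_def\<close>)
     finally show ?thesis .
    qed
    ultimately show "\<forall>\<^sub>F k in sequentially. matrix_inv (\<delta> k) *v (matrix_inv \<gamma> *v w) = matrix_inv h *v w"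
     unfolding w'_def[symmetric] using N(1) by (rule integral_vectors_tendsto_eventually)
  qed
  \<comment> \<open>So \<open>hk k ** matrix_inv h\<close> centralizes eventually, and tends to one.\<close>
  obtain e where e: "e > 0" "!!z. z \<in> H ==> dist z (mat 1) < e ==> (\<forall>X\<in>XS. z ** X = X ** z) ==>
     (\<forall>w\<in>WS. z *v w = w) ==> z \<in> T" using T_local by blast
  have "(\<lambda>k. hk k ** matrix_inv h) \<longlonglongrightarrow> h ** matrix_inv h"
    by (intro tendsto_matrix_mult hk tendsto_const)
  then have "(\<lambda>k. hk k ** matrix_inv h) \<longlonglongrightarrow> mat 1" using inv by (simp add: group_simps)
  then have "\<forall>\<^sub>F k in sequentially. dist (hk k ** matrix_inv h) (mat 1) < e" using e(1) by (rule tendstoD)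
  then have "\<forall>\<^sub>F k in sequentially. hk k ** matrix_inv h \<in> T"
    using Xconst Wconst
  proof eventually_elim
    case (elim k)
    have "hk k ** matrix_inv h \<in> H" by (intro mult_H hkH inv_H h)
    moreover have "hk k ** matrix_inv h ** X = X ** (hk k ** matrix_inv h)" if X: "X \<in> XS" for X
    proof -
     have "hk k ** (matrix_inv (\<delta> k) ** (matrix_inv \<gamma> ** X ** \<gamma>) ** \<delta> k) ** matrix_inv h
      = t k ** X ** \<gamma> ** \<delta> k ** matrix_inv h"
      unfolding hk_def using inv by (simp add: group_simps)
     also have "\<dots> = X ** (hk k ** matrix_inv h)"
      unfolding hk_def XS_T[OF t X] by (simp add: group_simps)
     finally show ?thesis
      unfolding bspec[OF elim(2) X] using inv by (simp add: group_simps)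
    qed
    moreover have "hk k ** matrix_inv h *v w = w" if w: "w \<in> WS" for w
    proof -
     have "hk k ** matrix_inv h *v w = hk k *v (matrix_inv h *v w)" by (simp add: matrix_vector_mul_assoc)
     also have "\<dots> = hk k *v (matrix_inv (\<delta> k) *v (matrix_inv \<gamma> *v w))" using elim(3) w by simp
     also have "\<dots> = t k *v w" unfolding hk_def using inv by (simp add: matrix_vector_mul_assoc group_simps)
     finally show ?thesis using WS_T[OF t w] by simp
    qed
    ultimately show ?case using e(2) elim(1) by blast
  qed
  then obtain K where K: "!!k. k \<ge> K ==> hk k ** matrix_inv h \<in> T" by (auto simp: eventually_sequentially)
  define z where "z = matrix_inv (hk K ** matrix_inv h) ** t K"
  have zT: "z \<in> T" unfolding z_def by (intro mult_T inv_T K t) simp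
  have hz: "h = z ** \<gamma> ** \<delta> K"
    unfolding z_def hk_def using inv by (simp add: group_simps)
  have "\<gamma> ** \<delta> k ** matrix_inv (\<delta> K) ** matrix_inv \<gamma> \<in> T" if "k \<ge> K" for k
  proof -
    have "matrix_inv (t k) ** (hk k ** matrix_inv h) ** z \<in> T" by (intro mult_T inv_T K t zT that)
    moreover have "matrix_inv (t k) ** (hk k ** matrix_inv h) ** z = \<gamma> ** \<delta> k ** matrix_inv (\<delta> K) ** matrix_inv \<gamma>"
    proof -
     have "matrix_inv h = matrix_inv (\<delta> K) ** matrix_inv \<gamma> ** matrix_inv z"
      unfolding hz using inv invertible_H[OF inH[OF zT]] by (simp add: group_simps)
     then show ?thesis unfolding hk_def using inv invertible_H[OF inH[OF zT]] by (simp add: group_simps)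
    qed
    ultimately show ?thesis by simp
  qed
  then have "\<forall>\<^sub>F k in sequentially. \<gamma> ** \<delta> k ** matrix_inv (\<delta> K) ** matrix_inv \<gamma> \<in> T"
    by (auto simp: eventually_sequentially)
  with that zT hz \<delta> show ?thesis by blast
qed

end

section \<open>Two by two matrices\<close>

definition mat2 :: "real => real => real => real => real^2^2" where
  "mat2 a b c d = vector [vector [a, b], vector [c, d]]"

lemma mat2_nth [simp]:
  "mat2 a b c d $ 1 $ 1 = a" "mat2 a b c d $ 1 $ 2 = b" "mat2 a b c d $ 2 $ 1 = c" "mat2 a b c d $ 2 $ 2 = d"
  by (simp_all add: mat2_def)

lemma mat2_eta: "m = mat2 (m $ 1 $ 1) (m $ 1 $ 2) (m $ 2 $ 1) (m $ 2 $ 2)"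
  by (simp add: vec_eq_iff forall_2)

lemma mat2_eq_iff: "mat2 a b c d = mat2 a' b' c' d' \<longleftrightarrow> a = a' & b = b' & c = c' & d = d'"
  by (auto simp: vec_eq_iff forall_2)

lemma mat2_mult [simp]:
  "mat2 a b c d ** mat2 a' b' c' d' = mat2 (a*a' + b*c') (a*b' + b*d') (c*a' + d*c') (c*b' + d*d')"
  by (simp add: vec_eq_iff forall_2 matrix_matrix_mult_def sum_2)

lemma mat_1_mat2: "mat 1 = mat2 1 0 0 1"
  by (simp add: vec_eq_iff forall_2 mat_def)

lemma det_mat2 [simp]: "det (mat2 a b c d) = a * d - b * c"
  by (simp add: det_2)

lemma mat2_SL [simp]: "mat2 a b c d \<in> SL \<longleftrightarrow> a * d - b * c = 1"
  by (simp add: SL_def)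

lemma SL_mult: "m \<in> SL ==> m' \<in> SL ==> m ** m' \<in> SL"
  by (simp add: SL_def det_mul)

lemma one_SL [simp]: "mat 1 \<in> SL"
  by (simp add: SL_def)

lemma SL_invertible: "m \<in> SL ==> invertible (m :: real^'n^'n)"
  by (simp add: SL_def invertible_det_nz)

lemma SL_inv: "m \<in> SL ==> matrix_inv m \<in> SL" for m :: "real^'n^'n"
proof -
  assume m: "m \<in> SL"
  have "det (m ** matrix_inv m) = 1" using SL_invertible[OF m] by (simp add: group_simps)
  then show "matrix_inv m \<in> SL" using m by (simp add: SL_def det_mul)
qed

lemma matrix_inv_mat2: "a * d - b * c = 1 ==> matrix_inv (mat2 a b c d) = mat2 d (-b) (-c) a"
  by (rule matrix_inv_unique) (simp add: mat_1_mat2 mat2_eq_iff algebra_simps)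

definition dg :: "real => real^2^2" where "dg \<alpha> = mat2 \<alpha> 0 0 (1 / \<alpha>)"
definition upper :: "real => real^2^2" where "upper x = mat2 1 x 0 1"
definition lower :: "real => real^2^2" where "lower x = mat2 1 0 x 1"

lemma dg_SL [simp]: "\<alpha> ~= 0 ==> dg \<alpha> \<in> SL" by (simp add: dg_def)
lemma upper_SL [simp]: "upper x \<in> SL" by (simp add: upper_def)
lemma lower_SL [simp]: "lower x \<in> SL" by (simp add: lower_def)

lemma dg_mult: "dg \<alpha> ** dg \<beta> = dg (\<alpha> * \<beta>)" by (simp add: dg_def)
lemma dg_mult_left: "dg \<alpha> ** (dg \<beta> ** m) = dg (\<alpha> * \<beta>) ** m" by (simp add: matrix_mul_assoc dg_mult)
lemma dg_1 [simp]: "dg 1 = mat 1" by (simp add: dg_def mat_1_mat2)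
lemma dg_inv: "\<alpha> ~= 0 ==> matrix_inv (dg \<alpha>) = dg (1 / \<alpha>)"
  by (simp add: dg_def matrix_inv_mat2)
lemma dg_upper: "\<alpha> ~= 0 ==> dg \<alpha> ** upper x ** dg (1 / \<alpha>) = upper (\<alpha>\<^sup>2 * x)"
  by (simp add: dg_def upper_def mat2_eq_iff power2_eq_square)
lemma dg_lower: "\<alpha> ~= 0 ==> dg \<alpha> ** lower x ** dg (1 / \<alpha>) = lower (x / \<alpha>\<^sup>2)"
  by (simp add: dg_def lower_def mat2_eq_iff power2_eq_square)
lemma upper_inv: "matrix_inv (upper x) = upper (-x)"
  by (simp add: upper_def matrix_inv_mat2)
lemma lower_inv: "matrix_inv (lower x) = lower (-x)"
  by (simp add: lower_def matrix_inv_mat2)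

lemma tendsto_mat2:
  assumes "(a \<longlongrightarrow> a') F" "(b \<longlongrightarrow> b') F" "(c \<longlongrightarrow> c') F" "(d \<longlongrightarrow> d') F"
  shows "((\<lambda>x. mat2 (a x) (b x) (c x) (d x)) \<longlongrightarrow> mat2 a' b' c' d') F"
proof -
  have "\<forall>i j. ((\<lambda>x. mat2 (a x) (b x) (c x) (d x) $ i $ j) \<longlongrightarrow> mat2 a' b' c' d' $ i $ j) F"
    using assms by (simp add: forall_2)
  then show ?thesis by (intro vec_tendstoI) blast
qed

lemma rational_mat2: "rational_matrix (mat2 a b c d) \<longleftrightarrow> a \<in> \<rat> & b \<in> \<rat> & c \<in> \<rat> & d \<in> \<rat>"
  by (auto simp: rational_matrix_def forall_2)

text \<open>Along a subsequence a positive sequence tends to a positive number, to zero or to infinity. Applied to both parameters of the torus this produces the four quadrants.\<close>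

lemma positive_sequence_cases [consumes 1]:
  fixes s :: "nat => real"
  assumes "\<forall>k. s k > 0"
  obtains (inner) r l where "strict_mono r" "l > 0" "(s \<circ> r) \<longlonglongrightarrow> l"
    | (zero) r where "strict_mono r" "(s \<circ> r) \<longlonglongrightarrow> 0"
    | (infinity) r where "strict_mono r" "(\<lambda>k. 1 / s (r k)) \<longlonglongrightarrow> 0"
proof -
  define u where "u k = s k / (1 + s k)" for k
  have "u k \<in> {0..1}" for k using assms[rule_format, of k] by (auto simp: u_def field_simps)
  then obtain l r where l: "l \<in> {0..1}" and r: "strict_mono r" and lim': "(u \<circ> r) \<longlonglongrightarrow> l"
    using compact_Icc[of 0 "1::real"] unfolding compact_def by metis
  have lim: "(\<lambda>k. u (r k)) \<longlonglongrightarrow> l" using lim' by (simp add: o_def)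
  have s_u: "s k = u k / (1 - u k)" and u1: "u k < 1" and inv: "1 / s k = (1 - u k) / u k" and u0: "u k > 0" for k
    using assms[rule_format, of k] by (simp_all add: u_def divide_simps)
  consider "l = 0" | "l = 1" | "0 < l" "l < 1" using l by force
  then show ?thesis
  proof cases
    case 1
    have "(\<lambda>k. u (r k) / (1 - u (r k))) \<longlonglongrightarrow> 0 / (1 - 0)"
     using lim 1 by (intro tendsto_intros) auto
    then have "(s \<circ> r) \<longlonglongrightarrow> 0" by (simp add: o_def s_u[symmetric])
    then show ?thesis using zero r by blast
  next
    case 2
    have "(\<lambda>k. (1 - u (r k)) / u (r k)) \<longlonglongrightarrow> (1 - 1) / 1"
     using lim 2 by (intro tendsto_intros) auto
    then have "(\<lambda>k. 1 / s (r k)) \<longlonglongrightarrow> 0" by (simp add: o_def inv)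
    then show ?thesis using infinity r by blast
  next
    case 3
    have "(\<lambda>k. u (r k) / (1 - u (r k))) \<longlonglongrightarrow> l / (1 - l)"
     using lim 3 by (intro tendsto_intros) auto
    then have "(s \<circ> r) \<longlonglongrightarrow> l / (1 - l)" by (simp add: o_def s_u[symmetric])
    then show ?thesis using inner[OF r, of "l / (1 - l)"] 3 by simp
  qed
qed

section \<open>The torus\<close>

lemma conj_pair_rational: "real D * x \<in> \<int> ==> conj_pair d D x x"
  unfolding conj_pair_def
proof (elim Ints_cases)
  fix z assume "real D * x = of_int z"
  then show "\<exists>u v :: int. real D * x = of_int u + of_int v * sqrt (real d) &
     real D * x = of_int u - of_int v * sqrt (real d)"
    by (intro exI[of _ z] exI[of _ 0]) simp
qed

text \<open>The products of entries of the two factors that survive an unknown scalar: \<open>m1\<close> and \<open>m2\<close> behave like Galois conjugates, up to reciprocal scalars.\<close>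

definition norm_integral :: "nat => nat => real^2^2 => real^2^2 => bool" where
  "norm_integral d N m1 m2 \<longleftrightarrow>
     (\<forall>i j k l. conj_pair d N (m1 $ i $ k * m2 $ j $ l) (m1 $ j $ l * m2 $ i $ k))"

lemma norm_integral_left:
  assumes "norm_integral d N m1 m2" "!!i j. real D * \<gamma> $ i $ j \<in> \<int>"
  shows "norm_integral d (D * D * N) (\<gamma> ** m1) (\<gamma> ** m2)"
  unfolding norm_integral_def
proof (intro allI)
  fix i j k l
  have e: "(\<gamma> ** m) $ i $ k * (\<gamma> ** m') $ j $ l
     = (\<Sum>a\<in>UNIV. \<Sum>b\<in>UNIV. \<gamma> $ i $ a * \<gamma> $ j $ b * (m $ a $ k * m' $ b $ l))" for m m' :: "real^2^2"
    unfolding matrix_matrix_mult_def by (simp add: sum_2 algebra_simps)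
  have e': "(\<gamma> ** m) $ j $ l * (\<gamma> ** m') $ i $ k
     = (\<Sum>a\<in>UNIV. \<Sum>b\<in>UNIV. \<gamma> $ i $ a * \<gamma> $ j $ b * (m $ b $ l * m' $ a $ k))" for m m' :: "real^2^2"
    unfolding matrix_matrix_mult_def by (simp add: sum_2 algebra_simps)
  show "conj_pair d (D * D * N) ((\<gamma> ** m1) $ i $ k * (\<gamma> ** m2) $ j $ l) ((\<gamma> ** m1) $ j $ l * (\<gamma> ** m2) $ i $ k)"
    by (subst e, subst e', intro conj_pair_sum conj_pair_mult conj_pair_rational assms(2))
     (use assms(1) in \<open>simp add: norm_integral_def\<close>)
qed

lemma norm_integral_right:
  assumes "norm_integral d N m1 m2" "!!i j. real D * \<gamma> $ i $ j \<in> \<int>"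
  shows "norm_integral d (D * D * N) (m1 ** \<gamma>) (m2 ** \<gamma>)"
  unfolding norm_integral_def
proof (intro allI)
  fix i j k l
  have e: "(m ** \<gamma>) $ i $ k * (m' ** \<gamma>) $ j $ l
     = (\<Sum>a\<in>UNIV. \<Sum>b\<in>UNIV. \<gamma> $ a $ k * \<gamma> $ b $ l * (m $ i $ a * m' $ j $ b))" for m m' :: "real^2^2"
    unfolding matrix_matrix_mult_def by (simp add: sum_2 algebra_simps)
  have e': "(m ** \<gamma>) $ j $ l * (m' ** \<gamma>) $ i $ k
     = (\<Sum>a\<in>UNIV. \<Sum>b\<in>UNIV. \<gamma> $ a $ k * \<gamma> $ b $ l * (m $ j $ b * m' $ i $ a))" for m m' :: "real^2^2"
    unfolding matrix_matrix_mult_def by (simp add: sum_2 algebra_simps)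
  show "conj_pair d (D * D * N) ((m1 ** \<gamma>) $ i $ k * (m2 ** \<gamma>) $ j $ l) ((m1 ** \<gamma>) $ j $ l * (m2 ** \<gamma>) $ i $ k)"
    by (subst e, subst e', intro conj_pair_sum conj_pair_mult conj_pair_rational assms(2))
     (use assms(1) in \<open>simp add: norm_integral_def\<close>)
qed

text \<open>Elements normalizing the positive diagonal group; up to diagonal factors they represent the Weyl group of \<open>SL\<^sub>2\<close>.\<close>

definition normalizes_diagonal :: "real^2^2 => bool" where
  "normalizes_diagonal n \<longleftrightarrow> n \<in> SL & (\<forall>\<alpha>>0. \<exists>\<beta>>0. dg \<alpha> ** n = n ** dg \<beta>) & (\<forall>\<alpha>>0. \<exists>\<beta>>0. n ** dg \<alpha> = dg \<beta> ** n)"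

text \<open>Conjugation by the diagonal sequence shrinks \<open>X\<close> to the identity. Such a factor in front of a point does not change the limits of its translates.\<close>

definition contracting :: "(nat => real) => real^2^2 => bool" where
  "contracting a X \<longleftrightarrow> (\<lambda>k. dg (a k) ** X ** dg (1 / a k)) \<longlonglongrightarrow> mat 1"

lemma contracting_upper: "a \<longlonglongrightarrow> 0 ==> (!!k. a k > 0) ==> contracting a (upper x)"
proof -
  assume a: "a \<longlonglongrightarrow> 0" "!!k. a k > 0"
  have "dg (a k) ** upper x ** dg (1 / a k) = upper ((a k)\<^sup>2 * x)" for k
    using a(2)[of k] by (intro dg_upper) simp
  moreover have "(\<lambda>k. upper ((a k)\<^sup>2 * x)) \<longlonglongrightarrow> upper (0\<^sup>2 * x)"
    unfolding upper_def by (intro tendsto_mat2 tendsto_intros a)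
  ultimately show ?thesis by (simp add: contracting_def upper_def mat_1_mat2)
qed

lemma contracting_lower: "(\<lambda>k. 1 / a k) \<longlonglongrightarrow> 0 ==> (!!k. a k > 0) ==> contracting a (lower x)"
proof -
  assume a: "(\<lambda>k. 1 / a k) \<longlonglongrightarrow> 0" "!!k. a k > 0"
  have "dg (a k) ** lower x ** dg (1 / a k) = lower (x * (1 / a k)\<^sup>2)" for k
    using dg_lower[of "a k" x] a(2)[of k] by (simp add: power_divide)
  moreover have "(\<lambda>k. lower (x * (1 / a k)\<^sup>2)) \<longlonglongrightarrow> lower (x * 0\<^sup>2)"
    unfolding lower_def by (intro tendsto_mat2 tendsto_intros a)
  ultimately show ?thesis by (simp add: contracting_def lower_def mat_1_mat2)
qed

text \<open>The preimage in the group of a torus orbit in the quotient; all topology of orbits is done with these sets.\<close>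

definition double_coset :: "(real^'n^'n) set => (real^'n^'n) set => real^'n^'n => (real^'n^'n) set" where
  "double_coset T D g = {t ** g ** \<delta> | t \<delta>. t \<in> T & \<delta> \<in> D}"

text \<open>The common structure of both families of groups: a homomorphic image of \<open>SL\<^sub>2 \<times> SL\<^sub>2\<close> whose integral elements are, up to finite index, pairs of Galois conjugates (a Hilbert modular group), together with a commuting group \<open>C\<close>, such that the torus is the product of \<open>C\<close> and the two diagonal groups.\<close>

locale hilbert_torus = rational_torus H T XS WS
  for H :: "(real^'n^'n) set" and T XS WS +
  fixes C :: "(real^'n^'n) set" and \<phi> :: "real^2^2 => real^2^2 => real^'n^'n" and d :: nat
  assumes closed_H: "closed H"
    and C_H: "C \<subseteq> H" and one_C: "mat 1 \<in> C"
    and mult_C: "b \<in> C ==> c \<in> C ==> b ** c \<in> C" and inv_C: "c \<in> C ==> matrix_inv c \<in> C"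
    and phi_H: "m1 \<in> SL ==> m2 \<in> SL ==> \<phi> m1 m2 \<in> H"
    and phi_one: "\<phi> (mat 1) (mat 1) = mat 1"
    and phi_mult: "m1 \<in> SL ==> m2 \<in> SL ==> m1' \<in> SL ==> m2' \<in> SL ==>
       \<phi> m1 m2 ** \<phi> m1' m2' = \<phi> (m1 ** m1') (m2 ** m2')"
    and phi_cont: "continuous_on UNIV (\<lambda>p. \<phi> (fst p) (snd p))"
    and C_comm: "c \<in> C ==> m1 \<in> SL ==> m2 \<in> SL ==> c ** \<phi> m1 m2 = \<phi> m1 m2 ** c"
    and T_eq: "T = {\<phi> (dg \<alpha>) (dg \<beta>) ** c | \<alpha> \<beta> c. \<alpha> > 0 & \<beta> > 0 & c \<in> C}"
    and coord1: "\<exists>L :: real^'n^'n => real. continuous_on UNIV L & (\<forall>x. L (\<phi> (upper x) (mat 1)) = x)"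
    and coord2: "\<exists>L :: real^'n^'n => real. continuous_on UNIV L & (\<forall>x. L (\<phi> (mat 1) (upper x)) = x)"
    and phi_rational: "m \<in> SL ==> rational_matrix m ==> rational_matrix (\<phi> m m)"
    and irrational: "sqrt (real d) \<notin> \<rat>"
    and congruence: "\<exists>N>0. \<forall>m1\<in>SL. \<forall>m2\<in>SL.
       (\<forall>i j. conj_pair d 1 ((m1 $ i $ j - mat 1 $ i $ j) / real N) ((m2 $ i $ j - mat 1 $ i $ j) / real N))
       --> \<phi> m1 m2 \<in> integer_points H"
    and integrality: "\<exists>N>0. \<forall>m1\<in>SL. \<forall>m2\<in>SL. \<forall>c\<in>C. \<phi> m1 m2 ** c \<in> integer_points H --> norm_integral d N m1 m2"
begin

lemma swap: "hilbert_torus H T XS WS C (\<lambda>m1 m2. \<phi> m2 m1) d"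
proof unfold_locales
  show "continuous_on UNIV (\<lambda>p. \<phi> (snd p) (fst p))"
  proof -
    have "continuous_on UNIV (\<lambda>p. \<phi> (fst (prod.swap p)) (snd (prod.swap p)))"
     by (rule continuous_on_compose2[OF phi_cont]) (auto intro: continuous_on_swap)
    then show ?thesis by simp
  qed
  show "T = {\<phi> (dg \<beta>) (dg \<alpha>) ** c | \<alpha> \<beta> c. \<alpha> > 0 & \<beta> > 0 & c \<in> C}"
    unfolding T_eq by blast
  show "\<exists>N>0. \<forall>m1\<in>SL. \<forall>m2\<in>SL.
       (\<forall>i j. conj_pair d 1 ((m1 $ i $ j - mat 1 $ i $ j) / real N) ((m2 $ i $ j - mat 1 $ i $ j) / real N))
       --> \<phi> m2 m1 \<in> integer_points H"
  proof -
    obtain N where N: "N > 0" "!!m1 m2. m1 \<in> SL ==> m2 \<in> SL ==>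
       (\<forall>i j. conj_pair d 1 ((m1 $ i $ j - mat 1 $ i $ j) / real N) ((m2 $ i $ j - mat 1 $ i $ j) / real N))
       ==> \<phi> m1 m2 \<in> integer_points H" using congruence by blast
    show ?thesis
    proof (intro exI[of _ N] conjI ballI impI N(1))
     fix m1 m2 :: "real^2^2" assume m: "m1 \<in> SL" "m2 \<in> SL"
      and cp: "\<forall>i j. conj_pair d 1 ((m1 $ i $ j - mat 1 $ i $ j) / real N) ((m2 $ i $ j - mat 1 $ i $ j) / real N)"
     show "\<phi> m2 m1 \<in> integer_points H"
     proof (rule N(2)[OF m(2,1)], intro allI)
      fix i j
      show "conj_pair d 1 ((m2 $ i $ j - mat 1 $ i $ j) / real N) ((m1 $ i $ j - mat 1 $ i $ j) / real N)"
       by (rule conj_pair_sym) (use cp in blast)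
     qed
    qed
  qed
  show "\<exists>N>0. \<forall>m1\<in>SL. \<forall>m2\<in>SL. \<forall>c\<in>C. \<phi> m2 m1 ** c \<in> integer_points H --> norm_integral d N m1 m2"
  proof -
    obtain N where N: "N > 0" "!!m1 m2 c. m1 \<in> SL ==> m2 \<in> SL ==> c \<in> C ==> \<phi> m1 m2 ** c \<in> integer_points H ==> norm_integral d N m1 m2"
     using integrality by blast
    have "norm_integral d N m1 m2" if "norm_integral d N m2 m1" for m1 m2
     using that unfolding norm_integral_def by (simp add: mult.commute)
    with N show ?thesis by blast
  qed
qed (use closed_H C_H one_C mult_C inv_C phi_H phi_one phi_mult C_comm coord1 coord2 phi_rational irrational in auto)

lemma phi_tendsto:
  assumes "(f \<longlongrightarrow> m1) F" "(g \<longlongrightarrow> m2) F"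
  shows "((\<lambda>x. \<phi> (f x) (g x)) \<longlongrightarrow> \<phi> m1 m2) F"
proof -
  have "((\<lambda>x. (f x, g x)) \<longlongrightarrow> (m1, m2)) F" by (intro tendsto_Pair assms)
  from continuous_on_tendsto_compose[OF phi_cont this] show ?thesis by simp
qed

lemma phi_inv: "m1 \<in> SL ==> m2 \<in> SL ==> matrix_inv (\<phi> m1 m2) = \<phi> (matrix_inv m1) (matrix_inv m2)"
  by (rule matrix_inv_unique) (simp add: phi_mult SL_inv SL_invertible matrix_inv_mult_right phi_one)

lemma phi_mult_left: "m1 \<in> SL ==> m2 \<in> SL ==> m1' \<in> SL ==> m2' \<in> SL ==>
    \<phi> m1 m2 ** (\<phi> m1' m2' ** g) = \<phi> (m1 ** m1') (m2 ** m2') ** g"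
  by (simp add: phi_mult matrix_mul_assoc)

lemma C_comm_left: "c \<in> C ==> m1 \<in> SL ==> m2 \<in> SL ==> c ** (\<phi> m1 m2 ** g) = \<phi> m1 m2 ** (c ** g)"
  by (simp add: C_comm matrix_mul_assoc)

lemmas phi_simps = phi_mult phi_mult_left C_comm C_comm_left matrix_mul_assoc[symmetric] SL_mult SL_inv

lemma C_in_H: "c \<in> C ==> c \<in> H" using C_H by blast

lemma torus_cases:
  assumes "t \<in> T"
  obtains \<alpha> \<beta> c where "\<alpha> > 0" "\<beta> > 0" "c \<in> C" "t = \<phi> (dg \<alpha>) (dg \<beta>) ** c"
  using assms unfolding T_eq by blast

lemma torusI: "\<alpha> > 0 ==> \<beta> > 0 ==> c \<in> C ==> \<phi> (dg \<alpha>) (dg \<beta>) ** c \<in> T"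
  unfolding T_eq by blast

abbreviation "orb \<equiv> double_coset T \<Delta>"

lemma orbI: "t \<in> T ==> \<delta> \<in> \<Delta> ==> t ** g ** \<delta> \<in> orb g" by (auto simp: double_coset_def)

lemma orb_self: "g \<in> orb g" using orbI[OF one_T one_Delta, of g] by simp

lemma orb_H: "g \<in> H ==> orb g \<subseteq> H"
  using inH Delta_H by (auto simp: double_coset_def intro!: mult_H)

lemma orb_sym: "g \<in> H ==> h \<in> orb g ==> g \<in> orb h"
proof -
  assume g: "g \<in> H" and "h \<in> orb g"
  then obtain t \<delta> where t: "t \<in> T" "\<delta> \<in> \<Delta>" "h = t ** g ** \<delta>" by (auto simp: double_coset_def)
  have "g = matrix_inv t ** h ** matrix_inv \<delta>"
    using t g by (simp add: group_simps invertible_H inH invertible_Delta)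
  then show ?thesis using t by (metis orbI inv_T inv_Delta)
qed

lemma orb_trans: "h \<in> orb g ==> orb h \<subseteq> orb g"
proof
  fix x assume "h \<in> orb g" "x \<in> orb h"
  then obtain t \<delta> t' \<delta>' where t: "t \<in> T" "\<delta> \<in> \<Delta>" "h = t ** g ** \<delta>" "t' \<in> T" "\<delta>' \<in> \<Delta>" "x = t' ** h ** \<delta>'"
    by (auto simp: double_coset_def)
  then have "x = (t' ** t) ** g ** (\<delta> ** \<delta>')" by (simp add: matrix_mul_assoc)
  then show "x \<in> orb g" using t by (auto intro: orbI mult_T mult_Delta)
qed

subsection \<open>Arithmetic\<close>

text \<open>Conjugating by rational points only enlarges denominators.\<close>

lemma integrality_conj:
  assumes \<gamma>: "\<gamma> \<in> SL" "rational_matrix \<gamma>" and \<gamma>': "\<gamma>' \<in> SL" "rational_matrix \<gamma>'"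
  shows "\<exists>N>0. \<forall>m1\<in>SL. \<forall>m2\<in>SL. \<forall>c\<in>C.
    matrix_inv (\<phi> \<gamma> \<gamma>) ** (\<phi> m1 m2 ** c) ** \<phi> \<gamma>' \<gamma>' \<in> \<Delta> --> norm_integral d N m1 m2"
proof -
  obtain N where N: "N > 0" "!!m1 m2 c. m1 \<in> SL ==> m2 \<in> SL ==> c \<in> C ==> \<phi> m1 m2 ** c \<in> integer_points H ==> norm_integral d N m1 m2"
    using integrality by blast
  obtain D where D: "D > 0" "!!i j. real D * \<gamma> $ i $ j \<in> \<int>" using rational_matrix_denominator[OF \<gamma>(2)] by blast
  have "rational_matrix (matrix_inv \<gamma>')" using \<gamma>' by (simp add: rational_matrix_inv SL_invertible)
  then obtain D' where D': "D' > 0" "!!i j. real D' * matrix_inv \<gamma>' $ i $ j \<in> \<int>" using rational_matrix_denominator by blast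
  have "norm_integral d (D' * D' * (D * D * N)) m1 m2"
    if m: "m1 \<in> SL" "m2 \<in> SL" "c \<in> C" and mem: "matrix_inv (\<phi> \<gamma> \<gamma>) ** (\<phi> m1 m2 ** c) ** \<phi> \<gamma>' \<gamma>' \<in> \<Delta>" for m1 m2 c
  proof -
    have "matrix_inv (\<phi> \<gamma> \<gamma>) ** (\<phi> m1 m2 ** c) ** \<phi> \<gamma>' \<gamma>'
      = \<phi> (matrix_inv \<gamma> ** m1 ** \<gamma>') (matrix_inv \<gamma> ** m2 ** \<gamma>') ** c"
     using m \<gamma> \<gamma>' by (simp add: phi_inv phi_simps)
    with mem have "norm_integral d N (matrix_inv \<gamma> ** m1 ** \<gamma>') (matrix_inv \<gamma> ** m2 ** \<gamma>')"
     using m \<gamma> \<gamma>' by (intro N(2)) (auto intro!: SL_mult SL_inv)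
    from norm_integral_right[OF norm_integral_left[OF this D(2)] D'(2)]
    show ?thesis using \<gamma> \<gamma>' by (simp add: group_simps SL_invertible)
  qed
  moreover have "D' * D' * (D * D * N) > 0" using N D D' by simp
  ultimately show ?thesis by blast
qed

lemma power_bounds:
  fixes x :: real
  assumes "x > 0" "K > 0" "!!j::nat. K * x ^ j \<ge> 1" "!!j::nat. K * (1 / x) ^ j \<ge> 1"
  shows "x = 1"
proof -
  have "\<not> y < 1" if y: "y > 0" "!!j::nat. K * y ^ j \<ge> 1" for y :: real
  proof
    assume "y < 1"
    then obtain j where "y ^ j < 1 / K" using real_arch_pow_inv[of "1 / K" y] assms by auto
    then show False using y(2)[of j] assms by (simp add: field_simps)
  qed
  from this[of x] this[of "1 / x"] show ?thesis using assms by (simp add: field_simps)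
qed

lemma Ints_pos_ge_1: "x \<in> \<int> ==> x > 0 ==> x \<ge> (1::real)"
  by (elim Ints_cases) auto

text \<open>A diagonal pair in a conjugate of the lattice is a unit and its Galois conjugate: the two parameters are inverse to each other and their traces are integral.\<close>

lemma torus_stabilizer:
  assumes \<gamma>: "\<gamma> \<in> SL" "rational_matrix \<gamma>"
  shows "\<exists>N>0. \<forall>a b c. a > 0 --> b > 0 --> c \<in> C -->
    matrix_inv (\<phi> \<gamma> \<gamma>) ** (\<phi> (dg a) (dg b) ** c) ** \<phi> \<gamma> \<gamma> \<in> \<Delta> --> a * b = 1 & real N * (b\<^sup>2 + 1 / b\<^sup>2) \<in> \<int>"
proof -
  obtain N where N: "N > 0" "!!m1 m2 c. m1 \<in> SL ==> m2 \<in> SL ==> c \<in> C ==>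
    matrix_inv (\<phi> \<gamma> \<gamma>) ** (\<phi> m1 m2 ** c) ** \<phi> \<gamma> \<gamma> \<in> \<Delta> ==> norm_integral d N m1 m2"
    using integrality_conj[OF \<gamma> \<gamma>] by blast
  have "a * b = 1 & real N * (b\<^sup>2 + 1 / b\<^sup>2) \<in> \<int>"
    if a: "a > 0" and b: "b > 0" and c: "c \<in> C" and mem: "matrix_inv (\<phi> \<gamma> \<gamma>) ** (\<phi> (dg a) (dg b) ** c) ** \<phi> \<gamma> \<gamma> \<in> \<Delta>" for a b c
  proof -
    have inv: "invertible (\<phi> \<gamma> \<gamma>)" using \<gamma> by (simp add: invertible_H phi_H)
    have pw: "\<exists>c'\<in>C. matrix_inv (\<phi> \<gamma> \<gamma>) ** (\<phi> (dg (a ^ j)) (dg (b ^ j)) ** c') ** \<phi> \<gamma> \<gamma> \<in> \<Delta>" for j :: nat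
    proof (induction j)
     case 0
     show ?case using inv by (intro bexI[of _ "mat 1"]) (simp_all add: one_C phi_one group_simps one_Delta)
    next
     case (Suc j)
     then obtain c' where c': "c' \<in> C" and m: "matrix_inv (\<phi> \<gamma> \<gamma>) ** (\<phi> (dg (a ^ j)) (dg (b ^ j)) ** c') ** \<phi> \<gamma> \<gamma> \<in> \<Delta>" by blast
     have "matrix_inv (\<phi> \<gamma> \<gamma>) ** (\<phi> (dg a) (dg b) ** c) ** \<phi> \<gamma> \<gamma> **
       (matrix_inv (\<phi> \<gamma> \<gamma>) ** (\<phi> (dg (a ^ j)) (dg (b ^ j)) ** c') ** \<phi> \<gamma> \<gamma>)
      = matrix_inv (\<phi> \<gamma> \<gamma>) ** ((\<phi> (dg a) (dg b) ** c) ** (\<phi> (dg (a ^ j)) (dg (b ^ j)) ** c')) ** \<phi> \<gamma> \<gamma>"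
      using inv by (simp add: group_simps)
     also have "(\<phi> (dg a) (dg b) ** c) ** (\<phi> (dg (a ^ j)) (dg (b ^ j)) ** c') = \<phi> (dg (a ^ Suc j)) (dg (b ^ Suc j)) ** (c ** c')"
      using a b c c' by (simp add: phi_simps dg_mult)
     finally show ?case using mult_Delta[OF mem m] mult_C[OF c c'] by auto
    qed
    have ni: "norm_integral d N (dg (a ^ j)) (dg (b ^ j))" for j :: nat
     using pw[of j] a b by (auto intro: N(2))
    have e: "dg (a ^ j) $ 1 $ 1 * dg (b ^ j) $ 1 $ 1 = (a * b) ^ j"
     "dg (a ^ j) $ 2 $ 2 * dg (b ^ j) $ 2 $ 2 = (1 / (a * b)) ^ j" for j
     by (simp_all add: dg_def power_mult_distrib power_divide)
    have "conj_pair d N ((a * b) ^ j) ((a * b) ^ j)" for j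
     using ni[of j] unfolding norm_integral_def e(1)[symmetric] by blast
    then have "real N * (a * b) ^ j \<in> \<int>" for j using conj_pair_self[OF irrational] by blast
    then have 1: "real N * (a * b) ^ j \<ge> 1" for j using a b N(1) by (intro Ints_pos_ge_1) auto
    have "conj_pair d N ((1 / (a * b)) ^ j) ((1 / (a * b)) ^ j)" for j
     using ni[of j] unfolding norm_integral_def e(2)[symmetric] by blast
    then have "real N * (1 / (a * b)) ^ j \<in> \<int>" for j using conj_pair_self[OF irrational] by blast
    then have 2: "real N * (1 / (a * b)) ^ j \<ge> 1" for j using a b N(1) by (intro Ints_pos_ge_1) auto
    have ab: "a * b = 1" by (rule power_bounds[of _ "real N"]) (use a b N(1) 1 2 in auto)
    have "conj_pair d N (dg a $ 1 $ 1 * dg b $ 2 $ 2) (dg a $ 2 $ 2 * dg b $ 1 $ 1)"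
     using ni[of 1] unfolding norm_integral_def by simp
    then have "conj_pair d N (a / b) (b / a)" by (simp add: dg_def)
    moreover have "a = 1 / b" using ab b by (simp add: field_simps)
    ultimately have "conj_pair d N (1 / b\<^sup>2) (b\<^sup>2)" using b by (simp add: power2_eq_square)
    from conj_pair_trace[OF this] ab show ?thesis by (simp add: add.commute)
  qed
  with N(1) show ?thesis by blast
qed

text \<open>A power of the fundamental Pell unit is congruent to one modulo any given number, so it gives a nontrivial element of the torus that stabilizes the orbit.\<close>

lemma congruence_unit:
  assumes \<gamma>: "\<gamma> \<in> SL" "rational_matrix \<gamma>"
  shows "\<exists>\<alpha>>1. matrix_inv (\<phi> \<gamma> \<gamma>) ** \<phi> (dg \<alpha>) (dg (1 / \<alpha>)) ** \<phi> \<gamma> \<gamma> \<in> \<Delta>"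
proof -
  obtain N where N: "N > 0" "!!m1 m2. m1 \<in> SL ==> m2 \<in> SL ==>
      (!!i j. conj_pair d 1 ((m1 $ i $ j - mat 1 $ i $ j) / real N) ((m2 $ i $ j - mat 1 $ i $ j) / real N))
      ==> \<phi> m1 m2 \<in> integer_points H" using congruence by blast
  obtain D where D: "D > 0" "!!i j. real D * \<gamma> $ i $ j \<in> \<int>" using rational_matrix_denominator[OF \<gamma>(2)] by blast
  define q where "q = N * D * D"
  have q0: "q > 0" using N D by (simp add: q_def)
  have "sqrt (real (d * q\<^sup>2)) = sqrt (real d) * real q" by (simp add: real_sqrt_mult)
  have "sqrt (real (d * q\<^sup>2)) \<notin> \<rat>"
  proof
    assume "sqrt (real (d * q\<^sup>2)) \<in> \<rat>"
    then have "sqrt (real (d * q\<^sup>2)) / real q \<in> \<rat>" by (intro Rats_divide) auto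
    then show False using irrational q0 by (simp add: real_sqrt_mult)
  qed
  then obtain x y :: int where xy: "x > 0" "y > 0" "x\<^sup>2 - int (d * q\<^sup>2) * y\<^sup>2 = 1"
    using pell_solution by blast
  define s where "s = sqrt (real d)"
  have s2: "s * s = real d" by (simp add: s_def)
  define X Y :: int where "X = 2 * int d * int q * y\<^sup>2" and "Y = 2 * x * y"
  define \<alpha> where "\<alpha> = 1 + real q * (of_int X + of_int Y * s)"
  have "real_of_int (x\<^sup>2 - int (d * q\<^sup>2) * y\<^sup>2) = 1" using xy(3) by simp
  then have eq: "(of_int x)\<^sup>2 - real d * (real q)\<^sup>2 * (of_int y)\<^sup>2 = 1" by simp
  have l1: "\<alpha> = (of_int x + of_int y * real q * s)\<^sup>2"
    and l2: "1 + real q * (of_int X - of_int Y * s) = (of_int x - of_int y * real q * s)\<^sup>2"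
    using eq unfolding \<alpha>_def X_def Y_def
    by (simp_all add: power2_eq_square algebra_simps s2[symmetric])
  have "(of_int x + of_int y * real q * s) * (of_int x - of_int y * real q * s) = 1"
    using eq by (simp add: power2_eq_square algebra_simps s2[symmetric])
  then have l3: "1 + real q * (of_int X - of_int Y * s) = 1 / \<alpha>"
  proof -
    assume a: "(of_int x + of_int y * real q * s) * (of_int x - of_int y * real q * s) = 1"
    have "((of_int x + of_int y * real q * s) * (of_int x - of_int y * real q * s))\<^sup>2 = 1" unfolding a by simp
    then have "\<alpha> * (1 + real q * (of_int X - of_int Y * s)) = 1" unfolding l1 l2 power_mult_distrib .
    then show ?thesis by (simp add: divide_simps mult.commute) (metis mult_zero_left zero_neq_one)
  qed
  have "s > 0" using irrational by (auto simp: s_def intro!: Nat.gr0I)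
  moreover have "d > 0" using irrational by (intro Nat.gr0I) auto
  ultimately have "real q * (of_int X + of_int Y * s) > 0"
    using xy q0 by (intro mult_pos_pos add_pos_pos) (auto simp: X_def Y_def)
  then have lam: "\<alpha> > 1" by (simp add: \<alpha>_def)
  obtain a b c e where g: "\<gamma> = mat2 a b c e" by (metis mat2_eta)
  have det: "a * e - b * c = 1" using \<gamma>(1) g by simp
  define m1 where "m1 = matrix_inv \<gamma> ** dg \<alpha> ** \<gamma>"
  define m2 where "m2 = matrix_inv \<gamma> ** dg (1 / \<alpha>) ** \<gamma>"
  have m: "m1 \<in> SL" "m2 \<in> SL" unfolding m1_def m2_def using \<gamma> lam by (auto intro!: SL_mult SL_inv)
  \<comment> \<open>Traces of conjugates of diagonal matrices are symmetric in the eigenvalue and its inverse.\<close>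
  have conjd: "matrix_inv \<gamma> ** mat2 (1 + u) 0 0 (1 + v) ** \<gamma> =
     mat2 (1 + u + (u - v) * (b * c)) ((u - v) * (e * b)) ((v - u) * (a * c)) (1 + v - (u - v) * (b * c))" for u v
    unfolding g using det
    by (simp add: matrix_inv_mat2 mat2_eq_iff) (simp add: algebra_simps, algebra)
  have Dint: "real D * a \<in> \<int>" "real D * b \<in> \<int>" "real D * c \<in> \<int>" "real D * e \<in> \<int>"
    using D(2)[of 1 1] D(2)[of 1 2] D(2)[of 2 1] D(2)[of 2 2] by (simp_all add: g)
  have bc: "conj_pair d (D * D) (b * c) (b * c)" and eb: "conj_pair d (D * D) (e * b) (e * b)"
    and ac: "conj_pair d (D * D) (a * c) (a * c)"
    by (intro conj_pair_mult conj_pair_rational Dint)+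
  define u v where "u = real q * (of_int X + of_int Y * s)" and "v = real q * (of_int X - of_int Y * s)"
  have m1: "m1 = matrix_inv \<gamma> ** mat2 (1 + u) 0 0 (1 + v) ** \<gamma>"
    using l3 by (simp add: m1_def dg_def u_def v_def \<alpha>_def)
  have m2: "m2 = matrix_inv \<gamma> ** mat2 (1 + v) 0 0 (1 + u) ** \<gamma>"
    using l3 lam by (simp add: m2_def dg_def u_def v_def \<alpha>_def)
  have uv: "conj_pair d 1 (u / real N) (v / real N)" and vu: "conj_pair d 1 (v / real N) (u / real N)"
  proof -
    have "conj_pair d 1 (real (D * D) * (of_int X + of_int Y * s)) (real (D * D) * (of_int X - of_int Y * s))"
     unfolding conj_pair_def s_def
     by (intro exI[of _ "int (D * D) * X"] exI[of _ "int (D * D) * Y"]) (simp add: algebra_simps)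
    moreover have "real (D * D) * z = real q * z / real N" for z using N(1) by (simp add: q_def)
    ultimately show "conj_pair d 1 (u / real N) (v / real N)" by (simp add: u_def v_def)
    then show "conj_pair d 1 (v / real N) (u / real N)" by (rule conj_pair_sym)
  qed
  have *: "conj_pair d 1 ((u - v) * z / real N) ((v - u) * z / real N)" if "conj_pair d (D * D) z z" for z
  proof -
    have e: "(u - v) / real N = 2 * (real (D * D) * (of_int Y * s))"
     using N(1) by (simp add: u_def v_def q_def algebra_simps)
    have e': "real (D * D) * z \<in> \<int>" using conj_pair_self[OF irrational that] .
    then obtain w where w: "real (D * D) * z = of_int w" by (elim Ints_cases)
    have "(u - v) * z / real N = (u - v) / real N * z" by simp
    also have "\<dots> = 2 * of_int Y * s * of_int w" unfolding e w[symmetric] by simp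
    finally have 1: "(u - v) * z / real N = 2 * of_int Y * s * of_int w" .
    have 2: "(v - u) * z / real N = - ((u - v) * z / real N)"
     unfolding minus_divide_left minus_mult_left by simp
    show ?thesis unfolding conj_pair_def 2 1 s_def
     by (intro exI[of _ 0] exI[of _ "2 * Y * w"]) simp
  qed
  have **: "conj_pair d 1 ((v - u) * z / real N) ((u - v) * z / real N)" if "conj_pair d (D * D) z z" for z
    using *[OF that] by (rule conj_pair_sym)
  have "\<phi> m1 m2 \<in> \<Delta>"
  proof (rule N(2)[OF m])
    fix i j
    have "\<forall>i j. conj_pair d 1 ((m1 $ i $ j - mat 1 $ i $ j) / real N) ((m2 $ i $ j - mat 1 $ i $ j) / real N)"
    proof -
     have "conj_pair d 1 ((u + (u - v) * (b * c)) / real N) ((v + (v - u) * (b * c)) / real N)"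
      using conj_pair_add[OF uv *[OF bc]] by (simp add: add_divide_distrib)
     moreover have "conj_pair d 1 ((v + (v - u) * (b * c)) / real N) ((u + (u - v) * (b * c)) / real N)"
      using conj_pair_add[OF vu **[OF bc]] by (simp add: add_divide_distrib)
     ultimately show ?thesis
      unfolding m1 m2 conjd mat_1_mat2 using *[OF eb] **[OF ac]
      by (simp add: forall_2 algebra_simps)
    qed
    then show "conj_pair d 1 ((m1 $ i $ j - mat 1 $ i $ j) / real N) ((m2 $ i $ j - mat 1 $ i $ j) / real N)" by blast
  qed
  moreover have "matrix_inv (\<phi> \<gamma> \<gamma>) ** \<phi> (dg \<alpha>) (dg (1 / \<alpha>)) ** \<phi> \<gamma> \<gamma> = \<phi> m1 m2"
    unfolding m1_def m2_def using \<gamma> lam by (simp add: phi_inv phi_simps)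
  ultimately show ?thesis using lam by auto
qed

end

context hilbert_torus
begin

subsection \<open>One bounded coordinate\<close>

text \<open>The part of the torus without the second diagonal group already has closed orbits at rational points: a limit lies in the full torus orbit, and the relation between a unit and its conjugate fixes the second parameter. This controls the torus parameters one at a time.\<close>

lemma bounded_coordinate:
  assumes \<gamma>: "\<gamma> \<in> SL" "rational_matrix \<gamma>"
    and a: "!!k. a k > 0" and c: "!!k. c k \<in> C" and \<delta>: "!!k. \<delta> k \<in> \<Delta>"
    and lim: "(\<lambda>k::nat. \<phi> (dg (a k)) (mat 1) ** c k ** \<phi> \<gamma> \<gamma> ** \<delta> k) \<longlonglongrightarrow> h" and h: "h \<in> H"
  shows "\<exists>a>0. \<exists>c\<in>C. \<exists>\<delta>\<in>\<Delta>. h = \<phi> (dg a) (mat 1) ** c ** \<phi> \<gamma> \<gamma> ** \<delta>"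
proof -
  define g where "g = \<phi> \<gamma> \<gamma>"
  have gH: "g \<in> H" and gr: "rational_matrix g" using \<gamma> by (simp_all add: g_def phi_H phi_rational)
  define t where "t k = \<phi> (dg (a k)) (mat 1) ** c k" for k
  have tT: "t k \<in> T" for k using torusI[of "a k" 1 "c k"] a c by (simp add: t_def)
  obtain z \<delta>' where z: "z \<in> T" "\<delta>' \<in> \<Delta>" "h = z ** g ** \<delta>'"
    and ev: "\<forall>\<^sub>F k in sequentially. g ** \<delta> k ** matrix_inv \<delta>' ** matrix_inv g \<in> T"
    by (rule orbit_limit[where t=t, OF gH gr tT \<delta> lim[folded t_def g_def] h])
  obtain az bz cz where zz: "az > 0" "bz > 0" "cz \<in> C" "z = \<phi> (dg az) (dg bz) ** cz" using torus_cases[OF z(1)] .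
  define s where "s k = g ** \<delta> k ** matrix_inv \<delta>' ** matrix_inv g" for k
  obtain K where K: "!!k. k \<ge> K ==> s k \<in> T" using ev by (auto simp: eventually_sequentially s_def)
  have inv: "invertible g" "invertible \<delta>'" "invertible h" using gH z h by (auto simp: invertible_H invertible_Delta)
  have "(\<lambda>k. t k ** g ** \<delta> k ** matrix_inv \<delta>' ** matrix_inv g) \<longlonglongrightarrow> h ** matrix_inv \<delta>' ** matrix_inv g"
    using lim by (intro tendsto_matrix_mult tendsto_const) (simp add: t_def g_def)
  moreover have "t k ** g ** \<delta> k ** matrix_inv \<delta>' ** matrix_inv g = t k ** s k" for k by (simp add: s_def matrix_mul_assoc)
  moreover have "h ** matrix_inv \<delta>' ** matrix_inv g = z" unfolding z(3) using inv by (simp add: group_simps)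
  ultimately have ts: "(\<lambda>k. t k ** s k) \<longlonglongrightarrow> z" by simp
  have "\<forall>k. \<exists>p q r. p > 0 & q > 0 & r \<in> C & s (k + K) = \<phi> (dg p) (dg q) ** r"
    using K torus_cases by (metis le_add2)
  then obtain p q r where pqr: "!!k. p k > 0" "!!k. q k > 0" "!!k. r k \<in> C"
    "!!k. s (k + K) = \<phi> (dg (p k)) (dg (q k)) ** r k" by metis
  \<comment> \<open>As \<open>s\<close> tends to \<open>z\<close>, so does its second coordinate.\<close>
  have conj: "(\<phi> (dg x) (dg y) ** e) ** \<phi> (mat 1) (upper 1) ** matrix_inv (\<phi> (dg x) (dg y) ** e) = \<phi> (mat 1) (upper (y\<^sup>2))"
    if "x > 0" "y > 0" "e \<in> C" for x y e
  proof -
    have "(\<phi> (dg x) (dg y) ** e) ** \<phi> (mat 1) (upper 1) = \<phi> (dg x ** mat 1 ** dg (1/x)) (dg y ** upper 1 ** dg (1/y)) ** (\<phi> (dg x) (dg y) ** e)"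
     using that by (simp add: phi_simps dg_mult)
    also have "\<dots> = \<phi> (mat 1) (upper (y\<^sup>2)) ** (\<phi> (dg x) (dg y) ** e)"
     using that by (simp add: dg_upper dg_mult)
    finally show ?thesis using that
     by (simp add: group_simps invertible_H phi_H C_in_H)
  qed
  have tdef: "t (k + K) ** s (k + K) = \<phi> (dg (a (k + K) * p k)) (dg (q k)) ** (c (k + K) ** r k)" for k
    unfolding t_def pqr(4) using a[of "k + K"] pqr[of k] c[of "k + K"]
    by (simp add: phi_simps dg_mult)
  have tsK: "(\<lambda>k. t (k + K) ** s (k + K)) \<longlonglongrightarrow> z" using ts by (rule LIMSEQ_ignore_initial_segment)
  have "(\<lambda>k. (t (k + K) ** s (k + K)) ** \<phi> (mat 1) (upper 1) ** matrix_inv (t (k + K) ** s (k + K)))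
     \<longlonglongrightarrow> z ** \<phi> (mat 1) (upper 1) ** matrix_inv z"
  proof (intro tendsto_matrix_mult tendsto_matrix_inv tsK tendsto_const)
    show "det z ~= 0" using det_H[OF inH[OF z(1)]] by simp
    fix k
    have "t (k + K) ** s (k + K) \<in> T" by (intro mult_T tT K) simp
    from det_H[OF inH[OF this]] show "det (t (k + K) ** s (k + K)) ~= 0" by simp
  qed
  then have "(\<lambda>k. \<phi> (mat 1) (upper ((q k)\<^sup>2))) \<longlonglongrightarrow> \<phi> (mat 1) (upper (bz\<^sup>2))"
    unfolding tdef zz(4) using a pqr zz mult_C[OF c pqr(3)] by (simp add: conj)
  moreover obtain L :: "real^'n^'n => real" where L: "continuous_on UNIV L" "!!x. L (\<phi> (mat 1) (upper x)) = x"
    using coord2 by blast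
  ultimately have "(\<lambda>k. L (\<phi> (mat 1) (upper ((q k)\<^sup>2)))) \<longlonglongrightarrow> L (\<phi> (mat 1) (upper (bz\<^sup>2)))"
    by (intro continuous_on_tendsto_compose[OF L(1)]) auto
  then have q2: "(\<lambda>k. (q k)\<^sup>2) \<longlonglongrightarrow> bz\<^sup>2" by (simp add: L(2))
  obtain N where N: "N > 0" "!!a b c. a > 0 ==> b > 0 ==> c \<in> C ==>
    matrix_inv (\<phi> \<gamma> \<gamma>) ** (\<phi> (dg a) (dg b) ** c) ** \<phi> \<gamma> \<gamma> \<in> \<Delta> ==> a * b = 1 & real N * (b\<^sup>2 + 1 / b\<^sup>2) \<in> \<int>"
    using torus_stabilizer[OF \<gamma>] by blast
  have "real N * ((q k)\<^sup>2 + 1 / (q k)\<^sup>2) \<in> \<int>" for k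
  proof -
    have "matrix_inv g ** s (k + K) ** g = \<delta> (k + K) ** matrix_inv \<delta>'" unfolding s_def using inv by (simp add: group_simps)
    then have "matrix_inv g ** s (k + K) ** g \<in> \<Delta>" using mult_Delta[OF \<delta> inv_Delta[OF z(2)]] by simp
    then show ?thesis using N(2)[OF pqr(1-3)] by (simp add: pqr(4) g_def)
  qed
  moreover have "(\<lambda>k. (q k)\<^sup>2 + 1 / (q k)\<^sup>2) \<longlonglongrightarrow> bz\<^sup>2 + 1 / bz\<^sup>2"
    by (rule tendsto_add[OF q2 tendsto_divide[OF tendsto_const q2]]) (use zz in auto)
  ultimately have "\<forall>\<^sub>F k in sequentially. (q k)\<^sup>2 + 1 / (q k)\<^sup>2 = bz\<^sup>2 + 1 / bz\<^sup>2"
    using Ints_tendsto_eventually N(1) by blast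
  moreover have "\<forall>\<^sub>F k in sequentially. bz\<^sup>2 = 1 / bz\<^sup>2 \<or> (q k)\<^sup>2 ~= 1 / bz\<^sup>2"
    using tendsto_imp_eventually_ne[OF q2] by (cases "bz\<^sup>2 = 1 / bz\<^sup>2") auto
  ultimately have "\<forall>\<^sub>F k in sequentially. q k = bz"
  proof eventually_elim
    case (elim k)
    define u v where "u = (q k)\<^sup>2" and "v = bz\<^sup>2"
    have pos: "u > 0" "v > 0" using pqr(2)[of k] zz by (simp_all add: u_def v_def)
    have "u + 1 / u = v + 1 / v" "v = 1 / v \<or> u ~= 1 / v" using elim by (simp_all add: u_def v_def)
    moreover have "(u - v) * (u * v - 1) = (u + 1 / u - (v + 1 / v)) * (u * v)" using pos by (simp add: field_simps)
    ultimately have "(u - v) * (u * v - 1) = 0" by simp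
    then consider "u = v" | "u * v = 1" by auto
    then have "u = v"
    proof cases
     case 2
     then have "u = 1 / v" using pos by (simp add: field_simps)
     then show ?thesis using \<open>v = 1 / v \<or> u ~= 1 / v\<close> by simp
    qed
    then show "q k = bz" using pqr(2)[of k] zz by (simp add: u_def v_def)
  qed
  then obtain k where k: "q k = bz" by (auto simp: eventually_sequentially)
  have "s (k + K) \<in> T" by (rule K) simp
  then have invs: "invertible (s (k + K))" by (simp add: invertible_H inH)
  have "h = (z ** matrix_inv (s (k + K))) ** g ** (\<delta> (k + K) ** matrix_inv \<delta>' ** \<delta>')"
    unfolding z(3) using inv invs by (simp add: s_def group_simps invertible_Delta[OF \<delta>])
  moreover have "z ** matrix_inv (s (k + K)) = \<phi> (dg (az / p k)) (mat 1) ** (cz ** matrix_inv (r k))"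
    unfolding zz(4) pqr(4)[of k] k using zz pqr[of k] inv_C[OF pqr(3)[of k]]
    by (simp add: phi_inv dg_inv matrix_inv_mult invertible_H phi_H C_in_H phi_simps dg_mult)
  moreover have "az / p k > 0" using zz pqr(1)[of k] by simp
  ultimately have "h = \<phi> (dg (az / p k)) (mat 1) ** (cz ** matrix_inv (r k)) ** \<phi> \<gamma> \<gamma> ** (\<delta> (k + K) ** matrix_inv \<delta>' ** \<delta>')"
    and "az / p k > 0" by (simp_all add: g_def)
  moreover have "cz ** matrix_inv (r k) \<in> C" by (intro mult_C inv_C zz pqr)
  moreover have "\<delta> (k + K) ** matrix_inv \<delta>' ** \<delta>' \<in> \<Delta>" by (intro mult_Delta inv_Delta \<delta> z)
  ultimately show ?thesis by blast
qed

subsection \<open>Boundary orbits\<close>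

lemma normalizes_torus:
  assumes n: "normalizes_diagonal n" and t: "t \<in> T"
  shows "\<exists>t'\<in>T. t ** \<phi> n (mat 1) = \<phi> n (mat 1) ** t'" "\<exists>t'\<in>T. \<phi> n (mat 1) ** t = t' ** \<phi> n (mat 1)"
proof -
  obtain a b c where t': "a > 0" "b > 0" "c \<in> C" "t = \<phi> (dg a) (dg b) ** c" using torus_cases[OF t] .
  have nS: "n \<in> SL" using n by (simp add: normalizes_diagonal_def)
  obtain a1 where a1: "a1 > 0" "dg a ** n = n ** dg a1" using n t'(1) by (auto simp: normalizes_diagonal_def)
  obtain a2 where a2: "a2 > 0" "n ** dg a = dg a2 ** n" using n t'(1) by (auto simp: normalizes_diagonal_def)
  have "t ** \<phi> n (mat 1) = \<phi> n (mat 1) ** (\<phi> (dg a1) (dg b) ** c)"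
    unfolding t'(4) using t' nS a1 by (simp add: phi_simps)
  then show "\<exists>t'\<in>T. t ** \<phi> n (mat 1) = \<phi> n (mat 1) ** t'" using torusI[OF a1(1) t'(2,3)] by blast
  have "\<phi> n (mat 1) ** t = (\<phi> (dg a2) (dg b) ** c) ** \<phi> n (mat 1)"
    unfolding t'(4) using t' nS a2 by (simp add: phi_simps)
  then show "\<exists>t'\<in>T. \<phi> n (mat 1) ** t = t' ** \<phi> n (mat 1)" using torusI[OF a2(1) t'(2,3)] by blast
qed

definition point :: "real^2^2 => real^2^2 => real^'n^'n" where
  "point n \<gamma> = \<phi> n (mat 1) ** \<phi> \<gamma> \<gamma>"

lemma point_H: "n \<in> SL ==> \<gamma> \<in> SL ==> point n \<gamma> \<in> H"
  by (simp add: point_def mult_H phi_H)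

text \<open>A Weyl translate of a rational point has a closed orbit since the translating element normalizes the torus.\<close>

lemma closed_orb_point:
  assumes n: "normalizes_diagonal n" and \<gamma>: "\<gamma> \<in> SL" "rational_matrix \<gamma>"
  shows "closed (orb (point n \<gamma>))"
  unfolding closed_sequential_limits
proof (intro allI impI, elim conjE)
  fix x h assume x: "\<forall>k::nat. x k \<in> orb (point n \<gamma>)" and lim: "x \<longlonglongrightarrow> h"
  have nS: "n \<in> SL" using n by (simp add: normalizes_diagonal_def)
  have "\<forall>k. x k \<in> H" using x orb_H[OF point_H[OF nS \<gamma>(1)]] by blast
  then have h: "h \<in> H" using closed_H lim unfolding closed_sequential_limits by blast
  have "\<forall>k. \<exists>t \<delta>. t \<in> T & \<delta> \<in> \<Delta> & x k = \<phi> n (mat 1) ** (t ** \<phi> \<gamma> \<gamma> ** \<delta>)"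
  proof
    fix k
    obtain t \<delta> where t: "t \<in> T" "\<delta> \<in> \<Delta>" "x k = t ** point n \<gamma> ** \<delta>" using x unfolding double_coset_def by blast
    obtain t' where t': "t' \<in> T" "t ** \<phi> n (mat 1) = \<phi> n (mat 1) ** t'" using normalizes_torus(1)[OF n t(1)] by blast
    have "x k = (t ** \<phi> n (mat 1)) ** \<phi> \<gamma> \<gamma> ** \<delta>" using t(3) by (simp add: point_def matrix_mul_assoc)
    then have "x k = \<phi> n (mat 1) ** (t' ** \<phi> \<gamma> \<gamma> ** \<delta>)" unfolding t'(2) by (simp add: matrix_mul_assoc)
    then show "\<exists>t \<delta>. t \<in> T & \<delta> \<in> \<Delta> & x k = \<phi> n (mat 1) ** (t ** \<phi> \<gamma> \<gamma> ** \<delta>)" using t t' by blast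
  qed
  then obtain t \<delta> where t: "!!k. t k \<in> T" "!!k. \<delta> k \<in> \<Delta>" "!!k. x k = \<phi> n (mat 1) ** (t k ** \<phi> \<gamma> \<gamma> ** \<delta> k)" by metis
  have inv: "invertible (\<phi> n (mat 1))" using nS by (simp add: invertible_H phi_H)
  have "(\<lambda>k. matrix_inv (\<phi> n (mat 1)) ** x k) \<longlonglongrightarrow> matrix_inv (\<phi> n (mat 1)) ** h"
    by (intro tendsto_matrix_mult tendsto_const lim)
  then have "(\<lambda>k. t k ** \<phi> \<gamma> \<gamma> ** \<delta> k) \<longlonglongrightarrow> matrix_inv (\<phi> n (mat 1)) ** h"
    unfolding t(3) using inv by (simp add: matrix_cancel)
  from orbit_limit[OF phi_H[OF \<gamma>(1,1)] phi_rational[OF \<gamma>] t(1,2) this]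
  obtain z \<delta>' where z: "z \<in> T" "\<delta>' \<in> \<Delta>" "matrix_inv (\<phi> n (mat 1)) ** h = z ** \<phi> \<gamma> \<gamma> ** \<delta>'"
    using h nS by (metis inv_H mult_H one_SL phi_H)
  have "h = \<phi> n (mat 1) ** (matrix_inv (\<phi> n (mat 1)) ** h)" using inv by (simp add: matrix_cancel)
  then have h': "h = (\<phi> n (mat 1) ** z) ** \<phi> \<gamma> \<gamma> ** \<delta>'" unfolding z(3) by (simp add: matrix_mul_assoc)
  obtain t' where "t' \<in> T" "\<phi> n (mat 1) ** z = t' ** \<phi> n (mat 1)" using normalizes_torus(2)[OF n z(1)] by blast
  then have "h = t' ** point n \<gamma> ** \<delta>'" using h' by (simp add: point_def matrix_mul_assoc)
  then show "h \<in> orb (point n \<gamma>)" using \<open>t' \<in> T\<close> z(2) by (simp add: orbI)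
qed

lemma contraction_tendsto:
  fixes y :: "nat => real^'n^'n"
  assumes X: "X \<in> SL" "Y \<in> SL" and a: "!!k. a k > 0" "!!k. b k > 0" and c: "!!k. c k \<in> C"
    and con: "contracting a X" "contracting b Y"
  shows "((\<lambda>k. \<phi> (dg (a k)) (dg (b k)) ** c k ** \<phi> X Y ** y k) \<longlonglongrightarrow> h) \<longleftrightarrow>
      ((\<lambda>k. \<phi> (dg (a k)) (dg (b k)) ** c k ** y k) \<longlonglongrightarrow> h)"
proof -
  define E where "E k = \<phi> (dg (a k) ** X ** dg (1 / a k)) (dg (b k) ** Y ** dg (1 / b k))" for k
  have S: "dg (a k) ** X ** dg (1 / a k) \<in> SL" "dg (b k) ** Y ** dg (1 / b k) \<in> SL" for k
    using a[of k] X by (auto intro!: SL_mult)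
  have EH: "E k \<in> H" for k unfolding E_def using S by (rule phi_H)
  have E1: "E \<longlonglongrightarrow> mat 1"
    using phi_tendsto[OF con[unfolded contracting_def]] unfolding E_def[abs_def] phi_one .
  have "(\<lambda>k. matrix_inv (E k)) \<longlonglongrightarrow> matrix_inv (mat 1)"
    by (rule tendsto_matrix_inv[OF E1]) (use EH det_H in auto)
  then have Ei: "(\<lambda>k. matrix_inv (E k)) \<longlonglongrightarrow> mat 1" by simp
  have eq: "\<phi> (dg (a k)) (dg (b k)) ** c k ** \<phi> X Y ** y k = E k ** (\<phi> (dg (a k)) (dg (b k)) ** c k ** y k)" for k
  proof -
    have "dg (1 / a k) ** dg (a k) = mat 1" "dg (1 / b k) ** dg (b k) = mat 1" using a[of k] by (simp_all add: dg_mult)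
    then show ?thesis unfolding E_def using a[of k] X c[of k] S[of k] by (simp add: phi_simps)
  qed
  show ?thesis
  proof
    assume "(\<lambda>k. \<phi> (dg (a k)) (dg (b k)) ** c k ** \<phi> X Y ** y k) \<longlonglongrightarrow> h"
    then have "(\<lambda>k. matrix_inv (E k) ** (E k ** (\<phi> (dg (a k)) (dg (b k)) ** c k ** y k))) \<longlonglongrightarrow> mat 1 ** h"
     unfolding eq by (rule tendsto_matrix_mult[OF Ei])
    then show "(\<lambda>k. \<phi> (dg (a k)) (dg (b k)) ** c k ** y k) \<longlonglongrightarrow> h"
     using EH by (simp add: matrix_cancel invertible_H)
  next
    assume "(\<lambda>k. \<phi> (dg (a k)) (dg (b k)) ** c k ** y k) \<longlonglongrightarrow> h"
    then have "(\<lambda>k. E k ** (\<phi> (dg (a k)) (dg (b k)) ** c k ** y k)) \<longlonglongrightarrow> mat 1 ** h"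
     by (rule tendsto_matrix_mult[OF E1])
    then show "(\<lambda>k. \<phi> (dg (a k)) (dg (b k)) ** c k ** \<phi> X Y ** y k) \<longlonglongrightarrow> h" unfolding eq by simp
  qed
qed

text \<open>When both parameters degenerate in directions contracting \<open>X\<close> and \<open>Y\<close>, the translates of \<open>g\<close> run asymptotically along the closed orbit of \<open>point n \<gamma>\<close>.\<close>

lemma quadrant_limit:
  assumes g: "g = \<phi> X Y ** point n \<gamma>" and X: "X \<in> SL" "Y \<in> SL"
    and n: "normalizes_diagonal n" and \<gamma>: "\<gamma> \<in> SL" "rational_matrix \<gamma>"
    and a: "!!k. a k > 0" "!!k. b k > 0" and c: "!!k. c k \<in> C" and \<delta>: "!!k. \<delta> k \<in> \<Delta>"
    and con: "contracting a X" "contracting b Y"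
    and lim: "(\<lambda>k. \<phi> (dg (a k)) (dg (b k)) ** c k ** g ** \<delta> k) \<longlonglongrightarrow> h"
  shows "h \<in> orb (point n \<gamma>)"
proof -
  have "(\<lambda>k. \<phi> (dg (a k)) (dg (b k)) ** c k ** \<phi> X Y ** (point n \<gamma> ** \<delta> k)) \<longlonglongrightarrow> h"
    using lim unfolding g by (simp add: matrix_mul_assoc)
  then have "(\<lambda>k. \<phi> (dg (a k)) (dg (b k)) ** c k ** (point n \<gamma> ** \<delta> k)) \<longlonglongrightarrow> h"
    by (rule iffD1[OF contraction_tendsto[OF X a c con]])
  then show ?thesis
  proof (rule closed_sequentially[OF closed_orb_point[OF n \<gamma>], rotated])
    fix k
    show "\<phi> (dg (a k)) (dg (b k)) ** c k ** (point n \<gamma> ** \<delta> k) \<in> orb (point n \<gamma>)"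
     using orbI[OF torusI[OF a(1)[of k] a(2)[of k] c[of k]] \<delta>[of k], of "point n \<gamma>"] by (simp add: matrix_mul_assoc)
  qed
qed

text \<open>Conversely the whole closed orbit is reached: moving along the stabilizing Pell unit keeps the closed orbit fixed while contracting \<open>X\<close> and \<open>Y\<close>.\<close>

lemma quadrant_accumulation:
  assumes g: "g = \<phi> X Y ** point n \<gamma>" and X: "X \<in> SL" "Y \<in> SL"
    and n: "n \<in> SL" and \<gamma>: "\<gamma> \<in> SL" "rational_matrix \<gamma>"
    and rec: "!!u. u > 1 ==> \<exists>a b e. (\<forall>k. a k > 0) & (\<forall>k. b k > 0) & contracting a X & contracting b Y &
      (\<forall>k. dg (a k) ** n = n ** dg (e k)) &
      (\<forall>k. (e k = u ^ k & b k = (1 / u) ^ k) \<or> (e k = (1 / u) ^ k & b k = u ^ k))"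
  shows "orb (point n \<gamma>) \<subseteq> closure (orb g)"
proof -
  obtain u where u: "u > 1" and mem: "matrix_inv (\<phi> \<gamma> \<gamma>) ** \<phi> (dg u) (dg (1 / u)) ** \<phi> \<gamma> \<gamma> \<in> \<Delta>"
    using congruence_unit[OF \<gamma>] by blast
  obtain a b e where ab: "!!k. a k > 0" "!!k. b k > 0" "contracting a X" "contracting b Y"
    "!!k. dg (a k) ** n = n ** dg (e k)"
    "!!k. (e k = u ^ k & b k = (1 / u) ^ k) \<or> (e k = (1 / u) ^ k & b k = u ^ k)"
    using rec[OF u] by blast
  have inv: "invertible (\<phi> \<gamma> \<gamma>)" using \<gamma> by (simp add: invertible_H phi_H)
  have gdelta: "\<exists>\<delta>\<in>\<Delta>. \<phi> (dg (u ^ k)) (dg ((1 / u) ^ k)) ** \<phi> \<gamma> \<gamma> = \<phi> \<gamma> \<gamma> ** \<delta>" for k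
  proof (induction k)
    case 0
    show ?case by (intro bexI[of _ "mat 1"]) (simp_all add: phi_one one_Delta)
  next
    case (Suc k)
    then obtain \<delta> where \<delta>: "\<delta> \<in> \<Delta>" "\<phi> (dg (u ^ k)) (dg ((1 / u) ^ k)) ** \<phi> \<gamma> \<gamma> = \<phi> \<gamma> \<gamma> ** \<delta>" by blast
    have "\<phi> (dg (u ^ Suc k)) (dg ((1 / u) ^ Suc k)) ** \<phi> \<gamma> \<gamma>
     = \<phi> (dg u) (dg (1 / u)) ** (\<phi> (dg (u ^ k)) (dg ((1 / u) ^ k)) ** \<phi> \<gamma> \<gamma>)"
     using u \<gamma> by (simp add: phi_simps dg_mult dg_mult_left)
    also have "\<dots> = \<phi> (dg u) (dg (1 / u)) ** (\<phi> \<gamma> \<gamma> ** \<delta>)" unfolding \<delta>(2) ..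
    also have "\<dots> = \<phi> \<gamma> \<gamma> ** ((matrix_inv (\<phi> \<gamma> \<gamma>) ** \<phi> (dg u) (dg (1 / u)) ** \<phi> \<gamma> \<gamma>) ** \<delta>)"
     using inv by (simp add: group_simps)
    finally show ?case using mult_Delta[OF mem \<delta>(1)] by blast
  qed
  have gdelta': "\<exists>\<delta>\<in>\<Delta>. \<phi> (dg (e k)) (dg (b k)) ** \<phi> \<gamma> \<gamma> ** \<delta> = \<phi> \<gamma> \<gamma>" for k
  proof -
    obtain \<delta> where \<delta>: "\<delta> \<in> \<Delta>" "\<phi> (dg (u ^ k)) (dg ((1 / u) ^ k)) ** \<phi> \<gamma> \<gamma> = \<phi> \<gamma> \<gamma> ** \<delta>" using gdelta by blast
    show ?thesis
    proof (cases "e k = u ^ k & b k = (1 / u) ^ k")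
     case True
     then have "\<phi> (dg (e k)) (dg (b k)) ** \<phi> \<gamma> \<gamma> ** matrix_inv \<delta> = \<phi> \<gamma> \<gamma>"
      using \<delta> invertible_Delta[OF \<delta>(1)] by (simp add: matrix_mul_assoc[symmetric] matrix_inv_mult_right)
     then show ?thesis using inv_Delta[OF \<delta>(1)] by blast
    next
     case False
     then have eb: "e k = (1 / u) ^ k" "b k = u ^ k" using ab(6)[of k] by auto
     have "\<phi> (dg (e k)) (dg (b k)) ** \<phi> \<gamma> \<gamma> ** \<delta> = \<phi> (dg (e k)) (dg (b k)) ** (\<phi> \<gamma> \<gamma> ** \<delta>)" by (simp add: matrix_mul_assoc)
     also have "\<dots> = \<phi> (dg (e k)) (dg (b k)) ** (\<phi> (dg (u ^ k)) (dg ((1 / u) ^ k)) ** \<phi> \<gamma> \<gamma>)" unfolding \<delta>(2) ..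
     also have "\<dots> = \<phi> \<gamma> \<gamma>" unfolding eb using u \<gamma> by (simp add: phi_simps dg_mult dg_mult_left power_divide)
     finally show ?thesis using \<delta>(1) by blast
    qed
  qed
  then obtain \<delta> where \<delta>: "!!k. \<delta> k \<in> \<Delta>" "!!k. \<phi> (dg (e k)) (dg (b k)) ** \<phi> \<gamma> \<gamma> ** \<delta> k = \<phi> \<gamma> \<gamma>" by metis
  have e0: "e k ~= 0" for k using ab(6)[of k] u by auto
  have const: "\<phi> (dg (a k)) (dg (b k)) ** mat 1 ** (point n \<gamma> ** \<delta> k) = point n \<gamma>" for k
  proof -
    have "\<phi> (dg (a k)) (dg (b k)) ** mat 1 ** (point n \<gamma> ** \<delta> k) = \<phi> (dg (a k) ** n) (dg (b k)) ** \<phi> \<gamma> \<gamma> ** \<delta> k"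
     using ab(1,2)[of k] n \<gamma> by (simp add: point_def phi_simps)
    also have "\<dots> = \<phi> n (mat 1) ** (\<phi> (dg (e k)) (dg (b k)) ** \<phi> \<gamma> \<gamma> ** \<delta> k)"
     unfolding ab(5) using ab(2)[of k] n e0[of k] \<gamma> by (simp add: phi_simps)
    finally show ?thesis unfolding \<delta>(2) by (simp add: point_def)
  qed
  have "(\<lambda>k. \<phi> (dg (a k)) (dg (b k)) ** mat 1 ** (point n \<gamma> ** \<delta> k)) \<longlonglongrightarrow> point n \<gamma>" by (simp only: const tendsto_const)
  then have lim: "(\<lambda>k. \<phi> (dg (a k)) (dg (b k)) ** mat 1 ** \<phi> X Y ** (point n \<gamma> ** \<delta> k)) \<longlonglongrightarrow> point n \<gamma>"
    by (rule iffD2[OF contraction_tendsto[OF X ab(1,2) one_C ab(3,4)]])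
  show ?thesis
  proof
    fix x assume "x \<in> orb (point n \<gamma>)"
    then obtain t d where t: "t \<in> T" "d \<in> \<Delta>" "x = t ** point n \<gamma> ** d" by (auto simp: double_coset_def)
    define y where "y k = t ** (\<phi> (dg (a k)) (dg (b k)) ** mat 1 ** \<phi> X Y ** (point n \<gamma> ** \<delta> k)) ** d" for k
    have "y \<longlonglongrightarrow> x" unfolding y_def t(3) by (intro tendsto_matrix_mult tendsto_const lim)
    moreover have "y k \<in> orb g" for k
    proof -
     have "y k = (t ** (\<phi> (dg (a k)) (dg (b k)) ** mat 1)) ** g ** (\<delta> k ** d)"
      unfolding y_def g by (simp add: matrix_mul_assoc)
     moreover have "t ** (\<phi> (dg (a k)) (dg (b k)) ** mat 1) \<in> T" by (intro mult_T t torusI ab one_C)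
     moreover have "\<delta> k ** d \<in> \<Delta>" by (intro mult_Delta t \<delta>)
     ultimately show ?thesis by (simp only: orbI)
    qed
    ultimately show "x \<in> closure (orb g)" unfolding closure_sequential by blast
  qed
qed

text \<open>In a compact set the two torus parameters would have to be bounded modulo the stabilizer, but one direction of the plane of parameters is not covered by units.\<close>

lemma noncompact_point:
  assumes n: "normalizes_diagonal n" and \<gamma>: "\<gamma> \<in> SL" "rational_matrix \<gamma>" and K: "compact K"
  shows "\<exists>t\<in>T. \<forall>\<delta>\<in>\<Delta>. t ** point n \<gamma> ** \<delta> \<notin> K"
proof (rule ccontr)
  assume "\<not> ?thesis"
  then have all: "!!t. t \<in> T ==> \<exists>\<delta>\<in>\<Delta>. t ** point n \<gamma> ** \<delta> \<in> K" by blast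
  have nS: "n \<in> SL" using n by (simp add: normalizes_diagonal_def)
  define g where "g = \<phi> \<gamma> \<gamma>"
  have gH: "g \<in> H" and gr: "rational_matrix g" using \<gamma> by (simp_all add: g_def phi_H phi_rational)
  define t where "t k = \<phi> (dg (real (Suc k))) (dg (real (Suc k))) ** mat 1" for k
  have tT: "t k \<in> T" for k unfolding t_def by (intro torusI one_C) auto
  have "\<exists>\<delta>\<in>\<Delta>. \<phi> n (mat 1) ** (t k ** g ** \<delta>) \<in> K" for k
  proof -
    obtain t' where t': "t' \<in> T" "\<phi> n (mat 1) ** t k = t' ** \<phi> n (mat 1)" using normalizes_torus(2)[OF n tT] by blast
    obtain \<delta> where \<delta>: "\<delta> \<in> \<Delta>" "t' ** point n \<gamma> ** \<delta> \<in> K" using all[OF t'(1)] by blast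
    have "\<phi> n (mat 1) ** (t k ** g ** \<delta>) = (\<phi> n (mat 1) ** t k) ** g ** \<delta>" by (simp add: matrix_mul_assoc)
    also have "\<dots> = t' ** point n \<gamma> ** \<delta>" unfolding t'(2) by (simp add: point_def g_def matrix_mul_assoc)
    finally have eq: "\<phi> n (mat 1) ** (t k ** g ** \<delta>) = t' ** point n \<gamma> ** \<delta>" .
    show ?thesis by (rule bexI[OF _ \<delta>(1)]) (simp only: eq \<delta>(2))
  qed
  then obtain \<delta>0 where \<delta>0: "!!k. \<delta>0 k \<in> \<Delta>" "!!k. \<phi> n (mat 1) ** (t k ** g ** \<delta>0 k) \<in> K" by metis
  define f where "f k = \<phi> n (mat 1) ** (t k ** g ** \<delta>0 k)" for k
  have "\<forall>k. f k \<in> K" using \<delta>0(2) by (simp add: f_def)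
  then have "\<exists>l\<in>K. \<exists>r. strict_mono r & (f \<circ> r) \<longlonglongrightarrow> l" using K unfolding compact_def by blast
  then obtain l r where r: "strict_mono r" and "(f \<circ> r) \<longlonglongrightarrow> l" by blast
  then have lim: "(\<lambda>k. \<phi> n (mat 1) ** (t (r k) ** g ** \<delta>0 (r k))) \<longlonglongrightarrow> l" by (simp add: o_def f_def)
  have inv0: "invertible (\<phi> n (mat 1))" using nS by (simp add: invertible_H phi_H)
  define h where "h = matrix_inv (\<phi> n (mat 1)) ** l"
  have "(\<lambda>k. matrix_inv (\<phi> n (mat 1)) ** (\<phi> n (mat 1) ** (t (r k) ** g ** \<delta>0 (r k)))) \<longlonglongrightarrow> h"
    unfolding h_def by (intro tendsto_matrix_mult tendsto_const lim)
  then have lim': "(\<lambda>k. t (r k) ** g ** \<delta>0 (r k)) \<longlonglongrightarrow> h" using inv0 by (simp add: matrix_cancel)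
  define \<delta> where "\<delta> k = \<delta>0 (r k)" for k
  have \<delta>: "\<delta> k \<in> \<Delta>" for k by (simp add: \<delta>_def \<delta>0)
  have lim'': "(\<lambda>k. t (r k) ** g ** \<delta> k) \<longlonglongrightarrow> h" using lim' by (simp add: \<delta>_def)
  have "t (r k) ** g ** \<delta> k \<in> H" for k using inH[OF tT] gH Delta_H[OF \<delta>] by (auto intro!: mult_H)
  then have h: "h \<in> H" by (rule closed_sequentially[OF closed_H _ lim''])
  obtain z \<delta>' where z: "z \<in> T" "\<delta>' \<in> \<Delta>" "h = z ** g ** \<delta>'"
    and ev: "\<forall>\<^sub>F k in sequentially. g ** \<delta> k ** matrix_inv \<delta>' ** matrix_inv g \<in> T"
    by (rule orbit_limit[where t="\<lambda>k. t (r k)", OF gH gr tT \<delta> lim'' h])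
  obtain az bz cz where zz: "az > 0" "bz > 0" "cz \<in> C" "z = \<phi> (dg az) (dg bz) ** cz" using torus_cases[OF z(1)] .
  define s where "s k = g ** \<delta> k ** matrix_inv \<delta>' ** matrix_inv g" for k
  obtain K where K: "!!k. k \<ge> K ==> s k \<in> T" using ev by (auto simp: eventually_sequentially s_def)
  have inv: "invertible g" "invertible \<delta>'" "invertible h" using gH z h by (auto simp: invertible_H invertible_Delta)
  have "(\<lambda>k. t (r k) ** g ** \<delta> k ** matrix_inv \<delta>' ** matrix_inv g) \<longlonglongrightarrow> h ** matrix_inv \<delta>' ** matrix_inv g"
    by (intro tendsto_matrix_mult tendsto_const lim'')
  moreover have "t (r k) ** g ** \<delta> k ** matrix_inv \<delta>' ** matrix_inv g = t (r k) ** s k" for k by (simp add: s_def matrix_mul_assoc)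
  moreover have "h ** matrix_inv \<delta>' ** matrix_inv g = z" unfolding z(3) using inv by (simp add: group_simps)
  ultimately have ts: "(\<lambda>k. t (r k) ** s k) \<longlonglongrightarrow> z" by simp
  have "\<forall>k. \<exists>p q c. p > 0 & q > 0 & c \<in> C & s (k + K) = \<phi> (dg p) (dg q) ** c"
    using K torus_cases by (metis le_add2)
  then obtain p q c where pqc: "!!k. p k > 0" "!!k. q k > 0" "!!k. c k \<in> C"
    "!!k. s (k + K) = \<phi> (dg (p k)) (dg (q k)) ** c k" by metis
  define m where "m k = real (Suc (r (k + K)))" for k
  have m0: "m k > 0" for k by (simp add: m_def)
  have conj: "(\<phi> (dg x) (dg y) ** e) ** \<phi> (upper v) (upper w) ** matrix_inv (\<phi> (dg x) (dg y) ** e) = \<phi> (upper (x\<^sup>2 * v)) (upper (y\<^sup>2 * w))"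
    if "x > 0" "y > 0" "e \<in> C" for x y e v w
  proof -
    have "(\<phi> (dg x) (dg y) ** e) ** \<phi> (upper v) (upper w) = \<phi> (dg x ** upper v ** dg (1/x)) (dg y ** upper w ** dg (1/y)) ** (\<phi> (dg x) (dg y) ** e)"
     using that by (simp add: phi_simps dg_mult)
    also have "\<dots> = \<phi> (upper (x\<^sup>2 * v)) (upper (y\<^sup>2 * w)) ** (\<phi> (dg x) (dg y) ** e)"
     using that by (simp add: dg_upper)
    finally show ?thesis using that
     by (simp add: group_simps invertible_H phi_H C_in_H)
  qed
  have tdef: "t (r (k + K)) ** s (k + K) = \<phi> (dg (m k * p k)) (dg (m k * q k)) ** c k" for k
    unfolding t_def pqc(4) m_def using pqc[of k] by (simp add: phi_simps dg_mult)
  have tsK: "(\<lambda>k. t (r (k + K)) ** s (k + K)) \<longlonglongrightarrow> z" using LIMSEQ_ignore_initial_segment[OF ts, of K] by simp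
  have clim: "(\<lambda>k. (t (r (k + K)) ** s (k + K)) ** x ** matrix_inv (t (r (k + K)) ** s (k + K)))
     \<longlonglongrightarrow> z ** x ** matrix_inv z" for x :: "real^'n^'n"
  proof (intro tendsto_matrix_mult tendsto_matrix_inv tsK tendsto_const)
    show "det z ~= 0" using det_H[OF inH[OF z(1)]] by simp
    fix k
    have "t (r (k + K)) ** s (k + K) \<in> T" by (intro mult_T tT K) simp
    from det_H[OF inH[OF this]] show "det (t (r (k + K)) ** s (k + K)) ~= 0" by simp
  qed
  have u0: "upper 0 = mat 1" by (simp add: upper_def mat_1_mat2)
  have pos: "m k * p k > 0" "m k * q k > 0" for k using m0[of k] pqc[of k] by auto
  have "(\<lambda>k. \<phi> (upper ((m k * p k)\<^sup>2)) (mat 1)) \<longlonglongrightarrow> \<phi> (upper (az\<^sup>2)) (mat 1)"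
    using clim[of "\<phi> (upper 1) (upper 0)"] unfolding tdef zz(4) conj[OF pos pqc(3)] conj[OF zz(1-3)] by (simp add: u0)
  moreover obtain L where L: "continuous_on UNIV L" "!!x. L (\<phi> (upper x) (mat 1)) = (x::real)"
    using coord1 by blast
  ultimately have "(\<lambda>k. L (\<phi> (upper ((m k * p k)\<^sup>2)) (mat 1))) \<longlonglongrightarrow> L (\<phi> (upper (az\<^sup>2)) (mat 1))"
    by (intro continuous_on_tendsto_compose[OF L(1)]) auto
  then have p2: "(\<lambda>k. (m k * p k)\<^sup>2) \<longlonglongrightarrow> az\<^sup>2" by (simp add: L(2))
  have "(\<lambda>k. \<phi> (mat 1) (upper ((m k * q k)\<^sup>2))) \<longlonglongrightarrow> \<phi> (mat 1) (upper (bz\<^sup>2))"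
    using clim[of "\<phi> (upper 0) (upper 1)"] unfolding tdef zz(4) conj[OF pos pqc(3)] conj[OF zz(1-3)] by (simp add: u0)
  moreover obtain L' where L': "continuous_on UNIV L'" "!!x. L' (\<phi> (mat 1) (upper x)) = (x::real)"
    using coord2 by blast
  ultimately have "(\<lambda>k. L' (\<phi> (mat 1) (upper ((m k * q k)\<^sup>2)))) \<longlonglongrightarrow> L' (\<phi> (mat 1) (upper (bz\<^sup>2)))"
    by (intro continuous_on_tendsto_compose[OF L'(1)]) auto
  then have q2: "(\<lambda>k. (m k * q k)\<^sup>2) \<longlonglongrightarrow> bz\<^sup>2" by (simp add: L'(2))
  obtain N where N: "N > 0" "!!a b c. a > 0 ==> b > 0 ==> c \<in> C ==>
    matrix_inv (\<phi> \<gamma> \<gamma>) ** (\<phi> (dg a) (dg b) ** c) ** \<phi> \<gamma> \<gamma> \<in> \<Delta> ==> a * b = 1 & real N * (b\<^sup>2 + 1 / b\<^sup>2) \<in> \<int>"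
    using torus_stabilizer[OF \<gamma>] by blast
  have pq: "p k * q k = 1" for k
  proof -
    have "matrix_inv g ** s (k + K) ** g = \<delta> (k + K) ** matrix_inv \<delta>'" unfolding s_def using inv by (simp add: group_simps)
    then have "matrix_inv g ** s (k + K) ** g \<in> \<Delta>" using mult_Delta[OF \<delta> inv_Delta[OF z(2)]] by simp
    then show ?thesis using N(2)[OF pqc(1-3)] by (simp add: pqc(4) g_def)
  qed
  have "(\<lambda>k. (m k * p k)\<^sup>2 * (m k * q k)\<^sup>2) \<longlonglongrightarrow> az\<^sup>2 * bz\<^sup>2" by (intro tendsto_mult p2 q2)
  moreover have "(m k * p k)\<^sup>2 * (m k * q k)\<^sup>2 = (m k) ^ 4" for k
  proof -
    have "(m k * p k)\<^sup>2 * (m k * q k)\<^sup>2 = (p k * q k)\<^sup>2 * (m k) ^ 4" by (simp add: power_mult_distrib eval_nat_numeral)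
    then show ?thesis by (simp add: pq)
  qed
  ultimately have "(\<lambda>k. (m k) ^ 4) \<longlonglongrightarrow> az\<^sup>2 * bz\<^sup>2" by simp
  then have "Bseq (\<lambda>k. (m k) ^ 4)" by (rule convergent_imp_Bseq[OF convergentI])
  then obtain B where B: "!!k. \<bar>(m k) ^ 4\<bar> \<le> B" by (auto simp: Bseq_def)
  obtain k :: nat where k: "real k > B" using reals_Archimedean2 by blast
  have "real k \<le> m k" using seq_suble[OF r, of "k + K"] by (simp add: m_def)
  also have "m k \<le> (m k) ^ 4" by (intro self_le_power) (auto simp: m_def)
  also have "\<dots> \<le> B" using B[of k] by linarith
  finally show False using k by simp
qed

end

text \<open>The conclusion on orbits, pulled back to the group.\<close>

definition four_boundary_cosets :: "(real^'n^'n) set => (real^'n^'n) set => (real^'n^'n) set => bool" where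
  "four_boundary_cosets H T D \<longleftrightarrow>
  (\<exists>g\<in>H. \<exists>h :: nat => real^'n^'n.
     (\<forall>i\<in>{1..4}. h i \<in> H & closed (double_coset T D (h i)) & (\<forall>K. compact K --> (\<exists>t\<in>T. \<forall>\<delta>\<in>D. t ** h i ** \<delta> \<notin> K))) &
     (\<forall>i\<in>{1..4}. \<forall>j\<in>{1..4}. i ~= j --> double_coset T D (h i) ~= double_coset T D (h j)) &
     (\<forall>i\<in>{1..4}. double_coset T D (h i) \<inter> double_coset T D g = {}) &
     closure (double_coset T D g) = double_coset T D g \<union> (\<Union>i\<in>{1..4}. double_coset T D (h i)))"

context hilbert_torus
begin

text \<open>If one parameter of the torus converges to a positive number, limits stay in the orbit itself. Together with the previous section, only the four corners of the plane of parameters can contribute new limit points.\<close>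

lemma bounded_first:
  assumes g1: "g1 \<in> SL"
    and a: "!!k. a k > 0" and l: "a \<longlonglongrightarrow> l" "l > 0" and b: "!!k. b k > 0" and c: "!!k. c k \<in> C" and \<delta>: "!!k. \<delta> k \<in> \<Delta>"
    and lim: "(\<lambda>k::nat. \<phi> (dg (a k)) (dg (b k)) ** c k ** \<phi> g1 (mat 1) ** \<delta> k) \<longlonglongrightarrow> h" and h: "h \<in> H"
  shows "h \<in> orb (\<phi> g1 (mat 1))"
proof -
  have inv: "invertible (\<phi> g1 (mat 1))" using g1 by (simp add: invertible_H phi_H)
  have i1: "(\<lambda>k. \<phi> (dg (1 / a k)) (mat 1)) \<longlonglongrightarrow> \<phi> (dg (1 / l)) (mat 1)"
    unfolding dg_def using l a by (intro phi_tendsto tendsto_mat2 tendsto_intros) (auto simp: less_imp_neq[symmetric])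
  define h' where "h' = matrix_inv (\<phi> g1 (mat 1)) ** (\<phi> (dg (1 / l)) (mat 1) ** h)"
  have "(\<lambda>k. matrix_inv (\<phi> g1 (mat 1)) ** (\<phi> (dg (1 / a k)) (mat 1) ** (\<phi> (dg (a k)) (dg (b k)) ** c k ** \<phi> g1 (mat 1) ** \<delta> k))) \<longlonglongrightarrow> h'"
    unfolding h'_def by (intro tendsto_matrix_mult tendsto_const i1 lim)
  moreover have "matrix_inv (\<phi> g1 (mat 1)) ** (\<phi> (dg (1 / a k)) (mat 1) ** (\<phi> (dg (a k)) (dg (b k)) ** c k ** \<phi> g1 (mat 1) ** \<delta> k))
     = \<phi> (mat 1) (dg (b k)) ** c k ** \<phi> (mat 1) (mat 1) ** \<delta> k" for k
  proof -
    have "\<phi> (dg (1 / a k)) (mat 1) ** (\<phi> (dg (a k)) (dg (b k)) ** c k ** \<phi> g1 (mat 1) ** \<delta> k)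
      = \<phi> g1 (mat 1) ** (\<phi> (mat 1) (dg (b k)) ** c k ** \<phi> (mat 1) (mat 1) ** \<delta> k)"
     using a[of k] b[of k] c[of k] g1 by (simp add: phi_simps dg_mult dg_mult_left)
    then show ?thesis using inv by (simp add: matrix_cancel)
  qed
  ultimately have lim': "(\<lambda>k. \<phi> (mat 1) (dg (b k)) ** c k ** \<phi> (mat 1) (mat 1) ** \<delta> k) \<longlonglongrightarrow> h'" by simp
  have h'H: "h' \<in> H" unfolding h'_def using g1 l h by (intro mult_H inv_H phi_H) auto
  have "rational_matrix (mat 1 :: real^2^2)" by (simp add: mat_1_mat2 rational_mat2)
  from hilbert_torus.bounded_coordinate[OF swap one_SL this b c \<delta> lim' h'H]
  obtain b' c' d' where *: "b' > 0" "c' \<in> C" "d' \<in> \<Delta>" "h' = \<phi> (mat 1) (dg b') ** c' ** \<phi> (mat 1) (mat 1) ** d'" by blast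
  have "h = \<phi> (dg l) (mat 1) ** (\<phi> g1 (mat 1) ** h')"
    unfolding h'_def using inv l by (simp add: matrix_cancel phi_simps dg_mult phi_one)
  also have "\<dots> = \<phi> (dg l) (dg b') ** c' ** \<phi> g1 (mat 1) ** d'"
    unfolding *(4) using l * g1 by (simp add: phi_simps phi_one)
  finally show ?thesis using orbI[OF torusI[OF l(2) *(1,2)] *(3)] by simp
qed

lemma bounded_second:
  assumes g1: "g1 \<in> SL" "rational_matrix g1"
    and b: "!!k. b k > 0" and l: "b \<longlonglongrightarrow> l" "l > 0" and a: "!!k. a k > 0" and c: "!!k. c k \<in> C" and \<delta>: "!!k. \<delta> k \<in> \<Delta>"
    and lim: "(\<lambda>k::nat. \<phi> (dg (a k)) (dg (b k)) ** c k ** \<phi> g1 (mat 1) ** \<delta> k) \<longlonglongrightarrow> h" and h: "h \<in> H"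
  shows "h \<in> orb (\<phi> g1 (mat 1))"
proof -
  have inv: "invertible (\<phi> (mat 1) g1)" using g1 by (simp add: invertible_H phi_H)
  have gi: "matrix_inv g1 \<in> SL" "matrix_inv g1 ** g1 = mat 1" "g1 ** matrix_inv g1 = mat 1"
    using g1 by (simp_all add: SL_inv SL_invertible group_simps)
  have i1: "(\<lambda>k. \<phi> (mat 1) (dg (1 / b k))) \<longlonglongrightarrow> \<phi> (mat 1) (dg (1 / l))"
    unfolding dg_def using l b by (intro phi_tendsto tendsto_mat2 tendsto_intros) (auto simp: less_imp_neq[symmetric])
  define h' where "h' = \<phi> (mat 1) g1 ** (\<phi> (mat 1) (dg (1 / l)) ** h)"
  have "(\<lambda>k. \<phi> (mat 1) g1 ** (\<phi> (mat 1) (dg (1 / b k)) ** (\<phi> (dg (a k)) (dg (b k)) ** c k ** \<phi> g1 (mat 1) ** \<delta> k))) \<longlonglongrightarrow> h'"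
    unfolding h'_def by (intro tendsto_matrix_mult tendsto_const i1 lim)
  moreover have "\<phi> (mat 1) g1 ** (\<phi> (mat 1) (dg (1 / b k)) ** (\<phi> (dg (a k)) (dg (b k)) ** c k ** \<phi> g1 (mat 1) ** \<delta> k))
     = \<phi> (dg (a k)) (mat 1) ** c k ** \<phi> g1 g1 ** \<delta> k" for k
    using a[of k] b[of k] c[of k] g1 by (simp add: phi_simps dg_mult dg_mult_left)
  ultimately have lim': "(\<lambda>k. \<phi> (dg (a k)) (mat 1) ** c k ** \<phi> g1 g1 ** \<delta> k) \<longlonglongrightarrow> h'" by simp
  have h'H: "h' \<in> H" unfolding h'_def using g1 l h by (intro mult_H inv_H phi_H) auto
  from bounded_coordinate[OF g1 a c \<delta> lim' h'H]
  obtain a' c' d' where *: "a' > 0" "c' \<in> C" "d' \<in> \<Delta>" "h' = \<phi> (dg a') (mat 1) ** c' ** \<phi> g1 g1 ** d'" by blast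
  have "h = \<phi> (mat 1) (dg l) ** (\<phi> (mat 1) (matrix_inv g1) ** h')"
    unfolding h'_def using l gi g1 by (simp add: phi_simps dg_mult dg_mult_left phi_one matrix_mul_assoc[of "matrix_inv g1" g1])
  also have "\<dots> = \<phi> (dg a') (dg l) ** c' ** \<phi> g1 (mat 1) ** d'"
    unfolding *(4) using l * g1 gi by (simp add: phi_simps phi_one)
  finally show ?thesis using orbI[OF torusI[OF *(1) l(2) *(2)] *(3)] by simp
qed

subsection \<open>Separating orbits\<close>

lemma point_relation:
  assumes n: "n \<in> SL" "n' \<in> SL" and \<gamma>: "\<gamma> \<in> SL" "\<gamma>' \<in> SL" and mem: "point n \<gamma> \<in> orb (point n' \<gamma>')"
  obtains a b c where "a > 0" "b > 0" "c \<in> C"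
    "matrix_inv (\<phi> \<gamma> \<gamma>) ** (\<phi> (matrix_inv n ** dg a ** n') (dg b) ** c) ** \<phi> \<gamma>' \<gamma>' \<in> \<Delta>"
proof -
  obtain t \<delta> where t: "t \<in> T" "\<delta> \<in> \<Delta>" "point n \<gamma> = t ** point n' \<gamma>' ** \<delta>" using mem by (auto simp: double_coset_def)
  obtain a b c where abc: "a > 0" "b > 0" "c \<in> C" "t = \<phi> (dg a) (dg b) ** c" using torus_cases[OF t(1)] .
  have inv: "invertible \<delta>" "invertible (\<phi> \<gamma> \<gamma>)" "invertible (\<phi> n (mat 1))" using t(2) \<gamma> n by (simp_all add: invertible_Delta invertible_H phi_H)
  have "matrix_inv (point n \<gamma>) ** t ** point n' \<gamma>' = matrix_inv \<delta>"
    using inv by (simp add: t(3)[symmetric] point_def[of n \<gamma>] matrix_mul_assoc[symmetric] flip: )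
     (metis t(3) point_def inv invertible_mult matrix_cancel(1) matrix_inv_mult matrix_inv_mult_right matrix_mul_assoc matrix_mul_rid)
  moreover have "matrix_inv (point n \<gamma>) ** t ** point n' \<gamma>'
    = matrix_inv (\<phi> \<gamma> \<gamma>) ** (\<phi> (matrix_inv n ** dg a ** n') (dg b) ** c) ** \<phi> \<gamma>' \<gamma>'"
    unfolding point_def abc(4) using inv n \<gamma> abc by (simp add: matrix_inv_mult phi_inv phi_simps SL_invertible)
  ultimately show ?thesis using that abc inv_Delta[OF t(2)] by metis
qed

lemma conj_pair_commute: "conj_pair d N z z' \<longleftrightarrow> conj_pair d N z' z"
  using conj_pair_sym by blast

text \<open>A relation between the two points would give a lattice element whose first factor has a nonzero corner while its conjugate factor has a zero corner, which is impossible for Galois conjugates.\<close>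

lemma point_not_in_orb:
  assumes n: "n \<in> SL" "n' \<in> SL" and \<gamma>: "\<gamma> \<in> SL" "\<gamma>' \<in> SL" "rational_matrix \<gamma>" "rational_matrix \<gamma>'"
    and ne: "!!a. a > 0 ==> (matrix_inv n ** dg a ** n') $ 1 $ 2 ~= 0"
  shows "point n \<gamma> \<notin> orb (point n' \<gamma>')"
proof
  assume "point n \<gamma> \<in> orb (point n' \<gamma>')"
  from point_relation[OF n \<gamma>(1,2) this]
  obtain a b c where abc: "a > 0" "b > 0" "c \<in> C"
    "matrix_inv (\<phi> \<gamma> \<gamma>) ** (\<phi> (matrix_inv n ** dg a ** n') (dg b) ** c) ** \<phi> \<gamma>' \<gamma>' \<in> \<Delta>" .
  moreover obtain N where N: "N > 0" "\<forall>m1\<in>SL. \<forall>m2\<in>SL. \<forall>c\<in>C.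
    matrix_inv (\<phi> \<gamma> \<gamma>) ** (\<phi> m1 m2 ** c) ** \<phi> \<gamma>' \<gamma>' \<in> \<Delta> --> norm_integral d N m1 m2"
    using integrality_conj[OF \<gamma>(1,3) \<gamma>(2,4)] by blast
  moreover have "matrix_inv n ** dg a ** n' \<in> SL" "dg b \<in> SL" using n abc by (auto intro!: SL_mult SL_inv)
  ultimately have "norm_integral d N (matrix_inv n ** dg a ** n') (dg b)" by blast
  then have "conj_pair d N ((matrix_inv n ** dg a ** n') $ 1 $ 2 * dg b $ 1 $ 1) ((matrix_inv n ** dg a ** n') $ 1 $ 1 * dg b $ 1 $ 2)"
    unfolding norm_integral_def by blast
  then have "conj_pair d N 0 ((matrix_inv n ** dg a ** n') $ 1 $ 2 * b)" by (subst (asm) conj_pair_commute) (simp add: dg_def)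
  from conj_pair_zero[OF irrational this N(1)] ne[OF abc(1)] abc(2) show False by simp
qed

text \<open>Points with the same Weyl element are separated arithmetically: the translation \<open>z\<close> is chosen smaller than the denominators of integral elements allow.\<close>

lemma lower_not_in_orb:
  assumes n: "n \<in> SL" "n' \<in> SL" and \<gamma>: "\<gamma> \<in> SL" "\<phi> \<gamma> \<gamma> \<in> \<Delta>"
    and diag: "!!a. a > 0 ==> \<exists>x. x ~= 0 & matrix_inv n ** dg a ** n' = dg x"
    and N: "!!m1 m2 c. m1 \<in> SL ==> m2 \<in> SL ==> c \<in> C ==> \<phi> m1 m2 ** c \<in> \<Delta> ==> norm_integral d N m1 m2"
    and z: "0 < real N * z" "real N * z < 1"
  shows "point n \<gamma> \<notin> orb (point n' (lower z))"
proof
  assume "point n \<gamma> \<in> orb (point n' (lower z))"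
  from point_relation[OF n \<gamma>(1) lower_SL this]
  obtain a b c where abc: "a > 0" "b > 0" "c \<in> C"
    "matrix_inv (\<phi> \<gamma> \<gamma>) ** (\<phi> (matrix_inv n ** dg a ** n') (dg b) ** c) ** \<phi> (lower z) (lower z) \<in> \<Delta>" .
  obtain x where x: "x ~= 0" "matrix_inv n ** dg a ** n' = dg x" using diag[OF abc(1)] by blast
  have "\<phi> \<gamma> \<gamma> ** (matrix_inv (\<phi> \<gamma> \<gamma>) ** (\<phi> (dg x) (dg b) ** c) ** \<phi> (lower z) (lower z)) \<in> \<Delta>"
    using mult_Delta[OF \<gamma>(2) abc(4)] unfolding x(2) .
  moreover have "\<phi> \<gamma> \<gamma> ** (matrix_inv (\<phi> \<gamma> \<gamma>) ** (\<phi> (dg x) (dg b) ** c) ** \<phi> (lower z) (lower z))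
     = \<phi> (dg x ** lower z) (dg b ** lower z) ** c"
    using invertible_Delta[OF \<gamma>(2)] abc x by (simp add: group_simps phi_simps)
  ultimately have "norm_integral d N (dg x ** lower z) (dg b ** lower z)"
    using abc x by (intro N) (auto intro!: SL_mult)
  then have "conj_pair d N ((dg x ** lower z) $ i $ k * (dg b ** lower z) $ i $ k) ((dg x ** lower z) $ i $ k * (dg b ** lower z) $ i $ k)" for i k
    unfolding norm_integral_def by blast
  from conj_pair_self[OF irrational this[of 1 1]] conj_pair_self[OF irrational this[of 2 1]]
  have "real N * (x * b) \<in> \<int>" "real N * (z\<^sup>2 / (x * b)) \<in> \<int>"
    by (simp_all add: dg_def lower_def power2_eq_square)
  then have "(real N * (x * b)) * (real N * (z\<^sup>2 / (x * b))) \<in> \<int>" by (rule Ints_mult)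
  also have "(real N * (x * b)) * (real N * (z\<^sup>2 / (x * b))) = (real N * z)\<^sup>2"
    using abc x by (simp add: power2_eq_square)
  finally have "(real N * z)\<^sup>2 \<in> \<int>" .
  then have "(real N * z)\<^sup>2 \<ge> 1" using zero_less_power[OF z(1)] by (rule Ints_pos_ge_1)
  moreover have "(real N * z)\<^sup>2 < 1" using z by (simp add: power_less_one_iff abs_square_less_1)
  ultimately show False by linarith
qed

lemma normalizes_dg: "x ~= 0 ==> normalizes_diagonal (dg x)"
  unfolding normalizes_diagonal_def by (auto simp: dg_mult mult.commute)

lemma dg_anti: "\<alpha> ~= 0 ==> y ~= 0 ==> dg \<alpha> ** mat2 0 (-y) (1 / y) 0 = mat2 0 (-y) (1 / y) 0 ** dg (1 / \<alpha>)"
  by (simp add: dg_def mat2_eq_iff)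

lemma normalizes_anti:
  assumes "y ~= 0"
  shows "normalizes_diagonal (mat2 0 (-y) (1 / y) 0)"
  unfolding normalizes_diagonal_def
proof (intro conjI allI impI)
  show "mat2 0 (-y) (1 / y) 0 \<in> SL" using assms by simp
  fix \<alpha> :: real assume a: "\<alpha> > 0"
  show "\<exists>\<beta>>0. dg \<alpha> ** mat2 0 (-y) (1 / y) 0 = mat2 0 (-y) (1 / y) 0 ** dg \<beta>"
    using dg_anti[of \<alpha> y] assms a by (intro exI[of _ "1 / \<alpha>"]) simp
  show "\<exists>\<beta>>0. mat2 0 (-y) (1 / y) 0 ** dg \<alpha> = dg \<beta> ** mat2 0 (-y) (1 / y) 0"
    using dg_anti[of "1 / \<alpha>" y] assms a by (intro exI[of _ "1 / \<alpha>"]) simp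
qed

subsection \<open>The orbit closure\<close>

lemma one_to_four: "i \<in> {1..4} ==> i = 1 \<or> i = 2 \<or> i = 3 \<or> i = (4::nat)"
  unfolding atLeastAtMost_iff by arith

text \<open>The point \<open>g\<close> differs from a rational point in the first factor only, by a product of an upper and a lower unipotent matrix. It can be written in four ways as a contracted factor times a Weyl translate of a rational point, one for each corner of the plane of torus parameters, and these four points give the boundary.\<close>

theorem four_boundary_orbits: "four_boundary_cosets H T \<Delta>"
proof -
  obtain N where N: "N > 0" "!!m1 m2 c. m1 \<in> SL ==> m2 \<in> SL ==> c \<in> C ==> \<phi> m1 m2 ** c \<in> \<Delta> ==> norm_integral d N m1 m2"
    using integrality by blast
  obtain Q where Q: "Q > 0" "!!m1 m2. m1 \<in> SL ==> m2 \<in> SL ==>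
     (!!i j. conj_pair d 1 ((m1 $ i $ j - mat 1 $ i $ j) / real Q) ((m2 $ i $ j - mat 1 $ i $ j) / real Q))
      ==> \<phi> m1 m2 \<in> \<Delta>" using congruence by blast
  define M where "M = real (Q * (N + 1))"
  have "Q * (N + 1) > 0" using Q(1) by simp
  then have M0: "M > 0" unfolding M_def by (simp only: of_nat_0_less_iff)
  have MN: "real N < M"
  proof -
    have "N < N + 1" by simp
    also have "N + 1 \<le> Q * (N + 1)" 
    proof -
     have "1 \<le> Q" using Q(1) by simp
     from mult_le_mono1[OF this, of "N + 1"] show ?thesis by (simp only: mult_1)
    qed
    finally show ?thesis unfolding M_def by (simp only: of_nat_less_iff)
  qed
  have up: "\<phi> (upper (of_int k * M)) (upper (of_int k * M)) \<in> \<Delta>" for k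
  proof (rule Q(2))
    have e: "of_int k * M / real Q = of_int (k * int (N + 1))" using Q(1) by (simp add: M_def field_simps)
    fix i j
    have "\<forall>i j. conj_pair d 1 ((upper (of_int k * M) $ i $ j - mat 1 $ i $ j) / real Q) ((upper (of_int k * M) $ i $ j - mat 1 $ i $ j) / real Q)"
     unfolding forall_2 mat_1_mat2 upper_def mat2_nth using conj_pair_int[of d 1 "k * int (N + 1)"] by (simp add: e)
    then show "conj_pair d 1 ((upper (of_int k * M) $ i $ j - mat 1 $ i $ j) / real Q) ((upper (of_int k * M) $ i $ j - mat 1 $ i $ j) / real Q)" by blast
  qed simp_all
  have MQ: "M \<in> \<rat>" by (simp add: M_def)
  define g1 where "g1 = mat2 1 M (1 / M) 2"
  define g where "g = \<phi> g1 (mat 1)"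
  have g1: "g1 \<in> SL" "rational_matrix g1" using M0 MQ by (simp_all add: g1_def rational_mat2)
  have gH: "g \<in> H" using g1 by (simp add: g_def phi_H)
  define n where "n = (\<lambda>i::nat. if i = 1 then dg (1/2) else if i = 2 then dg 1
     else if i = 3 then mat2 0 (-M) (1/M) 0 else mat2 0 (- (-M)) (1 / (-M)) 0)"
  define \<gamma> where "\<gamma> = (\<lambda>i::nat. if i = 1 then lower (1 / (2 * M)) else if i = 2 then upper M
     else if i = 3 then upper (2 * M) else lower (1 / M))"
  define X where "X = (\<lambda>i::nat. if i = 1 then upper (M / 2) else if i = 2 then lower (1 / M)
     else if i = 3 then upper M else lower (2 / M))"
  define Y where "Y = (\<lambda>i::nat. matrix_inv (\<gamma> i))"
  define h where "h i = point (n i) (\<gamma> i)" for i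
  have nn: "normalizes_diagonal (n i)" for i
    unfolding n_def using M0 normalizes_dg[of "1/2"] normalizes_dg[of 1] normalizes_anti[of M] normalizes_anti[of "-M"] by simp
  then have nS: "n i \<in> SL" for i by (simp add: normalizes_diagonal_def)
  have gS: "\<gamma> i \<in> SL" for i by (simp add: \<gamma>_def)
  have gR: "rational_matrix (\<gamma> i)" for i
    using MQ by (simp add: \<gamma>_def lower_def upper_def rational_mat2)
  have XS: "X i \<in> SL" and YS: "Y i \<in> SL" for i using gS by (simp_all add: X_def Y_def SL_inv)
  have hH: "h i \<in> H" for i by (simp add: h_def point_H nS gS)
  have XnG: "X i ** n i ** \<gamma> i = g1" for i
    using M0 by (simp add: X_def n_def \<gamma>_def g1_def lower_def upper_def dg_def mat2_eq_iff field_simps)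
  have gX: "g = \<phi> (X i) (Y i) ** point (n i) (\<gamma> i)" for i
    using XnG[of i] XS[of i] YS[of i] nS[of i] gS[of i]
    by (simp add: g_def point_def Y_def phi_simps SL_invertible matrix_inv_mult_left)
  have cl: "closed (orb (h i))" for i unfolding h_def by (intro closed_orb_point nn gS gR)
  have nc: "\<exists>t\<in>T. \<forall>\<delta>\<in>\<Delta>. t ** h i ** \<delta> \<notin> K" if "compact K" for i K
    unfolding h_def using noncompact_point[OF nn gS gR that] .
  \<comment> \<open>Each of the four closed orbits is reached, one from each corner of the plane of parameters.\<close>
  have acc: "orb (h i) \<subseteq> closure (orb g)" if "i \<in> {1..4}" for i
    unfolding h_def
  proof (rule quadrant_accumulation[OF gX XS YS nS gS gR])
    fix u :: real assume u: "u > 1"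
    have t0: "(\<lambda>k. (1 / u) ^ k) \<longlonglongrightarrow> 0" using u by (intro LIMSEQ_realpow_zero) auto
    have p: "(1 / u) ^ k > 0" "u ^ k > 0" "(1 / u) ^ k ~= 0" "u ^ k ~= 0" for k using u by auto
    have inv: "1 / ((1 / u) ^ k) = u ^ k" "1 / (u ^ k) = (1 / u) ^ k" for k by (simp_all add: power_divide)
    have t1: "(\<lambda>k. 1 / (u ^ k)) \<longlonglongrightarrow> 0" using t0 by (simp add: inv)
    have cu: "contracting (\<lambda>k. (1 / u) ^ k) (upper x)" for x by (rule contracting_upper[OF t0 p(1)])
    have cl: "contracting (\<lambda>k. u ^ k) (lower x)" for x by (rule contracting_lower[OF t1 p(2)])
    have dd: "dg a ** dg b = dg b ** dg a" for a b by (simp add: dg_mult mult.commute)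
    consider "i = 1" | "i = 2" | "i = 3" | "i = 4" using one_to_four[OF \<open>i \<in> {1..4}\<close>] by blast
    then show "\<exists>a b e. (\<forall>k. a k > 0) & (\<forall>k. b k > 0) & contracting a (X i) & contracting b (Y i) &
      (\<forall>k. dg (a k) ** n i = n i ** dg (e k)) &
      (\<forall>k. (e k = u ^ k & b k = (1 / u) ^ k) \<or> (e k = (1 / u) ^ k & b k = u ^ k))"
    proof cases
     case 1
     show ?thesis
      by (rule exI[of _ "\<lambda>k. (1 / u) ^ k"], rule exI[of _ "\<lambda>k. u ^ k"], rule exI[of _ "\<lambda>k. (1 / u) ^ k"])
       (use 1 p cu cl dd in \<open>auto simp: X_def Y_def n_def \<gamma>_def lower_inv\<close>)
    next
     case 2
     show ?thesis
      by (rule exI[of _ "\<lambda>k. u ^ k"], rule exI[of _ "\<lambda>k. (1 / u) ^ k"], rule exI[of _ "\<lambda>k. u ^ k"])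
       (use 2 p cu cl dd in \<open>auto simp: X_def Y_def n_def \<gamma>_def upper_inv\<close>)
    next
     case 3
     have hn: "dg ((1 / u) ^ k) ** n i = n i ** dg (u ^ k)" for k
      using dg_anti[OF p(3), of M k] M0 3 by (simp add: n_def inv)
     show ?thesis
      by (rule exI[of _ "\<lambda>k. (1 / u) ^ k"], rule exI[of _ "\<lambda>k. (1 / u) ^ k"], rule exI[of _ "\<lambda>k. u ^ k"])
       (use 3 p cu hn in \<open>auto simp: X_def Y_def \<gamma>_def upper_inv\<close>)
    next
     case 4
     have hn: "dg (u ^ k) ** n i = n i ** dg ((1 / u) ^ k)" for k
      using dg_anti[OF p(4), of "-M" k] M0 4 by (simp add: n_def inv)
     show ?thesis
      by (rule exI[of _ "\<lambda>k. u ^ k"], rule exI[of _ "\<lambda>k. u ^ k"], rule exI[of _ "\<lambda>k. (1 / u) ^ k"])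
       (use 4 p cl hn in \<open>auto simp: X_def Y_def \<gamma>_def lower_inv\<close>)
    qed
  qed
  \<comment> \<open>Limit points come from bounded parameters, which stay in the orbit, or from one of the four corners.\<close>
  have lims: "x \<in> orb g \<union> (\<Union>i\<in>{1..4}. orb (h i))" if x: "x \<in> closure (orb g)" for x
  proof -
    obtain s where s: "!!k. s k \<in> orb g" "s \<longlonglongrightarrow> x" using x unfolding closure_sequential by blast
    have xH: "x \<in> H" using closed_sequentially[OF closed_H _ s(2)] s(1) orb_H[OF gH] by blast
    have "\<forall>k. \<exists>a b c e. a > 0 & b > 0 & c \<in> C & e \<in> \<Delta> & s k = \<phi> (dg a) (dg b) ** c ** g ** e"
    proof
     fix k
     obtain t e where te: "t \<in> T" "e \<in> \<Delta>" "s k = t ** g ** e" using s(1)[of k] by (auto simp: double_coset_def)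
     obtain a b c where "a > 0" "b > 0" "c \<in> C" "t = \<phi> (dg a) (dg b) ** c" using torus_cases[OF te(1)] .
     then show "\<exists>a b c e. a > 0 & b > 0 & c \<in> C & e \<in> \<Delta> & s k = \<phi> (dg a) (dg b) ** c ** g ** e" using te by blast
    qed
    then obtain a b c e where abc: "!!k. a k > 0" "!!k. b k > 0" "!!k. c k \<in> C" "!!k. e k \<in> \<Delta>"
     "!!k. s k = \<phi> (dg (a k)) (dg (b k)) ** c k ** g ** e k" by metis
    have sub: "(\<lambda>k. \<phi> (dg (a (r k))) (dg (b (r k))) ** c (r k) ** g ** e (r k)) \<longlonglongrightarrow> x" if "strict_mono r" for r
     using LIMSEQ_subseq_LIMSEQ[OF s(2) that] by (simp add: o_def abc(5))
    have first: "x \<in> orb g" if "strict_mono r" "(a \<circ> r) \<longlonglongrightarrow> l" "l > 0" for r l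
    proof -
     have "(\<lambda>k. a (r k)) \<longlonglongrightarrow> l" using that(2) by (simp add: o_def)
     from bounded_first[OF g1(1) abc(1) this that(3) abc(2,3,4) sub[OF that(1), unfolded g_def] xH]
     show ?thesis by (simp add: g_def)
    qed
    have second: "x \<in> orb g" if "strict_mono r" "(\<lambda>k. b (r k)) \<longlonglongrightarrow> l" "l > 0" for r l
     using bounded_second[OF g1 abc(2) that(2,3) abc(1,3,4) sub[OF that(1), unfolded g_def] xH] by (simp add: g_def)
    have quad: "x \<in> orb (h i)" if "strict_mono r" "contracting (\<lambda>k. a (r k)) (X i)" "contracting (\<lambda>k. b (r k)) (Y i)" for r i
     unfolding h_def by (rule quadrant_limit[OF gX XS YS nn gS gR abc(1,2,3,4) that(2,3) sub[OF that(1)]])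
    have combine: "x \<in> orb g \<union> (\<Union>i\<in>{1..4}. orb (h i))"
     if r: "strict_mono r" and iu: "iu \<in> {1..4}" and il: "il \<in> {1..4}" and ca: "!!r'. strict_mono r' ==> contracting (\<lambda>k. a (r (r' k))) (X iu) & contracting (\<lambda>k. a (r (r' k))) (X il)"
      and Yu: "\<exists>y. Y iu = upper y" and Yl: "\<exists>y. Y il = lower y" for r :: "nat => nat" and iu il
    proof -
     have "\<forall>k. (b \<circ> r) k > 0" using abc(2) by simp
     then show ?thesis
     proof (cases rule: positive_sequence_cases)
     case (inner r' l)
     have "strict_mono (r \<circ> r')" using r inner(1) by (rule strict_mono_o)
     moreover have "(\<lambda>k. b ((r \<circ> r') k)) \<longlonglongrightarrow> l" using inner(3) by (simp add: o_def)
     ultimately show ?thesis using second inner(2) by blast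
    next
     case (zero r')
     obtain y where y: "Y iu = upper y" using Yu by blast
     have "contracting (\<lambda>k. b (r (r' k))) (Y iu)" unfolding y
      by (rule contracting_upper) (use zero(2) abc(2) in \<open>auto simp: o_def\<close>)
     then have "x \<in> orb (h iu)" using quad[of "r \<circ> r'" iu] ca[OF zero(1)] strict_mono_o[OF r zero(1)] by (simp add: o_def)
     then show ?thesis using iu by blast
    next
     case (infinity r')
     obtain y where y: "Y il = lower y" using Yl by blast
     have "contracting (\<lambda>k. b (r (r' k))) (Y il)" unfolding y
      by (rule contracting_lower) (use infinity(2) abc(2) in \<open>auto simp: o_def\<close>)
     then have "x \<in> orb (h il)" using quad[of "r \<circ> r'" il] ca[OF infinity(1)] strict_mono_o[OF r infinity(1)] by (simp add: o_def)
     then show ?thesis using il by blast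
    qed
    qed
    have "\<forall>k. a k > 0" using abc(1) by simp
    then show ?thesis
    proof (cases rule: positive_sequence_cases)
     case (inner r l)
     then show ?thesis using first by blast
    next
     case (zero r)
     have "contracting (\<lambda>k. a (r (r' k))) (upper z)" if "strict_mono r'" for r' z
      by (rule contracting_upper) (use LIMSEQ_subseq_LIMSEQ[OF zero(2) that] abc(1) in \<open>auto simp: o_def\<close>)
     then show ?thesis
      by (intro combine[OF zero(1), of 3 1]) (auto simp: X_def Y_def \<gamma>_def upper_inv lower_inv)
    next
     case (infinity r)
     have "contracting (\<lambda>k. a (r (r' k))) (lower z)" if "strict_mono r'" for r' z
      by (rule contracting_lower) (use LIMSEQ_subseq_LIMSEQ[OF infinity(2) that] abc(1) in \<open>auto simp: o_def\<close>)
     then show ?thesis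
      by (intro combine[OF infinity(1), of 2 4]) (auto simp: X_def Y_def \<gamma>_def upper_inv lower_inv)
    qed
  qed
  have closure: "closure (orb g) = orb g \<union> (\<Union>i\<in>{1..4}. orb (h i))"
    using acc lims closure_subset[of "orb g"] by blast
  \<comment> \<open>A common point would give a relation that a nonvanishing corner entry excludes.\<close>
  have disj: "orb (h i) \<inter> orb g = {}" if "i \<in> {1..4}" for i
  proof -
    have gp: "g = point g1 (mat 1)" by (simp add: point_def phi_one g_def)
    have "g \<notin> orb (h i)"
     unfolding gp h_def
    proof (rule point_not_in_orb[OF g1(1) nS one_SL gS _ gR])
     show "rational_matrix (mat 1 :: real^2^2)" by (simp add: mat_1_mat2 rational_mat2)
     fix a :: real assume a: "a > 0"
     have "matrix_inv g1 = mat2 2 (-M) (- (1 / M)) 1" unfolding g1_def using M0 by (intro matrix_inv_mat2) simp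
     then show "(matrix_inv g1 ** dg a ** n i) $ 1 $ 2 ~= 0" using a M0 by (simp add: n_def dg_def)
    qed
    show ?thesis
    proof (rule ccontr)
     assume "orb (h i) \<inter> orb g ~= {}"
     then obtain y where y: "y \<in> orb (h i)" "y \<in> orb g" by blast
     have "g \<in> orb y" by (rule orb_sym[OF gH y(2)])
     then have "g \<in> orb (h i)" using orb_trans[OF y(1)] by blast
     with \<open>g \<notin> orb (h i)\<close> show False ..
    qed
  qed
  \<comment> \<open>Different Weyl elements are separated by a vanishing entry, equal ones by the small translation.\<close>
  have inv3: "matrix_inv (n 3) = mat2 0 M (- (1/M)) 0" unfolding n_def using M0 by (simp add: matrix_inv_mat2)
  have inv1: "matrix_inv (n 1) = dg 2" "matrix_inv (n 2) = mat 1" unfolding n_def by (simp_all add: dg_inv[of "1/2"])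
  have d12: "h 2 \<notin> orb (h 1)"
  proof -
    have "point (n 2) (\<gamma> 2) \<notin> orb (point (n 1) (lower (1 / (2 * M))))"
    proof (rule lower_not_in_orb[OF nS nS gS _ _ N(2)])
     show "\<phi> (\<gamma> 2) (\<gamma> 2) \<in> \<Delta>" using up[of 1] by (simp add: \<gamma>_def)
     show "\<exists>x. x ~= 0 & matrix_inv (n 2) ** dg a ** n 1 = dg x" if "a > 0" for a
      using that by (intro exI[of _ "a / 2"]) (simp add: inv1 n_def dg_mult)
    qed (use M0 MN N(1) in \<open>auto simp: field_simps\<close>)
    then show ?thesis by (simp add: h_def \<gamma>_def)
  qed
  have d34: "h 3 \<notin> orb (h 4)"
  proof -
    have "point (n 3) (\<gamma> 3) \<notin> orb (point (n 4) (lower (1 / M)))"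
    proof (rule lower_not_in_orb[OF nS nS gS _ _ N(2)])
     show "\<phi> (\<gamma> 3) (\<gamma> 3) \<in> \<Delta>" using up[of 2] by (simp add: \<gamma>_def)
     show "\<exists>x. x ~= 0 & matrix_inv (n 3) ** dg a ** n 4 = dg x" if "a > 0" for a
      using that M0 unfolding inv3 by (intro exI[of _ "- 1 / a"]) (simp add: n_def dg_def mat2_eq_iff)
    qed (use M0 MN N(1) in \<open>auto simp: field_simps\<close>)
    then show ?thesis by (simp add: h_def \<gamma>_def)
  qed
  have dd: "h i \<notin> orb (h j)" if "i \<in> {1,2}" "j \<in> {3,4}" for i j
    unfolding h_def
    by (rule point_not_in_orb[OF nS nS gS gS gR gR])
     (use that M0 in \<open>auto simp: inv1 n_def dg_def mat_1_mat2 matrix_inv_mat2\<close>)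
  have eq_mem: "h i \<in> orb (h j)" "h j \<in> orb (h i)" if "orb (h i) = orb (h j)" for i j
    using that orb_self by blast+
  have distinct: "orb (h i) ~= orb (h j)" if ij: "i \<in> {1..4}" "j \<in> {1..4}" "i ~= j" for i j
  proof
    assume e: "orb (h i) = orb (h j)"
    have "i = 1 \<or> i = 2 \<or> i = 3 \<or> i = 4" "j = 1 \<or> j = 2 \<or> j = 3 \<or> j = 4" using ij one_to_four by blast+
    then show False using eq_mem[OF e] d12 d34 dd[of i j] dd[of j i] ij(3) by auto
  qed
  show ?thesis unfolding four_boundary_cosets_def
    by (intro bexI[OF _ gH] exI[of _ h]) (use hH cl nc distinct disj closure in blast)
qed

end

section \<open>Embeddings\<close>

definition dmat :: "('n => 'a::zero) => 'a^'n^'n" where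
  "dmat l = (\<chi> i j. if i = j then l i else 0)"

lemma dmat_nth [simp]: "dmat l $ i $ j = (if i = j then l i else 0)"
  by (simp add: dmat_def)

lemma dmat_mult: "dmat l ** dmat m = dmat (\<lambda>i. l i * m i)" for l m :: "'n::finite => 'a::semiring_1"
  by (simp add: vec_eq_iff matrix_matrix_mult_def if_distrib[of "\<lambda>x. x * _"] cong: if_cong)

lemma dmat_1: "dmat (\<lambda>_. 1) = mat 1"
  by (simp add: vec_eq_iff mat_def)

lemma mult_dmat_nth: "(A ** dmat l) $ i $ j = A $ i $ j * l j" for A :: "'a::comm_semiring_1^'n^'m"
  by (simp add: matrix_matrix_mult_def if_distrib[of "\<lambda>x. _ * x"] cong: if_cong)

lemma dmat_mult_nth: "(dmat l ** A) $ i $ j = l i * A $ i $ j" for A :: "'a::comm_semiring_1^'n^'m"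
  by (simp add: matrix_matrix_mult_def if_distrib[of "\<lambda>x. x * _"] cong: if_cong)

lemma det_dmat: "det (dmat l) = (\<Prod>i\<in>UNIV. l i)" for l :: "'n::finite => 'a::comm_ring_1"
  by (subst det_diagonal) auto

lemma dmat_inv: "(!!i. l i ~= 0) ==> matrix_inv (dmat l) = dmat (\<lambda>i. inverse (l i))" for l :: "'n::finite => 'a::field"
  by (rule matrix_inv_unique) (simp add: dmat_mult dmat_1)

lemma invertible_dmat: "(!!i. l i ~= 0) ==> invertible (dmat l)" for l :: "'n::finite => 'a::field"
  unfolding invertible_det_nz by (simp add: det_dmat)

text \<open>The identity matrix with a block placed at the indices in the range of \<open>\<iota>\<close>.\<close>

definition emb :: "('b::finite => 'n) => 'a^'b^'b => 'a::zero_neq_one^'n^'n" where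
  "emb \<iota> M = (\<chi> i j. if i \<in> range \<iota> & j \<in> range \<iota> then M $ (inv \<iota> i) $ (inv \<iota> j) else if i = j then 1 else 0)"

lemma emb_nth:
  assumes "inj \<iota>"
  shows "emb \<iota> M $ \<iota> p $ \<iota> q = M $ p $ q"
    and "i \<notin> range \<iota> ==> emb \<iota> M $ i $ j = (if i = j then 1 else 0)"
    and "j \<notin> range \<iota> ==> emb \<iota> M $ i $ j = (if i = j then 1 else 0)"
  using assms by (simp_all add: emb_def)

lemma sum_range_split:
  fixes f :: "'n::finite => 'a::comm_monoid_add" and \<iota> :: "'b::finite => 'n"
  assumes "inj \<iota>"
  shows "sum f UNIV = (\<Sum>p\<in>UNIV. f (\<iota> p)) + sum f (- range \<iota>)"
proof -
  have "sum f UNIV = sum f (range \<iota>) + sum f (- range \<iota>)"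
    by (metis Compl_eq_Diff_UNIV finite subset_UNIV sum.subset_diff add.commute)
  also have "sum f (range \<iota>) = (\<Sum>p\<in>UNIV. f (\<iota> p))" using assms by (simp add: sum.reindex)
  finally show ?thesis .
qed

lemma emb_cases:
  assumes "inj \<iota>"
  shows "(!!p q. A $ \<iota> p $ \<iota> q = M $ p $ q) ==> (!!i j. i \<notin> range \<iota> \<or> j \<notin> range \<iota> ==> A $ i $ j = (if i = j then 1 else 0)) ==> A = emb \<iota> M"
  by (auto simp: vec_eq_iff emb_def inv_f_f[OF assms])

lemma emb_mult:
  fixes \<iota> :: "'b::finite => 'n::finite" and A B :: "'a::field^'b^'b"
  assumes "inj \<iota>"
  shows "emb \<iota> A ** emb \<iota> B = emb \<iota> (A ** B)"
proof (rule emb_cases[OF assms])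
  fix p q
  show "(emb \<iota> A ** emb \<iota> B) $ \<iota> p $ \<iota> q = (A ** B) $ p $ q"
    unfolding matrix_matrix_mult_def vec_lambda_beta sum_range_split[OF assms]
    using assms by (auto simp: emb_nth intro!: sum.neutral)
next
  fix i j assume "i \<notin> range \<iota> \<or> j \<notin> range \<iota>"
  then show "(emb \<iota> A ** emb \<iota> B) $ i $ j = (if i = j then 1 else 0)"
  proof
    assume i: "i \<notin> range \<iota>"
    have "(emb \<iota> A ** emb \<iota> B) $ i $ j = (\<Sum>k\<in>UNIV. (if i = k then 1 else 0) * emb \<iota> B $ k $ j)"
     unfolding matrix_matrix_mult_def vec_lambda_beta emb_nth(2)[OF assms i] ..
    also have "\<dots> = emb \<iota> B $ i $ j" by (simp add: if_distrib[of "\<lambda>x. x * _"] cong: if_cong)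
    finally show ?thesis by (simp add: emb_nth(2)[OF assms i])
  next
    assume i: "j \<notin> range \<iota>"
    have "(emb \<iota> A ** emb \<iota> B) $ i $ j = (\<Sum>k\<in>UNIV. emb \<iota> A $ i $ k * (if k = j then 1 else 0))"
     unfolding matrix_matrix_mult_def vec_lambda_beta emb_nth(3)[OF assms i] ..
    also have "\<dots> = emb \<iota> A $ i $ j" by (simp add: if_distrib[of "\<lambda>x. _ * x"] cong: if_cong)
    finally show ?thesis by (simp add: emb_nth(3)[OF assms i])
  qed
qed

lemma emb_1: "inj \<iota> ==> emb \<iota> (mat 1) = mat 1"
  by (rule emb_cases[symmetric]) (auto simp: mat_def inj_eq)

lemma emb_dmat: "inj \<iota> ==> emb \<iota> (dmat l) = dmat (\<lambda>i. if i \<in> range \<iota> then l (inv \<iota> i) else 1)"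
  by (rule emb_cases[symmetric]) (auto simp: inj_eq)

lemma matrix_add_rdistrib': "(A + B) ** C = A ** C + B ** C" for A B C :: "real^'n^'n"
  by (simp add: vec_eq_iff matrix_matrix_mult_def sum.distrib distrib_right)

lemma conj_emb_nth:
  fixes E F :: "real^'n^'n" and \<iota> :: "'b::finite => 'n::finite"
  assumes "inj \<iota>" "E ** F = mat 1"
  shows "(E ** emb \<iota> M ** F) $ a $ b = mat 1 $ a $ b + (\<Sum>p\<in>UNIV. \<Sum>q\<in>UNIV. E $ a $ \<iota> p * (M - mat 1) $ p $ q * F $ \<iota> q $ b)"
proof -
  define Z where "Z = emb \<iota> M - mat 1"
  have Z: "Z $ \<iota> p $ \<iota> q = (M - mat 1) $ p $ q" "i \<notin> range \<iota> \<or> j \<notin> range \<iota> ==> Z $ i $ j = 0" for p q i j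
    using assms(1) by (auto simp: Z_def emb_nth mat_def inj_eq)
  have "E ** emb \<iota> M ** F = E ** (mat 1 + Z) ** F" by (simp add: Z_def)
  also have "\<dots> = mat 1 + E ** Z ** F"
    using assms(2) by (simp add: matrix_add_ldistrib matrix_add_rdistrib')
  finally have "(E ** emb \<iota> M ** F) $ a $ b = mat 1 $ a $ b + (E ** Z ** F) $ a $ b" by simp
  also have "(E ** Z ** F) $ a $ b = (\<Sum>q\<in>UNIV. \<Sum>p\<in>UNIV. E $ a $ p * Z $ p $ q * F $ q $ b)"
    by (simp add: matrix_matrix_mult_def sum_distrib_right)
  also have "\<dots> = (\<Sum>q\<in>UNIV. \<Sum>p\<in>UNIV. E $ a $ \<iota> p * Z $ \<iota> p $ \<iota> q * F $ \<iota> q $ b)"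
  proof -
    have "(\<Sum>p\<in>UNIV. E $ a $ p * Z $ p $ q * F $ q $ b) = (\<Sum>p\<in>UNIV. E $ a $ \<iota> p * Z $ \<iota> p $ q * F $ q $ b)" for q
     unfolding sum_range_split[OF assms(1), of "\<lambda>p. E $ a $ p * Z $ p $ q * F $ q $ b"]
     by (simp add: Z(2))
    then have "(\<Sum>q\<in>UNIV. \<Sum>p\<in>UNIV. E $ a $ p * Z $ p $ q * F $ q $ b) = (\<Sum>q\<in>UNIV. \<Sum>p\<in>UNIV. E $ a $ \<iota> p * Z $ \<iota> p $ q * F $ q $ b)" by simp
    also have "\<dots> = (\<Sum>q\<in>UNIV. \<Sum>p\<in>UNIV. E $ a $ \<iota> p * Z $ \<iota> p $ \<iota> q * F $ \<iota> q $ b)"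
     unfolding sum_range_split[OF assms(1), of "\<lambda>q. \<Sum>p\<in>UNIV. E $ a $ \<iota> p * Z $ \<iota> p $ q * F $ q $ b"]
     by (simp add: Z(2))
    finally show ?thesis .
  qed
  also have "\<dots> = (\<Sum>p\<in>UNIV. \<Sum>q\<in>UNIV. E $ a $ \<iota> p * (M - mat 1) $ p $ q * F $ \<iota> q $ b)"
    unfolding Z(1) by (rule sum.swap)
  finally show ?thesis .
qed

text \<open>The part with positive eigenvalues of the diagonalizable subgroup of \<open>H\<close> with eigenbasis the columns of \<open>E\<close>.\<close>

definition pos_torus :: "(real^'n^'n) set => real^'n^'n => (real^'n^'n) set" where
  "pos_torus H E = {g \<in> H. \<exists>l. (\<forall>i. l i > 0) & g = E ** dmat l ** matrix_inv E}"

lemma pos_torusI: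
  "g \<in> H ==> (!!i. l i > 0) ==> g = E ** dmat l ** matrix_inv E ==> g \<in> pos_torus H E"
  unfolding pos_torus_def by auto

lemma pos_torusE:
  assumes "g \<in> pos_torus H E"
  obtains l where "g \<in> H" "!!i. l i > 0" "g = E ** dmat l ** matrix_inv E"
  using assms unfolding pos_torus_def by auto

lemma E_dmat_simps:
  fixes E :: "real^'n^'n"
  assumes "invertible E"
  shows "(E ** A ** matrix_inv E) ** (E ** B ** matrix_inv E) = E ** (A ** B) ** matrix_inv E"
    "(E ** A ** matrix_inv E = E ** B ** matrix_inv E) = (A = B)"
    "invertible A ==> matrix_inv (E ** A ** matrix_inv E) = E ** matrix_inv A ** matrix_inv E"
proof -
  show "(E ** A ** matrix_inv E) ** (E ** B ** matrix_inv E) = E ** (A ** B) ** matrix_inv E"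
    using assms by (simp add: group_simps)
  have "A = matrix_inv E ** (E ** A ** matrix_inv E) ** E" for A :: "real^'n^'n" using assms by (simp add: group_simps)
  then show "(E ** A ** matrix_inv E = E ** B ** matrix_inv E) = (A = B)" by metis
  show "invertible A ==> matrix_inv (E ** A ** matrix_inv E) = E ** matrix_inv A ** matrix_inv E"
    using assms by (simp add: group_simps)
qed

text \<open>Data placing the two copies of \<open>SL\<^sub>2\<close> in a four-dimensional block. In the basis \<open>E\<close> the involution \<open>\<kappa>\<close> of the block indices is the Galois action, so that conjugate pairs become rational matrices.\<close>

locale quadratic_embedding = matrix_group H
  for H :: "(real^'n^'n) set" +
  fixes E :: "real^'n^'n" and \<iota> :: "2 \<times> 2 => 'n" and \<kappa> :: "2 \<times> 2 => 2 \<times> 2"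
    and K :: "real^2^2 => real^2^2 => real^(2 \<times> 2)^(2 \<times> 2)" and d :: nat
    and scalar :: "(2 \<times> 2 => real) => bool" and kd :: "real => real => 2 \<times> 2 => real"
    and XS :: "(real^'n^'n) set" and WS :: "(real^'n) set"
  assumes closed_H: "closed H"
    and inv_E: "invertible E" and inj_iota: "inj \<iota>" and kappa: "\<kappa> (\<kappa> p) = p"
    and irrational: "sqrt (real d) \<notin> \<rat>"
    and E_conj: "\<exists>N>0. (\<forall>a p. conj_pair d N (E $ a $ \<iota> p) (E $ a $ \<iota> (\<kappa> p))) &
       (\<forall>a p. conj_pair d N (matrix_inv E $ \<iota> p $ a) (matrix_inv E $ \<iota> (\<kappa> p) $ a))"
    and K_mult: "m1 \<in> SL ==> m2 \<in> SL ==> m1' \<in> SL ==> m2' \<in> SL ==>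
       K m1 m2 ** K m1' m2' = K (m1 ** m1') (m2 ** m2')"
    and K_one: "K (mat 1) (mat 1) = mat 1"
    and K_cont: "continuous_on UNIV (\<lambda>x. K (fst x) (snd x) $ p $ q)"
    and K_dg: "a > 0 ==> b > 0 ==> K (dg a) (dg b) = dmat (kd a b)" and kd_pos: "a > 0 ==> b > 0 ==> kd a b p > 0"
    and K_H: "m1 \<in> SL ==> m2 \<in> SL ==> E ** emb \<iota> (K m1 m2) ** matrix_inv E \<in> H"
    and K_congruence: "m1 \<in> SL ==> m2 \<in> SL ==> N > 0 ==>
       (!!i j. conj_pair d 1 ((m1 $ i $ j - mat 1 $ i $ j) / real N) ((m2 $ i $ j - mat 1 $ i $ j) / real N)) ==>
       conj_pair d 1 ((K m1 m2 $ p $ q - mat 1 $ p $ q) / real N) ((K m1 m2 $ \<kappa> p $ \<kappa> q - mat 1 $ \<kappa> p $ \<kappa> q) / real N)"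
    and K_rational: "m \<in> SL ==> rational_matrix m ==> rational_matrix (K m m)"
     "m \<in> SL ==> K m m $ \<kappa> p $ \<kappa> q = K m m $ p $ q"
    and K_coord1: "\<exists>p q. \<forall>x. K (upper x) (mat 1) $ p $ q = x"
    and K_coord2: "\<exists>p q. \<forall>x. K (mat 1) (upper x) $ p $ q = x"
    and scalar_1: "scalar (\<lambda>_. 1)" and scalar_mult: "scalar \<nu> ==> scalar \<nu>' ==> scalar (\<lambda>p. \<nu> p * \<nu>' p)"
    and scalar_inv: "scalar \<nu> ==> scalar (\<lambda>p. inverse (\<nu> p))"
    and scalar_comm: "scalar \<nu> ==> m1 \<in> SL ==> m2 \<in> SL ==> K m1 m2 $ p $ q ~= 0 ==> \<nu> p = \<nu> q"
    and decompose: "(!!i. l i > 0) ==> E ** dmat l ** matrix_inv E \<in> H ==>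
       \<exists>a>0. \<exists>b>0. \<exists>\<nu>. scalar \<nu> & (\<forall>p. \<nu> p > 0) & (\<forall>p. l (\<iota> p) = kd a b p * \<nu> p)"
    and integral: "m1 \<in> SL ==> m2 \<in> SL ==> (!!i. l i > 0) ==> scalar (l \<circ> \<iota>) ==> E ** dmat l ** matrix_inv E \<in> H ==>
       E ** (emb \<iota> (K m1 m2) ** dmat l) ** matrix_inv E \<in> integer_points H ==>
       (!!p q. conj_pair d M (K m1 m2 $ p $ q * l (\<iota> q)) (K m1 m2 $ \<kappa> p $ \<kappa> q * l (\<iota> (\<kappa> q)))) ==> M > 0 ==>
       norm_integral d (M * M) m1 m2"
    and XS: "finite XS" "X \<in> XS ==> rational_matrix X" "X \<in> XS ==> \<exists>\<mu>. X = E ** dmat \<mu> ** matrix_inv E"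
    and WS: "finite WS" "w \<in> WS ==> w $ i \<in> \<rat>" "w \<in> WS ==> t \<in> pos_torus H E ==> t *v w = w"
    and separated: "z \<in> H ==> (!!X. X \<in> XS ==> z ** X = X ** z) ==> (!!w. w \<in> WS ==> z *v w = w) ==>
       i ~= j ==> (matrix_inv E ** z ** E) $ i $ j = 0"
begin

abbreviation "F \<equiv> matrix_inv E"
abbreviation "T \<equiv> pos_torus H E"

definition phi :: "real^2^2 => real^2^2 => real^'n^'n" where
  "phi m1 m2 = E ** emb \<iota> (K m1 m2) ** F"

definition C :: "(real^'n^'n) set" where
  "C = {g \<in> H. \<exists>l. (\<forall>i. l i > 0) & scalar (l \<circ> \<iota>) & g = E ** dmat l ** F}"

lemma CI: "g \<in> H ==> (!!i. l i > 0) ==> scalar (l \<circ> \<iota>) ==> g = E ** dmat l ** F ==> g \<in> C"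
  unfolding C_def by auto

lemma EF: "E ** F = mat 1" "F ** E = mat 1"
  using inv_E by (simp_all add: group_simps)

text \<open>A sum over the block indices is invariant under the Galois action, hence it is a trace and has a bounded rational denominator.\<close>

lemma conj_sum_integral:
  assumes N: "!!a p. conj_pair d N (E $ a $ \<iota> p) (E $ a $ \<iota> (\<kappa> p))"
    "!!a p. conj_pair d N (F $ \<iota> p $ a) (F $ \<iota> (\<kappa> p) $ a)"
    and z: "!!p q. conj_pair d M (z p q) (z (\<kappa> p) (\<kappa> q))"
  shows "real (N * M * N) * (\<Sum>p\<in>UNIV. \<Sum>q\<in>UNIV. E $ a $ \<iota> p * z p q * F $ \<iota> q $ b) \<in> \<int>"
proof -
  define S where "S = (\<Sum>p\<in>UNIV. \<Sum>q\<in>UNIV. E $ a $ \<iota> p * z p q * F $ \<iota> q $ b)"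
  have bij: "bij \<kappa>" using kappa by (metis bijI')
  have "(\<Sum>p\<in>UNIV. \<Sum>q\<in>UNIV. E $ a $ \<iota> (\<kappa> p) * z (\<kappa> p) (\<kappa> q) * F $ \<iota> (\<kappa> q) $ b)
     = (\<Sum>p\<in>UNIV. \<Sum>q\<in>UNIV. E $ a $ \<iota> (\<kappa> p) * z (\<kappa> p) q * F $ \<iota> q $ b)"
    by (intro sum.cong refl sum.reindex_bij_betw[OF bij])
  also have "\<dots> = S" unfolding S_def by (rule sum.reindex_bij_betw[OF bij])
  finally have e: "(\<Sum>p\<in>UNIV. \<Sum>q\<in>UNIV. E $ a $ \<iota> (\<kappa> p) * z (\<kappa> p) (\<kappa> q) * F $ \<iota> (\<kappa> q) $ b) = S" .
  have "conj_pair d (N * M * N) (\<Sum>p\<in>UNIV. \<Sum>q\<in>UNIV. E $ a $ \<iota> p * z p q * F $ \<iota> q $ b)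
     (\<Sum>p\<in>UNIV. \<Sum>q\<in>UNIV. E $ a $ \<iota> (\<kappa> p) * z (\<kappa> p) (\<kappa> q) * F $ \<iota> (\<kappa> q) $ b)"
    by (intro conj_pair_sum conj_pair_mult N z)
  then show ?thesis unfolding e S_def[symmetric] by (rule conj_pair_self[OF irrational])
qed

lemma phi_nth: "phi m1 m2 $ a $ b = mat 1 $ a $ b + (\<Sum>p\<in>UNIV. \<Sum>q\<in>UNIV. E $ a $ \<iota> p * (K m1 m2 - mat 1) $ p $ q * F $ \<iota> q $ b)"
  unfolding phi_def by (rule conj_emb_nth[OF inj_iota EF(1)])

lemma hilbert_torus: "hilbert_torus H T XS WS C phi d"
proof unfold_locales
  obtain N where N: "N > 0" "!!a p. conj_pair d N (E $ a $ \<iota> p) (E $ a $ \<iota> (\<kappa> p))"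
    "!!a p. conj_pair d N (F $ \<iota> p $ a) (F $ \<iota> (\<kappa> p) $ a)" using E_conj by blast
  have pos0: "l i ~= 0" if "\<forall>i. l i > (0::real)" for l :: "'n => real" and i using that by (metis less_irrefl)
  have e1: "mat 1 = E ** dmat (\<lambda>_. 1) ** F" by (simp add: dmat_1 EF)
  show "T \<subseteq> H" by (auto simp: pos_torus_def)
  show one_T: "mat 1 \<in> T"
    unfolding pos_torus_def using one_H e1 by (auto intro!: exI[of _ "\<lambda>_. 1"])
  show "s ** t \<in> T" if st: "s \<in> T" "t \<in> T" for s t
  proof -
    obtain l m where l: "\<forall>i. l i > 0" "s = E ** dmat l ** F" and m: "\<forall>i. m i > 0" "t = E ** dmat m ** F"
     using st by (auto simp: pos_torus_def)
    have "s ** t = E ** dmat (\<lambda>i. l i * m i) ** F" unfolding l m by (simp add: E_dmat_simps inv_E dmat_mult)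
    moreover have "s ** t \<in> H" using st by (auto simp: pos_torus_def intro: mult_H)
    ultimately show ?thesis using l m by (intro pos_torusI) auto
  qed
  show "matrix_inv t \<in> T" if st: "t \<in> T" for t
  proof -
    obtain l where l: "\<forall>i. l i > 0" "t = E ** dmat l ** F" using st by (auto simp: pos_torus_def)
    have "matrix_inv t = E ** dmat (\<lambda>i. inverse (l i)) ** F"
     unfolding l(2) using pos0[OF l(1)] by (simp add: E_dmat_simps inv_E invertible_dmat dmat_inv)
    moreover have "matrix_inv t \<in> H" using st by (auto simp: pos_torus_def intro: inv_H)
    ultimately show ?thesis using l by (intro pos_torusI) auto
  qed
  show "t ** X = X ** t" if tX: "t \<in> T" "X \<in> XS" for t X
  proof -
    obtain l where l: "t = E ** dmat l ** F" using tX by (auto simp: pos_torus_def)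
    obtain \<mu> where m: "X = E ** dmat \<mu> ** F" using XS(3)[OF tX(2)] by blast
    show ?thesis unfolding l m by (simp add: E_dmat_simps inv_E dmat_mult mult.commute)
  qed
  show "\<exists>e>0. \<forall>z\<in>H. dist z (mat 1) < e --> (\<forall>X\<in>XS. z ** X = X ** z) --> (\<forall>w\<in>WS. z *v w = w) --> z \<in> T"
  proof -
    have "isCont (\<lambda>z. F ** z ** E) (mat 1)"
     unfolding isCont_def by (intro tendsto_matrix_mult tendsto_const tendsto_ident_at)
    then obtain e where e: "e > 0" "!!z. dist z (mat 1) < e ==> dist (F ** z ** E) (F ** mat 1 ** E) < 1"
     unfolding continuous_at_eps_delta by (metis zero_less_one)
    have "z \<in> T" if z: "z \<in> H" "dist z (mat 1) < e" "\<forall>X\<in>XS. z ** X = X ** z" "\<forall>w\<in>WS. z *v w = w" for z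
    proof -
     define l where "l i = (F ** z ** E) $ i $ i" for i
     have "F ** z ** E = dmat l"
      using separated[OF z(1)] z(3,4) by (auto simp: vec_eq_iff l_def)
     then have zl: "z = E ** dmat l ** F" using inv_E by (metis matrix_cancel(2) matrix_inv_mult_right matrix_mul_assoc matrix_mul_rid)
     have "l i > 0" for i
     proof -
      have "\<bar>l i - 1\<bar> \<le> dist (F ** z ** E) (mat 1)"
      proof -
       have "\<bar>(F ** z ** E - mat 1) $ i $ i\<bar> \<le> norm ((F ** z ** E - mat 1) $ i)" by (rule component_le_norm_cart)
       also have "\<dots> \<le> norm (F ** z ** E - mat 1)" by (rule Finite_Cartesian_Product.norm_nth_le)
       finally show ?thesis by (simp add: l_def dist_norm mat_def)
      qed
      also have "\<dots> < 1" using e(2)[OF z(2)] by (simp add: EF)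
      finally show ?thesis by linarith
     qed
     with zl z(1) show ?thesis by (auto simp: pos_torus_def)
    qed
    with e(1) show ?thesis by blast
  qed
  have C_T: "C \<subseteq> T" by (auto simp: C_def pos_torus_def)
  show "C \<subseteq> H" by (auto simp: C_def)
  show one_C: "mat 1 \<in> C"
    unfolding C_def using one_H e1 scalar_1 by (auto intro!: exI[of _ "\<lambda>_. 1"] simp: o_def)
  show "b ** c \<in> C" if st: "b \<in> C" "c \<in> C" for b c
  proof -
    obtain l m where l: "\<forall>i. l i > 0" "scalar (l \<circ> \<iota>)" "b = E ** dmat l ** F" and m: "\<forall>i. m i > 0" "scalar (m \<circ> \<iota>)" "c = E ** dmat m ** F"
     using st by (auto simp: C_def)
    have "b ** c = E ** dmat (\<lambda>i. l i * m i) ** F" unfolding l m by (simp add: E_dmat_simps inv_E dmat_mult)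
    moreover have "b ** c \<in> H" using st by (auto simp: C_def intro: mult_H)
    moreover have "scalar ((\<lambda>i. l i * m i) \<circ> \<iota>)" using scalar_mult[OF l(2) m(2)] by (simp add: o_def)
    ultimately show ?thesis using l m by (intro CI) auto
  qed
  show "matrix_inv t \<in> C" if st: "t \<in> C" for t
  proof -
    obtain l where l: "\<forall>i. l i > 0" "scalar (l \<circ> \<iota>)" "t = E ** dmat l ** F" using st by (auto simp: C_def)
    have "matrix_inv t = E ** dmat (\<lambda>i. inverse (l i)) ** F"
     unfolding l(3) using pos0[OF l(1)] by (simp add: E_dmat_simps inv_E invertible_dmat dmat_inv)
    moreover have "matrix_inv t \<in> H" using st by (auto simp: C_def intro: inv_H)
    moreover have "scalar ((\<lambda>i. inverse (l i)) \<circ> \<iota>)" using scalar_inv[OF l(2)] by (simp add: o_def)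
    ultimately show ?thesis using l by (intro CI) auto
  qed
  show phi_H: "phi m1 m2 \<in> H" if "m1 \<in> SL" "m2 \<in> SL" for m1 m2 unfolding phi_def using K_H that .
  show "phi (mat 1) (mat 1) = mat 1" by (simp add: phi_def K_one emb_1 inj_iota EF)
  show phi_mult: "phi m1 m2 ** phi m1' m2' = phi (m1 ** m1') (m2 ** m2')"
    if "m1 \<in> SL" "m2 \<in> SL" "m1' \<in> SL" "m2' \<in> SL" for m1 m2 m1' m2'
    unfolding phi_def using that by (simp add: E_dmat_simps inv_E emb_mult inj_iota K_mult)
  show "continuous_on UNIV (\<lambda>p. phi (fst p) (snd p))"
  proof -
    have "continuous_on UNIV (\<lambda>p. phi (fst p) (snd p) $ a $ b)" for a b
     unfolding phi_nth vector_minus_component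
     by (intro continuous_on_add continuous_on_const continuous_on_sum continuous_on_mult continuous_on_diff K_cont)
    then show ?thesis unfolding continuous_on_def by (intro ballI vec_tendstoI) blast
  qed
  have emb_comm: "dmat l ** emb \<iota> (K m1 m2) = emb \<iota> (K m1 m2) ** dmat l"
    if "scalar (l \<circ> \<iota>)" "m1 \<in> SL" "m2 \<in> SL" for l m1 m2
  proof -
    have "l i * emb \<iota> (K m1 m2) $ i $ j = emb \<iota> (K m1 m2) $ i $ j * l j" for i j
    proof (cases "i \<in> range \<iota> & j \<in> range \<iota>")
     case True
     then obtain p q where "i = \<iota> p" "j = \<iota> q" by blast
     then show ?thesis using scalar_comm[OF that, of p q] by (cases "K m1 m2 $ p $ q = 0") (auto simp: emb_nth inj_iota)
    next
     case False
     then show ?thesis by (auto simp: emb_nth inj_iota)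
    qed
    then show ?thesis by (simp add: vec_eq_iff dmat_mult_nth mult_dmat_nth)
  qed
  show "c ** phi m1 m2 = phi m1 m2 ** c" if c: "c \<in> C" and m: "m1 \<in> SL" "m2 \<in> SL" for c m1 m2
  proof -
    obtain l where l: "scalar (l \<circ> \<iota>)" "c = E ** dmat l ** F" using c by (auto simp: C_def)
    show ?thesis unfolding l(2) phi_def by (simp only: E_dmat_simps(1) inv_E emb_comm[OF l(1) m])
  qed
  show "T = {phi (dg a) (dg b) ** c | a b c. a > 0 & b > 0 & c \<in> C}"
  proof (intro set_eqI iffI)
    fix t assume t: "t \<in> T"
    then obtain l where l: "!!i. l i > 0" "t = E ** dmat l ** F" "t \<in> H" by (auto simp: pos_torus_def)
    obtain a b \<nu> where ab: "a > 0" "b > 0" "scalar \<nu>" "!!p. \<nu> p > 0" "!!p. l (\<iota> p) = kd a b p * \<nu> p"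
     using decompose[of l] l by blast
    define l' where "l' i = (if i \<in> range \<iota> then \<nu> (inv \<iota> i) else l i)" for i
    define c where "c = E ** dmat l' ** F"
    have "t = phi (dg a) (dg b) ** c"
     unfolding phi_def c_def l(2) K_dg[OF ab(1,2)] emb_dmat[OF inj_iota] E_dmat_simps(1)[OF inv_E] dmat_mult E_dmat_simps(2)[OF inv_E]
     by (rule arg_cong[of _ _ dmat]) (use ab(5) inj_iota in \<open>auto simp: l'_def fun_eq_iff\<close>)
    moreover have "c = phi (dg (1 / a)) (dg (1 / b)) ** t"
    proof -
     have "phi (dg (1 / a)) (dg (1 / b)) ** phi (dg a) (dg b) = mat 1"
      using ab by (simp add: phi_mult dg_mult) (simp add: phi_def K_one emb_1 inj_iota EF)
     then have "phi (dg (1 / a)) (dg (1 / b)) ** (phi (dg a) (dg b) ** c) = c" by (simp add: matrix_mul_assoc)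
     then show ?thesis using \<open>t = phi (dg a) (dg b) ** c\<close> by simp
    qed
    then have "c \<in> H" using ab l(3) by (auto intro!: mult_H phi_H)
    moreover have "l' i > 0" for i using l ab by (simp add: l'_def)
    moreover have "l' \<circ> \<iota> = \<nu>" using inj_iota by (simp add: l'_def fun_eq_iff)
    ultimately have "c \<in> C" using ab(3) by (intro CI[of c l']) (simp_all add: c_def)
    then show "t \<in> {phi (dg a) (dg b) ** c | a b c. a > 0 & b > 0 & c \<in> C}" using ab(1,2) \<open>t = phi (dg a) (dg b) ** c\<close> by blast
  next
    fix t assume "t \<in> {phi (dg a) (dg b) ** c | a b c. a > 0 & b > 0 & c \<in> C}"
    then obtain a b c where t: "t = phi (dg a) (dg b) ** c" "a > 0" "b > 0" "c \<in> C" by blast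
    then obtain l where l: "!!i. l i > 0" "c = E ** dmat l ** F" "c \<in> H" by (auto simp: C_def)
    have "t = E ** dmat (\<lambda>i. (if i \<in> range \<iota> then kd a b (inv \<iota> i) else 1) * l i) ** F"
     unfolding t(1) phi_def l(2) K_dg[OF t(2,3)] emb_dmat[OF inj_iota] E_dmat_simps(1)[OF inv_E] dmat_mult ..
    moreover have "(if i \<in> range \<iota> then kd a b (inv \<iota> i) else 1) * l i > 0" for i using l kd_pos[OF t(2,3)] by simp
    moreover have "t \<in> H" unfolding t(1) using t l by (auto intro!: mult_H phi_H)
    ultimately show "t \<in> T" by (intro pos_torusI) auto
  qed
  have coordc: "continuous_on UNIV (\<lambda>g. (F ** g ** E) $ i $ j)" for i j
    by (intro continuous_intros)
  have coord: "(F ** phi m1 m2 ** E) $ \<iota> p $ \<iota> q = K m1 m2 $ p $ q" for m1 m2 p q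
    unfolding phi_def using inv_E by (simp add: group_simps emb_nth inj_iota)
  show "\<exists>L :: real^'n^'n => real. continuous_on UNIV L & (\<forall>x. L (phi (upper x) (mat 1)) = x)"
  proof -
    obtain p q where "\<forall>x. K (upper x) (mat 1) $ p $ q = x" using K_coord1 by blast
    then show ?thesis using coordc coord by (intro exI[of _ "\<lambda>g. (F ** g ** E) $ \<iota> p $ \<iota> q"]) simp
  qed
  show "\<exists>L :: real^'n^'n => real. continuous_on UNIV L & (\<forall>x. L (phi (mat 1) (upper x)) = x)"
  proof -
    obtain p q where "\<forall>x. K (mat 1) (upper x) $ p $ q = x" using K_coord2 by blast
    then show ?thesis using coordc coord by (intro exI[of _ "\<lambda>g. (F ** g ** E) $ \<iota> p $ \<iota> q"]) simp
  qed
  show "rational_matrix (phi m m)" if m: "m \<in> SL" "rational_matrix m" for m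
  proof -
    have "rational_matrix (K m m - mat 1)" using K_rational(1)[OF m] by (auto simp: rational_matrix_def mat_def)
    then obtain D where D: "D > 0" "!!p q. real D * (K m m - mat 1) $ p $ q \<in> \<int>" using rational_matrix_denominator by blast
    have one: "(mat 1 :: real^(2 \<times> 2)^(2 \<times> 2)) $ \<kappa> p $ \<kappa> q = mat 1 $ p $ q" for p q using kappa by (simp add: mat_def) metis
    have "conj_pair d D ((K m m - mat 1) $ p $ q) ((K m m - mat 1) $ \<kappa> p $ \<kappa> q)" for p q
     using conj_pair_rational[OF D(2)[of p q]] by (simp add: K_rational(2)[OF m(1)] one)
    from conj_sum_integral[where z="\<lambda>p q. (K m m - mat 1) $ p $ q", OF N(2,3) this]
    have *: "real (N * D * N) * (\<Sum>p\<in>UNIV. \<Sum>q\<in>UNIV. E $ a $ \<iota> p * (K m m - mat 1) $ p $ q * F $ \<iota> q $ b) \<in> \<int>" for a b .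
    have rat: "x \<in> \<rat>" if "real k * x \<in> \<int>" "k > 0" for k x
    proof -
     have "x = (real k * x) / real k" using that by simp
     also have "\<dots> \<in> \<rat>" using that(1) by (intro Rats_divide) (auto elim!: Ints_cases)
     finally show ?thesis .
    qed
    show ?thesis
     unfolding rational_matrix_def
    proof (intro allI)
     fix a b
     have "(\<Sum>p\<in>UNIV. \<Sum>q\<in>UNIV. E $ a $ \<iota> p * (K m m - mat 1) $ p $ q * F $ \<iota> q $ b) \<in> \<rat>"
      by (rule rat[OF *]) (use N(1) D(1) in simp)
     then show "phi m m $ a $ b \<in> \<rat>" unfolding phi_nth by (intro Rats_add) (auto simp: mat_def)
    qed
  qed
  show "\<exists>N>0. \<forall>m1\<in>SL. \<forall>m2\<in>SL.
      (\<forall>i j. conj_pair d 1 ((m1 $ i $ j - mat 1 $ i $ j) / real N) ((m2 $ i $ j - mat 1 $ i $ j) / real N))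
      --> phi m1 m2 \<in> integer_points H"
  proof (intro exI[of _ "N * N"] conjI ballI impI)
    show "N * N > 0" using N by simp
    fix m1 m2 :: "real^2^2" assume m: "m1 \<in> SL" "m2 \<in> SL"
     and cp: "\<forall>i j. conj_pair d 1 ((m1 $ i $ j - mat 1 $ i $ j) / real (N * N)) ((m2 $ i $ j - mat 1 $ i $ j) / real (N * N))"
    have "conj_pair d 1 ((K m1 m2 $ p $ q - mat 1 $ p $ q) / real (N * N)) ((K m1 m2 $ \<kappa> p $ \<kappa> q - mat 1 $ \<kappa> p $ \<kappa> q) / real (N * N))" for p q
     by (rule K_congruence[OF m]) (use N cp in auto)
    from conj_sum_integral[where z="\<lambda>p q. (K m1 m2 $ p $ q - mat 1 $ p $ q) / real (N * N)", OF N(2,3) this]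
    have *: "real (N * 1 * N) * (\<Sum>p\<in>UNIV. \<Sum>q\<in>UNIV. E $ a $ \<iota> p * ((K m1 m2 $ p $ q - mat 1 $ p $ q) / real (N * N)) * F $ \<iota> q $ b) \<in> \<int>" for a b .
    have eqS: "real (N * 1 * N) * (\<Sum>p\<in>UNIV. \<Sum>q\<in>UNIV. E $ a $ \<iota> p * ((K m1 m2 $ p $ q - mat 1 $ p $ q) / real (N * N)) * F $ \<iota> q $ b)
     = (\<Sum>p\<in>UNIV. \<Sum>q\<in>UNIV. E $ a $ \<iota> p * (K m1 m2 - mat 1) $ p $ q * F $ \<iota> q $ b)" for a b
     unfolding sum_distrib_left by (intro sum.cong refl) (use N(1) in \<open>simp add: field_simps\<close>)
    have "(\<Sum>p\<in>UNIV. \<Sum>q\<in>UNIV. E $ a $ \<iota> p * (K m1 m2 - mat 1) $ p $ q * F $ \<iota> q $ b) \<in> \<int>" for a b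
     using *[of a b] unfolding eqS .
    then have "phi m1 m2 $ a $ b \<in> \<int>" for a b unfolding phi_nth by (intro Ints_add) (auto simp: mat_def)
    then show "phi m1 m2 \<in> integer_points H" using phi_H[OF m] by (simp add: integer_points_def)
  qed
  show "\<exists>N>0. \<forall>m1\<in>SL. \<forall>m2\<in>SL. \<forall>c\<in>C. phi m1 m2 ** c \<in> integer_points H --> norm_integral d N m1 m2"
  proof (intro exI[of _ "(N * 1 * N) * (N * 1 * N)"] conjI ballI impI)
    show "(N * 1 * N) * (N * 1 * N) > 0" using N by simp
    fix m1 m2 :: "real^2^2" and c assume m: "m1 \<in> SL" "m2 \<in> SL" and c: "c \<in> C" and mem: "phi m1 m2 ** c \<in> integer_points H"
    obtain l where l: "!!i. l i > 0" "scalar (l \<circ> \<iota>)" "c = E ** dmat l ** F" "c \<in> H" using c by (auto simp: C_def)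
    have eq: "phi m1 m2 ** c = E ** (emb \<iota> (K m1 m2) ** dmat l) ** F"
     unfolding l(3) phi_def by (simp only: E_dmat_simps(1) inv_E)
    define \<delta> where "\<delta> = phi m1 m2 ** c"
    have dint: "\<delta> $ a $ b \<in> \<int>" for a b using mem by (simp add: \<delta>_def integer_points_def)
    have ent: "K m1 m2 $ p $ q * l (\<iota> q) = (\<Sum>a\<in>UNIV. \<Sum>b\<in>UNIV. F $ \<iota> p $ a * \<delta> $ a $ b * E $ b $ \<iota> q)" for p q
    proof -
     have "F ** \<delta> ** E = emb \<iota> (K m1 m2) ** dmat l" unfolding \<delta>_def eq using inv_E by (simp add: group_simps)
     then have "K m1 m2 $ p $ q * l (\<iota> q) = (F ** \<delta> ** E) $ \<iota> p $ \<iota> q" by (simp add: mult_dmat_nth emb_nth inj_iota)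
     also have "\<dots> = (\<Sum>b\<in>UNIV. \<Sum>a\<in>UNIV. F $ \<iota> p $ a * \<delta> $ a $ b * E $ b $ \<iota> q)"
      by (simp add: matrix_matrix_mult_def sum_distrib_right)
     finally show ?thesis by (subst sum.swap)
    qed
    show "norm_integral d ((N * 1 * N) * (N * 1 * N)) m1 m2"
    proof (rule integral[OF m l(1,2)])
     show "E ** dmat l ** F \<in> H" using l by simp
     show "E ** (emb \<iota> (K m1 m2) ** dmat l) ** F \<in> integer_points H" using mem eq by simp
     show "N * 1 * N > 0" using N by simp
     fix p q
     have "conj_pair d 1 (\<delta> $ a $ b) (\<delta> $ a $ b)" for a b by (rule conj_pair_rational) (simp add: dint)
     then show "conj_pair d (N * 1 * N) (K m1 m2 $ p $ q * l (\<iota> q)) (K m1 m2 $ \<kappa> p $ \<kappa> q * l (\<iota> (\<kappa> q)))"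
      unfolding ent by (intro conj_pair_sum conj_pair_mult N)
    qed
  qed
qed (use closed_H irrational XS WS in auto)

end

section \<open>The special linear group\<close>

text \<open>\<open>SL\<^sub>2\<close> is generated by commutators. This gives determinant one for images of \<open>SL\<^sub>2 \<times> SL\<^sub>2\<close> without computing determinants of four by four matrices.\<close>

lemma character_SL2_trivial:
  fixes \<psi> :: "real^2^2 => real"
  assumes mult: "!!m m'. m \<in> SL ==> m' \<in> SL ==> \<psi> (m ** m') = \<psi> m * \<psi> m'" and one: "\<psi> (mat 1) = 1"
    and m: "m \<in> SL"
  shows "\<psi> m = 1"
proof -
  have d: "\<psi> (dg 2) * \<psi> (dg (1 / 2)) = 1"
    using mult[of "dg 2" "dg (1 / 2)"] one by (simp add: dg_mult)
  have u: "\<psi> (upper x) = 1" for x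
  proof -
    have "upper x = dg 2 ** upper (x / 3) ** dg (1 / 2) ** upper (- (x / 3))"
     by (simp add: dg_def upper_def mat2_eq_iff)
    then have "\<psi> (upper x) = \<psi> (dg 2) * \<psi> (upper (x / 3)) * \<psi> (dg (1 / 2)) * \<psi> (upper (- (x / 3)))"
     by (simp add: mult SL_mult)
    moreover have "\<psi> (upper (x / 3)) * \<psi> (upper (- (x / 3))) = 1"
     using mult[of "upper (x / 3)" "upper (- (x / 3))"] one by (simp add: upper_def mat_1_mat2)
    ultimately show ?thesis using d by (simp add: mult_ac)
  qed
  have l: "\<psi> (lower x) = 1" for x
  proof -
    have "lower x = dg (1 / 2) ** lower (x / 3) ** dg 2 ** lower (- (x / 3))"
     by (simp add: dg_def lower_def mat2_eq_iff)
    then have "\<psi> (lower x) = \<psi> (dg (1 / 2)) * \<psi> (lower (x / 3)) * \<psi> (dg 2) * \<psi> (lower (- (x / 3)))"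
     by (simp add: mult SL_mult)
    moreover have "\<psi> (lower (x / 3)) * \<psi> (lower (- (x / 3))) = 1"
     using mult[of "lower (x / 3)" "lower (- (x / 3))"] one by (simp add: lower_def mat_1_mat2)
    ultimately show ?thesis using d by (simp add: mult_ac)
  qed
  have gen: "\<psi> (mat2 a b c e) = 1" if c: "c ~= 0" and det: "a * e - b * c = 1" for a b c e
  proof -
    have "mat2 a b c e = upper ((a - 1) / c) ** lower c ** upper ((e - 1) / c)"
     using c det by (simp add: upper_def lower_def mat2_eq_iff field_simps)
    then show ?thesis by (simp add: mult SL_mult u l)
  qed
  obtain a b c e where m': "m = mat2 a b c e" by (metis mat2_eta)
  have det: "a * e - b * c = 1" using m by (simp add: m')
  show ?thesis
  proof (cases "c = 0")
    case False
    then show ?thesis unfolding m' using gen det by blast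
  next
    case True
    have e: "e ~= 0" using det True by auto
    have "m = mat2 (a + b) b e e ** lower (-1)" using True by (simp add: m' lower_def mat2_eq_iff)
    moreover have "\<psi> (mat2 (a + b) b e e) = 1" by (rule gen[OF e]) (use det True in \<open>simp add: algebra_simps\<close>)
    moreover have "mat2 (a + b) b e e \<in> SL" using det True by (simp add: algebra_simps)
    ultimately show ?thesis by (simp add: mult l)
  qed
qed

lemma one_neq_two [simp]: "(1::2) ~= 2" "(2::2) ~= 1"
  by simp_all

lemma sum_22: "sum f (UNIV :: (2 \<times> 2) set) = f (1, 1) + f (1, 2) + f (2, 1) + f (2, 2)"
proof -
  have "sum f (UNIV :: (2 \<times> 2) set) = (\<Sum>i\<in>UNIV. \<Sum>j\<in>UNIV. f (i, j))"
    by (simp add: sum.cartesian_product UNIV_Times_UNIV[symmetric] del: UNIV_Times_UNIV)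
  then show ?thesis by (simp add: sum_2 add.assoc)
qed

lemma forall_22: "(\<forall>p :: 2 \<times> 2. P p) \<longleftrightarrow> P (1, 1) & P (1, 2) & P (2, 1) & P (2, 2)"
  by (auto simp: forall_2 split_paired_All)

lemma det_conj_emb:
  fixes K :: "real^2^2 => real^2^2 => real^(2 \<times> 2)^(2 \<times> 2)" and E :: "real^'n^'n" and \<iota> :: "2 \<times> 2 => 'n"
  assumes K_mult: "!!m1 m2 m1' m2'. m1 \<in> SL ==> m2 \<in> SL ==> m1' \<in> SL ==> m2' \<in> SL ==>
       K m1 m2 ** K m1' m2' = K (m1 ** m1') (m2 ** m2')"
    and K_one: "K (mat 1) (mat 1) = (mat 1 :: real^(2 \<times> 2)^(2 \<times> 2))"
    and inj: "inj \<iota>" and E: "invertible E" and m: "m1 \<in> SL" "m2 \<in> SL"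
  shows "det (E ** emb \<iota> (K m1 m2) ** matrix_inv E) = 1"
proof -
  have dE: "det E * det (matrix_inv E) = 1"
    using E by (metis det_I det_mul matrix_inv_mult_right)
  have 1: "det (emb \<iota> (K m1 (mat 1))) = 1"
    by (rule character_SL2_trivial[where \<psi>="\<lambda>m. det (emb \<iota> (K m (mat 1)))" and m=m1])
     (use m in \<open>auto simp: K_one emb_1 inj det_mul[symmetric] emb_mult K_mult\<close>)
  have 2: "det (emb \<iota> (K (mat 1) m2)) = 1"
    by (rule character_SL2_trivial[where \<psi>="\<lambda>m. det (emb \<iota> (K (mat 1) m))" and m=m2])
     (use m in \<open>auto simp: K_one emb_1 inj det_mul[symmetric] emb_mult K_mult\<close>)
  have "emb \<iota> (K m1 m2) = emb \<iota> (K m1 (mat 1)) ** emb \<iota> (K (mat 1) m2)"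
    using m by (simp add: emb_mult inj K_mult)
  then have "det (emb \<iota> (K m1 m2)) = 1" using 1 2 by (simp add: det_mul)
  then show ?thesis using dE by (simp add: det_mul)
qed

lemma sqrt_2_irrational: "sqrt 2 \<notin> \<rat>"
proof
  assume "sqrt 2 \<in> \<rat>"
  then obtain m n :: nat where n: "n ~= 0" and r: "\<bar>sqrt (2::real)\<bar> = m / n" and c: "coprime m n"
    by (rule Rats_abs_nat_div_natE)
  have "real (m\<^sup>2) = (sqrt 2)\<^sup>2 * real (n\<^sup>2)" using n r by (simp add: power2_eq_square)
  then have "real (m\<^sup>2) = real (2 * n\<^sup>2)" by simp
  then have eq: "m\<^sup>2 = 2 * n\<^sup>2" by (simp only: of_nat_eq_iff)
  then have "even m" by (metis dvd_triv_left even_power)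
  then obtain k where k: "m = 2 * k" by (elim dvdE)
  with eq have "n\<^sup>2 = 2 * k\<^sup>2" by (simp add: power2_eq_square)
  then have "even n" by (metis dvd_triv_left even_power)
  with \<open>even m\<close> c show False by (metis coprime_common_divisor_nat odd_one nat_dvd_1_iff_1)
qed

lemma matrix_group_SL: "matrix_group (SL :: (real^'n^'n) set)"
  by unfold_locales (simp_all add: SL_mult SL_inv, simp add: SL_def)

lemma closed_SL: "closed (SL :: (real^'n^'n) set)"
proof -
  have "continuous_on UNIV (det :: real^'n^'n => real)"
    unfolding continuous_on_def by (auto intro: tendsto_det tendsto_ident_at)
  then have "closed {g :: real^'n^'n. det g = 1}" by (intro closed_Collect_eq) auto
  then show ?thesis by (simp add: SL_def)
qed

definition block2 :: "real^2^2 => real^2^2 => real^(2 \<times> 2)^(2 \<times> 2)" where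
  "block2 m1 m2 = (\<chi> p q. if fst p = fst q then (if fst p = 1 then m1 else m2) $ snd p $ snd q else 0)"

text \<open>The change of basis from a rational basis to the eigenvectors of multiplication by the square root of two.\<close>

definition R2 :: "real^(2 \<times> 2)^(2 \<times> 2)" where
  "R2 = (\<chi> p q. if snd p = snd q then (if fst p = 1 then 1 / 2 else if fst q = 1 then sqrt 2 / 4 else - sqrt 2 / 4) else 0)"

definition R2i :: "real^(2 \<times> 2)^(2 \<times> 2)" where
  "R2i = (\<chi> p q. if snd p = snd q then (if fst q = 1 then 1 else if fst p = 1 then sqrt 2 else - sqrt 2) else 0)"

text \<open>A rational matrix with distinct eigenvalues on the block; its centralizer cuts out the torus.\<close>

definition X2 :: "real^(2 \<times> 2)^(2 \<times> 2)" where
  "X2 = (\<chi> p q. if snd p = snd q then (if snd p = 1 then 1 else 2) *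
     (if fst p = 1 & fst q = 2 then 2 else if fst p = 2 & fst q = 1 then 1 else 0) else 0)"

lemma R2_R2i: "R2 ** R2i = mat 1"
  unfolding vec_eq_iff forall_22 by (simp add: matrix_matrix_mult_def sum_22 R2_def R2i_def mat_def)

definition mu2 :: "2 \<times> 2 => real" where
  "mu2 p = (if fst p = 1 then 1 else -1) * (if snd p = 1 then 1 else 2) * sqrt 2"

lemma R2_mu: "R2 ** dmat mu2 ** R2i = X2"
  unfolding vec_eq_iff forall_22 by (simp add: matrix_matrix_mult_def sum_22 R2_def R2i_def X2_def mu2_def)

definition conj2 :: "2 \<times> 2 => 2 \<times> 2" where
  "conj2 p = (if fst p = 1 then 2 else 1, snd p)"

lemma conj_pair_sqrt2:
  "real N * z = of_int x + of_int y * sqrt 2 ==> real N * z' = of_int x - of_int y * sqrt 2 ==> conj_pair 2 N z z'"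
  unfolding conj_pair_def by auto

text \<open>Restriction of scalars of \<open>SL\<^sub>2\<close> from the field generated by the square root of two, acting on four-dimensional rational space.\<close>

lemma SL_embedding:
  fixes \<iota> :: "2 \<times> 2 => 'n::finite"
  assumes inj: "inj \<iota>"
  shows "\<exists>XS. quadratic_embedding SL (emb \<iota> R2) \<iota> conj2 block2 2
    (\<lambda>\<nu>. \<nu> (1, 1) = \<nu> (1, 2) & \<nu> (2, 1) = \<nu> (2, 2))
    (\<lambda>a b p. (if fst p = 1 then dg a else dg b) $ snd p $ snd p) XS {}"
proof -
  interpret matrix_group "SL :: (real^'n^'n) set" by (rule matrix_group_SL)
  define E :: "real^'n^'n" where "E = emb \<iota> R2"
  have EE: "E ** emb \<iota> R2i = mat 1" by (simp add: E_def emb_mult inj R2_R2i emb_1)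
  have Ei: "matrix_inv E = emb \<iota> R2i" by (rule matrix_inv_unique[OF EE])
  have invE: "invertible E" using EE by (metis invertible_def matrix_left_right_inverse)
  obtain f :: "'n => nat" where f: "inj f" by (metis finite_imp_inj_to_nat_seg finite UNIV_I)
  define nu where "nu i = (if i \<in> range \<iota> then 0 else real (f i) + 1)" for i
  define l0 where "l0 i = (if i \<in> range \<iota> then mu2 (inv \<iota> i) else 1)" for i
  define X0 where "X0 = E ** dmat l0 ** matrix_inv E"
  define X1 where "X1 = E ** dmat nu ** matrix_inv E"
  have X0: "X0 = emb \<iota> X2"
  proof -
    have "dmat l0 = emb \<iota> (dmat mu2)" by (simp add: emb_dmat inj l0_def[abs_def])
    then show ?thesis unfolding X0_def Ei by (simp add: E_def emb_mult inj R2_mu)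
  qed
  have X1: "X1 = dmat nu"
  proof -
    have "(E ** dmat nu) $ i $ j = (dmat nu ** E) $ i $ j" for i j
     unfolding mult_dmat_nth dmat_mult_nth
     by (cases "i \<in> range \<iota>"; cases "j \<in> range \<iota>") (auto simp: E_def emb_nth inj nu_def)
    then have "E ** dmat nu = dmat nu ** E" by (simp add: vec_eq_iff)
    then show ?thesis unfolding X1_def using invE by (simp add: group_simps)
  qed
  have K_mult: "block2 m1 m2 ** block2 m1' m2' = block2 (m1 ** m1') (m2 ** m2')" for m1 m2 m1' m2'
    unfolding vec_eq_iff forall_22 by (simp add: matrix_matrix_mult_def sum_22 sum_2 block2_def)
  have K_one: "block2 (mat 1) (mat 1) = mat 1"
    unfolding vec_eq_iff forall_22 by (simp add: block2_def mat_def)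
  have col: "(E ** (emb \<iota> M ** dmat l) ** matrix_inv E) $ i $ a = (if i = a then l a else 0)"
    if a: "a \<notin> range \<iota>" for i a M l
  proof -
    have "(E ** (emb \<iota> M ** dmat l) ** matrix_inv E) $ i $ a = (\<Sum>k\<in>UNIV. (emb \<iota> (R2 ** M) ** dmat l) $ i $ k * (if k = a then 1 else 0))"
     unfolding Ei unfolding E_def matrix_mul_assoc emb_mult[OF inj]
     by (simp add: matrix_matrix_mult_def[of _ "emb \<iota> R2i"] emb_nth(3)[OF inj a])
    also have "\<dots> = (emb \<iota> (R2 ** M) ** dmat l) $ i $ a" by (simp add: if_distrib[of "\<lambda>x. _ * x"] cong: if_cong)
    finally show ?thesis by (simp add: mult_dmat_nth emb_nth(3)[OF inj a])
  qed
  have "quadratic_embedding SL E \<iota> conj2 block2 2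
    (\<lambda>\<nu>. \<nu> (1, 1) = \<nu> (1, 2) & \<nu> (2, 1) = \<nu> (2, 2))
    (\<lambda>a b p. (if fst p = 1 then dg a else dg b) $ snd p $ snd p) {X0, X1} {}"
  proof unfold_locales
    show "closed (SL :: (real^'n^'n) set)" by (rule closed_SL)
    show "invertible E" by (rule invE)
    show "inj \<iota>" by (rule inj)
    show "conj2 (conj2 p) = p" for p
     using exhaust_2[of "fst p"] by (auto simp: conj2_def prod_eq_iff)
    show "sqrt (real 2) \<notin> \<rat>" using sqrt_2_irrational by simp
    show "\<exists>N>0. (\<forall>a p. conj_pair 2 N (E $ a $ \<iota> p) (E $ a $ \<iota> (conj2 p))) &
       (\<forall>a p. conj_pair 2 N (matrix_inv E $ \<iota> p $ a) (matrix_inv E $ \<iota> (conj2 p) $ a))"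
    proof (intro exI[of _ 4] conjI allI)
     fix a p
     have r: "conj_pair 2 4 (R2 $ q $ p) (R2 $ q $ conj2 p)" for q
     proof -
      have "\<forall>q p. conj_pair 2 4 (R2 $ q $ p) (R2 $ q $ conj2 p)"
       unfolding forall_22 R2_def conj2_def vec_lambda_beta
       by (auto intro: conj_pair_sqrt2[of 4 _ 2 0] conj_pair_sqrt2[of 4 _ 0 1] conj_pair_sqrt2[of 4 _ 0 "-1"])
      then show ?thesis by blast
     qed
     have ri: "conj_pair 2 4 (R2i $ p $ q) (R2i $ conj2 p $ q)" for q
     proof -
      have "\<forall>q p. conj_pair 2 4 (R2i $ p $ q) (R2i $ conj2 p $ q)"
       unfolding forall_22 R2i_def conj2_def vec_lambda_beta
       by (auto intro: conj_pair_sqrt2[of 4 _ 4 0] conj_pair_sqrt2[of 4 _ 0 4] conj_pair_sqrt2[of 4 _ 0 "-4"])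
      then show ?thesis by blast
     qed
     show "conj_pair 2 4 (E $ a $ \<iota> p) (E $ a $ \<iota> (conj2 p))"
      by (cases "a \<in> range \<iota>") (auto simp: E_def emb_nth inj r)
     show "conj_pair 2 4 (matrix_inv E $ \<iota> p $ a) (matrix_inv E $ \<iota> (conj2 p) $ a)"
      by (cases "a \<in> range \<iota>") (auto simp: Ei emb_nth inj ri)
    qed simp
    show "block2 m1 m2 ** block2 m1' m2' = block2 (m1 ** m1') (m2 ** m2')" for m1 m2 m1' m2' by (rule K_mult)
    show "block2 (mat 1) (mat 1) = mat 1" by (rule K_one)
    show "continuous_on UNIV (\<lambda>x. block2 (fst x) (snd x) $ p $ q)" for p q
     by (cases "fst p = fst q"; cases "fst p = 1") (auto simp: block2_def intro!: continuous_intros)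
    show "block2 (dg a) (dg b) = dmat (\<lambda>p. (if fst p = 1 then dg a else dg b) $ snd p $ snd p)" for a b
     unfolding vec_eq_iff forall_22 by (simp add: block2_def dg_def)
    show "(if fst p = 1 then dg a else dg b) $ snd p $ snd p > 0" if "a > 0" "b > 0" for a b and p :: "2 \<times> 2"
     using that exhaust_2[of "snd p"] by (auto simp: dg_def)
    show "E ** emb \<iota> (block2 m1 m2) ** matrix_inv E \<in> SL" if "m1 \<in> SL" "m2 \<in> SL" for m1 m2
     unfolding SL_def using det_conj_emb[of block2, OF K_mult K_one inj invE that] by simp
    show "conj_pair 2 1 ((block2 m1 m2 $ p $ q - mat 1 $ p $ q) / real N) ((block2 m1 m2 $ conj2 p $ conj2 q - mat 1 $ conj2 p $ conj2 q) / real N)"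
     if cp: "!!i j. conj_pair 2 1 ((m1 $ i $ j - mat 1 $ i $ j) / real N) ((m2 $ i $ j - mat 1 $ i $ j) / real N)" for m1 m2 N p q
    proof -
     have "\<forall>p q. conj_pair 2 1 ((block2 m1 m2 $ p $ q - mat 1 $ p $ q) / real N) ((block2 m1 m2 $ conj2 p $ conj2 q - mat 1 $ conj2 p $ conj2 q) / real N)"
      unfolding forall_22
      using cp[of 1 1] cp[of 1 2] cp[of 2 1] cp[of 2 2] cp[of 1 1, THEN conj_pair_sym] cp[of 1 2, THEN conj_pair_sym]
       cp[of 2 1, THEN conj_pair_sym] cp[of 2 2, THEN conj_pair_sym] by (simp add: block2_def conj2_def mat_def)
     then show ?thesis by blast
    qed
    show "rational_matrix (block2 m m)" if "rational_matrix m" for m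
     using that by (auto simp: rational_matrix_def block2_def)
    show "block2 m m $ conj2 p $ conj2 q = block2 m m $ p $ q" for m p q
     using exhaust_2[of "fst p"] exhaust_2[of "fst q"] by (auto simp: block2_def conj2_def)
    show "\<exists>p q. \<forall>x. block2 (upper x) (mat 1) $ p $ q = x"
     by (rule exI[of _ "(1, 1)"], rule exI[of _ "(1, 2)"]) (simp add: block2_def upper_def)
    show "\<exists>p q. \<forall>x. block2 (mat 1) (upper x) $ p $ q = x"
     by (rule exI[of _ "(2, 1)"], rule exI[of _ "(2, 2)"]) (simp add: block2_def upper_def)
    show "\<nu> p = \<nu> q" if "\<nu> (1, 1) = \<nu> (1, 2) & \<nu> (2, 1) = \<nu> (2, 2)" "block2 m1 m2 $ p $ q ~= 0" for \<nu> :: "2 \<times> 2 => real" and m1 m2 p q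
     using that exhaust_2[of "fst p"] exhaust_2[of "fst q"] exhaust_2[of "snd p"] exhaust_2[of "snd q"]
     by (cases p; cases q) (auto simp: block2_def split: if_splits)
    show "\<exists>a>0. \<exists>b>0. \<exists>\<nu>. (\<nu> (1, 1) = \<nu> (1, 2) & \<nu> (2, 1) = \<nu> (2, 2)) & (\<forall>p. \<nu> p > 0) &
      (\<forall>p. l (\<iota> p) = (if fst p = 1 then dg a else dg b) $ snd p $ snd p * \<nu> p)" if l: "!!i. l i > (0::real)" for l
    proof -
     have split: "\<exists>u>0. \<exists>v>0. x = u * v & y = 1 / u * v" if "x > 0" "y > 0" for x y :: real
     proof -
      have "sqrt (x / y) * sqrt (x * y) = sqrt (x * x)" using that by (simp add: real_sqrt_mult[symmetric])
      then have a: "x = sqrt (x / y) * sqrt (x * y)" using that by simp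
      have "1 / sqrt (x / y) * sqrt (x * y) = sqrt (y * y)" using that by (simp add: real_sqrt_mult[symmetric] real_sqrt_divide[symmetric])
      then have b: "y = 1 / sqrt (x / y) * sqrt (x * y)" using that by simp
      have p: "sqrt (x / y) > 0" "sqrt (x * y) > 0" using that by auto
      show ?thesis
       by (rule exI[of _ "sqrt (x / y)"], rule conjI, rule p(1), rule exI[of _ "sqrt (x * y)"])
        (intro conjI p(2) a b)
     qed
     obtain u1 v1 where 1: "u1 > 0" "v1 > 0" "l (\<iota> (1,1)) = u1 * v1" "l (\<iota> (1,2)) = 1 / u1 * v1" using split[OF l l] by metis
     obtain u2 v2 where 2: "u2 > 0" "v2 > 0" "l (\<iota> (2,1)) = u2 * v2" "l (\<iota> (2,2)) = 1 / u2 * v2" using split[OF l l] by metis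
     have e: "\<forall>p. l (\<iota> p) = (if fst p = 1 then dg u1 else dg u2) $ snd p $ snd p * (if fst p = 1 then v1 else v2)"
      unfolding forall_22 using 1 2 by (simp add: dg_def)
     show ?thesis
      by (rule exI[of _ u1], rule conjI, rule 1(1), rule exI[of _ u2], rule conjI, rule 2(1),
        rule exI[of _ "\<lambda>p. if fst p = 1 then v1 else v2"]) (use e 1(2) 2(2) in simp)
    qed
    show "norm_integral 2 (M * M) m1 m2"
     if m: "m1 \<in> SL" "m2 \<in> SL" and l: "!!i. l i > (0::real)" and sc: "(l \<circ> \<iota>) (1, 1) = (l \<circ> \<iota>) (1, 2) & (l \<circ> \<iota>) (2, 1) = (l \<circ> \<iota>) (2, 2)"
      and lH: "E ** dmat l ** matrix_inv E \<in> SL"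
      and mem: "E ** (emb \<iota> (block2 m1 m2) ** dmat l) ** matrix_inv E \<in> integer_points SL"
      and cp: "!!p q. conj_pair 2 M (block2 m1 m2 $ p $ q * l (\<iota> q)) (block2 m1 m2 $ conj2 p $ conj2 q * l (\<iota> (conj2 q)))"
     for m1 m2 :: "real^2^2" and l and M :: nat
    proof -
     define \<delta> where "\<delta> = E ** (emb \<iota> (block2 m1 m2) ** dmat l) ** matrix_inv E"
     have dI: "integer_matrix \<delta>" "det \<delta> = 1" "invertible \<delta>" 
      using mem invertible_Delta[OF mem] det_H unfolding \<delta>_def[symmetric] Delta_iff by auto
     have l1: "l a = 1" if a: "a \<notin> range \<iota>" for a
     proof -
      have c: "\<delta> $ i $ a = (if i = a then l a else 0)" for i unfolding \<delta>_def using col[OF a] .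
      have "(matrix_inv \<delta> ** \<delta>) $ a $ a = matrix_inv \<delta> $ a $ a * l a"
       unfolding matrix_matrix_mult_def by (simp add: c if_distrib[of "\<lambda>x. _ * x"] cong: if_cong)
      then have "matrix_inv \<delta> $ a $ a * l a = 1" using dI(3) by (simp add: group_simps mat_def)
      moreover obtain u v where "matrix_inv \<delta> $ a $ a = of_int u" "l a = of_int v"
       using integer_matrix_inv[OF dI(1,2)] dI(1) c[of a] unfolding integer_matrix_def by (metis Ints_cases)
      ultimately have uv: "u * v = 1" "v > 0" using l[of a] by (simp_all flip: of_int_mult)
      then show ?thesis using \<open>l a = of_int v\<close> by (auto simp: zmult_eq_1_iff)
     qed
     define c1 c2 where "c1 = l (\<iota> (1, 1))" and "c2 = l (\<iota> (2, 1))"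
     have c: "l (\<iota> (1, 2)) = c1" "l (\<iota> (2, 2)) = c2" "c1 > 0" "c2 > 0" using sc l by (simp_all add: c1_def c2_def)
     have "det (dmat l) = 1"
     proof -
      have "det E * det (matrix_inv E) = 1" using invE by (metis det_I det_mul matrix_inv_mult_right)
      moreover have "det E * det (dmat l) * det (matrix_inv E) = 1" using lH by (simp add: SL_def det_mul)
      ultimately show ?thesis by (simp add: mult_ac) (metis mult.assoc mult.commute mult.right_neutral)
     qed
     moreover have "(\<Prod>i\<in>UNIV. l i) = (\<Prod>p\<in>UNIV. l (\<iota> p))"
     proof -
      have "(\<Prod>i\<in>UNIV. l i) = (\<Prod>i\<in>range \<iota>. l i)" by (intro prod.mono_neutral_right) (auto simp: l1)
      then show ?thesis using inj by (simp add: prod.reindex)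
     qed
     moreover have "(\<Prod>p\<in>UNIV. l (\<iota> p)) = (c1 * c2)\<^sup>2"
     proof -
      have "(\<Prod>p\<in>UNIV. l (\<iota> p)) = (\<Prod>i\<in>UNIV. \<Prod>j\<in>UNIV. l (\<iota> (i, j)))"
       by (simp add: prod.cartesian_product UNIV_Times_UNIV[symmetric] del: UNIV_Times_UNIV)
      also have "\<dots> = (c1 * c2)\<^sup>2" by (simp add: UNIV_2 c power2_eq_square flip: c1_def c2_def)
      finally show ?thesis .
     qed
     ultimately have "(c1 * c2)\<^sup>2 = 1" by (simp add: det_dmat)
     then have c12: "c1 * c2 = 1" using c by (simp add: power2_eq_1_iff) (smt (verit) mult_pos_pos)
     have A: "conj_pair 2 M (m1 $ i $ k * c1) (m2 $ i $ k * c2)" for i k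
      using cp[of "(1, i)" "(1, k)"] exhaust_2[of k] c by (auto simp: block2_def conj2_def c1_def c2_def)
     show ?thesis
      unfolding norm_integral_def
     proof (intro allI)
      fix i j k p
      have "conj_pair 2 (M * M) ((m1 $ i $ k * c1) * (m2 $ j $ p * c2)) ((m2 $ i $ k * c2) * (m1 $ j $ p * c1))"
       by (intro conj_pair_mult A conj_pair_sym[OF A])
      moreover have "(m1 $ i $ k * c1) * (m2 $ j $ p * c2) = m1 $ i $ k * m2 $ j $ p"
       "(m2 $ i $ k * c2) * (m1 $ j $ p * c1) = m1 $ j $ p * m2 $ i $ k"
       using c12 by (simp_all add: algebra_simps)
      ultimately show "conj_pair 2 (M * M) (m1 $ i $ k * m2 $ j $ p) (m1 $ j $ p * m2 $ i $ k)" by simp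
     qed
    qed
    show "finite {X0, X1}" by simp
    show "rational_matrix X" if "X \<in> {X0, X1}" for X
     using that unfolding X0 X1 by (auto simp: rational_matrix_def emb_def X2_def nu_def)
    show "\<exists>\<mu>. X = E ** dmat \<mu> ** matrix_inv E" if "X \<in> {X0, X1}" for X
     using that X0_def X1_def by auto
    show "(matrix_inv E ** z ** E) $ i $ j = 0"
     if com: "!!X. X \<in> {X0, X1} ==> z ** X = X ** z" and ij: "i ~= j" for z :: "real^'n^'n" and i j
    proof -
     have key: "(matrix_inv E ** z ** E) $ i $ j * (\<mu> j - \<mu> i) = 0"
      if X: "X = E ** dmat \<mu> ** matrix_inv E" "z ** X = X ** z" for X \<mu>
     proof -
      have "(matrix_inv E ** z ** E) ** dmat \<mu> = matrix_inv E ** (z ** X) ** E"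
       unfolding X(1) using invE by (simp add: group_simps)
      also have "\<dots> = dmat \<mu> ** (matrix_inv E ** z ** E)"
       unfolding X(2) unfolding X(1) using invE by (simp add: group_simps)
      finally have "((matrix_inv E ** z ** E) ** dmat \<mu>) $ i $ j = (dmat \<mu> ** (matrix_inv E ** z ** E)) $ i $ j" by simp
      then show ?thesis unfolding mult_dmat_nth dmat_mult_nth by (simp add: algebra_simps)
     qed
     have s2: "sqrt 2 * x ~= 1" if "x \<in> \<rat>" for x
     proof
      assume e: "sqrt 2 * x = 1"
      then have "x ~= 0" by auto
      then have "sqrt 2 = 1 / x" using e by (simp add: field_simps)
      then show False using sqrt_2_irrational that by simp
     qed
     have mu1: "mu2 p ~= 1" for p
      using s2[of 1] s2[of 2] s2[of "-1"] s2[of "-2"] by (auto simp: mu2_def mult.commute)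
     have mu_inj: "mu2 p ~= mu2 q" if "p ~= q" for p q
     proof -
      have "\<forall>p q. p ~= q --> mu2 p ~= mu2 q" unfolding forall_22 by (simp add: mu2_def)
      then show ?thesis using that by blast
     qed
     have "l0 i ~= l0 j \<or> nu i ~= nu j"
     proof (cases "i \<in> range \<iota> \<or> j \<in> range \<iota>")
      case True
      have lp: "l0 (\<iota> p) = mu2 p" "k \<notin> range \<iota> ==> l0 k = 1" for p k using inj by (simp_all add: l0_def)
      have "l0 i ~= l0 j" using True ij mu1 mu_inj by (metis lp rangeE)
      then show ?thesis ..
     next
      case False
      then show ?thesis using ij f by (simp add: nu_def inj_eq)
     qed
     then show ?thesis
      using key[OF X0_def com] key[OF X1_def com] by auto
    qed
  qed simp_all
  then show ?thesis unfolding E_def by blast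
qed

lemma SL_four_boundary:
  assumes "CARD('n::finite) \<ge> 4"
  shows "\<exists>E :: real^'n^'n. invertible E & four_boundary_cosets SL (pos_torus SL E) (integer_points SL)"
proof -
  have "card (UNIV :: (2 \<times> 2) set) \<le> card (UNIV :: 'n set)" using assms by simp
  then obtain \<iota> :: "2 \<times> 2 => 'n" where i: "inj \<iota>"
    using card_le_inj[of "UNIV :: (2 \<times> 2) set" "UNIV :: 'n set"] by auto
  obtain XS where "quadratic_embedding SL (emb \<iota> R2) \<iota> conj2 block2 2
    (\<lambda>\<nu>. \<nu> (1, 1) = \<nu> (1, 2) & \<nu> (2, 1) = \<nu> (2, 2))
    (\<lambda>a b p. (if fst p = 1 then dg a else dg b) $ snd p $ snd p) XS {}"
    using SL_embedding[OF i] by blast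
  then interpret quadratic_embedding SL "emb \<iota> R2" \<iota> conj2 block2 2
    "\<lambda>\<nu>. \<nu> (1, 1) = \<nu> (1, 2) & \<nu> (2, 1) = \<nu> (2, 2)"
    "\<lambda>a b p. (if fst p = 1 then dg a else dg b) $ snd p $ snd p" XS "{}" .
  show ?thesis using hilbert_torus.four_boundary_orbits[OF hilbert_torus] inv_E by blast
qed

section \<open>Orthogonal groups\<close>

text \<open>The Kronecker product. The form on four-space that is the tensor product of two symplectic forms has spin group \<open>SL\<^sub>2 \<times> SL\<^sub>2\<close>.\<close>

definition kron2 :: "real^2^2 => real^2^2 => real^(2 \<times> 2)^(2 \<times> 2)" where
  "kron2 m1 m2 = (\<chi> p q. m1 $ fst p $ fst q * m2 $ snd p $ snd q)"

definition eps :: "2 => 2 => real" where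
  "eps i j = (if i = j then 0 else if i = 1 then 1 else -1)"

definition isometries :: "real^'n^'n => (real^'n^'n) set" where
  "isometries S = {g. det g = 1 & transpose g ** S ** g = S}"

lemma matrix_group_isometries: "matrix_group (isometries S)"
proof
  show "mat 1 \<in> isometries S" by (simp add: isometries_def)
  fix g assume g: "g \<in> isometries S"
  then show d: "det g = 1" by (simp add: isometries_def)
  have inv: "invertible g" using d by (simp add: invertible_det_nz)
  have gS: "transpose g ** S ** g = S" using g by (simp add: isometries_def)
  have eq: "transpose (matrix_inv g) ** (transpose g ** S ** g) ** matrix_inv g
     = transpose (g ** matrix_inv g) ** S ** (g ** matrix_inv g)" by (simp add: matrix_transpose_mul matrix_mul_assoc)
  have "transpose (matrix_inv g) ** S ** matrix_inv g = S"
    using eq unfolding gS matrix_inv_mult_right[OF inv] by simp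
  moreover have "det (matrix_inv g) = 1" using inv d by (metis det_I det_mul matrix_inv_mult_right mult_1)
  ultimately show "matrix_inv g \<in> isometries S" by (simp add: isometries_def)
  fix h assume h: "h \<in> isometries S"
  have "transpose (g ** h) ** S ** (g ** h) = transpose h ** (transpose g ** S ** g) ** h"
    by (simp add: matrix_transpose_mul matrix_mul_assoc)
  then show "g ** h \<in> isometries S" using g h by (simp add: isometries_def det_mul)
qed

lemma closed_isometries: "closed (isometries S)"
proof (rule closed_sequential_limits[THEN iffD2], intro allI impI, elim conjE)
  fix x l assume x: "\<forall>n. x n \<in> isometries S" and lim: "x \<longlonglongrightarrow> l"
  have t: "(\<lambda>n. transpose (x n)) \<longlonglongrightarrow> transpose l"
    unfolding transpose_def by (intro vec_tendstoI) (simp, intro tendsto_vec_nth lim)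
  have "(\<lambda>n. transpose (x n) ** S ** x n) \<longlonglongrightarrow> transpose l ** S ** l"
    by (intro tendsto_matrix_mult t lim tendsto_const)
  then have "(\<lambda>n::nat. S) \<longlonglongrightarrow> transpose l ** S ** l" using x by (simp add: isometries_def)
  then have "transpose l ** S ** l = S" by (simp add: LIMSEQ_const_iff)
  moreover have "(\<lambda>n. det (x n)) \<longlonglongrightarrow> det l" by (rule tendsto_det[OF lim])
  then have "(\<lambda>n::nat. 1) \<longlonglongrightarrow> det l" using x by (simp add: isometries_def)
  then have "det l = 1" by (simp add: LIMSEQ_const_iff)
  ultimately show "l \<in> isometries S" by (simp add: isometries_def)
qed

lemma triple_product_nth:
  "(transpose X ** M ** Y) $ i $ j = (\<Sum>k\<in>UNIV. \<Sum>l\<in>UNIV. X $ k $ i * M $ k $ l * Y $ l $ j)" for X M Y :: "real^'n^'n"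
proof -
  have "(transpose X ** M ** Y) $ i $ j = (\<Sum>l\<in>UNIV. \<Sum>k\<in>UNIV. X $ k $ i * M $ k $ l * Y $ l $ j)"
    by (simp add: matrix_matrix_mult_def transpose_def sum_distrib_right)
  then show ?thesis by (subst sum.swap)
qed

lemma isometry_conj_iff:
  fixes E S X :: "'a::field^'n^'n"
  assumes E: "invertible E"
  shows "transpose (E ** X ** matrix_inv E) ** S ** (E ** X ** matrix_inv E) = S \<longleftrightarrow>
    transpose X ** (transpose E ** S ** E) ** X = transpose E ** S ** E"
proof -
  have tE: "transpose (matrix_inv E) ** transpose E = mat 1" "transpose E ** transpose (matrix_inv E) = mat 1"
    using E by (simp_all add: matrix_transpose_mul[symmetric] group_simps)
  have e: "transpose E ** (transpose (E ** X ** matrix_inv E) ** S ** (E ** X ** matrix_inv E)) ** E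
     = transpose X ** (transpose E ** S ** E) ** X"
  proof -
    have "transpose E ** (transpose (E ** X ** matrix_inv E) ** S ** (E ** X ** matrix_inv E)) ** E
     = (transpose E ** transpose (matrix_inv E)) ** transpose X ** (transpose E ** S ** E) ** X ** (matrix_inv E ** E)"
     by (simp add: matrix_transpose_mul matrix_mul_assoc)
    then show ?thesis using E tE by (simp add: group_simps)
  qed
  have inj: "A = B" if "transpose E ** A ** E = transpose E ** B ** E" for A B :: "'a^'n^'n"
  proof -
    have c: "transpose (matrix_inv E) ** (transpose E ** A ** E) ** matrix_inv E = A" for A :: "'a^'n^'n"
    proof -
     have "transpose (matrix_inv E) ** (transpose E ** A ** E) ** matrix_inv E
      = (transpose (matrix_inv E) ** transpose E) ** A ** (E ** matrix_inv E)" by (simp add: matrix_mul_assoc)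
     then show ?thesis using E tE by (simp add: group_simps)
    qed
    have "A = transpose (matrix_inv E) ** (transpose E ** A ** E) ** matrix_inv E" by (rule c[symmetric])
    also have "\<dots> = transpose (matrix_inv E) ** (transpose E ** B ** E) ** matrix_inv E" by (simp only: that)
    also have "\<dots> = B" by (rule c)
    finally show ?thesis .
  qed
  show ?thesis
  proof
    assume "transpose (E ** X ** matrix_inv E) ** S ** (E ** X ** matrix_inv E) = S"
    from e[unfolded this] show "transpose X ** (transpose E ** S ** E) ** X = transpose E ** S ** E" by (rule sym)
  next
    assume "transpose X ** (transpose E ** S ** E) ** X = transpose E ** S ** E"
    from e[unfolded this] show "transpose (E ** X ** matrix_inv E) ** S ** (E ** X ** matrix_inv E) = S" by (rule inj)
  qed
qed

lemma kron2_mult: "kron2 m1 m2 ** kron2 m1' m2' = kron2 (m1 ** m1') (m2 ** m2')"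
  unfolding vec_eq_iff forall_22 by (simp add: matrix_matrix_mult_def sum_22 sum_2 kron2_def algebra_simps)

lemma kron2_one: "kron2 (mat 1) (mat 1) = mat 1"
  unfolding vec_eq_iff forall_22 by (simp add: kron2_def mat_def)

lemma kron2_eps:
  assumes "m1 \<in> SL" "m2 \<in> SL"
  shows "(\<Sum>r\<in>UNIV. \<Sum>s\<in>UNIV. kron2 m1 m2 $ r $ p * (\<mu> * eps (fst r) (fst s) * eps (snd r) (snd s)) * kron2 m1 m2 $ s $ q)
    = \<mu> * eps (fst p) (fst q) * eps (snd p) (snd q)"
proof -
  define D where "D m = m $ 1 $ 1 * m $ 2 $ 2 - m $ 1 $ 2 * m $ 2 $ 1" for m :: "real^2^2"
  have D: "D m1 = 1" "D m2 = 1" using assms by (simp_all add: SL_def det_2 D_def)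
  have two: "(\<Sum>i\<in>UNIV. \<Sum>k\<in>UNIV. m $ i $ a * eps i k * m $ k $ b) = D m * eps a b" for m a b
    using exhaust_2[of a] exhaust_2[of b] by (auto simp: sum_2 eps_def D_def)
  have "(\<Sum>r\<in>UNIV. \<Sum>s\<in>UNIV. kron2 m1 m2 $ r $ p * (\<mu> * eps (fst r) (fst s) * eps (snd r) (snd s)) * kron2 m1 m2 $ s $ q)
    = \<mu> * (\<Sum>i\<in>UNIV. \<Sum>k\<in>UNIV. m1 $ i $ fst p * eps i k * m1 $ k $ fst q) * (\<Sum>i\<in>UNIV. \<Sum>k\<in>UNIV. m2 $ i $ snd p * eps i k * m2 $ k $ snd q)"
    unfolding sum_22 sum_2 kron2_def vec_lambda_beta fst_conv snd_conv by (simp add: eps_def algebra_simps)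
  then show ?thesis unfolding two D by simp
qed

text \<open>A four-dimensional rational quadratic space whose discriminant is not a square has as spin group the restriction of scalars of \<open>SL\<^sub>2\<close>; Galois conjugation exchanges the two tensor factors.\<close>

lemma SO_embedding:
  fixes E S :: "real^'n^'n" and \<iota> :: "2 \<times> 2 => 'n"
  assumes invE: "invertible E" and inj: "inj \<iota>" and irr: "sqrt (real d) \<notin> \<rat>"
    and E_conj: "\<exists>N>0. (\<forall>a p. conj_pair d N (E $ a $ \<iota> p) (E $ a $ \<iota> (prod.swap p))) &
       (\<forall>a p. conj_pair d N (matrix_inv E $ \<iota> p $ a) (matrix_inv E $ \<iota> (prod.swap p) $ a))"
    and gram: "!!p q. (transpose E ** S ** E) $ \<iota> p $ \<iota> q = \<mu> * eps (fst p) (fst q) * eps (snd p) (snd q)" and mu: "\<mu> ~= 0"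
    and gram0: "!!p j. j \<notin> range \<iota> ==> (transpose E ** S ** E) $ \<iota> p $ j = 0 & (transpose E ** S ** E) $ j $ \<iota> p = 0"
    and XS: "finite XS" "!!X. X \<in> XS ==> rational_matrix X" "!!X. X \<in> XS ==> \<exists>\<mu>. X = E ** dmat \<mu> ** matrix_inv E"
    and WS: "finite WS" "!!w i. w \<in> WS ==> w $ i \<in> \<rat>" "!!w t. w \<in> WS ==> t \<in> pos_torus (isometries S) E ==> t *v w = w"
    and separated: "!!z i j. (!!X. X \<in> XS ==> z ** X = X ** z) ==> (!!w. w \<in> WS ==> z *v w = w) ==>
       i ~= j ==> (matrix_inv E ** z ** E) $ i $ j = 0"
  shows "quadratic_embedding (isometries S) E \<iota> prod.swap kron2 d (\<lambda>\<nu>. \<forall>p. \<nu> p = 1)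
    (\<lambda>a b p. dg a $ fst p $ fst p * dg b $ snd p $ snd p) XS WS"
proof -
  interpret matrix_group "isometries S" by (rule matrix_group_isometries)
  define M where "M = transpose E ** S ** E"
  note gram = gram[folded M_def] and gram0 = gram0[folded M_def]
  have pres: "transpose (emb \<iota> (kron2 m1 m2)) ** M ** emb \<iota> (kron2 m1 m2) = M" if m: "m1 \<in> SL" "m2 \<in> SL" for m1 m2
  proof -
    define X where "X = emb \<iota> (kron2 m1 m2)"
    have X1: "X $ \<iota> p $ \<iota> q = kron2 m1 m2 $ p $ q" for p q by (simp add: X_def emb_nth inj)
    have X2: "X $ k $ j = (if k = j then 1 else 0)" if "k \<notin> range \<iota> \<or> j \<notin> range \<iota>" for k j
     using that by (auto simp: X_def emb_nth inj)
    have "(transpose X ** M ** X) $ i $ j = M $ i $ j" for i j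
    proof -
     have in_out: "(transpose X ** M ** X) $ i $ j = M $ i $ j" if i: "i \<notin> range \<iota>"
     proof -
      have "(\<Sum>k\<in>UNIV. \<Sum>l\<in>UNIV. X $ k $ i * M $ k $ l * X $ l $ j) = (\<Sum>k\<in>UNIV. (if k = i then 1 else 0) * (\<Sum>l\<in>UNIV. M $ k $ l * X $ l $ j))"
       by (simp add: X2 i sum_distrib_left mult.assoc)
      also have "\<dots> = (\<Sum>l\<in>UNIV. M $ i $ l * X $ l $ j)" by (simp add: if_distrib[of "\<lambda>x. x * _"] cong: if_cong)
      also have "\<dots> = (\<Sum>l\<in>UNIV. M $ i $ l * (if l = j then 1 else 0))"
      proof (intro sum.cong refl)
       fix l show "M $ i $ l * X $ l $ j = M $ i $ l * (if l = j then 1 else 0)"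
        using gram0[OF i] X2[of l j] by (cases "l \<in> range \<iota>") auto
      qed
      also have "\<dots> = M $ i $ j" by (simp add: if_distrib[of "\<lambda>x. _ * x"] cong: if_cong)
      finally show ?thesis by (simp add: triple_product_nth)
     qed
     show ?thesis
     proof (cases "i \<in> range \<iota>")
      case False
      then show ?thesis by (rule in_out)
     next
      case True
      then obtain p where p: "i = \<iota> p" by blast
      show ?thesis
      proof (cases "j \<in> range \<iota>")
       case True
       then obtain q where q: "j = \<iota> q" by blast
       have "(transpose X ** M ** X) $ i $ j = (\<Sum>k\<in>UNIV. \<Sum>l\<in>UNIV. X $ k $ \<iota> p * M $ k $ l * X $ l $ \<iota> q)"
        by (simp add: triple_product_nth p q)
       also have "\<dots> = (\<Sum>r\<in>UNIV. \<Sum>l\<in>UNIV. X $ \<iota> r $ \<iota> p * M $ \<iota> r $ l * X $ l $ \<iota> q)"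
        by (subst sum_range_split[OF inj]) (auto simp: X2 intro!: sum.neutral)
       also have "\<dots> = (\<Sum>r\<in>UNIV. \<Sum>s\<in>UNIV. X $ \<iota> r $ \<iota> p * M $ \<iota> r $ \<iota> s * X $ \<iota> s $ \<iota> q)"
        by (intro sum.cong refl, subst sum_range_split[OF inj]) (auto simp: X2 intro!: sum.neutral)
       also have "\<dots> = \<mu> * eps (fst p) (fst q) * eps (snd p) (snd q)"
        unfolding X1 gram by (rule kron2_eps[OF m])
       finally show ?thesis by (simp add: p q gram)
      next
       case False
       have "(transpose X ** M ** X) $ i $ j = (\<Sum>k\<in>UNIV. \<Sum>l\<in>UNIV. X $ k $ i * M $ k $ l * (if l = j then 1 else 0))"
        by (simp add: triple_product_nth X2 False)
       also have "\<dots> = (\<Sum>k\<in>UNIV. X $ k $ i * M $ k $ j)" by (simp add: if_distrib[of "\<lambda>x. _ * x"] cong: if_cong)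
       also have "\<dots> = 0"
       proof (intro sum.neutral ballI)
        fix k show "X $ k $ i * M $ k $ j = 0"
         using gram0[OF False] X2[of k i] by (cases "k \<in> range \<iota>") (auto simp: p)
       qed
       finally show ?thesis using gram0[OF False] by (simp add: p)
      qed
     qed
    qed
    then show ?thesis by (simp add: vec_eq_iff X_def)
  qed
  show ?thesis
  proof unfold_locales
    show "closed (isometries S)" by (rule closed_isometries)
    show "invertible E" "inj \<iota>" "sqrt (real d) \<notin> \<rat>" by fact+
    show "prod.swap (prod.swap p) = p" for p :: "2 \<times> 2" by simp
    show "\<exists>N>0. (\<forall>a p. conj_pair d N (E $ a $ \<iota> p) (E $ a $ \<iota> (prod.swap p))) &
       (\<forall>a p. conj_pair d N (matrix_inv E $ \<iota> p $ a) (matrix_inv E $ \<iota> (prod.swap p) $ a))" by (rule E_conj)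
    show "kron2 m1 m2 ** kron2 m1' m2' = kron2 (m1 ** m1') (m2 ** m2')" for m1 m2 m1' m2' by (rule kron2_mult)
    show "kron2 (mat 1) (mat 1) = mat 1" by (rule kron2_one)
    show "continuous_on UNIV (\<lambda>x. kron2 (fst x) (snd x) $ p $ q)" for p q
     unfolding kron2_def by (auto intro!: continuous_intros)
    show "kron2 (dg a) (dg b) = dmat (\<lambda>p. dg a $ fst p $ fst p * dg b $ snd p $ snd p)" for a b
     unfolding vec_eq_iff forall_22 by (simp add: kron2_def dg_def)
    show "dg a $ fst p $ fst p * dg b $ snd p $ snd p > 0" if "a > 0" "b > 0" for a b and p :: "2 \<times> 2"
     using that exhaust_2[of "snd p"] exhaust_2[of "fst p"] by (auto simp: dg_def)
    show "E ** emb \<iota> (kron2 m1 m2) ** matrix_inv E \<in> isometries S" if m: "m1 \<in> SL" "m2 \<in> SL" for m1 m2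
    proof -
     have "det (E ** emb \<iota> (kron2 m1 m2) ** matrix_inv E) = 1"
      by (rule det_conj_emb[of kron2, OF kron2_mult kron2_one inj invE m])
     then show ?thesis unfolding isometries_def using isometry_conj_iff[OF invE, of _ S] pres[OF m] by (simp add: M_def)
    qed
    show "conj_pair d 1 ((kron2 m1 m2 $ p $ q - mat 1 $ p $ q) / real N)
      ((kron2 m1 m2 $ prod.swap p $ prod.swap q - mat 1 $ prod.swap p $ prod.swap q) / real N)"
     if N: "N > 0" and cp: "!!i j. conj_pair d 1 ((m1 $ i $ j - mat 1 $ i $ j) / real N) ((m2 $ i $ j - mat 1 $ i $ j) / real N)" for m1 m2 N p q
    proof -
     define x where "x = (m1 $ fst p $ fst q - mat 1 $ fst p $ fst q) / real N"
     define x' where "x' = (m2 $ fst p $ fst q - mat 1 $ fst p $ fst q) / real N"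
     define y where "y = (m2 $ snd p $ snd q - mat 1 $ snd p $ snd q) / real N"
     define y' where "y' = (m1 $ snd p $ snd q - mat 1 $ snd p $ snd q) / real N"
     define u v :: real where "u = mat 1 $ fst p $ fst q" and "v = mat 1 $ snd p $ snd q"
     have c: "conj_pair d 1 x x'" "conj_pair d 1 y y'" unfolding x_def x'_def y_def y'_def using cp conj_pair_sym[OF cp] by blast+
     have uv: "conj_pair d 1 u u" "conj_pair d 1 v v" "conj_pair d 1 (real N) (real N)"
      using conj_pair_int[of d 1 0] conj_pair_int[of d 1 1] conj_pair_int[of d 1 "int N"] by (auto simp: u_def v_def mat_def)
     have "conj_pair d 1 (x * v + u * y + real N * x * y) (x' * v + u * y' + real N * x' * y')"
      using c uv conj_pair_mult[of d 1 _ _ 1] by (intro conj_pair_add) (metis mult_1)+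
     moreover have "(kron2 m1 m2 $ p $ q - mat 1 $ p $ q) / real N = x * v + u * y + real N * x * y"
     proof -
      have "m1 $ fst p $ fst q = u + real N * x" "m2 $ snd p $ snd q = v + real N * y" using N by (simp_all add: x_def y_def u_def v_def)
      moreover have "mat 1 $ p $ q = u * v" by (auto simp: mat_def u_def v_def prod_eq_iff)
      ultimately show ?thesis using N by (simp add: kron2_def field_simps)
     qed
     moreover have "(kron2 m1 m2 $ prod.swap p $ prod.swap q - mat 1 $ prod.swap p $ prod.swap q) / real N = x' * v + u * y' + real N * x' * y'"
     proof -
      have "m2 $ fst p $ fst q = u + real N * x'" "m1 $ snd p $ snd q = v + real N * y'" using N by (simp_all add: x'_def y'_def u_def v_def)
      moreover have "mat 1 $ prod.swap p $ prod.swap q = u * v" by (auto simp: mat_def u_def v_def prod_eq_iff)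
      ultimately show ?thesis using N by (simp add: kron2_def field_simps)
     qed
     ultimately show ?thesis by simp
    qed
    show "rational_matrix (kron2 m m)" if "rational_matrix m" for m
     using that by (auto simp: rational_matrix_def kron2_def)
    show "kron2 m m $ prod.swap p $ prod.swap q = kron2 m m $ p $ q" for m p q by (simp add: kron2_def)
    show "\<exists>p q. \<forall>x. kron2 (upper x) (mat 1) $ p $ q = x"
     by (rule exI[of _ "(1, 1)"], rule exI[of _ "(2, 1)"]) (simp add: kron2_def upper_def mat_def)
    show "\<exists>p q. \<forall>x. kron2 (mat 1) (upper x) $ p $ q = x"
     by (rule exI[of _ "(1, 1)"], rule exI[of _ "(1, 2)"]) (simp add: kron2_def upper_def mat_def)
    show "\<exists>a>0. \<exists>b>0. \<exists>\<nu>. (\<forall>p. \<nu> p = 1) & (\<forall>p. \<nu> p > 0) &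
      (\<forall>p. l (\<iota> p) = dg a $ fst p $ fst p * dg b $ snd p $ snd p * \<nu> p)"
     if l: "!!i. l i > (0::real)" and mem: "E ** dmat l ** matrix_inv E \<in> isometries S" for l
    proof -
     have "transpose (dmat l) ** M ** dmat l = M"
      using mem unfolding isometries_def M_def using isometry_conj_iff[OF invE, of "dmat l" S] by simp
     then have "(transpose (dmat l) ** M ** dmat l) $ i $ j = M $ i $ j" for i j by simp
     moreover have "transpose (dmat l) = dmat l" by (simp add: vec_eq_iff transpose_def)
     ultimately have e: "l i * M $ i $ j * l j = M $ i $ j" for i j by (simp add: mult_dmat_nth dmat_mult_nth)
     have e1: "l (\<iota> (1,1)) * l (\<iota> (2,2)) = 1" using e[of "\<iota> (1,1)" "\<iota> (2,2)"] mu by (simp add: gram eps_def)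
     have e2: "l (\<iota> (1,2)) * l (\<iota> (2,1)) = 1" using e[of "\<iota> (1,2)" "\<iota> (2,1)"] mu by (simp add: gram eps_def)
     define x y where "x = l (\<iota> (1,1))" and "y = l (\<iota> (1,2))"
     have nz: "l i ~= 0" for i using l[of i] by simp
     have xy: "x > 0" "y > 0" "l (\<iota> (2,2)) = 1 / x" "l (\<iota> (2,1)) = 1 / y"
      using e1 e2 l nz by (simp_all add: x_def y_def eq_divide_eq mult.commute)
     define a b where "a = sqrt (x * y)" and "b = sqrt (x / y)"
     have ab: "a > 0" "b > 0" using xy by (simp_all add: a_def b_def)
     have "a * b = sqrt (x * x)" unfolding a_def b_def using xy by (simp add: real_sqrt_mult[symmetric])
     then have "x = a * b" using xy by simp
     have "a / b = sqrt (y * y)" unfolding a_def b_def using xy by (simp add: real_sqrt_divide[symmetric])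
     then have "y = a / b" using xy by simp
     have "\<forall>p. l (\<iota> p) = dg a $ fst p $ fst p * dg b $ snd p $ snd p * 1"
      unfolding forall_22 using \<open>x = a * b\<close> \<open>y = a / b\<close> xy ab by (simp add: dg_def flip: x_def y_def)
     then show ?thesis
      by (intro exI[of _ a] conjI ab exI[of _ b] exI[of _ "\<lambda>_. 1"]) auto
    qed
    show "norm_integral d (M * M) m1 m2"
     if sc: "\<forall>p. (l \<circ> \<iota>) p = 1"
      and cp: "!!p q. conj_pair d M (kron2 m1 m2 $ p $ q * l (\<iota> q)) (kron2 m1 m2 $ prod.swap p $ prod.swap q * l (\<iota> (prod.swap q)))"
     for m1 m2 :: "real^2^2" and l and M :: nat
     unfolding norm_integral_def
    proof (intro allI)
     fix i j k p
     have "conj_pair d M (m1 $ i $ k * m2 $ j $ p) (m1 $ j $ p * m2 $ i $ k)"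
      using cp[of "(i, j)" "(k, p)"] sc by (simp add: kron2_def)
     then show "conj_pair d (M * M) (m1 $ i $ k * m2 $ j $ p) (m1 $ j $ p * m2 $ i $ k)"
      by (rule conj_pair_mono) simp
    qed
  qed (use XS WS separated in auto)
qed

section \<open>Quadratic spaces\<close>

definition bil :: "real^'n^'n => real^'n => real^'n => real" where
  "bil S x y = x \<bullet> (S *v y)"

text \<open>Indices below \<open>2 * m\<close> are grouped into hyperbolic pairs; the others are their own partners.\<close>

definition partner :: "nat => nat => nat" where
  "partner m k = (if k < 2 * m then (if even k then k + 1 else k - 1) else k)"

lemma partner_lt: "k < 2 * m ==> partner m k < 2 * m"
  unfolding partner_def by (auto elim!: evenE oddE)

lemma partner_partner [simp]: "partner m (partner m k) = k"
proof (cases "k < 2 * m")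
  case True
  then have "partner m k < 2 * m" by (rule partner_lt)
  then show ?thesis using True by (auto simp: partner_def elim!: evenE oddE)
qed (simp add: partner_def)

lemma partner_less: "2 * m \<le> N ==> k < N ==> partner m k < N"
  using partner_lt[of k m] by (cases "k < 2 * m") (auto simp: partner_def)

lemma partner_0 [simp]: "partner 0 k = k" by (simp add: partner_def)

lemma partner_eq_iff: "k' = partner m k \<longleftrightarrow> k = partner m k'"
  by (metis partner_partner)

text \<open>A basis of part of the space consisting of \<open>m\<close> hyperbolic pairs followed by orthogonal vectors. Taking \<open>m = 0\<close> gives orthogonal bases.\<close>

definition frame :: "real^'n^'n => nat => nat => (nat => real) => (nat => real^'n) => bool" where
  "frame S m N w e \<longleftrightarrow> 2 * m \<le> N & (\<forall>k<N. w k ~= 0) &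
     (\<forall>k<N. \<forall>k'<N. bil S (e k) (e k') = (if k' = partner m k then w k else 0))"

definition indep_family :: "nat => (nat => 'a::real_vector) => bool" where
  "indep_family N e \<longleftrightarrow> (\<forall>r. (\<Sum>k<N. r k *\<^sub>R e k) = 0 --> (\<forall>k<N. r k = 0))"

lemma independent_family:
  fixes e :: "nat => 'a::real_vector"
  assumes "indep_family N e"
  shows "inj_on e {..<N}" "independent (e ` {..<N})"
proof -
  show inj: "inj_on e {..<N}"
  proof (rule inj_onI, rule ccontr)
    fix k k' assume k: "k \<in> {..<N}" "k' \<in> {..<N}" "e k = e k'" "k ~= k'"
    define r where "r i = (if i = k then 1 else if i = k' then -1 else (0::real))" for i
    have "(\<Sum>i<N. r i *\<^sub>R e i) = (\<Sum>i\<in>{k, k'}. r i *\<^sub>R e i)"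
     using k by (intro sum.mono_neutral_right) (auto simp: r_def)
    also have "\<dots> = 0" using k by (simp add: r_def)
    finally have "r k = 0" using assms k unfolding indep_family_def by blast
    then show False by (simp add: r_def)
  qed
  show "independent (e ` {..<N})"
  proof
    assume "dependent (e ` {..<N})"
    then obtain u where u: "\<exists>v\<in>e ` {..<N}. u v ~= 0" "(\<Sum>v\<in>e ` {..<N}. u v *\<^sub>R v) = 0"
     by (auto simp: dependent_finite)
    then have "(\<Sum>k<N. u (e k) *\<^sub>R e k) = 0" using inj by (simp add: sum.reindex)
    then have "\<forall>k<N. u (e k) = 0" using assms[unfolded indep_family_def, rule_format, of "\<lambda>k. u (e k)"] by simp
    then show False using u(1) by auto
  qed
qed

lemma family_span_dim:
  fixes e :: "nat => real^'n"
  assumes "indep_family N e"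
  shows "dim (span (e ` {..<N})) = N" "N \<le> CARD('n)"
proof -
  note i = independent_family[OF assms]
  show "dim (span (e ` {..<N})) = N" using dim_span_eq_card_independent[OF i(2)] card_image[OF i(1)] by simp
  then show "N \<le> CARD('n)" using dim_subset_UNIV_cart[of "span (e ` {..<N})"] by simp
qed

lemma span_family:
  fixes e :: "nat => real^'n"
  assumes "x \<in> span (e ` {..<N})"
  obtains r where "x = (\<Sum>k<N. r k *\<^sub>R e k)"
  using assms
proof (induction arbitrary: thesis rule: span_induct_alt)
  case base
  show ?case by (rule base[of "\<lambda>_. 0"]) simp
next
  case (step c y z)
  obtain k where k: "k < N" "y = e k" using step.hyps(1) by auto
  obtain r where r: "z = (\<Sum>k<N. r k *\<^sub>R e k)" using step.IH by blast
  have "c *\<^sub>R y + z = (\<Sum>i<N. (r i + (if i = k then c else 0)) *\<^sub>R e i)"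
    using k by (simp add: scaleR_add_left sum.distrib r if_distrib[of "\<lambda>x. x *\<^sub>R _"] cong: if_cong)
  then show ?case by (rule step.prems)
qed

locale sym_form =
  fixes S :: "real^'n^'n"
  assumes symmetric: "transpose S = S" and nondegenerate: "det S ~= 0"
begin

abbreviation "B \<equiv> bil S"

lemma B_sym: "B x y = B y x"
  unfolding bil_def by (metis dot_lmul_matrix inner_commute symmetric transpose_matrix_vector)

lemma B_add_right: "B x (y + z) = B x y + B x z"
  and B_add_left: "B (y + z) x = B y x + B z x"
  and B_diff_right: "B x (y - z) = B x y - B x z"
  and B_diff_left: "B (y - z) x = B y x - B z x"
  and B_scale_right: "B x (c *\<^sub>R y) = c * B x y"
  and B_scale_left: "B (c *\<^sub>R y) x = c * B y x"
  by (simp_all add: bil_def matrix_vector_right_distrib matrix_vector_mult_diff_distrib inner_add inner_diff matrix_vector_mult_scaleR)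

lemma B_0 [simp]: "B 0 x = 0" "B x 0 = 0"
  by (simp_all add: bil_def)

lemma B_sum_left: "B (sum f A) x = (\<Sum>i\<in>A. B (f i) x)"
  by (simp add: bil_def inner_sum_left)

lemma B_sum_right: "B x (sum f A) = (\<Sum>i\<in>A. B x (f i))"
proof -
  have "B x (sum f A) = (\<Sum>i\<in>A. B (f i) x)" using B_sym B_sum_left by metis
  also have "\<dots> = (\<Sum>i\<in>A. B x (f i))" by (intro sum.cong refl B_sym)
  finally show ?thesis .
qed

lemmas B_simps = B_add_left B_add_right B_diff_left B_diff_right B_scale_left B_scale_right

lemma B_nondegenerate: "(!!y. B x y = 0) ==> x = 0"
proof -
  assume z: "!!y. B x y = 0"
  have "B (S *v x) x = 0" using z[of "S *v x"] B_sym by metis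
  then have "S *v x = 0" by (simp add: bil_def)
  moreover have "inj ((*v) S)" using nondegenerate by (metis inj_matrix_vector_mult invertible_det_nz)
  ultimately show ?thesis by (metis injD matrix_vector_mult_0_right)
qed

lemma frame_sum:
  assumes fr: "frame S m N w e" and j: "j < N"
  shows "B (\<Sum>k<N. r k *\<^sub>R e k) (e j) = r (partner m j) * w (partner m j)"
proof -
  have p: "partner m j < N" using fr j partner_less by (auto simp: frame_def)
  have "B (\<Sum>k<N. r k *\<^sub>R e k) (e j) = (\<Sum>k<N. r k * (if k = partner m j then w k else 0))"
    unfolding B_sum_left B_scale_left
    by (intro sum.cong refl) (use fr j in \<open>auto simp: frame_def partner_eq_iff[of j]\<close>)
  also have "\<dots> = r (partner m j) * w (partner m j)" using p by (simp add: if_distrib[of "\<lambda>x. _ * x"] cong: if_cong)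
  finally show ?thesis .
qed

lemma frame_independent:
  assumes fr: "frame S m N w e" and z: "(\<Sum>k<N. r k *\<^sub>R e k) = 0" and k: "k < N"
  shows "r k = 0"
proof -
  have p: "partner m k < N" using fr k partner_less by (auto simp: frame_def)
  show ?thesis using frame_sum[OF fr p, of r] z fr k by (simp add: frame_def)
qed

lemma frame_indep: "frame S m N w e ==> indep_family N e"
  unfolding indep_family_def using frame_independent by blast

lemma frame_le: "frame S m N w e ==> N \<le> CARD('n)"
  using family_span_dim(2)[OF frame_indep] .

text \<open>The projection to the orthogonal complement of a frame.\<close>

definition rest :: "nat => nat => (nat => real) => (nat => real^'n) => real^'n => real^'n" where
  "rest m N w e x = x - (\<Sum>k<N. (B x (e (partner m k)) / w k) *\<^sub>R e k)"

lemma rest_orthogonal: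
  assumes fr: "frame S m N w e" and j: "j < N"
  shows "B (rest m N w e x) (e j) = 0" "B (e j) (rest m N w e x) = 0"
proof -
  have p: "partner m j < N" using fr j partner_less by (auto simp: frame_def)
  show "B (rest m N w e x) (e j) = 0"
    unfolding rest_def B_diff_left frame_sum[OF fr j] using fr p by (simp add: frame_def)
  then show "B (e j) (rest m N w e x) = 0" by (simp add: B_sym)
qed

lemma rest_id: "(!!j. j < N ==> B x (e j) = 0) ==> 2 * m \<le> N ==> rest m N w e x = x"
  unfolding rest_def by (simp add: partner_less)

lemma B_rest_right:
  assumes "frame S m N w e" "!!j. j < N ==> B x (e j) = 0"
  shows "B x (rest m N w e y) = B x y"
  unfolding rest_def B_diff_right B_sum_right B_scale_right using assms(2) by simp

lemma rest_nonzero_if_less: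
  assumes fr: "frame S m N w e" and N: "N < CARD('n)"
  shows "\<exists>i. rest m N w e (axis i 1) ~= 0"
proof (rule ccontr)
  assume "\<not> ?thesis"
  then have z: "rest m N w e (axis i 1) = 0" for i by blast
  have "axis i 1 \<in> span (e ` {..<N})" for i
  proof -
    have e: "axis i 1 = (\<Sum>k<N. (B (axis i 1) (e (partner m k)) / w k) *\<^sub>R e k)" using z[of i] by (simp add: rest_def)
    show ?thesis by (subst e, intro span_sum span_scale span_base) auto
  qed
  then have "(\<Sum>i\<in>UNIV. x $ i *\<^sub>R axis i 1) \<in> span (e ` {..<N})" for x :: "real^'n"
    by (intro span_sum span_scale)
  moreover have "(\<Sum>i\<in>UNIV. x $ i *\<^sub>R axis i 1) = x" for x :: "real^'n"
    using basis_expansion[of x] by (simp add: scalar_mult_eq_scaleR)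
  ultimately have "span (e ` {..<N}) = (UNIV :: (real^'n) set)" by (metis UNIV_eq_I)
  then have "dim (span (e ` {..<N})) = CARD('n)" by simp
  then show False using family_span_dim(1)[OF frame_indep[OF fr]] N by simp
qed

lemma frame_append:
  assumes fr: "frame S m N w e" and x: "!!j. j < N ==> B x (e j) = 0" and B: "B x x ~= 0"
  shows "frame S m (Suc N) (w(N := B x x)) (e(N := x))"
  unfolding frame_def
proof (intro conjI allI impI)
  show "2 * m \<le> Suc N" using fr by (simp add: frame_def)
  show "(w(N := B x x)) k ~= 0" if "k < Suc N" for k using fr B that by (auto simp: frame_def less_Suc_eq)
  fix k k' assume k: "k < Suc N" "k' < Suc N"
  have pN: "partner m N = N" using fr by (simp add: partner_def frame_def)
  have pk: "partner m k < N" if "k < N" for k using fr that partner_less by (auto simp: frame_def)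
  show "B ((e(N := x)) k) ((e(N := x)) k') = (if k' = partner m k then (w(N := B x x)) k else 0)"
  proof -
    have old: "B (e k) (e k') = (if k' = partner m k then w k else 0)" if "k < N" "k' < N" for k k'
     using fr that by (simp add: frame_def)
    have new: "B (e k) x = 0" "B x (e k) = 0" if "k < N" for k using x[OF that] B_sym by metis+
    have cases: "k < N \<or> k = N" "k' < N \<or> k' = N" using k by auto
    show ?thesis using cases old[of k k'] new pN pk[of k] by auto
  qed
qed

lemma frame_append_pair:
  assumes fr: "frame S m (2 * m) w e" and x: "!!j. j < 2 * m ==> B x (e j) = 0 & B y (e j) = 0"
    and B: "B x x = 0" "B y y = 0" "B x y = c" "c ~= 0"
  shows "frame S (Suc m) (2 * Suc m) (w(2 * m := c, 2 * m + 1 := c)) (e(2 * m := x, 2 * m + 1 := y))"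
  unfolding frame_def
proof (intro conjI allI impI)
  show "2 * Suc m \<le> 2 * Suc m" by simp
  show "(w(2 * m := c, 2 * m + 1 := c)) k ~= 0" if "k < 2 * Suc m" for k
    using fr B that by (auto simp: frame_def)
  fix k k' assume k: "k < 2 * Suc m" "k' < 2 * Suc m"
  have p: "partner (Suc m) (2 * m) = 2 * m + 1" "partner (Suc m) (2 * m + 1) = 2 * m"
    by (simp_all add: partner_def)
  have pk: "partner (Suc m) k = partner m k" "partner m k < 2 * m" if "k < 2 * m" for k
    using that partner_lt[OF that] by (simp_all add: partner_def)
  have cases: "k < 2 * m \<or> k = 2 * m \<or> k = 2 * m + 1" "k' < 2 * m \<or> k' = 2 * m \<or> k' = 2 * m + 1" using k by auto
  have old: "B (e k) (e k') = (if k' = partner m k then w k else 0)" if "k < 2 * m" "k' < 2 * m" for k k'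
    using fr that by (simp add: frame_def)
  have new: "B (e k) x = 0" "B (e k) y = 0" "B x (e k) = 0" "B y (e k) = 0" if "k < 2 * m" for k
    using x[OF that] B_sym by metis+
  show "B ((e(2 * m := x, 2 * m + 1 := y)) k) ((e(2 * m := x, 2 * m + 1 := y)) k')
     = (if k' = partner (Suc m) k then (w(2 * m := c, 2 * m + 1 := c)) k else 0)"
    using cases p pk[of k] pk[of k'] old[of k k'] new B B_sym[of y x, unfolded B(3)] by auto
qed

text \<open>A subspace on which the form is definite meets one on which it has the opposite weak sign only in zero.\<close>

lemma definite_isotropic_dim:
  assumes P: "subspace P" "!!x. x \<in> P ==> x ~= 0 ==> s * B x x > 0"
    and Q: "subspace Q" "!!x. x \<in> Q ==> s * B x x \<le> 0"
  shows "dim P + dim Q \<le> CARD('n)"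
proof -
  have "P \<inter> Q \<subseteq> {0}" using P Q by fastforce
  then have "dim (P \<inter> Q) = 0" by (metis dim_eq_0)
  moreover have "dim {x + y | x y. x \<in> P & y \<in> Q} + dim (P \<inter> Q) = dim P + dim Q"
    by (rule dim_sums_Int[OF P(1) Q(1)])
  ultimately show ?thesis using dim_subset_UNIV_cart[of "{x + y | x y. x \<in> P & y \<in> Q}"] by linarith
qed

lemma orthogonal_definite_span:
  fixes e :: "nat => real^'n"
  assumes orth: "!!i j. i < N ==> j < N ==> i ~= j ==> B (e i) (e j) = 0" and pos: "!!i. i < N ==> s * B (e i) (e i) > 0"
  shows "dim (span (e ` {..<N})) = N" "x \<in> span (e ` {..<N}) ==> x ~= 0 ==> s * B x x > 0"
proof -
  have eq: "B (\<Sum>k<N. r k *\<^sub>R e k) (\<Sum>k<N. r k *\<^sub>R e k) = (\<Sum>k<N. (r k)\<^sup>2 * B (e k) (e k))" for r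
  proof -
    have "B (\<Sum>k<N. r k *\<^sub>R e k) (\<Sum>k<N. r k *\<^sub>R e k) = (\<Sum>k<N. \<Sum>j<N. r k * (r j * B (e k) (e j)))"
     unfolding B_sum_left unfolding B_sum_right by (simp add: B_scale_left B_scale_right mult.left_commute)
    also have "\<dots> = (\<Sum>k<N. \<Sum>j<N. if j = k then (r k)\<^sup>2 * B (e k) (e k) else 0)"
     by (intro sum.cong refl) (auto simp: orth power2_eq_square)
    finally show ?thesis by simp
  qed
  have nn: "s * ((r k)\<^sup>2 * B (e k) (e k)) \<ge> 0" if "k < N" for r k
    using pos[OF that] by (metis less_imp_le mult.left_commute mult_nonneg_nonneg zero_le_power2)
  have p: "s * B (\<Sum>k<N. r k *\<^sub>R e k) (\<Sum>k<N. r k *\<^sub>R e k) > 0" if "j < N" "r j ~= 0" for r j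
  proof -
    have "s * ((r j)\<^sup>2 * B (e j) (e j)) > 0" using pos[OF that(1)] that(2)
     by (metis mult.left_commute mult_pos_pos zero_less_power2)
    then have "(\<Sum>k<N. s * ((r k)\<^sup>2 * B (e k) (e k))) > 0" using that(1) nn by (intro sum_pos2[of _ j]) auto
    then show ?thesis unfolding eq by (simp add: sum_distrib_left)
  qed
  show "dim (span (e ` {..<N})) = N"
  proof (rule family_span_dim(1), unfold indep_family_def, intro allI impI)
    fix r k assume z: "(\<Sum>k<N. r k *\<^sub>R e k) = 0" "k < N"
    show "r k = 0" using p[OF z(2), of r] unfolding z(1) by auto
  qed
  assume "x \<in> span (e ` {..<N})" "x ~= 0"
  then obtain r where r: "x = (\<Sum>k<N. r k *\<^sub>R e k)" using span_family by blast
  have "\<exists>j<N. r j ~= 0"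
  proof (rule ccontr)
    assume "\<not> ?thesis"
    then have "x = 0" unfolding r by (intro sum.neutral) auto
    with \<open>x ~= 0\<close> show False ..
  qed
  then obtain j where "j < N" "r j ~= 0" by blast
  then show "s * B x x > 0" unfolding r by (rule p)
qed

end

context sym_form
begin

definition normal_frame :: "nat => real => (nat => real^'n) => bool" where
  "normal_frame m \<epsilon> e \<longleftrightarrow> \<bar>\<epsilon>\<bar> = 1 & frame S m CARD('n) (\<lambda>k. if k < 2 * m then 1 else \<epsilon>) e"

lemma normal_frame_definite:
  assumes fr: "normal_frame m \<epsilon> e" and s: "\<bar>s\<bar> = 1"
  obtains P where "subspace P" "dim P = (if s = \<epsilon> then CARD('n) - m else m)" "!!x. x \<in> P ==> x ~= 0 ==> s * B x x > 0"
proof -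
  define n where "n = CARD('n)"
  define L where "L = (if s = \<epsilon> then n - m else m)"
  define f where "f k = (if k < m then e (2 * k) + s *\<^sub>R e (2 * k + 1) else e (k + m))" for k
  have m: "2 * m \<le> n" using fr by (simp add: normal_frame_def frame_def n_def)
  have e: "B (e k) (e k') = (if k' = partner m k then if k < 2 * m then 1 else \<epsilon> else 0)" if "k < n" "k' < n" for k k'
    using fr that by (simp add: normal_frame_def frame_def n_def)
  have ss: "s * s = 1" using s by (metis abs_mult_self_eq mult_1)
  have B: "B (f k) (f k') = (if k ~= k' then 0 else if k < m then 2 * s else \<epsilon>)" if k: "k < n - m" "k' < n - m" for k k'
  proof -
    have ev: "partner m (2 * i) = 2 * i + 1" "partner m (2 * i + 1) = 2 * i" if "i < m" for i
     using that by (simp_all add: partner_def)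
    have big: "partner m (i + m) = i + m" if "i \<ge> m" for i using that by (simp add: partner_def)
    consider "k < m" "k' < m" | "k < m" "k' \<ge> m" | "k \<ge> m" "k' < m" | "k \<ge> m" "k' \<ge> m" by linarith
    then show ?thesis
    proof cases
     case 1
     then have lt: "2 * k < n" "2 * k + 1 < n" "2 * k' < n" "2 * k' + 1 < n" using m by linarith+
     have "2 * k ~= 2 * k' + 1" "2 * k + 1 ~= 2 * k'" "2 * k' ~= 2 * k + 1" by presburger+
     then have E: "B (e (2 * k)) (e (2 * k')) = 0" "B (e (2 * k)) (e (2 * k' + 1)) = (if k = k' then 1 else 0)"
      "B (e (2 * k + 1)) (e (2 * k')) = (if k = k' then 1 else 0)" "B (e (2 * k + 1)) (e (2 * k' + 1)) = 0"
      using e[OF lt(1) lt(3)] e[OF lt(1) lt(4)] e[OF lt(2) lt(3)] e[OF lt(2) lt(4)] 1 ev[OF 1(1)]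
      by (simp_all split: if_splits)
     have "B (f k) (f k') = B (e (2 * k)) (e (2 * k')) + s * B (e (2 * k)) (e (2 * k' + 1))
       + s * B (e (2 * k + 1)) (e (2 * k')) + s * (s * B (e (2 * k + 1)) (e (2 * k' + 1)))"
      using 1 by (simp add: f_def B_simps algebra_simps)
     then show ?thesis unfolding E using 1 by simp
    next
     case 2
     then have lt: "2 * k < n" "2 * k + 1 < n" "k' + m < n" and ne: "k' + m ~= 2 * k" "k' + m ~= 2 * k + 1" using m k by linarith+
     have E: "B (e (2 * k)) (e (k' + m)) = 0" "B (e (2 * k + 1)) (e (k' + m)) = 0"
      using e[OF lt(1) lt(3)] e[OF lt(2) lt(3)] ev[OF 2(1)] ne by simp_all
     have "B (f k) (f k') = B (e (2 * k)) (e (k' + m)) + s * B (e (2 * k + 1)) (e (k' + m))"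
      using 2 by (simp add: f_def B_simps)
     then show ?thesis unfolding E using 2 by simp
    next
     case 3
     then have lt: "2 * k' < n" "2 * k' + 1 < n" "k + m < n" and ne: "k + m ~= 2 * k'" "k + m ~= 2 * k' + 1" using m k by linarith+
     have E: "B (e (k + m)) (e (2 * k')) = 0" "B (e (k + m)) (e (2 * k' + 1)) = 0"
      using e[OF lt(3) lt(1)] e[OF lt(3) lt(2)] big[OF 3(1)] ne by simp_all
     have "B (f k) (f k') = B (e (k + m)) (e (2 * k')) + s * B (e (k + m)) (e (2 * k' + 1))"
      using 3 by (simp add: f_def B_simps)
     then show ?thesis unfolding E using 3 by simp
    next
     case 4
     then have lt: "k + m < n" "k' + m < n" "\<not> k + m < 2 * m" using m k by linarith+
     show ?thesis using e[OF lt(1,2)] big[OF 4(1)] 4 lt(3) by (simp add: f_def)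
    qed
  qed
  have L: "L \<le> n - m" using m by (auto simp: L_def)
  have orth: "B (f i) (f j) = 0" if "i < L" "j < L" "i ~= j" for i j using B[of i j] that L by simp
  have pos: "s * B (f i) (f i) > 0" if "i < L" for i
    using B[of i i] that L ss by (auto simp: L_def split: if_splits)
  show ?thesis
    by (rule that[of "span (f ` {..<L})"])
     (use orthogonal_definite_span[of L f s, OF orth pos] in \<open>auto simp: L_def n_def\<close>)
qed

text \<open>Sylvester's law of inertia for normal frames, obtained by comparing the definite subspace of one frame with the opposite one of the other.\<close>

lemma sylvester:
  assumes "normal_frame m \<epsilon> e" "normal_frame m' \<epsilon>' e'"
  shows "m = m' & (2 * m < CARD('n) --> \<epsilon> = \<epsilon>')"
proof -
  define n where "n = CARD('n)"
  have key: "(if s = \<epsilon> then n - m else m) + (if - s = \<epsilon>' then n - m' else m') \<le> n"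
    if fr: "normal_frame m \<epsilon> e" "normal_frame m' \<epsilon>' e'" and s: "\<bar>s\<bar> = 1" for s m m' \<epsilon> \<epsilon>' e e'
  proof -
    obtain P where P: "subspace P" "dim P = (if s = \<epsilon> then n - m else m)" "!!x. x \<in> P ==> x ~= 0 ==> s * B x x > 0"
     using normal_frame_definite[OF fr(1) s] unfolding n_def by blast
    have s': "\<bar>- s\<bar> = 1" using s by simp
    obtain Q where Q: "subspace Q" "dim Q = (if - s = \<epsilon>' then n - m' else m')" "!!x. x \<in> Q ==> x ~= 0 ==> - s * B x x > 0"
     using normal_frame_definite[OF fr(2) s'] unfolding n_def by blast
    have "s * B x x \<le> 0" if "x \<in> Q" for x using Q(3)[OF that] by (cases "x = 0") auto
    from definite_isotropic_dim[OF P(1,3) Q(1) this] show ?thesis unfolding P(2) Q(2) n_def .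
  qed
  have m: "2 * m \<le> n" "2 * m' \<le> n" "\<bar>\<epsilon>\<bar> = 1" "\<bar>\<epsilon>'\<bar> = 1"
    using assms by (simp_all add: normal_frame_def frame_def n_def)
  show ?thesis
  proof (cases "\<epsilon> = \<epsilon>'")
    case True
    have "\<epsilon> ~= - \<epsilon>" using m(3) by auto
    then show ?thesis using key[OF assms m(3)] key[OF assms(2,1) m(4)] True m by auto
  next
    case False
    then have "\<epsilon>' = - \<epsilon>" using m by auto
    then show ?thesis using key[OF assms m(3)] m n_def by auto
  qed
qed

subsection \<open>Rational bases\<close>

definition ratvec :: "real^'n => bool" where
  "ratvec x \<longleftrightarrow> (\<forall>i. x $ i \<in> \<rat>)"

lemma ratvec_simps:
  "ratvec x ==> ratvec y ==> ratvec (x + y)" "ratvec x ==> ratvec y ==> ratvec (x - y)"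
  "c \<in> \<rat> ==> ratvec x ==> ratvec (c *\<^sub>R x)" "ratvec (axis i 1)"
  by (auto simp: ratvec_def axis_def)

lemma ratvec_sum: "(!!i. i \<in> A ==> ratvec (f i)) ==> ratvec (sum f A)"
  by (auto simp: ratvec_def intro: Rats_sum)

lemma B_rational:
  assumes "rational_matrix S" "ratvec x" "ratvec y"
  shows "B x y \<in> \<rat>"
  using assms unfolding bil_def inner_vec_def matrix_vector_mult_def rational_matrix_def ratvec_def
  by (auto intro!: Rats_sum Rats_mult)

lemma rational_extension:
  assumes S: "rational_matrix S" and fr: "frame S 0 N w e" and e: "!!k. k < N ==> ratvec (e k)" and N: "N < CARD('n)"
  shows "\<exists>x. ratvec x & (\<forall>k<N. B x (e k) = 0) & B x x ~= 0"
proof -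
  have w: "w k \<in> \<rat>" if "k < N" for k
  proof -
    have "w k = B (e k) (e k)" using fr that by (simp add: frame_def)
    then show ?thesis using B_rational[OF S e[OF that] e[OF that]] by simp
  qed
  have rr: "ratvec (rest 0 N w e x)" if "ratvec x" for x
    unfolding rest_def using that w e B_rational[OF S] by (auto intro!: ratvec_simps ratvec_sum Rats_divide)
  obtain i where i: "rest 0 N w e (axis i 1) ~= 0" using rest_nonzero_if_less[OF fr N] by blast
  define y where "y = rest 0 N w e (axis i 1)"
  have yo: "B y (e k) = 0" if "k < N" for k unfolding y_def by (rule rest_orthogonal(1)[OF fr that])
  have "\<exists>j. B y (axis j 1) ~= 0"
  proof (rule ccontr)
    assume "\<not> ?thesis"
    then have "B y (\<Sum>j\<in>UNIV. x $ j *\<^sub>R axis j 1) = 0" for x :: "real^'n" by (simp add: B_sum_right B_scale_right)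
    moreover have "(\<Sum>j\<in>UNIV. x $ j *\<^sub>R axis j 1) = x" for x :: "real^'n"
     using basis_expansion[of x] by (simp add: scalar_mult_eq_scaleR)
    ultimately have "B y x = 0" for x by metis
    then have "y = 0" by (rule B_nondegenerate)
    then show False using i by (simp add: y_def)
  qed
  then obtain j where j: "B y (axis j 1) ~= 0" by blast
  define z where "z = rest 0 N w e (axis j 1)"
  have yz: "B y z ~= 0" unfolding z_def using B_rest_right[OF fr yo] j by simp
  have zo: "B z (e k) = 0" if "k < N" for k unfolding z_def by (rule rest_orthogonal(1)[OF fr that])
  have r: "ratvec y" "ratvec z" "ratvec (y + z)" unfolding y_def z_def by (auto intro!: rr ratvec_simps)
  have "B (y + z) (y + z) = B y y + B z z + 2 * B y z" by (simp add: B_simps B_sym[of z y])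
  then have "B y y ~= 0 \<or> B z z ~= 0 \<or> B (y + z) (y + z) ~= 0" using yz by auto
  moreover have "B (y + z) (e k) = 0" if "k < N" for k using yo zo that by (simp add: B_simps)
  ultimately show ?thesis using yo zo r by blast
qed

lemma rational_completion:
  assumes S: "rational_matrix S" and fr: "frame S 0 N w e" and e: "!!k. k < N ==> ratvec (e k)"
  shows "\<exists>w' e'. frame S 0 CARD('n) w' e' & (\<forall>k<CARD('n). ratvec (e' k)) & (\<forall>k<N. w' k = w k & e' k = e k)"
  using fr e
proof (induction "CARD('n) - N" arbitrary: N w e)
  case 0
  then have "N = CARD('n)" using frame_le[OF 0(2)] by simp
  then show ?case using 0 by auto
next
  case (Suc d)
  have N: "N < CARD('n)" using Suc(2) by simp
  obtain x where x: "ratvec x" "\<forall>k<N. B x (e k) = 0" "B x x ~= 0" using rational_extension[OF S Suc(3,4) N] by blast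
  have fr': "frame S 0 (Suc N) (w(N := B x x)) (e(N := x))" by (rule frame_append[OF Suc(3)]) (use x in auto)
  have r': "ratvec ((e(N := x)) k)" if "k < Suc N" for k using that x Suc(4) by (auto simp: less_Suc_eq)
  have "d = CARD('n) - Suc N" using Suc(2) by simp
  from Suc(1)[OF this fr' r'] obtain w' e' where
    *: "frame S 0 CARD('n) w' e'" "\<forall>k<CARD('n). ratvec (e' k)" "\<forall>k<Suc N. w' k = (w(N := B x x)) k & e' k = (e(N := x)) k" by blast
  have "\<forall>k<N. w' k = w k & e' k = e k" using *(3) by (simp add: less_Suc_eq)
  with *(1,2) show ?case by blast
qed

lemma Rats_sqrt_square:
  assumes "sqrt x \<in> \<rat>" "x > 0"
  obtains s where "s \<in> \<rat>" "s > 0" "x = s * s"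
  using that[of "sqrt x"] assms by simp

text \<open>If the planes spanned by vectors of opposite sign both have square discriminant, a suitable rational combination of the two vectors of equal sign gives a plane whose discriminant is twice a square.\<close>

lemma nonsquare_plane:
  assumes rat: "ratvec p" "ratvec q" "ratvec r" "rational_matrix S"
    and orth: "B p q = 0" "B p r = 0" "B q r = 0" and sg: "B p p > 0" "B q q < 0" "B r r ~= 0"
    and o: "!!x. x \<in> A ==> B p x = 0 & B q x = 0 & B r x = 0"
  shows "\<exists>u v. ratvec u & ratvec v & B u v = 0 & B u u > 0 & B v v < 0 & (\<forall>x\<in>A. B u x = 0 & B v x = 0) & sqrt (- (B u u * B v v)) \<notin> \<rat>"
proof (cases "sqrt (- (B p p * B q q)) \<in> \<rat>")
  case False
  then show ?thesis using rat sg orth o by blast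
next
  case True
  have pq: "- (B p p * B q q) > 0" using sg by (simp add: mult_pos_neg)
  obtain s where s: "s \<in> \<rat>" "s > 0" "- (B p p * B q q) = s * s" using Rats_sqrt_square[OF True pq] by blast
  have irr: "sqrt (2 * (c * c)) \<notin> \<rat>" if "c \<in> \<rat>" "c > 0" for c
  proof
    assume "sqrt (2 * (c * c)) \<in> \<rat>"
    then have "sqrt 2 * c \<in> \<rat>" using that by (simp add: real_sqrt_mult)
    then have "sqrt 2 * c / c \<in> \<rat>" using that by (intro Rats_divide)
    then show False using sqrt_2_irrational that by simp
  qed
  show ?thesis
  proof (cases "B r r > 0")
    case rpos: True
    show ?thesis
    proof (cases "sqrt (- (B r r * B q q)) \<in> \<rat>")
     case False
     then show ?thesis using rat sg rpos orth o B_sym[of q r] by metis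
    next
     case True
     have "- (B r r * B q q) > 0" using sg rpos by (simp add: mult_pos_neg)
     from Rats_sqrt_square[OF True this] obtain t where t: "t \<in> \<rat>" "t > 0" "- (B r r * B q q) = t * t" by blast
     define u where "u = t *\<^sub>R p + s *\<^sub>R r"
     have uu: "B u u = t * t * B p p + s * s * B r r" by (simp add: u_def B_simps orth B_sym[of r p])
     have "- (B u u * B q q) = 2 * ((s * t) * (s * t))"
     proof -
      have "- (B u u * B q q) = t * t * (- (B p p * B q q)) + s * s * (- (B r r * B q q))" unfolding uu by (simp add: algebra_simps)
      then show ?thesis unfolding s(3) t(3) by (simp add: algebra_simps)
     qed
     then have "sqrt (- (B u u * B q q)) \<notin> \<rat>" using irr[of "s * t"] s t by simp
     moreover have "B u u > 0" unfolding uu using s t sg rpos by (intro add_pos_pos mult_pos_pos)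
     moreover have "B u q = 0" by (simp add: u_def B_simps orth B_sym[of r q])
     moreover have "ratvec u" unfolding u_def using rat s t by (intro ratvec_simps)
     moreover have "B u x = 0" if "x \<in> A" for x using o[OF that] by (simp add: u_def B_simps)
     ultimately show ?thesis using rat sg o by blast
    qed
  next
    case rneg: False
    show ?thesis
    proof (cases "sqrt (- (B p p * B r r)) \<in> \<rat>")
     case False
     then show ?thesis using rat sg rneg orth o by (metis linorder_neqE_linordered_idom)
    next
     case True
     have "- (B p p * B r r) > 0" using sg rneg by (simp add: mult_pos_neg)
     from Rats_sqrt_square[OF True this] obtain t where t: "t \<in> \<rat>" "t > 0" "- (B p p * B r r) = t * t" by blast
     define v where "v = t *\<^sub>R q + s *\<^sub>R r"
     have vv: "B v v = t * t * B q q + s * s * B r r" by (simp add: v_def B_simps orth B_sym[of r q])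
     have "- (B p p * B v v) = 2 * ((s * t) * (s * t))"
     proof -
      have "- (B p p * B v v) = t * t * (- (B p p * B q q)) + s * s * (- (B p p * B r r))" unfolding vv by (simp add: algebra_simps)
      then show ?thesis unfolding s(3) t(3) by (simp add: algebra_simps)
     qed
     then have "sqrt (- (B p p * B v v)) \<notin> \<rat>" using irr[of "s * t"] s t by simp
     moreover have "B v v < 0" unfolding vv using s t sg rneg by (intro add_neg_neg mult_pos_neg) auto
     moreover have "B p v = 0" by (simp add: v_def B_simps orth)
     moreover have "ratvec v" unfolding v_def using rat s t by (intro ratvec_simps)
     moreover have "B v x = 0" if "x \<in> A" for x using o[OF that] by (simp add: v_def B_simps)
     ultimately show ?thesis using rat sg o by blast
    qed
  qed
qed

lemma frame0_orth: "frame S 0 N w e ==> k < N ==> k' < N ==> B (e k) (e k') = (if k' = k then w k else 0)"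
  by (simp add: frame_def)

text \<open>The rational isotropic vector provides a rational hyperbolic plane; the assumption on the real rank then leaves vectors of both signs in its complement, and as the dimension is at least five there is room for a second plane with nonsquare discriminant.\<close>

lemma rational_planes:
  assumes S: "rational_matrix S" and n: "CARD('n) \<ge> 5"
    and W: "subspace W" "!!x. x \<in> W ==> B x x = 0" "dim W \<ge> 2"
    and p: "ratvec p" "p ~= 0" "B p p = 0"
  shows "\<exists>w e. frame S 0 4 w e & (\<forall>k<4. ratvec (e k)) & w 0 = 2 & w 1 = -2 & w 2 > 0 & w 3 < 0 & sqrt (- (w 2 * w 3)) \<notin> \<rat>"
proof -
  have "\<exists>j. B p (axis j 1) ~= 0"
  proof (rule ccontr)
    assume "\<not> ?thesis"
    then have "B p (\<Sum>j\<in>UNIV. x $ j *\<^sub>R axis j 1) = 0" for x :: "real^'n" by (simp add: B_sum_right B_scale_right)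
    moreover have "(\<Sum>j\<in>UNIV. x $ j *\<^sub>R axis j 1) = x" for x :: "real^'n"
     using basis_expansion[of x] by (simp add: scalar_mult_eq_scaleR)
    ultimately have "B p x = 0" for x by metis
    then have "p = 0" by (rule B_nondegenerate)
    then show False using p by simp
  qed
  then obtain j where j: "B p (axis j 1) ~= 0" by blast
  define c where "c = B p (axis j 1)"
  define q where "q = (1 / c) *\<^sub>R (axis j 1 - (B (axis j 1) (axis j 1) / (2 * c)) *\<^sub>R p)"
  have c: "c ~= 0" "c \<in> \<rat>" using j p B_rational[OF S] by (auto simp: c_def ratvec_simps)
  have pa: "B p (axis j 1) = c" "B (axis j 1) p = c" by (simp_all add: c_def B_sym)
  have pq: "B p q = 1" "B q p = 1" using c p by (simp_all add: q_def B_simps pa)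
  have qq: "B q q = 0" using c p by (simp add: q_def B_simps pa field_simps)
  have qr: "ratvec q" unfolding q_def using c p B_rational[OF S] by (intro ratvec_simps Rats_divide) (auto simp: ratvec_simps)
  define e0 where "e0 = (\<lambda>k::nat. if k = 0 then p + q else p - q)"
  define w0 where "w0 = (\<lambda>k::nat. if k = 0 then 2 else (-2::real))"
  have fr0: "frame S 0 2 w0 e0"
    unfolding frame_def using p pq qq by (auto simp: e0_def w0_def B_simps less_2_cases_iff)
  have r0: "ratvec (e0 k)" for k using p qr by (simp add: e0_def ratvec_simps)
  obtain w e where we: "frame S 0 CARD('n) w e" "\<forall>k<CARD('n). ratvec (e k)" "\<forall>k<2. w k = w0 k & e k = e0 k"
    using rational_completion[OF S fr0 r0] by blast
  define n where "n = CARD('n)"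
  have n5: "n \<ge> 5" using n by (simp add: n_def)
  note orth = frame0_orth[OF we(1), folded n_def]
  have w01: "w 0 = 2" "w 1 = -2" using we(3) by (simp_all add: w0_def)
  have wn: "w k ~= 0" if "k < n" for k using we(1) that by (simp add: frame_def n_def)
  \<comment> \<open>As the real rank is at least two, the complement of the first hyperbolic plane is indefinite.\<close>
  have no_def: False if g: "!!k. k < n - 1 ==> g k < n" "inj_on g {..<n - 1}" and s: "!!k. k < n - 1 ==> s * w (g k) > 0" for g :: "nat => nat" and s :: real
  proof -
    have o: "B (e (g i)) (e (g j)) = 0" if "i < n - 1" "j < n - 1" "i ~= j" for i j
     using orth[OF g(1)[OF that(1)] g(1)[OF that(2)]] g(2) that by (auto simp: inj_on_def)
    have pos: "s * B (e (g i)) (e (g i)) > 0" if "i < n - 1" for i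
     using orth[OF g(1)[OF that] g(1)[OF that]] s[OF that] by simp
    note d = orthogonal_definite_span[of "n - 1" "\<lambda>k. e (g k)" s, OF o pos]
    have "n - 1 + dim W \<le> n"
     using definite_isotropic_dim[of "span ((\<lambda>k. e (g k)) ` {..<n - 1})" s W, OF _ d(2) W(1)] W(2) d(1) by (simp add: n_def)
    then show False using W(3) n5 by linarith
  qed
  have "\<exists>i. 2 \<le> i & i < n & w i > 0"
  proof (rule ccontr)
    assume a: "\<not> ?thesis"
    show False
    proof (rule no_def[of "\<lambda>k. k + 1" "-1"])
     fix k assume k: "k < n - 1"
     show "- 1 * w (k + 1) > 0"
     proof (cases "k = 0")
      case True then show ?thesis using w01 by simp
     next
      case False
      then have "2 \<le> k + 1" "k + 1 < n" using k by auto
      then show ?thesis using a wn[of "k + 1"] by force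
     qed
    qed auto
  qed
  then obtain i where i: "2 \<le> i" "i < n" "w i > 0" by blast
  have "\<exists>i. 2 \<le> i & i < n & w i < 0"
  proof (rule ccontr)
    assume a: "\<not> ?thesis"
    show False
    proof (rule no_def[of "\<lambda>k. if k = 0 then 0 else k + 1" "1"])
     fix k assume k: "k < n - 1"
     show "1 * w (if k = 0 then 0 else k + 1) > 0"
     proof (cases "k = 0")
      case True then show ?thesis using w01 by simp
     next
      case False
      then have "2 \<le> k + 1" "k + 1 < n" using k by auto
      then show ?thesis using a wn[of "k + 1"] False by force
     qed
    qed (auto simp: inj_on_def)
  qed
  then obtain j where j: "2 \<le> j" "j < n" "w j < 0" by blast
  have ij: "i ~= j" using i j by auto
  have "\<exists>k. 2 \<le> k & k < n & k ~= i & k ~= j"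
  proof -
    have "\<not> {2, 3, 4} \<subseteq> {i, j}"
    proof
     assume "{2, 3, 4} \<subseteq> {i, j}"
     then have "card {2, 3, 4 :: nat} \<le> card {i, j}" by (intro card_mono) auto
     then show False using card_insert_le_m1[of 2 "{j}" i] by (auto simp: card_insert_if split: if_splits)
    qed
    then obtain k where "k \<in> {2, 3, 4}" "k ~= i" "k ~= j" by blast
    then show ?thesis using n5 by (intro exI[of _ k]) auto
  qed
  then obtain k where k: "2 \<le> k" "k < n" "k ~= i" "k ~= j" by blast
  have "\<exists>u v. ratvec u & ratvec v & B u v = 0 & B u u > 0 & B v v < 0 & (\<forall>x\<in>{e 0, e 1}. B u x = 0 & B v x = 0) & sqrt (- (B u u * B v v)) \<notin> \<rat>"
  proof (rule nonsquare_plane[of "e i" "e j" "e k"])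
    show "ratvec (e i)" "ratvec (e j)" "ratvec (e k)" using we(2) i j k by (simp_all add: n_def)
    show "B (e i) (e j) = 0" "B (e i) (e k) = 0" "B (e j) (e k) = 0" "B (e i) (e i) > 0" "B (e j) (e j) < 0" "B (e k) (e k) ~= 0"
     using orth i j k ij wn by auto
    fix x assume "x \<in> {e 0, e 1}"
    then show "B (e i) x = 0 & B (e j) x = 0 & B (e k) x = 0" using orth i j k n5 by auto
  qed (rule S)
  then obtain u v where uv: "ratvec u" "ratvec v" "B u v = 0" "B u u > 0" "B v v < 0" "B u (e 0) = 0" "B u (e 1) = 0" "B v (e 0) = 0" "B v (e 1) = 0" "sqrt (- (B u u * B v v)) \<notin> \<rat>"
    by auto
  have fr2: "frame S 0 2 w e" using we(1) n5 by (simp add: frame_def n_def)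
  have fr3: "frame S 0 (Suc 2) (w(2 := B u u)) (e(2 := u))"
    by (rule frame_append[OF fr2]) (use uv in \<open>auto simp: less_2_cases_iff\<close>)
  have fr4: "frame S 0 (Suc (Suc 2)) (w(2 := B u u, Suc 2 := B v v)) (e(2 := u, Suc 2 := v))"
    by (rule frame_append[OF fr3]) (use uv B_sym[of v u] in \<open>auto simp: less_Suc_eq numeral_2_eq_2\<close>)
  have e4: "Suc (Suc 2) = 4" "Suc 2 = 3" by simp_all
  have r: "ratvec ((e(2 := u, 3 := v)) k)" if "k < 4" for k
    using that uv we(2) n5 by (simp add: n_def)
  show ?thesis
    by (rule exI[of _ "w(2 := B u u, 3 := B v v)"], rule exI[of _ "e(2 := u, 3 := v)"])
     (use fr4[unfolded e4] r w01 uv in simp)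
qed

text \<open>The first \<open>m\<close> pairs of weights have opposite signs, so each spans a real hyperbolic plane.\<close>

definition alternating :: "nat => (nat => real) => bool" where
  "alternating m w \<longleftrightarrow> (\<forall>i<m. w (2 * i) > 0 & w (2 * i + 1) < 0)"

text \<open>A rational orthogonal basis adapted to the real splitting: its first plane is hyperbolic over the rationals and its second one only over a real quadratic field. The discriminant of these four vectors determines the field.\<close>

theorem rational_basis:
  assumes S: "rational_matrix S" and n: "CARD('n) \<ge> 5"
    and W: "subspace W" "!!x. x \<in> W ==> B x x = 0" "dim W \<ge> 2"
    and p: "ratvec p" "p ~= 0" "B p p = 0"
  shows "\<exists>m \<epsilon> w e. 2 \<le> m & 2 * m \<le> CARD('n) & \<bar>\<epsilon>\<bar> = 1 & frame S 0 CARD('n) w e & (\<forall>k<CARD('n). ratvec (e k)) &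
    alternating m w & (\<forall>k<CARD('n). 2 * m \<le> k --> \<epsilon> * w k > 0) &
    w 0 = 2 & w 1 = -2 & sqrt (- (w 2 * w 3)) \<notin> \<rat>"
proof -
  define good where "good m w e \<longleftrightarrow> 2 \<le> m & frame S 0 (2 * m) w e & (\<forall>k<2 * m. ratvec (e k)) & alternating m w &
    w 0 = 2 & w 1 = -2 & sqrt (- (w 2 * w 3)) \<notin> \<rat>" for m w e
  have bound: "m \<le> CARD('n)" if "good m w e" for m w e using that frame_le[of 0 "2 * m" w e] by (auto simp: good_def)
  obtain w4 e4 where "frame S 0 4 w4 e4 & (\<forall>k<4. ratvec (e4 k)) & w4 0 = 2 & w4 1 = -2 & w4 2 > 0 & w4 3 < 0 & sqrt (- (w4 2 * w4 3)) \<notin> \<rat>"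
    using rational_planes[OF S n W p] by blast
  then have "good 2 w4 e4" unfolding good_def alternating_def by (auto simp: less_2_cases_iff)
  then have ex: "\<exists>w e. good 2 w e" by blast
  define m where "m = (GREATEST m. \<exists>w e. good m w e)"
  have "\<exists>w e. good m w e" unfolding m_def by (rule GreatestI_nat[of _ 2 "CARD('n)"]) (use ex bound in blast)+
  then obtain w0 e0 where g: "good m w0 e0" by blast
  have max: "k \<le> m" if "good k w e" for k w e
    unfolding m_def by (rule Greatest_le_nat[of _ _ "CARD('n)"]) (use that bound in blast)+
  obtain w e where we: "frame S 0 CARD('n) w e" "\<forall>k<CARD('n). ratvec (e k)" "\<forall>k<2 * m. w k = w0 k & e k = e0 k"
    using rational_completion[OF S, of "2 * m" w0 e0] g unfolding good_def by blast
  have m2: "2 \<le> m" using g by (simp add: good_def)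
  have mn: "2 * m \<le> CARD('n)" using frame_le[of 0 "2 * m" w0 e0] g by (simp add: good_def)
  have alt: "alternating m w" using g we(3) by (simp add: good_def alternating_def)
  have w03: "w 0 = 2" "w 1 = -2" "sqrt (- (w 2 * w 3)) \<notin> \<rat>" using g we(3) m2 by (simp_all add: good_def)
  note orth = frame0_orth[OF we(1)]
  have same: "\<not> (w i > 0 & w j < 0)" if ij: "2 * m \<le> i" "i < CARD('n)" "2 * m \<le> j" "j < CARD('n)" for i j
  proof
    assume s: "w i > 0 & w j < 0"
    then have ne: "i ~= j" by auto
    have fr: "frame S 0 (2 * m) w e" using we(1) mn by (simp add: frame_def)
    have fr1: "frame S 0 (Suc (2 * m)) (w(2 * m := B (e i) (e i))) (e(2 * m := e i))"
     by (rule frame_append[OF fr]) (use orth ij s in auto)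
    have fr2: "frame S 0 (Suc (Suc (2 * m))) (w(2 * m := B (e i) (e i), Suc (2 * m) := B (e j) (e j))) (e(2 * m := e i, Suc (2 * m) := e j))"
     by (rule frame_append[OF fr1]) (use orth ij s ne in \<open>auto simp: less_Suc_eq\<close>)
    have "good (Suc m) (w(2 * m := B (e i) (e i), Suc (2 * m) := B (e j) (e j))) (e(2 * m := e i, Suc (2 * m) := e j))"
     unfolding good_def
    proof (intro conjI)
     show "frame S 0 (2 * Suc m) (w(2 * m := B (e i) (e i), Suc (2 * m) := B (e j) (e j))) (e(2 * m := e i, Suc (2 * m) := e j))"
      using fr2 by simp
     show "\<forall>k<2 * Suc m. ratvec ((e(2 * m := e i, Suc (2 * m) := e j)) k)" using we(2) ij mn by auto
     show "alternating (Suc m) (w(2 * m := B (e i) (e i), Suc (2 * m) := B (e j) (e j)))"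
      unfolding alternating_def
     proof (intro allI impI)
      fix l assume "l < Suc m"
      then have "l < m \<or> l = m" by auto
      then show "(w(2 * m := B (e i) (e i), Suc (2 * m) := B (e j) (e j))) (2 * l) > 0 &
        (w(2 * m := B (e i) (e i), Suc (2 * m) := B (e j) (e j))) (2 * l + 1) < 0"
      proof
       assume l: "l < m"
       then have "2 * l ~= 2 * m" "2 * l ~= Suc (2 * m)" "2 * l + 1 ~= 2 * m" "2 * l + 1 ~= Suc (2 * m)" by presburger+
       then show ?thesis using alt l by (simp add: alternating_def)
      next
       assume l: "l = m"
       show ?thesis using orth[OF ij(2,2)] orth[OF ij(4,4)] s by (simp add: l)
      qed
     qed
    qed (use m2 w03 in auto)
    from max[OF this] show False by simp
  qed
  define \<epsilon> :: real where "\<epsilon> = (if \<exists>i<CARD('n). 2 * m \<le> i & w i > 0 then 1 else -1)"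
  have wn: "w k ~= 0" if "k < CARD('n)" for k using we(1) that by (simp add: frame_def)
  have "\<epsilon> * w k > 0" if "k < CARD('n)" "2 * m \<le> k" for k
  proof (cases "\<exists>i<CARD('n). 2 * m \<le> i & w i > 0")
    case True
    then obtain i where i: "i < CARD('n)" "2 * m \<le> i" "w i > 0" by blast
    have "\<not> w k < 0" using same[OF i(2,1) that(2,1)] i(3) by simp
    then show ?thesis using True wn[OF that(1)] by (simp add: \<epsilon>_def)
  next
    case False
    then have "\<not> w k > 0" using that by blast
    then show ?thesis using False wn[OF that(1)] by (simp add: \<epsilon>_def)
  qed
  moreover have "\<bar>\<epsilon>\<bar> = 1" by (simp add: \<epsilon>_def)
  ultimately show ?thesis using m2 mn we alt w03 by blast
qed

end

definition quadratic_conj :: "nat => real => real => bool" where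
  "quadratic_conj d z z' \<longleftrightarrow> (\<exists>x\<in>\<rat>. \<exists>y\<in>\<rat>. z = x + y * sqrt (real d) & z' = x - y * sqrt (real d))"

lemma quadratic_conj_add: "quadratic_conj d z z' ==> quadratic_conj d w w' ==> quadratic_conj d (z + w) (z' + w')"
  unfolding quadratic_conj_def
proof (elim bexE conjE)
  fix x y a b assume "x \<in> \<rat>" "y \<in> \<rat>" "a \<in> \<rat>" "b \<in> \<rat>" "z = x + y * sqrt (real d)" "z' = x - y * sqrt (real d)"
    "w = a + b * sqrt (real d)" "w' = a - b * sqrt (real d)"
  then show "\<exists>x\<in>\<rat>. \<exists>y\<in>\<rat>. z + w = x + y * sqrt (real d) & z' + w' = x - y * sqrt (real d)"
    by (intro bexI[of _ "x + a"] bexI[of _ "y + b"]) (auto simp: algebra_simps)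
qed

lemma quadratic_conj_scale: "c \<in> \<rat> ==> quadratic_conj d z z' ==> quadratic_conj d (c * z) (c * z')"
  unfolding quadratic_conj_def
proof (elim bexE conjE)
  fix x y assume "c \<in> \<rat>" "x \<in> \<rat>" "y \<in> \<rat>" "z = x + y * sqrt (real d)" "z' = x - y * sqrt (real d)"
  then show "\<exists>x\<in>\<rat>. \<exists>y\<in>\<rat>. c * z = x + y * sqrt (real d) & c * z' = x - y * sqrt (real d)"
    by (intro bexI[of _ "c * x"] bexI[of _ "c * y"]) (auto simp: algebra_simps)
qed

lemma quadratic_conj_rat: "x \<in> \<rat> ==> quadratic_conj d x x"
  unfolding quadratic_conj_def by (intro bexI[of _ x] bexI[of _ 0]) auto

lemma quadratic_conj_sum: "(!!i. i \<in> A ==> quadratic_conj d (f i) (g i)) ==> quadratic_conj d (sum f A) (sum g A)"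
proof (induction A rule: infinite_finite_induct)
  case (insert x F)
  then show ?case by (auto intro!: quadratic_conj_add)
qed (auto intro: quadratic_conj_rat)

lemma quadratic_conj_denominator:
  assumes "finite I" "!!i. i \<in> I ==> quadratic_conj d (f i) (g i)"
  shows "\<exists>N>0. \<forall>i\<in>I. conj_pair d N (f i) (g i)"
  using assms
proof (induction I)
  case empty
  then show ?case by (intro exI[of _ 1]) simp
next
  case (insert i F)
  then obtain N where N: "N > 0" "\<forall>i\<in>F. conj_pair d N (f i) (g i)" by auto
  obtain x y where xy: "x \<in> \<rat>" "y \<in> \<rat>" "f i = x + y * sqrt (real d)" "g i = x - y * sqrt (real d)"
    using insert(4)[of i] unfolding quadratic_conj_def by blast
  obtain M where M: "M > 0" "\<forall>z\<in>{x, y}. real M * z \<in> \<int>" using common_denominator[of "{x, y}" "\<lambda>z. z"] xy by auto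
  obtain a b where ab: "real M * x = of_int a" "real M * y = of_int b" using M by (auto elim!: Ints_cases)
  have "conj_pair d M (f i) (g i)"
    unfolding conj_pair_def xy by (intro exI[of _ a] exI[of _ b]) (simp add: algebra_simps flip: ab)
  then have "\<forall>j\<in>insert i F. conj_pair d (N * M) (f j) (g j)"
    using N conj_pair_mono by (metis dvd_triv_left dvd_triv_right insert_iff)
  then show ?case using N M by (intro exI[of _ "N * M"]) simp
qed

lemma sqrt_rational_nat:
  assumes "x \<in> \<rat>" "x > 0"
  obtains d :: nat and r where "r \<in> \<rat>" "r > 0" "sqrt x = r * sqrt (real d)"
proof -
  obtain a b where ab: "b > 0" "x = of_int a / of_int b" using assms(1) by (rule Rats_cases') auto
  have a: "a > 0" using assms(2) ab by (simp add: zero_less_divide_iff)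
  have "real (nat (a * b)) = of_int a * of_int b" using a ab by simp
  then have "x = (1 / of_int b)\<^sup>2 * real (nat (a * b))" using ab by (simp add: power2_eq_square)
  then have "sqrt x = (1 / of_int b) * sqrt (real (nat (a * b)))" using ab(1) by (simp add: real_sqrt_mult)
  then show ?thesis using that[of "1 / of_int b" "nat (a * b)"] ab(1) by simp
qed

definition cols :: "('n => nat) => (nat => real^'n) => real^'n^'n" where
  "cols ix f = (\<chi> a i. f (ix i) $ a)"

lemma mult_cols: "(Z ** cols ix f) $ a $ i = (Z *v f (ix i)) $ a"
  by (simp add: matrix_matrix_mult_def matrix_vector_mult_def cols_def)

lemma corner_in_range: "pos ` (UNIV :: (2 \<times> 2) set) = {..<4::nat}" if "pos = (\<lambda>p. if p = (1, 1) then 0 else if p = (2, 2) then 1 else if p = (1, 2) then 2 else (3::nat))"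
proof -
  have "(UNIV :: (2 \<times> 2) set) = {(1, 1), (1, 2), (2, 1), (2, 2)}"
    using forall_22[of "\<lambda>p. p \<in> {(1, 1), (1, 2), (2, 1), (2, 2)}"] by blast
  then have "pos ` (UNIV :: (2 \<times> 2) set) = pos ` {(1, 1), (1, 2), (2, 1), (2, 2)}" by (rule arg_cong)
  also have "\<dots> = {0, 2, 3, 1}" unfolding that by (simp add: insert_commute)
  also have "\<dots> = {..<4::nat}" by auto
  finally show ?thesis .
qed

context sym_form
begin

lemma gram_cols: "(transpose (cols ix f) ** S ** cols ix f) $ i $ j = B (f (ix i)) (f (ix j))"
  unfolding triple_product_nth bil_def inner_vec_def matrix_vector_mult_def cols_def
  by (simp add: sum_distrib_left mult_ac)

lemma cols_inverse:
  assumes ix: "bij_betw ix UNIV {..<CARD('n)}" and fr: "frame S m CARD('n) w f"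
  shows "invertible (cols ix f)"
    and "matrix_inv (cols ix f) $ i $ a = (S *v f (partner m (ix i))) $ a / w (ix i)"
proof -
  define F where "F = (\<chi> i a. (S *v f (partner m (ix i))) $ a / w (ix i))"
  have lt: "ix i < CARD('n)" for i using ix by (auto simp: bij_betw_def)
  have inj: "ix i = ix j \<longleftrightarrow> i = j" for i j using ix by (auto simp: bij_betw_def inj_eq)
  have m: "2 * m \<le> CARD('n)" using fr by (simp add: frame_def)
  have "(F ** cols ix f) $ i $ j = mat 1 $ i $ j" for i j
  proof -
    have "(F ** cols ix f) $ i $ j = B (f (ix j)) (f (partner m (ix i))) / w (ix i)"
     by (simp add: matrix_matrix_mult_def F_def cols_def bil_def inner_vec_def sum_divide_distrib mult_ac)
    also have "\<dots> = (if i = j then 1 else 0)"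
    proof -
     have "B (f (ix j)) (f (partner m (ix i))) = (if partner m (ix i) = partner m (ix j) then w (ix j) else 0)"
      using fr lt[of j] partner_less[OF m lt[of i]] by (simp add: frame_def)
     moreover have "partner m (ix i) = partner m (ix j) \<longleftrightarrow> i = j" using inj by (metis partner_partner)
     moreover have "w (ix i) ~= 0" using fr lt[of i] by (simp add: frame_def)
     ultimately show ?thesis by (cases "i = j") simp_all
    qed
    finally show ?thesis by (simp add: mat_def)
  qed
  then have F: "F ** cols ix f = mat 1" by (simp add: vec_eq_iff)
  then have F': "cols ix f ** F = mat 1" by (simp add: matrix_left_right_inverse)
  show "invertible (cols ix f)" unfolding invertible_def using F F' by blast
  show "matrix_inv (cols ix f) $ i $ a = (S *v f (partner m (ix i))) $ a / w (ix i)"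
    using matrix_inv_unique[OF F'] by (simp add: F_def)
qed

text \<open>Splitting each rational plane of the basis into real isotropic lines gives a torus adapted to the four-dimensional block of nonsquare discriminant. The scalars \<open>c\<close> normalize the eigenvectors.\<close>

theorem orthogonal_four_boundary:
  assumes S: "rational_matrix S" and n: "CARD('n) \<ge> 5"
    and W: "subspace W" "!!x. x \<in> W ==> B x x = 0" "dim W \<ge> 2"
    and p: "ratvec p" "p ~= 0" "B p p = 0"
    and ix: "bij_betw ix UNIV {..<CARD('n)}"
  shows "\<exists>m \<epsilon> c e. 2 \<le> m & normal_frame m \<epsilon> e & (\<forall>k. c k ~= 0) &
     four_boundary_cosets (isometries S) (pos_torus (isometries S) (cols ix (\<lambda>k. c k *\<^sub>R e k))) (integer_points (isometries S))"
proof -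
  obtain m \<epsilon> w f where m2: "2 \<le> m" and mn: "2 * m \<le> CARD('n)" and eps: "\<bar>\<epsilon>\<bar> = 1" and fr: "frame S 0 CARD('n) w f"
    and frat: "\<forall>k<CARD('n). ratvec (f k)" and alt: "alternating m w" and sgn: "\<forall>k<CARD('n). 2 * m \<le> k --> \<epsilon> * w k > 0"
    and w01: "w 0 = 2" "w 1 = -2" and irr: "sqrt (- (w 2 * w 3)) \<notin> \<rat>"
    using rational_basis[OF S n W p] by blast
  define n where "n = CARD('n)"
  note mn = mn[folded n_def] and sgn = sgn[folded n_def] and frat = frat[folded n_def] and ix = ix[folded n_def]
  have n5: "n \<ge> 5" using n by (simp add: n_def)
  note orth = frame0_orth[OF fr, folded n_def]
  have alt1: "w (2 * i) > 0" "w (2 * i + 1) < 0" if "i < m" for i using alt that by (simp_all add: alternating_def)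
  have wn: "w k ~= 0" if "k < n" for k using fr that by (simp add: frame_def n_def)
  have wrat: "w k \<in> \<rat>" if "k < n" for k
    using orth[OF that that] B_rational[OF S] frat that by (metis (full_types))
  define \<theta> where "\<theta> i = sqrt (- (w (2 * i) / w (2 * i + 1)))" for i
  define \<rho> where "\<rho> i = (if i = 0 then - w 2 / w 0 else 1)" for i :: nat
  have th: "\<theta> i > 0" "\<theta> i * \<theta> i * w (2 * i + 1) = - w (2 * i)" if "i < m" for i
  proof -
    have q: "- (w (2 * i) / w (2 * i + 1)) > 0" using alt1[OF that] by (simp add: divide_pos_neg)
    then show "\<theta> i > 0" by (simp add: \<theta>_def)
    have "\<theta> i * \<theta> i = - (w (2 * i) / w (2 * i + 1))" using q by (simp only: \<theta>_def real_sqrt_mult_self abs_of_pos)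
    then show "\<theta> i * \<theta> i * w (2 * i + 1) = - w (2 * i)" using alt1[OF that] by simp
  qed
  have w2: "w 2 > 0" "w 3 < 0" using alt1[of 1] m2 by simp_all
  have rho: "\<rho> i ~= 0" for i using w2 w01 by (simp add: \<rho>_def)
  define P where "P i s = f (2 * i) + (s * \<theta> i) *\<^sub>R f (2 * i + 1)" for i s
  have lt: "2 * i < n" "2 * i + 1 < n" if "i < m" for i using that mn by linarith+
  have Bf: "B (P i s) (f k) = (if k = 2 * i then w (2 * i) else if k = 2 * i + 1 then s * \<theta> i * w (2 * i + 1) else 0)"
    if "i < m" "k < n" for i s k
    using orth[OF lt(1)[OF that(1)] that(2)] orth[OF lt(2)[OF that(1)] that(2)] by (simp add: P_def B_simps)
  have BP: "B (P i s) (P j t) = (if i = j then w (2 * i) * (1 - s * t) else 0)" if "i < m" "j < m" for i j s t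
  proof -
    have ne: "2 * j ~= 2 * i + 1" "2 * j + 1 ~= 2 * i" by presburger+
    have "B (P i s) (P j t) = B (P i s) (f (2 * j)) + t * \<theta> j * B (P i s) (f (2 * j + 1))" by (simp add: P_def[of j] B_simps)
    also have "\<dots> = (if i = j then w (2 * i) + s * t * (\<theta> i * \<theta> i * w (2 * i + 1)) else 0)"
     using Bf[OF that(1) lt(1)[OF that(2)], of s] Bf[OF that(1) lt(2)[OF that(2)], of s] ne by (auto simp: algebra_simps)
    finally show ?thesis unfolding th(2)[OF that(1)] by (simp add: algebra_simps)
  qed
  define v where "v k = (if k < 2 * m then if even k then P (k div 2) 1 else \<rho> (k div 2) *\<^sub>R P (k div 2) (-1) else f k)" for k
  define wt where "wt k = (if k < 2 * m then 2 * \<rho> (k div 2) * w (2 * (k div 2)) else w k)" for k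
  have v_even: "v (2 * i) = P i 1" "wt (2 * i) = 2 * \<rho> i * w (2 * i)" and v_odd: "v (2 * i + 1) = \<rho> i *\<^sub>R P i (-1)" "wt (2 * i + 1) = 2 * \<rho> i * w (2 * i)"
    and part: "partner m (2 * i) = 2 * i + 1" "partner m (2 * i + 1) = 2 * i" if "i < m" for i
    using that by (simp_all add: v_def wt_def partner_def)
  have v_big: "v k = f k" "wt k = w k" "partner m k = k" if "k \<ge> 2 * m" for k using that by (simp_all add: v_def wt_def partner_def)
  have pair: "(\<exists>i<m. k = 2 * i) \<or> (\<exists>i<m. k = 2 * i + 1) \<or> k \<ge> 2 * m" for k
  proof (cases "k < 2 * m")
    case True
    show ?thesis
    proof (cases "even k")
     case True then show ?thesis using \<open>k < 2 * m\<close> by (auto elim!: evenE)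
    next
     case False then show ?thesis using \<open>k < 2 * m\<close> by (auto elim!: oddE)
    qed
  qed simp
  have Bvf: "B (P i s) (v k) = 0" if "i < m" "k \<ge> 2 * m" "k < n" for i s k
  proof -
    have "k ~= 2 * i" "k ~= 2 * i + 1" using that by linarith+
    then show ?thesis using Bf[OF that(1,3), of s] that by (simp add: v_big)
  qed
  have frv: "frame S m n wt v"
    unfolding frame_def
  proof (intro conjI allI impI)
    show "2 * m \<le> n" by (rule mn)
    show "wt k ~= 0" if "k < n" for k
     using pair[of k] v_even(2) v_odd(2) v_big(2)[of k] rho alt1 wn[OF that] by (metis mult_eq_0_iff less_irrefl zero_neq_numeral)
    fix k k' assume k: "k < n" "k' < n"
    have ne: "2 * i ~= 2 * j + 1" "2 * i + 1 ~= 2 * j" for i j :: nat by presburger+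
    consider (ee) i j where "i < m" "j < m" "k = 2 * i" "k' = 2 * j" | (eo) i j where "i < m" "j < m" "k = 2 * i" "k' = 2 * j + 1"
     | (oe) i j where "i < m" "j < m" "k = 2 * i + 1" "k' = 2 * j" | (oo) i j where "i < m" "j < m" "k = 2 * i + 1" "k' = 2 * j + 1"
     | (eb) i where "i < m" "k = 2 * i" "k' \<ge> 2 * m" | (ob) i where "i < m" "k = 2 * i + 1" "k' \<ge> 2 * m"
     | (be) j where "k \<ge> 2 * m" "j < m" "k' = 2 * j" | (bo) j where "k \<ge> 2 * m" "j < m" "k' = 2 * j + 1"
     | (bb) "k \<ge> 2 * m" "k' \<ge> 2 * m"
     using pair[of k] pair[of k'] by metis
    then show "B (v k) (v k') = (if k' = partner m k then wt k else 0)"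
    proof cases
     case ee
     then show ?thesis using ne by (simp add: v_even v_odd part BP)
    next
     case eo
     then show ?thesis using ne by (simp add: v_even(1,2)[OF eo(1)] v_odd(1)[OF eo(2), simplified] part(1)[OF eo(1), simplified] BP B_simps)
    next
     case oe
     then show ?thesis using ne by (simp add: v_even(1,2)[OF oe(2)] v_odd(1)[OF oe(1), simplified] v_odd(2)[OF oe(1), simplified] part(2)[OF oe(1), simplified] BP B_simps)
    next
     case oo
     then show ?thesis using ne[of j i]
      by (simp add: v_odd(1)[OF oo(1), simplified] v_odd(1)[OF oo(2), simplified] part(2)[OF oo(1), simplified] BP B_simps)
    next
     case eb
     then have "k' ~= 2 * i + 1" by linarith
     then show ?thesis using eb Bvf[OF eb(1,3) k(2)] by (simp add: v_even part)
    next
     case ob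
     then have "k' ~= 2 * i" by linarith
     then show ?thesis using ob Bvf[OF ob(1,3) k(2)] by (simp add: v_odd(1)[OF ob(1), simplified] part(2)[OF ob(1), simplified] B_simps)
    next
     case be
     then have "k' ~= k" by linarith
     then show ?thesis using be Bvf[OF be(2,1) k(1)] by (simp add: v_even v_big(3) B_sym[of "v k"])
    next
     case bo
     then have "k' ~= k" by linarith
     then show ?thesis using bo Bvf[OF bo(2,1) k(1)] by (simp add: v_odd(1)[OF bo(2), simplified] v_big(3) B_simps B_sym[of "v k"])
    next
     case bb
     then show ?thesis using orth[OF k] by (simp add: v_big)
    qed
  qed
  \<comment> \<open>Sums and differences of the two vectors of a real hyperbolic plane are isotropic.\<close>
  define c where "c k = (if k < 2 * m then if even k then 1 else wt k else sqrt \<bar>w k\<bar>)" for k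
  have wt0: "wt k ~= 0" if "k < n" for k using frv that by (simp add: frame_def)
  define c' where "c' k = (if k < n then c k else 1)" for k
  have c0: "c' k ~= 0" for k using wt0[of k] wn[of k] by (simp add: c_def c'_def)
  define e where "e k = (1 / c' k) *\<^sub>R v k" for k
  have ve: "c' k *\<^sub>R e k = v k" for k using c0 by (simp add: e_def)
  have nf: "normal_frame m \<epsilon> e"
    unfolding normal_frame_def frame_def n_def[symmetric]
  proof (intro conjI allI impI)
    show "\<bar>\<epsilon>\<bar> = 1" "2 * m \<le> n" by fact+
    show "(if k < 2 * m then 1 else \<epsilon>) ~= 0" for k using eps by auto
    fix k k' assume k: "k < n" "k' < n"
    have "B (e k) (e k') = B (v k) (v k') / (c k * c k')" using k by (simp add: e_def B_simps c'_def)
    also have "\<dots> = (if k' = partner m k then wt k / (c k * c (partner m k)) else 0)" using frv k by (simp add: frame_def)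
    also have "\<dots> = (if k' = partner m k then if k < 2 * m then 1 else \<epsilon> else 0)"
    proof -
     have "wt k / (c k * c (partner m k)) = (if k < 2 * m then 1 else \<epsilon>)"
      using pair[of k]
     proof (elim disjE exE conjE)
      fix i assume i: "i < m" "k = 2 * i"
      then have "c k = 1" "c (partner m k) = wt k" using v_odd(2)[OF i(1)] v_even(2)[OF i(1)] by (simp_all add: part c_def)
      then show ?thesis using i wt0[OF k(1)] by simp
     next
      fix i assume i: "i < m" "k = 2 * i + 1"
      then have "c k = wt k" "c (partner m k) = 1" using part(2)[OF i(1)] by (simp_all add: c_def)
      then show ?thesis using i wt0[OF k(1)] by simp
     next
      assume b: "k \<ge> 2 * m"
      then have "wt k / (c k * c (partner m k)) = w k / \<bar>w k\<bar>" by (simp add: v_big c_def)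
      also have "\<dots> = \<epsilon>" using sgn[rule_format, OF k(1) b] eps by (auto simp: abs_if zero_less_mult_iff split: if_splits)
      finally show ?thesis using b by simp
     qed
     then show ?thesis by simp
    qed
    finally show "B (e k) (e k') = (if k' = partner m k then if k < 2 * m then 1 else \<epsilon> else 0)" .
  qed
  \<comment> \<open>The first four eigenvectors form the block on which the Kronecker product acts.\<close>
  define E where "E = cols ix v"
  note Einv = cols_inverse[of ix m wt v, folded n_def E_def, OF ix frv]
  have ixlt: "ix i < n" for i using ix by (auto simp: bij_betw_def)
  have ixinj: "ix i = ix j \<longleftrightarrow> i = j" for i j using ix by (auto simp: bij_betw_def inj_eq)
  define pos :: "2 \<times> 2 => nat" where "pos = (\<lambda>p. if p = (1, 1) then 0 else if p = (2, 2) then 1 else if p = (1, 2) then 2 else 3)"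
  have pos_range: "range pos = {..<4}" by (rule corner_in_range) (simp add: pos_def)
  have pos_inj: "inj pos"
  proof -
    have "\<forall>p q. pos p = pos q --> p = q" unfolding forall_22 by (simp add: pos_def)
    then show ?thesis by (auto simp: inj_def)
  qed
  define \<iota> where "\<iota> p = the_inv_into UNIV ix (pos p)" for p
  have pos_lt4: "pos p < 4" for p by (simp add: pos_def)
  have pos4: "pos p < n" for p using pos_lt4[of p] n5 by linarith
  have ixi: "ix (\<iota> p) = pos p" for p unfolding \<iota>_def using f_the_inv_into_f_bij_betw[OF ix] pos4 by simp
  have inj_iota: "inj \<iota>" using pos_inj by (metis inj_def ixi)
  have range_iota: "j \<in> range \<iota> \<longleftrightarrow> ix j < 4" for j
  proof
    assume "ix j < 4"
    then have "ix j \<in> range pos" using pos_range by simp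
    then obtain p where "ix j = pos p" by blast
    then have "j = \<iota> p" using ixi[of p] ixinj[of j "\<iota> p"] by simp
    then show "j \<in> range \<iota>" by blast
  next
    assume "j \<in> range \<iota>"
    then obtain p where "j = \<iota> p" by blast
    then show "ix j < 4" using ixi[of p] pos_lt4[of p] by simp
  qed
  have part4: "partner m 0 = 1" "partner m 1 = 0" "partner m 2 = 3" "partner m 3 = 2" using m2 by (simp_all add: partner_def)
  have wt4: "wt 0 = - (2 * w 2)" "wt 1 = - (2 * w 2)" "wt 2 = 2 * w 2" "wt 3 = 2 * w 2"
    using m2 w01 by (simp_all add: wt_def \<rho>_def)
  have Bv: "B (v k) (v k') = (if k' = partner m k then wt k else 0)" if "k < n" "k' < n" for k k' using frv that by (simp add: frame_def)
  have gram: "(transpose E ** S ** E) $ i $ j = (if ix j = partner m (ix i) then wt (ix i) else 0)" for i j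
    unfolding E_def gram_cols by (rule Bv[OF ixlt ixlt])
  \<comment> \<open>The discriminant of the block generates the quadratic field.\<close>
  have w23: "- (w 2 * w 3) \<in> \<rat>" "- (w 2 * w 3) > 0" using wrat n5 w2 by (simp_all add: mult_pos_neg)
  obtain d :: nat and r where dr: "r \<in> \<rat>" "r > 0" "sqrt (- (w 2 * w 3)) = r * sqrt (real d)" using sqrt_rational_nat[OF w23] by blast
  have d_irr: "sqrt (real d) \<notin> \<rat>" using irr dr by auto
  have th1: "\<theta> 1 = (r / (- w 3)) * sqrt (real d)"
  proof -
    have eq: "- (w 2 / w 3) = - (w 2 * w 3) / (w 3)\<^sup>2" using w2 by (simp add: power2_eq_square)
    have "\<theta> 1 = sqrt (- (w 2 / w 3))" by (simp add: \<theta>_def)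
    also have "\<dots> = sqrt (- (w 2 * w 3)) / sqrt ((w 3)\<^sup>2)" unfolding eq by (rule real_sqrt_divide)
    also have "\<dots> = sqrt (- (w 2 * w 3)) / (- w 3)" using w2 by (simp only: real_sqrt_abs abs_of_neg)
    finally show ?thesis by (simp add: dr(3))
  qed
  have th0: "\<theta> 0 = 1" by (simp add: \<theta>_def w01[simplified])
  have v0: "v 0 = f 0 + f 1" "v 1 = \<rho> 0 *\<^sub>R (f 0 - f 1)" "v 2 = f 2 + \<theta> 1 *\<^sub>R f 3" "v 3 = f 2 - \<theta> 1 *\<^sub>R f 3"
    using m2 th0 by (simp_all add: v_def P_def \<rho>_def)
  have rho0: "\<rho> 0 \<in> \<rat>" using wrat n5 by (simp add: \<rho>_def w01)
  have frat': "f k $ a \<in> \<rat>" if "k < n" for k a using frat that by (simp add: ratvec_def)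
  have qv: "quadratic_conj d (v 0 $ a) (v 0 $ a)" "quadratic_conj d (v 1 $ a) (v 1 $ a)" "quadratic_conj d (v 2 $ a) (v 3 $ a)" "quadratic_conj d (v 3 $ a) (v 2 $ a)" for a
  proof -
    show "quadratic_conj d (v 0 $ a) (v 0 $ a)" "quadratic_conj d (v 1 $ a) (v 1 $ a)"
     unfolding v0 using frat' n5 rho0 by (auto intro!: quadratic_conj_rat)
    have q: "r / w 3 * f 3 $ a \<in> \<rat>" "f 2 $ a \<in> \<rat>" using dr wrat frat' n5 by simp_all
    show "quadratic_conj d (v 2 $ a) (v 3 $ a)"
     unfolding quadratic_conj_def v0 th1 using q by (intro bexI[of _ "f 2 $ a"] bexI[of _ "- (r / w 3 * f 3 $ a)"]) auto
    show "quadratic_conj d (v 3 $ a) (v 2 $ a)"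
     unfolding quadratic_conj_def v0 th1 using q by (intro bexI[of _ "f 2 $ a"] bexI[of _ "r / w 3 * f 3 $ a"]) auto
  qed
  have posswap: "pos (prod.swap p) = (if pos p = 2 then 3 else if pos p = 3 then 2 else pos p)" for p
  proof -
    have "\<forall>p. pos (prod.swap p) = (if pos p = 2 then 3 else if pos p = 3 then 2 else pos p)" unfolding forall_22 by (simp add: pos_def)
    then show ?thesis by blast
  qed
  have pos_cases: "pos p = 0 \<or> pos p = 1 \<or> pos p = 2 \<or> pos p = 3" for p by (simp add: pos_def)
  have qE: "quadratic_conj d (E $ a $ \<iota> p) (E $ a $ \<iota> (prod.swap p))" for a p
    using pos_cases[of p] qv[of a] by (auto simp: E_def cols_def ixi posswap)
  have qS: "quadratic_conj d ((S *v x) $ a) ((S *v y) $ a)" if "!!b. quadratic_conj d (x $ b) (y $ b)" for x y a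
    unfolding matrix_vector_mult_def using S that by (auto intro!: quadratic_conj_sum quadratic_conj_scale simp: rational_matrix_def)
  have wt_rat: "1 / wt k \<in> \<rat>" if "k < 4" for k
  proof -
    have "k = 0 \<or> k = 1 \<or> k = 2 \<or> k = 3" using that by auto
    then show ?thesis using wrat[of 2] n5 wt4 by auto
  qed
  have qF: "quadratic_conj d (matrix_inv E $ \<iota> p $ a) (matrix_inv E $ \<iota> (prod.swap p) $ a)" for a p
  proof -
    have F: "matrix_inv E $ \<iota> p $ a = 1 / wt (pos p) * (S *v v (partner m (pos p))) $ a" for p unfolding Einv(2) ixi by simp
    have ws: "wt (pos (prod.swap p)) = wt (pos p)" using pos_cases[of p] wt4 by (auto simp: posswap)
    moreover have "quadratic_conj d ((S *v v (partner m (pos p))) $ a) ((S *v v (partner m (pos (prod.swap p)))) $ a)"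
     by (rule qS) (use pos_cases[of p] qv part4 in \<open>auto simp: posswap\<close>)
    moreover have "pos p < 4" using pos_cases[of p] by auto
    ultimately show ?thesis unfolding F[of p] F[of "prod.swap p"] ws using wt_rat by (intro quadratic_conj_scale) auto
  qed
  have E_conj: "\<exists>N>0. (\<forall>a p. conj_pair d N (E $ a $ \<iota> p) (E $ a $ \<iota> (prod.swap p))) &
     (\<forall>a p. conj_pair d N (matrix_inv E $ \<iota> p $ a) (matrix_inv E $ \<iota> (prod.swap p) $ a))"
  proof -
    obtain N1 where N1: "N1 > 0" "\<forall>x\<in>UNIV. conj_pair d N1 ((\<lambda>(a, p). E $ a $ \<iota> p) x) ((\<lambda>(a, p). E $ a $ \<iota> (prod.swap p)) x)"
     using quadratic_conj_denominator[of "UNIV :: ('n \<times> 2 \<times> 2) set" d "\<lambda>(a, p). E $ a $ \<iota> p" "\<lambda>(a, p). E $ a $ \<iota> (prod.swap p)"] qE by auto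
    obtain N2 where N2: "N2 > 0" "\<forall>x\<in>UNIV. conj_pair d N2 ((\<lambda>(a, p). matrix_inv E $ \<iota> p $ a) x) ((\<lambda>(a, p). matrix_inv E $ \<iota> (prod.swap p) $ a) x)"
     using quadratic_conj_denominator[of "UNIV :: ('n \<times> 2 \<times> 2) set" d "\<lambda>(a, p). matrix_inv E $ \<iota> p $ a" "\<lambda>(a, p). matrix_inv E $ \<iota> (prod.swap p) $ a"] qF by auto
    have "conj_pair d (N1 * N2) (E $ a $ \<iota> p) (E $ a $ \<iota> (prod.swap p))" for a p
    proof (rule conj_pair_mono[of d N1])
     show "conj_pair d N1 (E $ a $ \<iota> p) (E $ a $ \<iota> (prod.swap p))" using N1(2)[rule_format, of "(a, p)"] by (simp only: split_conv UNIV_I)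
    qed simp
    moreover have "conj_pair d (N1 * N2) (matrix_inv E $ \<iota> p $ a) (matrix_inv E $ \<iota> (prod.swap p) $ a)" for a p
    proof (rule conj_pair_mono[of d N2])
     show "conj_pair d N2 (matrix_inv E $ \<iota> p $ a) (matrix_inv E $ \<iota> (prod.swap p) $ a)"
      using N2(2)[rule_format, of "(a, p)"] by (simp only: split_conv UNIV_I)
    qed simp
    ultimately show ?thesis using N1(1) N2(1) by (intro exI[of _ "N1 * N2"]) simp
  qed
  \<comment> \<open>The rational operators and vectors that determine the torus inside the group.\<close>
  define X where "X i = (\<chi> a b. (S *v f (2 * i + 1)) $ b * f (2 * i) $ a - (S *v f (2 * i)) $ b * f (2 * i + 1) $ a)" for i
  have Xv: "X i *v x = B x (f (2 * i + 1)) *\<^sub>R f (2 * i) - B x (f (2 * i)) *\<^sub>R f (2 * i + 1)" for i x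
    by (simp add: vec_eq_iff X_def matrix_vector_mult_def[of "\<chi> a b. _ a b"] bil_def inner_vec_def left_diff_distrib right_diff_distrib sum_subtractf sum_distrib_left mult_ac)
  have SvR: "(S *v f k) $ b \<in> \<rat>" if "k < n" for k b
    using S frat'[OF that] by (auto simp: matrix_vector_mult_def rational_matrix_def intro!: Rats_sum)
  have Xrat: "rational_matrix (X i)" if "i < m" for i
    using SvR[OF lt(1)[OF that]] SvR[OF lt(2)[OF that]] frat'[OF lt(1)[OF that]] frat'[OF lt(2)[OF that]] by (simp add: rational_matrix_def X_def)
  define \<mu> where "\<mu> i k = (if k = 2 * i then \<theta> i * w (2 * i + 1) else if k = 2 * i + 1 then - (\<theta> i * w (2 * i + 1)) else 0)" for i k
  have XP: "X i *v P j s = (if j = i then (s * \<theta> i * w (2 * i + 1)) *\<^sub>R P i s else 0)" if ij: "i < m" "j < m" and s: "s * s = 1" for i j s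
  proof -
    have ne: "2 * i + 1 ~= 2 * j" "2 * i ~= 2 * j + 1" by presburger+
    show ?thesis
    proof (cases "j = i")
     case True
     have "X i *v P i s = (s * \<theta> i * w (2 * i + 1)) *\<^sub>R f (2 * i) - w (2 * i) *\<^sub>R f (2 * i + 1)"
      unfolding Xv using Bf[OF ij(1) lt(1)[OF ij(1)], of s] Bf[OF ij(1) lt(2)[OF ij(1)], of s] by simp
     also have "w (2 * i) = - ((s * \<theta> i * w (2 * i + 1)) * (s * \<theta> i))"
     proof -
      have "(s * \<theta> i * w (2 * i + 1)) * (s * \<theta> i) = (s * s) * (\<theta> i * \<theta> i * w (2 * i + 1))" by (simp add: algebra_simps)
      then show ?thesis unfolding th(2)[OF ij(1)] s by simp
     qed
     finally show ?thesis using True by (simp add: P_def scaleR_add_right)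
    next
     case False
     then show ?thesis unfolding Xv using Bf[OF ij(2) lt(1)[OF ij(1)], of s] Bf[OF ij(2) lt(2)[OF ij(1)], of s] ne by simp
    qed
  qed
  have Xmu: "X i *v v k = \<mu> i k *\<^sub>R v k" if i: "i < m" and k: "k < n" for i k
    using pair[of k]
  proof (elim disjE exE conjE)
    fix j assume j: "j < m" "k = 2 * j"
    have "2 * j ~= 2 * i + 1" by presburger
    then show ?thesis using XP[OF i j(1), of 1] j by (simp add: v_even \<mu>_def)
  next
    fix j assume j: "j < m" "k = 2 * j + 1"
    have "2 * j + 1 ~= 2 * i" by presburger
    then show ?thesis unfolding j(2) v_odd(1)[OF j(1)] using XP[OF i j(1), of "-1"] by (simp add: matrix_vector_mult_scaleR \<mu>_def)
  next
    assume b: "k \<ge> 2 * m"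
    then have ne: "k ~= 2 * i" "k ~= 2 * i + 1" using i by linarith+
    then show ?thesis unfolding Xv v_big(1)[OF b] using orth[OF k lt(1)[OF i]] orth[OF k lt(2)[OF i]] by (auto simp: \<mu>_def)
  qed
  have ZE: "Z ** E = E ** dmat (\<lambda>i. l (ix i))" if "!!k. k < n ==> Z *v v k = l k *\<^sub>R v k" for Z :: "real^'n^'n" and l
    using that[OF ixlt] by (simp add: vec_eq_iff mult_cols E_def mult_dmat_nth) (simp add: cols_def mult.commute)
  have XE: "X i = E ** dmat (\<lambda>j. \<mu> i (ix j)) ** matrix_inv E" if "i < m" for i
  proof -
    have "X i ** E ** matrix_inv E = E ** dmat (\<lambda>j. \<mu> i (ix j)) ** matrix_inv E"
     using ZE[of "X i" "\<mu> i"] Xmu[OF that] by simp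
    then show ?thesis using Einv(1) by (simp add: group_simps)
  qed
  define XS where "XS = X ` {..<m}"
  define WS where "WS = f ` {2 * m..<n}"
  have "quadratic_embedding (isometries S) E \<iota> prod.swap kron2 d (\<lambda>\<nu>. \<forall>p. \<nu> p = 1)
    (\<lambda>a b p. dg a $ fst p $ fst p * dg b $ snd p $ snd p) XS WS"
  proof (rule SO_embedding[OF Einv(1) inj_iota d_irr E_conj, where \<mu>="- (2 * w 2)"])
    show "(transpose E ** S ** E) $ \<iota> p $ \<iota> q = - (2 * w 2) * eps (fst p) (fst q) * eps (snd p) (snd q)" for p q
    proof -
     have "\<forall>p q. (if pos q = partner m (pos p) then wt (pos p) else 0) = - (2 * w 2) * eps (fst p) (fst q) * eps (snd p) (snd q)"
      unfolding forall_22 using part4 wt4 by (simp add: pos_def eps_def)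
     then show ?thesis unfolding gram ixi by blast
    qed
    show "- (2 * w 2) ~= 0" using w2 by simp
    show "(transpose E ** S ** E) $ \<iota> p $ j = 0 & (transpose E ** S ** E) $ j $ \<iota> p = 0" if j: "j \<notin> range \<iota>" for p j
    proof -
     have j4: "ix j \<ge> 4" using j range_iota by force
     have "partner m (pos p) < 4" using pos_cases[of p] part4 by auto
     then have "ix j ~= partner m (pos p)" using j4 by linarith
     moreover from this have "pos p ~= partner m (ix j)" using partner_eq_iff by metis
     ultimately show ?thesis unfolding gram ixi by simp
    qed
    show "finite XS" "finite WS" by (simp_all add: XS_def WS_def)
    show "rational_matrix Z" if "Z \<in> XS" for Z using that Xrat by (auto simp: XS_def)
    show "\<exists>\<mu>. Z = E ** dmat \<mu> ** matrix_inv E" if "Z \<in> XS" for Z using that XE by (auto simp: XS_def)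
    show "x $ i \<in> \<rat>" if "x \<in> WS" for x i using that frat' by (auto simp: WS_def)
    show "t *v x = x" if x: "x \<in> WS" and t: "t \<in> pos_torus (isometries S) E" for x t
    proof -
     obtain k where k: "x = f k" "2 * m \<le> k" "k < n" using x by (auto simp: WS_def)
     obtain l where l: "t \<in> isometries S" "!!i. l i > 0" "t = E ** dmat l ** matrix_inv E" using t by (rule pos_torusE) blast
     define j where "j = the_inv_into UNIV ix k"
     have j: "ix j = k" unfolding j_def using f_the_inv_into_f_bij_betw[OF ix] k by simp
     have "transpose (dmat l) ** (transpose E ** S ** E) ** dmat l = transpose E ** S ** E"
      using l(1) isometry_conj_iff[OF Einv(1), of "dmat l" S] by (simp add: isometries_def l(3))
     then have "(transpose (dmat l) ** (transpose E ** S ** E) ** dmat l) $ j $ j = (transpose E ** S ** E) $ j $ j" by simp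
     moreover have "transpose (dmat l) = dmat l" by (simp add: vec_eq_iff transpose_def)
     ultimately have "l j * wt k * l j = wt k" by (simp add: mult_dmat_nth dmat_mult_nth gram j v_big(3)[OF k(2)])
     then have "(l j)\<^sup>2 = 1" using wt0[OF k(3)] by (simp add: power2_eq_square)
     then have l1: "l j = 1" using l(2)[of j] by (simp add: power2_eq_1_iff)
     have "t ** E = E ** dmat l" unfolding l(3) using Einv(1) by (simp add: group_simps)
     then have "(t ** E) $ a $ j = (E ** dmat l) $ a $ j" for a by simp
     then have "(t *v v k) $ a = v k $ a" for a by (simp add: E_def mult_cols mult_dmat_nth j l1) (simp add: cols_def j)
     then have "t *v v k = v k" unfolding vec_eq_iff by blast
     then show ?thesis unfolding k(1) v_big(1)[OF k(2)] .
    qed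
    show "(matrix_inv E ** z ** E) $ i $ j = 0"
     if zX: "!!X. X \<in> XS ==> z ** X = X ** z" and zw: "!!w. w \<in> WS ==> z *v w = w" and ij: "i ~= j" for z i j
    proof (cases "ix j < 2 * m")
     case False
     then have k: "2 * m \<le> ix j" by simp
     then have "z *v v (ix j) = v (ix j)" using zw[of "f (ix j)"] v_big(1)[OF k] ixlt[of j] by (simp add: WS_def)
     then have "(z ** E) $ a $ j = E $ a $ j" for a by (simp add: E_def mult_cols) (simp add: cols_def)
     then have "(matrix_inv E ** (z ** E)) $ i $ j = (matrix_inv E ** E) $ i $ j" by (simp add: matrix_matrix_mult_def[of "matrix_inv E"])
     then show ?thesis using ij Einv(1) by (simp add: group_simps mat_def)
    next
     case True
     define i0 where "i0 = ix j div 2"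
     have i0: "i0 < m" "ix j = 2 * i0 \<or> ix j = 2 * i0 + 1" using True by (auto simp: i0_def)
     have com: "z ** X i0 = X i0 ** z" using zX i0 by (simp add: XS_def)
     define Y where "Y = matrix_inv E ** z ** E"
     have "Y ** dmat (\<lambda>j. \<mu> i0 (ix j)) = matrix_inv E ** (z ** X i0) ** E"
      unfolding Y_def XE[OF i0(1)] using Einv(1) by (simp add: group_simps)
     also have "\<dots> = dmat (\<lambda>j. \<mu> i0 (ix j)) ** Y"
      unfolding com unfolding Y_def XE[OF i0(1)] using Einv(1) by (simp add: group_simps)
     finally have "(Y ** dmat (\<lambda>j. \<mu> i0 (ix j))) $ i $ j = (dmat (\<lambda>j. \<mu> i0 (ix j)) ** Y) $ i $ j" by simp
     then have "Y $ i $ j * \<mu> i0 (ix j) = \<mu> i0 (ix i) * Y $ i $ j" unfolding mult_dmat_nth dmat_mult_nth .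
     then have "Y $ i $ j * (\<mu> i0 (ix j) - \<mu> i0 (ix i)) = 0" by (simp add: algebra_simps)
     moreover have "\<mu> i0 (ix j) ~= \<mu> i0 (ix i)"
     proof -
      have "ix i ~= ix j" using ij ixinj by simp
      moreover have "\<theta> i0 * w (2 * i0 + 1) < 0" using th(1)[OF i0(1)] alt1(2)[OF i0(1)] by (rule mult_pos_neg)
      ultimately show ?thesis using i0(2) by (auto simp: \<mu>_def)
     qed
     ultimately show ?thesis by (simp add: Y_def)
    qed
  qed
  then interpret quadratic_embedding "isometries S" E \<iota> prod.swap kron2 d "\<lambda>\<nu>. \<forall>p. \<nu> p = 1"
    "\<lambda>a b p. dg a $ fst p $ fst p * dg b $ snd p $ snd p" XS WS .
  have "four_boundary_cosets (isometries S) (pos_torus (isometries S) E) (integer_points (isometries S))"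
    by (rule hilbert_torus.four_boundary_orbits[OF hilbert_torus])
  moreover have "E = cols ix (\<lambda>k. c' k *\<^sub>R e k)" unfolding E_def ve ..
  ultimately show ?thesis using m2 nf c0 by metis
qed

end

section \<open>Split tori\<close>

lemma matrix_poly_continuous:
  assumes "p \<in> matrix_poly K"
  shows "continuous_on UNIV p"
  using assms by induction (auto intro!: continuous_intros)

lemma matrix_poly_sum: "0 \<in> K ==> (!!i. i \<in> A ==> f i \<in> matrix_poly K) ==> (\<lambda>g. \<Sum>i\<in>A. f i g) \<in> matrix_poly K"
  by (induction A rule: infinite_finite_induct) (auto intro: matrix_poly.intros)

lemma matrix_poly_prod: "1 \<in> K ==> (!!i. i \<in> A ==> f i \<in> matrix_poly K) ==> (\<lambda>g. \<Prod>i\<in>A. f i g) \<in> matrix_poly K"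
  by (induction A rule: infinite_finite_induct) (auto intro: matrix_poly.intros)

lemma matrix_poly_minus_const: "p \<in> matrix_poly K ==> -1 \<in> K ==> (\<lambda>g. p g - 1) \<in> matrix_poly K"
  using matrix_poly.add[of p K "\<lambda>_. -1"] matrix_poly.const[of "-1" K] by simp

abbreviation cm :: "real^'n^'m => complex^'n^'m" where "cm \<equiv> map_matrix complex_of_real"

lemma cm_nth [simp]: "cm A $ i $ j = complex_of_real (A $ i $ j)"
  by (simp add: map_matrix_def)

lemma cm_mult: "cm (A ** B) = cm A ** cm B"
  by (simp add: vec_eq_iff matrix_matrix_mult_def)

lemma cm_1 [simp]: "cm (mat 1) = mat 1"
  by (simp add: vec_eq_iff mat_def)

lemma cm_inject: "cm A = cm B \<longleftrightarrow> A = B"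
  by (simp add: vec_eq_iff)

lemma cm_inv: "invertible E ==> matrix_inv (cm E) = cm (matrix_inv E)" "invertible E ==> invertible (cm E)"
  for E :: "real^'n^'n"
proof -
  assume E: "invertible E"
  have e: "cm E ** cm (matrix_inv E) = mat 1" "cm (matrix_inv E) ** cm E = mat 1"
    using E by (simp_all add: cm_mult[symmetric] group_simps)
  show "matrix_inv (cm E) = cm (matrix_inv E)" by (rule matrix_inv_unique[OF e(1)])
  show "invertible (cm E)" unfolding invertible_def using e by blast
qed

lemma matrix_poly_conj:
  assumes "p \<in> matrix_poly \<real>"
  shows "(\<lambda>g. p (cm A ** g ** cm B)) \<in> matrix_poly \<real>"
  using assms
proof induction
  case (entry i j)
  have "(\<lambda>g. (cm A ** g ** cm B) $ i $ j) = (\<lambda>g. \<Sum>l\<in>UNIV. (\<Sum>k\<in>UNIV. cm A $ i $ k * g $ k $ l) * cm B $ l $ j)"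
    by (simp add: matrix_matrix_mult_def)
  also have "\<dots> \<in> matrix_poly \<real>"
    by (intro matrix_poly_sum matrix_poly.mult matrix_poly.const matrix_poly.entry) auto
  finally show ?case .
qed (auto intro: matrix_poly.intros)

lemma openin_zariski: "p \<in> matrix_poly UNIV ==> openin zariski_topology {g. p g ~= 0}"
  unfolding zariski_topology_def by (rule topology_generated_by_Basis) blast

text \<open>Polynomials are continuous, so Zariski open sets are open.\<close>

lemma connected_imp_zariski_connected:
  assumes "connected S"
  shows "connectedin zariski_topology S"
proof -
  have "continuous_map euclidean zariski_topology (id :: complex^'n^'n => _)"
    unfolding zariski_topology_def continuous_on_generated_topo_iff
  proof (intro conjI allI impI)
    fix U :: "(complex^'n^'n) set" assume "U \<in> {{g. p g ~= 0} | p. p \<in> matrix_poly UNIV}"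
    then obtain p where p: "U = {g. p g ~= 0}" "p \<in> matrix_poly UNIV" by blast
    have "open U" unfolding p(1) by (intro open_Collect_neq matrix_poly_continuous[OF p(2)] continuous_on_const)
    then show "openin euclidean (id -` U \<inter> topspace euclidean)" by simp
  next
    have one: "(\<lambda>g :: complex^'n^'n. 1) \<in> matrix_poly UNIV" by (rule matrix_poly.const) simp
    show "id ` topspace euclidean \<subseteq> \<Union>{{g :: complex^'n^'n. p g ~= 0} | p. p \<in> matrix_poly UNIV}"
    proof
     fix g :: "complex^'n^'n"
     have "g \<in> {g. (\<lambda>g :: complex^'n^'n. 1 :: complex) g ~= 0}" by simp
     then show "g \<in> \<Union>{{g :: complex^'n^'n. p g ~= 0} | p. p \<in> matrix_poly UNIV}" using one by blast
    qed
  qed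
  from connectedin_continuous_map_image[OF this, of S] show ?thesis using assms by simp
qed

definition diag_group :: "real^'n^'n => ('n => complex) set => (complex^'n^'n) set" where
  "diag_group E L = {cm E ** dmat l ** cm (matrix_inv E) | l. l \<in> L}"

text \<open>A closed subgroup \<open>L\<close> of the complex diagonal group. The paths \<open>t \<mapsto> exp (t z)\<close> make it connected, and real powers connect its positive points to one.\<close>

locale diagonal_torus =
  fixes E :: "real^'n^'n" and L :: "('n => complex) set" and Q :: "(complex^'n^'n => complex) set"
  assumes inv_E: "invertible E"
    and Q: "Q \<subseteq> matrix_poly \<real>"
    and L_eq: "L = {l. (\<forall>i. l i ~= 0) & (\<forall>p\<in>Q. p (dmat l) = 0)}"
    and one_L: "(\<lambda>_. 1) \<in> L" and mult_L: "l \<in> L ==> l' \<in> L ==> (\<lambda>i. l i * l' i) \<in> L"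
    and inv_L: "l \<in> L ==> (\<lambda>i. inverse (l i)) \<in> L"
    and path_L: "l \<in> L ==> \<exists>z. (\<forall>i. l i = exp (z i)) & (\<forall>t::real. (\<lambda>i. exp (of_real t * z i)) \<in> L)"
    and powr_L: "(!!i. x i > 0) ==> (\<lambda>i. complex_of_real (x i)) \<in> L ==> (\<lambda>i. complex_of_real (x i powr t)) \<in> L"
begin

lemma E_inv: "cm E ** cm (matrix_inv E) = mat 1" "cm (matrix_inv E) ** cm E = mat 1"
  using inv_E by (simp_all add: cm_mult[symmetric] group_simps)

lemma L_nz: "l \<in> L ==> l i ~= 0" by (simp add: L_eq)

lemma dmat_conj: "cm (matrix_inv E) ** (cm E ** A ** cm (matrix_inv E)) ** cm E = A"
proof -
  have "cm (matrix_inv E) ** (cm E ** A ** cm (matrix_inv E)) ** cm E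
    = (cm (matrix_inv E) ** cm E) ** A ** (cm (matrix_inv E) ** cm E)" by (simp add: matrix_mul_assoc)
  then show ?thesis by (simp add: E_inv)
qed

lemma conj_dmat: "cm E ** (cm (matrix_inv E) ** g ** cm E) ** cm (matrix_inv E) = g"
proof -
  have "cm E ** (cm (matrix_inv E) ** g ** cm E) ** cm (matrix_inv E)
    = (cm E ** cm (matrix_inv E)) ** g ** (cm E ** cm (matrix_inv E))" by (simp add: matrix_mul_assoc)
  then show ?thesis by (simp add: E_inv)
qed

lemma diag_mult: "(cm E ** dmat l ** cm (matrix_inv E)) ** (cm E ** dmat l' ** cm (matrix_inv E)) = cm E ** dmat (\<lambda>i. l i * l' i) ** cm (matrix_inv E)"
proof -
  have "(cm E ** dmat l ** cm (matrix_inv E)) ** (cm E ** dmat l' ** cm (matrix_inv E))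
    = cm E ** (dmat l ** (cm (matrix_inv E) ** cm E) ** dmat l') ** cm (matrix_inv E)" by (simp add: matrix_mul_assoc)
  then show ?thesis by (simp add: E_inv dmat_mult)
qed

lemma invertible_diag: "(!!i. l i ~= 0) ==> invertible (cm E ** dmat l ** cm (matrix_inv E))"
  using inv_E by (intro invertible_mult invertible_dmat cm_inv) (auto intro: invertible_matrix_inv)

lemma real_split_torus_diag: "real_split_torus (diag_group E L)"
proof -
  define P where "P = (\<lambda>p g. p (cm (matrix_inv E) ** g ** cm E)) ` (Q \<union> {(\<lambda>g. g $ i $ j) | i j. i ~= j})"
  have entries: "(\<lambda>g. g $ i $ j) \<in> matrix_poly \<real>" for i j by (rule matrix_poly.entry)
  have P: "P \<subseteq> matrix_poly \<real>"
    unfolding P_def using Q entries by (auto intro!: matrix_poly_conj)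
  have Pq: "(\<lambda>g. p (cm (matrix_inv E) ** g ** cm E)) \<in> P" if "p \<in> Q" for p
    unfolding P_def by (rule image_eqI[of _ _ p]) (use that in auto)
  have Pe: "(\<lambda>g. (cm (matrix_inv E) ** g ** cm E) $ i $ j) \<in> P" if "i ~= j" for i j
    unfolding P_def by (rule image_eqI[of _ _ "\<lambda>g. g $ i $ j"]) (use that in auto)
  have eq: "diag_group E L = {g. invertible g & (\<forall>p\<in>P. p g = 0)}"
  proof (intro set_eqI iffI)
    fix g assume "g \<in> diag_group E L"
    then obtain l where l: "l \<in> L" "g = cm E ** dmat l ** cm (matrix_inv E)" by (auto simp: diag_group_def)
    have "invertible g" unfolding l(2) using L_nz[OF l(1)] by (rule invertible_diag)
    moreover have "p g = 0" if "p \<in> P" for p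
     using that l(1) unfolding P_def l(2) by (auto simp: dmat_conj L_eq)
    ultimately show "g \<in> {g. invertible g & (\<forall>p\<in>P. p g = 0)}" by blast
  next
    fix g assume g: "g \<in> {g. invertible g & (\<forall>p\<in>P. p g = 0)}"
    then have Pall: "!!p. p \<in> P ==> p g = 0" by simp
    define A where "A = cm (matrix_inv E) ** g ** cm E"
    have gA: "g = cm E ** A ** cm (matrix_inv E)" by (simp add: A_def conj_dmat)
    have off: "A $ i $ j = 0" if "i ~= j" for i j
     using Pall[OF Pe[OF that]] by (simp add: A_def)
    define l where "l i = A $ i $ i" for i
    have Al: "A = dmat l" using off by (simp add: vec_eq_iff l_def)
    have "invertible A" unfolding A_def using g inv_E by (intro invertible_mult) (auto intro!: cm_inv invertible_matrix_inv)
    then have "l i ~= 0" for i unfolding Al invertible_det_nz det_dmat by auto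
    moreover have "p (dmat l) = 0" if "p \<in> Q" for p
     using Pall[OF Pq[OF that]] unfolding Al[symmetric] A_def .
    ultimately have "l \<in> L" by (simp add: L_eq)
    then show "g \<in> diag_group E L" using gA Al by (auto simp: diag_group_def)
  qed
  have "real_algebraic_group (diag_group E L)"
    unfolding real_algebraic_group_def
  proof (intro conjI ballI)
    show "\<exists>P\<subseteq>matrix_poly \<real>. diag_group E L = {g. invertible g & (\<forall>p\<in>P. p g = 0)}" using P eq by blast
    show "mat 1 \<in> diag_group E L"
     unfolding diag_group_def using one_L by (auto intro!: exI[of _ "\<lambda>_. 1"] simp: dmat_1 E_inv)
    fix g assume "g \<in> diag_group E L"
    then obtain l where l: "l \<in> L" "g = cm E ** dmat l ** cm (matrix_inv E)" by (auto simp: diag_group_def)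
    have "matrix_inv g = cm E ** dmat (\<lambda>i. inverse (l i)) ** cm (matrix_inv E)"
    proof (rule matrix_inv_unique)
     have "(\<lambda>i. l i * inverse (l i)) = (\<lambda>_. 1)" using L_nz[OF l(1)] by (simp add: fun_eq_iff)
     then show "g ** (cm E ** dmat (\<lambda>i. inverse (l i)) ** cm (matrix_inv E)) = mat 1"
      unfolding l(2) diag_mult by (simp add: dmat_1 E_inv)
    qed
    then show "matrix_inv g \<in> diag_group E L" using inv_L[OF l(1)] by (auto simp: diag_group_def)
    fix h assume "h \<in> diag_group E L"
    then obtain l' where l': "l' \<in> L" "h = cm E ** dmat l' ** cm (matrix_inv E)" by (auto simp: diag_group_def)
    have "g ** h = cm E ** dmat (\<lambda>i. l i * l' i) ** cm (matrix_inv E)" unfolding l(2) l'(2) by (rule diag_mult)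
    then show "g ** h \<in> diag_group E L" using mult_L[OF l(1) l'(1)] by (auto simp: diag_group_def)
  qed
  moreover have "connectedin zariski_topology (diag_group E L)"
  proof (rule connected_imp_zariski_connected, rule connected_iff_connected_component[THEN iffD2])
    have one: "connected_component (diag_group E L) (mat 1) g" if "g \<in> diag_group E L" for g
    proof -
     obtain l where l: "l \<in> L" "g = cm E ** dmat l ** cm (matrix_inv E)" using \<open>g \<in> diag_group E L\<close> by (auto simp: diag_group_def)
     obtain z where z: "\<forall>i. l i = exp (z i)" "\<forall>t::real. (\<lambda>i. exp (of_real t * z i)) \<in> L" using path_L[OF l(1)] by blast
     define \<gamma> where "\<gamma> t = cm E ** dmat (\<lambda>i. exp (complex_of_real t * z i)) ** cm (matrix_inv E)" for t
     have "continuous_on {0..1} \<gamma>"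
      unfolding continuous_on_def
     proof (intro ballI vec_tendstoI)
      fix t :: real and i j assume "t \<in> {0..1}"
      show "((\<lambda>x. \<gamma> x $ i $ j) \<longlongrightarrow> \<gamma> t $ i $ j) (at t within {0..1})"
       unfolding \<gamma>_def matrix_matrix_mult_def vec_lambda_beta dmat_nth
       by (intro tendsto_sum tendsto_mult tendsto_const) (auto intro!: tendsto_intros)
     qed
     then have "connected (\<gamma> ` {0..1})" by (rule connected_continuous_image) simp
     moreover have "\<gamma> ` {0..1} \<subseteq> diag_group E L" using z(2) by (auto simp: \<gamma>_def diag_group_def)
     moreover have "\<gamma> 0 = mat 1" by (simp add: \<gamma>_def dmat_1 E_inv)
     moreover have "\<gamma> 1 = g"
     proof -
      have "l = (\<lambda>i. exp (z i))" using z(1) by auto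
      then show ?thesis by (simp add: \<gamma>_def l(2))
     qed
     ultimately show ?thesis unfolding connected_component_def
      by (intro exI[of _ "\<gamma> ` {0..1}"]) (auto intro: rev_image_eqI[of 0] rev_image_eqI[of 1])
    qed
    show "\<forall>x\<in>diag_group E L. \<forall>y\<in>diag_group E L. connected_component (diag_group E L) x y"
     using one connected_component_sym connected_component_trans by metis
  qed
  moreover have "real_diagonalizable (diag_group E L)"
    unfolding real_diagonalizable_def
  proof (rule exI[of _ "matrix_inv E"], intro conjI ballI allI impI)
    show "invertible (matrix_inv E)" using inv_E by (rule invertible_matrix_inv)
    fix g and i j :: 'n assume g: "g \<in> diag_group E L" and ij: "i ~= j"
    obtain l where l: "g = cm E ** dmat l ** cm (matrix_inv E)" using g by (auto simp: diag_group_def)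
    show "(cm (matrix_inv E) ** g ** cm (matrix_inv (matrix_inv E))) $ i $ j = 0"
     using inv_E ij by (simp add: matrix_inv_matrix_inv l dmat_conj)
  qed
  ultimately show ?thesis by (simp add: real_split_torus_def)
qed

text \<open>Diagonal entries cannot change sign along a connected set of real points; conversely positive points are joined to the identity by real powers.\<close>

lemma identity_component:
  "connected_component_set (real_points (diag_group E L)) (mat 1) =
     {E ** dmat x ** matrix_inv E | x. (\<forall>i. x i > 0) & (\<lambda>i. complex_of_real (x i)) \<in> L}" (is "?C = ?P")
proof (intro set_eqI iffI)
  have cmE: "cm (E ** dmat x ** matrix_inv E) = cm E ** dmat (\<lambda>i. complex_of_real (x i)) ** cm (matrix_inv E)" for x
  proof -
    have "cm (dmat x) = dmat (\<lambda>i. complex_of_real (x i))" by (simp add: vec_eq_iff)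
    then show ?thesis by (simp add: cm_mult)
  qed
  have PR: "E ** dmat x ** matrix_inv E \<in> real_points (diag_group E L)" if "(\<lambda>i. complex_of_real (x i)) \<in> L" for x
    using that by (auto simp: real_points_def diag_group_def cmE)
  {
    fix g assume "g \<in> ?P"
    then obtain x where x: "!!i. x i > 0" "(\<lambda>i. complex_of_real (x i)) \<in> L" "g = E ** dmat x ** matrix_inv E" by auto
    have x0: "x i ~= 0" for i using x(1)[of i] by simp
    define \<gamma> where "\<gamma> t = E ** dmat (\<lambda>i. x i powr t) ** matrix_inv E" for t
    have "continuous_on {0..1} \<gamma>"
     unfolding continuous_on_def
    proof (intro ballI vec_tendstoI)
     fix t :: real and i j assume "t \<in> {0..1}"
     show "((\<lambda>s. \<gamma> s $ i $ j) \<longlongrightarrow> \<gamma> t $ i $ j) (at t within {0..1})"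
      unfolding \<gamma>_def matrix_matrix_mult_def vec_lambda_beta dmat_nth
      by (intro tendsto_sum tendsto_mult tendsto_const) (auto intro!: tendsto_intros simp: x0)
    qed
    then have "connected (\<gamma> ` {0..1})" by (rule connected_continuous_image) simp
    moreover have "\<gamma> ` {0..1} \<subseteq> real_points (diag_group E L)"
     using PR powr_L[OF x(1,2)] by (auto simp: \<gamma>_def)
    moreover have "\<gamma> 0 = mat 1" using inv_E x0 by (simp add: \<gamma>_def dmat_1 group_simps)
    moreover have "\<gamma> 1 = g" using x(1) by (simp add: \<gamma>_def x(3) less_imp_le)
    ultimately have "connected_component (real_points (diag_group E L)) (mat 1) g"
     unfolding connected_component_def
     by (intro exI[of _ "\<gamma> ` {0..1}"]) (auto intro: rev_image_eqI[of 0] rev_image_eqI[of 1])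
    then show "g \<in> ?C" by simp
  }
  fix g assume "g \<in> ?C"
  then obtain A where A: "connected A" "A \<subseteq> real_points (diag_group E L)" "mat 1 \<in> A" "g \<in> A"
    by (auto simp: connected_component_def)
  have diag: "\<exists>x. (\<lambda>i. complex_of_real (x i)) \<in> L & a = E ** dmat x ** matrix_inv E" if "a \<in> A" for a
  proof -
    obtain l where l: "l \<in> L" "cm a = cm E ** dmat l ** cm (matrix_inv E)"
     using A(2) \<open>a \<in> A\<close> by (auto simp: real_points_def diag_group_def)
    have "cm (matrix_inv E ** a ** E) = dmat l" by (simp add: cm_mult l(2) dmat_conj)
    then have e: "complex_of_real ((matrix_inv E ** a ** E) $ i $ j) = (if i = j then l i else 0)" for i j
     by (metis cm_nth dmat_nth)
    define x where "x i = (matrix_inv E ** a ** E) $ i $ i" for i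
    have "l = (\<lambda>i. complex_of_real (x i))" using e by (simp add: x_def fun_eq_iff)
    moreover have "a = E ** dmat x ** matrix_inv E"
     using l(2) unfolding \<open>l = _\<close> cmE[symmetric] cm_inject .
    ultimately show ?thesis using l(1) by blast
  qed
  have diag_nth: "(matrix_inv E ** (E ** dmat x ** matrix_inv E) ** E) $ i $ i = x i" for x :: "'n => real" and i
    using inv_E by (simp add: group_simps)
  have pos: "(matrix_inv E ** g ** E) $ i $ i > 0" for i
  proof (rule ccontr)
    define f where "f a = (matrix_inv E ** a ** E) $ i $ i" for a
    assume "\<not> (matrix_inv E ** g ** E) $ i $ i > 0"
    then have "f g \<le> 0" by (simp add: f_def)
    moreover have "f (mat 1) = 1" using inv_E by (simp add: f_def group_simps) (simp add: mat_def)
    moreover have "connected (f ` A)"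
     by (rule connected_continuous_image[OF _ A(1)]) (auto simp: f_def intro!: continuous_intros)
    ultimately have "0 \<in> f ` A"
     using A(3,4) connectedD_interval[of "f ` A" "f g" "f (mat 1)" 0] by auto
    then obtain a where a: "a \<in> A" "f a = 0" by auto
    obtain x where x: "(\<lambda>i. complex_of_real (x i)) \<in> L" "a = E ** dmat x ** matrix_inv E" using diag[OF a(1)] by blast
    then show False using a(2) L_nz[OF x(1), of i] by (simp add: f_def diag_nth)
  qed
  obtain x where x: "(\<lambda>i. complex_of_real (x i)) \<in> L" "g = E ** dmat x ** matrix_inv E" using diag[OF A(4)] by blast
  have "x i > 0" for i using pos[of i] unfolding x(2) diag_nth .
  then show "g \<in> ?P" using x by blast
qed

lemma maximal_torus_eq:
  assumes max: "maximal_real_split_algebraic_torus G S" and sub: "S \<subseteq> diag_group E L" "diag_group E L \<subseteq> G"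
  shows "connected_component_set (real_points S) (mat 1) =
     {E ** dmat x ** matrix_inv E | x. (\<forall>i. x i > 0) & (\<lambda>i. complex_of_real (x i)) \<in> L}"
proof -
  have "diag_group E L = S" using max sub real_split_torus_diag by (auto simp: maximal_real_split_algebraic_torus_def)
  then show ?thesis using identity_component by simp
qed

end

text \<open>Diagonalize a maximal torus. The full diagonal group of determinant one in its eigenbasis is again a split torus, so by maximality it is equal to it.\<close>

theorem maximal_split_torus_SL:
  assumes "maximal_real_split_torus SL T"
  shows "\<exists>E :: real^'n^'n. invertible E & T = pos_torus SL E"
proof -
  obtain S where S: "maximal_real_split_algebraic_torus SL S" "T = connected_component_set (real_points S) (mat 1)"
    using assms by (auto simp: maximal_real_split_torus_def)
  have "real_diagonalizable S" "S \<subseteq> SL" using S(1) by (simp_all add: maximal_real_split_algebraic_torus_def real_split_torus_def)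
  then obtain q :: "real^'n^'n" where q: "invertible q" "!!g i j. g \<in> S ==> i ~= j ==> (cm q ** g ** cm (matrix_inv q)) $ i $ j = 0"
    by (auto simp: real_diagonalizable_def)
  define E where "E = matrix_inv q"
  have E: "invertible E" "matrix_inv E = q" using q(1) by (simp_all add: E_def group_simps)
  define L :: "('n => complex) set" where "L = {l. (\<forall>i. l i ~= 0) & (\<Prod>i\<in>UNIV. l i) = 1}"
  define P :: "complex^'n^'n => complex" where "P g = (\<Prod>i\<in>UNIV. g $ i $ i) - 1" for g
  interpret diagonal_torus E L "{P}"
  proof
    show "invertible E" by (rule E(1))
    show "{P} \<subseteq> matrix_poly \<real>"
     unfolding P_def[abs_def] by (auto intro!: matrix_poly_minus_const matrix_poly_prod matrix_poly.entry)
    show "L = {l. (\<forall>i. l i ~= 0) & (\<forall>p\<in>{P}. p (dmat l) = 0)}" by (simp add: L_def P_def)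
    show "(\<lambda>_. 1) \<in> L" by (simp add: L_def)
    show "(\<lambda>i. l i * l' i) \<in> L" if "l \<in> L" "l' \<in> L" for l l' using that by (simp add: L_def prod.distrib)
    show "(\<lambda>i. inverse (l i)) \<in> L" if "l \<in> L" for l using that prod_inversef[of l UNIV] by (simp add: L_def o_def)
    show "\<exists>z. (\<forall>i. l i = exp (z i)) & (\<forall>t::real. (\<lambda>i. exp (of_real t * z i)) \<in> L)" if l: "l \<in> L" for l
    proof -
     obtain i0 :: 'n where True by blast
     define z where "z i = (if i = i0 then - (\<Sum>j\<in>UNIV - {i0}. Ln (l j)) else Ln (l i))" for i
     have sum0: "(\<Sum>i\<in>UNIV. z i) = 0"
     proof -
      have "(\<Sum>i\<in>UNIV. z i) = z i0 + (\<Sum>i\<in>UNIV - {i0}. z i)" by (rule sum.remove) auto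
      also have "(\<Sum>i\<in>UNIV - {i0}. z i) = (\<Sum>j\<in>UNIV - {i0}. Ln (l j))" by (intro sum.cong refl) (simp add: z_def)
      finally show ?thesis by (simp add: z_def)
     qed
     have nz: "l i ~= 0" for i using l by (simp add: L_def)
     have ne: "l i = exp (z i)" if "i ~= i0" for i using that nz by (simp add: z_def)
     have "l i0 = exp (z i0)"
     proof -
      have "l i0 * (\<Prod>i\<in>UNIV - {i0}. l i) = 1"
       using l prod.remove[of UNIV i0 l] by (simp add: L_def)
      moreover have "(\<Prod>i\<in>UNIV - {i0}. l i) = (\<Prod>i\<in>UNIV - {i0}. exp (z i))" by (intro prod.cong refl) (simp add: ne)
      moreover have "exp (z i0) * (\<Prod>i\<in>UNIV - {i0}. exp (z i)) = 1"
       using prod.remove[of UNIV i0 "\<lambda>i. exp (z i)"] sum0 by (simp flip: exp_sum)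
      ultimately show ?thesis by (metis mult_cancel_right mult_zero_right zero_neq_one)
     qed
     then have "\<forall>i. l i = exp (z i)" using ne by metis
     moreover have "(\<lambda>i. exp (of_real t * z i)) \<in> L" for t :: real
      using sum0 by (simp add: L_def flip: exp_sum sum_distrib_left)
     ultimately show ?thesis by blast
    qed
    show "(\<lambda>i. complex_of_real (x i powr t)) \<in> L" if x: "!!i. x i > 0" "(\<lambda>i. complex_of_real (x i)) \<in> L" for x t
    proof -
     have "complex_of_real (\<Prod>i\<in>UNIV. x i) = 1" unfolding of_real_prod using x(2) by (simp add: L_def)
     then have p: "(\<Prod>i\<in>UNIV. x i) = 1" by (metis of_real_eq_1_iff)
     have "(\<Prod>i\<in>UNIV. x i powr t) = (\<Prod>i\<in>UNIV. x i) powr t"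
      using x(1) by (simp add: prod_powr_distrib less_imp_le)
     then have "(\<Prod>i\<in>UNIV. x i powr t) = 1" by (simp add: p)
     then have "(\<Prod>i\<in>UNIV. complex_of_real (x i powr t)) = 1" by (metis of_real_1 of_real_prod)
     moreover have "x i powr t ~= 0" for i using x(1)[of i] by simp
     ultimately show ?thesis by (simp add: L_def)
    qed
  qed
  have dE: "det (cm E) * det (cm (matrix_inv E)) = 1" using E_inv(1) by (metis det_I det_mul)
  have detd: "det (cm E ** dmat l ** cm (matrix_inv E)) = (\<Prod>i\<in>UNIV. l i)" for l
    unfolding det_mul det_dmat using dE by algebra
  have sub1: "S \<subseteq> diag_group E L"
  proof
    fix g assume g: "g \<in> S"
    define A where "A = cm (matrix_inv E) ** g ** cm E"
    define l where "l i = A $ i $ i" for i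
    have "A = dmat l" using q(2)[OF g] by (auto simp: vec_eq_iff l_def A_def E(2)) (simp add: E_def)?
    then have gl: "g = cm E ** dmat l ** cm (matrix_inv E)" using conj_dmat[of g] by (simp add: A_def)
    have "det g = 1" using g \<open>S \<subseteq> SL\<close> by (auto simp: SL_def)
    then have p: "(\<Prod>i\<in>UNIV. l i) = 1" unfolding gl detd .
    then have "l i ~= 0" for i by (metis finite UNIV_I prod_zero_iff zero_neq_one)
    then have "l \<in> L" using p by (simp add: L_def)
    then show "g \<in> diag_group E L" using gl by (auto simp: diag_group_def)
  qed
  have sub2: "diag_group E L \<subseteq> SL" by (auto simp: diag_group_def SL_def detd L_def)
  have "T = {E ** dmat x ** matrix_inv E | x. (\<forall>i. x i > 0) & (\<lambda>i. complex_of_real (x i)) \<in> L}"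
    unfolding S(2) by (rule maximal_torus_eq[OF S(1) sub1 sub2])
  also have "\<dots> = pos_torus SL E"
  proof -
    have dE: "det E * det (matrix_inv E) = 1" using E(1) by (metis det_I det_mul matrix_inv_mult_right)
    have "(\<lambda>i. complex_of_real (x i)) \<in> L \<longleftrightarrow> E ** dmat x ** matrix_inv E \<in> SL" if "\<forall>i. x i > 0" for x
    proof -
     have "det (E ** dmat x ** matrix_inv E) = (\<Prod>i\<in>UNIV. x i)"
      unfolding det_mul det_dmat using dE by algebra
     moreover have "x i ~= 0" for i using that by (metis less_irrefl)
     moreover have "(\<Prod>i\<in>UNIV. complex_of_real (x i)) = 1 \<longleftrightarrow> (\<Prod>i\<in>UNIV. x i) = 1" by (metis of_real_1 of_real_eq_iff of_real_prod)
     ultimately show ?thesis by (simp add: L_def SL_def)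
    qed
    then show ?thesis unfolding pos_torus_def by blast
  qed
  finally show ?thesis using E(1) by blast
qed

section \<open>Forms over fields\<close>

definition polar_matrix :: "rat^'n^'n => 'a::field_char_0^'n^'n" where
  "polar_matrix A = (\<chi> i j. of_rat (A $ i $ j + A $ j $ i))"

text \<open>The bilinear form of a matrix over an arbitrary field.\<close>

definition pol :: "'a::field_char_0^'n^'n => 'a^'n => 'a^'n => 'a" where
  "pol S x y = (\<Sum>i\<in>UNIV. x $ i * (S *v y) $ i)"

lemma pol_sum: "pol S x y = (\<Sum>i\<in>UNIV. \<Sum>j\<in>UNIV. S $ i $ j * x $ i * y $ j)"
  by (simp add: pol_def matrix_vector_mult_def sum_distrib_left mult_ac)

lemma quad_form_add: "quad_form A (x + y) - quad_form A x - quad_form A y = pol (polar_matrix A) x y"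
proof -
  have "quad_form A (x + y) = quad_form A x + quad_form A y
     + ((\<Sum>i\<in>UNIV. \<Sum>j\<in>UNIV. of_rat (A $ i $ j) * x $ i * y $ j) + (\<Sum>i\<in>UNIV. \<Sum>j\<in>UNIV. of_rat (A $ i $ j) * y $ i * x $ j))"
    unfolding quad_form_def by (simp add: algebra_simps sum.distrib)
  also have "(\<Sum>i\<in>UNIV. \<Sum>j\<in>UNIV. of_rat (A $ i $ j) * y $ i * x $ j) = (\<Sum>i\<in>UNIV. \<Sum>j\<in>UNIV. of_rat (A $ j $ i) * x $ i * y $ j)"
    by (subst sum.swap) (simp add: mult_ac)
  finally show ?thesis
    by (simp add: pol_sum polar_matrix_def of_rat_add algebra_simps sum.distrib)
qed

lemma pol_self: "pol (polar_matrix A) x x = 2 * quad_form A x"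
proof -
  have "quad_form A (x + x) = 4 * quad_form A x"
    unfolding quad_form_def sum_distrib_left by (intro sum.cong refl) (simp add: algebra_simps)
  then show ?thesis using quad_form_add[of A x x] by simp
qed

lemma pol_isometry: "pol S (g *v x) (g *v y) = pol (transpose g ** S ** g) x y"
proof -
  have dot: "(\<Sum>i\<in>UNIV. (g *v x) $ i * z $ i) = (\<Sum>i\<in>UNIV. x $ i * (transpose g *v z) $ i)" for z
  proof -
    have "(\<Sum>i\<in>UNIV. (g *v x) $ i * z $ i) = (\<Sum>i\<in>UNIV. \<Sum>j\<in>UNIV. x $ j * (g $ i $ j * z $ i))"
     unfolding matrix_vector_mult_def by (simp add: sum_distrib_right) (intro sum.cong refl, simp add: mult_ac)
    also have "\<dots> = (\<Sum>j\<in>UNIV. \<Sum>i\<in>UNIV. x $ j * (g $ i $ j * z $ i))" by (rule sum.swap)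
    also have "\<dots> = (\<Sum>i\<in>UNIV. x $ i * (transpose g *v z) $ i)"
     unfolding matrix_vector_mult_def transpose_def by (simp add: sum_distrib_left)
    finally show ?thesis .
  qed
  have "S *v (g *v y) = (S ** g) *v y" by (rule matrix_vector_mul_assoc)
  moreover have "transpose g *v ((S ** g) *v y) = (transpose g ** S ** g) *v y"
    by (simp only: matrix_vector_mul_assoc matrix_mul_assoc)
  ultimately show ?thesis unfolding pol_def dot by simp
qed

lemma pol_axis:
  fixes S :: "'a::field_char_0^'n^'n"
  shows "pol S (axis i 1) (axis j 1) = S $ i $ j"
proof -
  have "S $ k $ l * axis j 1 $ l = (if l = j then S $ k $ l else 0)" for k l by (simp add: axis_def)
  then have "(S *v axis j 1) $ k = S $ k $ j" for k by (simp add: matrix_vector_mult_def)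
  moreover have "(axis i 1 :: 'a^'n) $ k * y = (if k = i then y else 0)" for k y by (simp add: axis_def)
  ultimately show ?thesis unfolding pol_def by simp
qed

lemma quad_form_isometry_iff:
  fixes g :: "'a::field_char_0^'n^'n"
  shows "(\<forall>x. quad_form A (g *v x) = quad_form A x) \<longleftrightarrow> transpose g ** polar_matrix A ** g = polar_matrix A"
proof
  assume q: "\<forall>x. quad_form A (g *v x) = quad_form A x"
  have eq: "pol (transpose g ** polar_matrix A ** g) x y = pol (polar_matrix A) x y" for x y :: "'a^'n"
  proof -
    have "quad_form A (g *v x + g *v y) = quad_form A (x + y)"
     using q[rule_format, of "x + y"] by (simp only: matrix_vector_right_distrib)
    then show ?thesis
     unfolding pol_isometry[symmetric] quad_form_add[symmetric] using q by simp
  qed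
  have "(transpose g ** polar_matrix A ** g) $ i $ j = (polar_matrix A :: 'a^'n^'n) $ i $ j" for i j
    using eq[of "axis i 1" "axis j 1"] by (simp only: pol_axis)
  then show "transpose g ** polar_matrix A ** g = polar_matrix A" by (simp only: vec_eq_iff) simp
next
  assume e: "transpose g ** polar_matrix A ** g = polar_matrix A"
  show "\<forall>x. quad_form A (g *v x) = quad_form A x"
  proof
    fix x
    have "2 * quad_form A (g *v x) = 2 * quad_form A x" unfolding pol_self[symmetric] pol_isometry e ..
    then show "quad_form A (g *v x) = quad_form A x" by simp
  qed
qed

lemma SO_iff: "g \<in> SO A \<longleftrightarrow> det g = 1 & transpose g ** polar_matrix A ** g = polar_matrix A"
  unfolding SO_def using quad_form_isometry_iff by auto

lemma SO_real: "(SO A :: (real^'n^'n) set) = isometries (polar_matrix A)"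
  unfolding isometries_def using SO_iff by blast

lemma pol_real: "pol S x y = bil S x y" for S :: "real^'n^'n"
  by (simp add: pol_def bil_def inner_vec_def)

lemma polar_matrix_symmetric: "transpose (polar_matrix A) = polar_matrix A"
  by (simp add: vec_eq_iff transpose_def polar_matrix_def add.commute)

lemma complex_of_real_of_rat: "complex_of_real (of_rat q) = of_rat q"
  by (cases q) (simp add: of_rat_rat)

lemma polar_matrix_complex: "polar_matrix A = cm (polar_matrix A)"
  by (simp add: vec_eq_iff polar_matrix_def complex_of_real_of_rat)

lemma rational_polar_matrix: "rational_matrix (polar_matrix A)"
  by (simp add: rational_matrix_def polar_matrix_def)

lemma det_of_rat: "det (polar_matrix A :: 'a::field_char_0^'n^'n) = of_rat (det (polar_matrix A :: rat^'n^'n))"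
  by (simp add: det_def polar_matrix_def of_rat_sum of_rat_mult of_rat_prod)

lemma nondegenerate_polar:
  assumes "nondegenerate_form (quad_form A :: rat^'n => rat)"
  shows "sym_form (polar_matrix A :: real^'n^'n)"
proof
  show "transpose (polar_matrix A) = (polar_matrix A :: real^'n^'n)" by (rule polar_matrix_symmetric)
  have "det (polar_matrix A :: rat^'n^'n) ~= 0"
  proof
    assume "det (polar_matrix A :: rat^'n^'n) = 0"
    then have "\<not> invertible (polar_matrix A :: rat^'n^'n)" by (simp add: invertible_det_nz)
    then have "\<not> (\<exists>B. B ** (polar_matrix A :: rat^'n^'n) = mat 1)"
     unfolding invertible_def by (metis matrix_left_right_inverse)
    then obtain x :: "rat^'n" where x: "polar_matrix A *v x = 0" "x ~= 0" using matrix_left_invertible_ker by blast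
    have "quad_form A (x + y) - quad_form A x - quad_form A y = 0" for y
    proof -
     have "quad_form A (x + y) - quad_form A x - quad_form A y = pol (polar_matrix A) y x"
      using quad_form_add[of A y x] by (simp add: add.commute algebra_simps)
     then show ?thesis using x(1) by (simp add: pol_def)
    qed
    then show False using assms x(2) by (auto simp: nondegenerate_form_def)
  qed
  then show "det (polar_matrix A :: real^'n^'n) ~= 0" unfolding det_of_rat[where ?'a = real] by simp
qed

section \<open>Frames of weight vectors\<close>

definition cv :: "real^'n => complex^'n" where "cv x = (\<chi> i. complex_of_real (x $ i))"

lemma cv_nth [simp]: "cv x $ i = complex_of_real (x $ i)" by (simp add: cv_def)

lemma cv_simps: "cv (x + y) = cv x + cv y" "cv (x - y) = cv x - cv y" "cv (c *\<^sub>R x) = complex_of_real c *s cv x" "cv 0 = 0"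
  by (simp_all add: vec_eq_iff)

lemma cm_cv: "cm A *v cv x = cv (A *v x)"
  by (simp add: vec_eq_iff matrix_vector_mult_def)

lemma pol_cv: "pol (cm S) (cv x) (cv y) = complex_of_real (bil S x y)"
  by (simp add: pol_def cm_cv bil_def inner_vec_def)

lemma pol_scale: "pol S (a *s x) (b *s y) = a * b * pol S x y"
  by (simp add: pol_sum sum_distrib_left mult_ac)

text \<open>A real eigenvector common to all elements of \<open>U\<close>, together with its character.\<close>

definition weight_vector :: "(complex^'n^'n) set => (complex^'n^'n => complex) => real^'n => bool" where
  "weight_vector U \<chi>' x \<longleftrightarrow> (\<forall>g\<in>U. g *v cv x = \<chi>' g *s cv x)"

lemma weight_0: "weight_vector U w 0" by (simp add: weight_vector_def cv_simps)

lemma weight_add: "weight_vector U w x ==> weight_vector U w y ==> weight_vector U w (x + y)"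
  by (simp add: weight_vector_def cv_simps matrix_vector_right_distrib vector_add_ldistrib)

lemma weight_scale: "weight_vector U w x ==> weight_vector U w (c *\<^sub>R x)"
  by (simp add: weight_vector_def cv_simps vector_scalar_commute vector_smult_assoc mult.commute)

lemma weight_cong: "weight_vector U w x ==> (!!g. g \<in> U ==> w g = w' g) ==> weight_vector U w' x"
  by (simp add: weight_vector_def)

lemma weight_sum: "(!!i. i \<in> A ==> weight_vector U w (f i)) ==> weight_vector U w (sum f A)"
  by (induction A rule: infinite_finite_induct) (auto intro: weight_0 weight_add)

lemma weight_diff: "weight_vector U w x ==> weight_vector U w y ==> weight_vector U w (x - y)"
  using weight_add[OF _ weight_scale[of U w y "-1"], of x] by simp

text \<open>A diagonalizable and Zariski connected group of isometries, with a spanning family of weight vectors.\<close>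

locale split_isometries = sym_form S for S :: "real^'n^'n" +
  fixes U :: "(complex^'n^'n) set" and v :: "'n => real^'n" and chr :: "'n => complex^'n^'n => complex"
  assumes preserves: "g \<in> U ==> pol (cm S) (g *v a) (g *v b) = pol (cm S) a b"
    and one_U: "mat 1 \<in> U"
    and connected_U: "connectedin zariski_topology U"
    and weight_v: "weight_vector U (chr j) (v j)"
    and span_v: "span (range v) = UNIV"
begin

text \<open>Vectors that are not orthogonal have inverse weights.\<close>

lemma weight_pair:
  assumes "weight_vector U w x" "weight_vector U w' y" "B x y ~= 0" "g \<in> U"
  shows "w g * w' g = 1"
proof -
  have "w g * w' g * complex_of_real (B x y) = pol (cm S) (g *v cv x) (g *v cv y)"
    using assms(1,2,4) by (simp add: weight_vector_def pol_scale pol_cv)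
  also have "\<dots> = complex_of_real (B x y)" using preserves[OF assms(4)] by (simp add: pol_cv)
  finally show ?thesis using assms(3) by simp
qed

text \<open>A character with values in \<open>{1, - 1}\<close> is constant on a Zariski connected group.\<close>

lemma weight_square_one:
  assumes w: "weight_vector U w x" and x: "x ~= 0" and sq: "!!g. g \<in> U ==> w g * w g = 1" and g: "g \<in> U"
  shows "w g = 1"
proof (rule ccontr)
  assume ng: "w g ~= 1"
  obtain a where a: "x $ a ~= 0" using x by (auto simp: vec_eq_iff)
  define p where "p g = inverse (complex_of_real (x $ a)) * (\<Sum>j\<in>UNIV. g $ a $ j * complex_of_real (x $ j))"
    for g :: "complex^'n^'n"
  have p: "(\<lambda>g. p g) \<in> matrix_poly UNIV" unfolding p_def
    by (intro matrix_poly.mult matrix_poly.const matrix_poly_sum matrix_poly.entry) auto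
  have pw: "p h = w h" if "h \<in> U" for h
  proof -
    have "(\<Sum>j\<in>UNIV. h $ a $ j * complex_of_real (x $ j)) = (h *v cv x) $ a" by (simp add: matrix_vector_mult_def)
    also have "h *v cv x = w h *s cv x" using w that by (simp add: weight_vector_def)
    finally show ?thesis using a by (simp add: p_def)
  qed
  have p1: "p (mat 1) = 1"
  proof -
    have "(\<Sum>j\<in>UNIV. mat 1 $ a $ j * complex_of_real (x $ j)) = (mat 1 *v cv x) $ a" by (simp add: matrix_vector_mult_def)
    then show ?thesis using a by (simp add: p_def)
  qed
  have pm: "p h = 1 \<or> p h = - 1" if "h \<in> U" for h
    using sq[OF that] pw[OF that] by (metis power2_eq_square power2_eq_1_iff)
  have o1: "openin zariski_topology {h. p h + 1 ~= 0}"
    by (rule openin_zariski[OF matrix_poly.add[OF p matrix_poly.const[of 1 UNIV]]]) simp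
  have o2: "openin zariski_topology {h. p h - 1 ~= 0}"
    by (rule openin_zariski[OF matrix_poly_minus_const[OF p]]) simp
  have c1: "U \<subseteq> {h. p h + 1 ~= 0} \<union> {h. p h - 1 ~= 0}"
  proof
    fix h assume "h \<in> U"
    then have "p h = 1 \<or> p h = - 1" by (rule pm)
    then show "h \<in> {h. p h + 1 ~= 0} \<union> {h. p h - 1 ~= 0}" by auto
  qed
  have c2: "{h. p h + 1 ~= 0} \<inter> {h. p h - 1 ~= 0} \<inter> U = {}" using pm by fastforce
  have c3: "mat 1 \<in> {h. p h + 1 ~= 0} \<inter> U" using one_U p1 by simp
  have c4: "g \<in> {h. p h - 1 ~= 0} \<inter> U" using g ng pw[OF g] by simp
  show False using connected_U o1 o2 c1 c2 c3 c4 unfolding connectedin by blast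
qed

lemma rest_weight:
  assumes fr: "frame S m N w e" and e: "!!k. k < N ==> \<exists>u. weight_vector U u (e k)" and x: "weight_vector U u' x"
  shows "weight_vector U u' (rest m N w e x)"
  unfolding rest_def
proof (rule weight_diff[OF x], rule weight_sum)
  fix k assume "k \<in> {..<N}"
  then have k: "k < N" by simp
  have p: "partner m k < N" using fr k partner_less by (auto simp: frame_def)
  obtain u1 u2 where u: "weight_vector U u1 (e k)" "weight_vector U u2 (e (partner m k))" using e k p by meson
  show "weight_vector U u' ((B x (e (partner m k)) / w k) *\<^sub>R e k)"
  proof (cases "B x (e (partner m k)) = 0")
    case True
    then show ?thesis by (simp add: weight_0)
  next
    case False
    have "B (e k) (e (partner m k)) = w k" "w k ~= 0" using fr k p by (simp_all add: frame_def)
    then have n: "B (e k) (e (partner m k)) ~= 0" by simp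
    have "u1 g = u' g" if "g \<in> U" for g
    proof -
     have "u' g * u2 g = 1" "u1 g * u2 g = 1" using weight_pair[OF x u(2) False that] weight_pair[OF u n that] .
     then show ?thesis by (metis mult_cancel_right mult_zero_right zero_neq_one)
    qed
    from weight_cong[OF u(1) this] show ?thesis by (rule weight_scale)
  qed
qed

lemma rest_linear: "linear (rest m N w e)"
  by (rule linearI) (simp_all add: rest_def B_simps add_divide_distrib scaleR_add_left sum.distrib scaleR_sum_right algebra_simps)

text \<open>An isotropic weight vector orthogonal to the frame has a weight vector that is not orthogonal to it; correcting the latter by a multiple of the former gives another hyperbolic pair.\<close>

lemma hyperbolic_extension:
  assumes fr: "frame S m (2 * m) (\<lambda>_. 1) e" and e: "!!k. k < 2 * m ==> \<exists>u. weight_vector U u (e k)"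
    and x: "weight_vector U u x" "x ~= 0" "B x x = 0" "!!j. j < 2 * m ==> B x (e j) = 0"
  shows "\<exists>e'. frame S (Suc m) (2 * Suc m) (\<lambda>_. 1) e' & (\<forall>k<2 * Suc m. \<exists>u. weight_vector U u (e' k))"
proof -
  have "\<exists>j. B x (v j) ~= 0"
  proof (rule ccontr)
    assume "\<not> ?thesis"
    then have "range v \<subseteq> {y. B x y = 0}" by auto
    moreover have "subspace {y. B x y = 0}" by (simp add: subspace_def B_simps)
    ultimately have "span (range v) \<subseteq> {y. B x y = 0}" by (rule span_minimal)
    then have "B x y = 0" for y using span_v by auto
    then have "x = 0" by (rule B_nondegenerate)
    then show False using x(2) by simp
  qed
  then obtain j where j: "B x (v j) ~= 0" by blast
  define y where "y = rest m (2 * m) (\<lambda>_. 1) e (v j)"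
  define c where "c = B x y"
  have c: "c = B x (v j)" "c ~= 0" using j B_rest_right[OF fr x(4)] by (simp_all add: c_def y_def)
  have wy: "weight_vector U (chr j) y" unfolding y_def by (rule rest_weight[OF fr e weight_v])
  have oy: "B y (e k) = 0" if "k < 2 * m" for k unfolding y_def by (rule rest_orthogonal(1)[OF fr that])
  define y' where "y' = (1 / c) *\<^sub>R (y - (B y y / (2 * c)) *\<^sub>R x)"
  have wy': "weight_vector U (chr j) y'"
  proof (cases "B y y = 0")
    case True
    then show ?thesis unfolding y'_def using weight_scale[OF wy] by simp
  next
    case False
    have "u g = chr j g" if "g \<in> U" for g
    proof -
     have "u g * chr j g = 1" using weight_pair[OF x(1) wy _ that] c by (simp add: c_def)
     moreover have "chr j g * chr j g = 1" by (rule weight_pair[OF wy wy False that])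
     ultimately show ?thesis by (metis mult_cancel_right mult_zero_right zero_neq_one)
    qed
    then have "weight_vector U (chr j) x" by (rule weight_cong[OF x(1)])
    then show ?thesis unfolding y'_def by (intro weight_scale weight_diff wy)
  qed
  have b1: "B x y' = 1" using c x(3) by (simp add: y'_def B_simps c_def[symmetric])
  have b2: "B y' y' = 0"
    unfolding y'_def using c(2) x(3) B_sym[of y x] by (simp add: B_simps c_def[symmetric] field_simps)
  have o: "B x (e k) = 0 & B y' (e k) = 0" if "k < 2 * m" for k using x(4)[OF that] oy[OF that] by (simp add: y'_def B_simps)
  have "frame S (Suc m) (2 * Suc m) ((\<lambda>_. 1)(2 * m := 1, 2 * m + 1 := 1)) (e(2 * m := x, 2 * m + 1 := y'))"
    by (rule frame_append_pair[OF fr o x(3) b2 b1]) auto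
  moreover have "((\<lambda>_::nat. 1::real)(2 * m := 1, 2 * m + 1 := 1)) = (\<lambda>_. 1)" by auto
  moreover have "\<exists>u. weight_vector U u ((e(2 * m := x, 2 * m + 1 := y')) k)" if kk: "k < 2 * Suc m" for k
  proof -
    have "k < 2 * m \<or> k = 2 * m \<or> k = 2 * m + 1" using kk by presburger
    then show ?thesis using e[of k] x(1) wy' by (elim disjE) auto
  qed
  ultimately show ?thesis by auto
qed

text \<open>A form without isotropic vectors cannot take both signs, since otherwise a quadratic equation would produce an isotropic vector.\<close>

lemma definite_sign:
  assumes V: "subspace V" and an: "!!x. x \<in> V ==> x ~= 0 ==> B x x ~= 0"
  shows "\<exists>\<epsilon>. \<bar>\<epsilon>\<bar> = 1 & (\<forall>x\<in>V. x ~= 0 --> \<epsilon> * B x x > 0)"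
proof -
  have no: False if x: "x \<in> V" "B x x > 0" and y: "y \<in> V" "B y y < 0" for x y
  proof -
    define a b c where "a = B x x" "b = B x y" "c = B y y"
    define D where "D = sqrt (b\<^sup>2 - a * c)"
    have "a * c < 0" using x y by (simp add: a_b_c_def mult_pos_neg)
    then have "a * c \<le> b\<^sup>2" using zero_le_power2[of b] by linarith
    then have D: "D\<^sup>2 = b\<^sup>2 - a * c" by (simp add: D_def)
    define t where "t = (D - b) / c"
    have tc: "t * c = D - b" using y by (simp add: t_def a_b_c_def)
    have "B (x + t *\<^sub>R y) (x + t *\<^sub>R y) = a + 2 * t * b + t * (t * c)"
     using B_sym[of y x] by (simp add: B_simps a_b_c_def algebra_simps)
    moreover have "c * (a + 2 * t * b + t * (t * c)) = 0"
    proof -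
     have "c * (a + 2 * t * b + t * (t * c)) = a * c + 2 * b * (t * c) + (t * c)\<^sup>2" by (simp add: algebra_simps power2_eq_square)
     also have "\<dots> = a * c + D\<^sup>2 - b\<^sup>2" unfolding tc by (simp add: algebra_simps power2_eq_square)
     finally show ?thesis using D by simp
    qed
    ultimately have z: "B (x + t *\<^sub>R y) (x + t *\<^sub>R y) = 0" using y by (simp add: a_b_c_def)
    have "x + t *\<^sub>R y \<in> V" using V x y by (simp add: subspace_add subspace_scale)
    then have "x + t *\<^sub>R y = 0" using an z by blast
    then have "x = (- t) *\<^sub>R y" by (simp add: add_eq_0_iff2)
    then have "B x x = B ((- t) *\<^sub>R y) ((- t) *\<^sub>R y)" by (simp only:)
    then have "B x x = t * t * B y y" unfolding B_scale_left B_scale_right by simp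
    then show False using x y by (metis mult_nonneg_nonpos less_imp_le not_le zero_le_square)
  qed
  show ?thesis
  proof (cases "\<exists>x\<in>V. B x x < 0")
    case True
    then obtain x where x: "x \<in> V" "B x x < 0" by blast
    show ?thesis
    proof (intro exI[of _ "-1"] conjI ballI impI)
     fix y assume y: "y \<in> V" "y ~= 0"
     show "- 1 * B y y > 0" using an[OF y] no[OF y(1) _ x] by (cases "B y y" "0 :: real" rule: linorder_cases) auto
    qed simp
  next
    case False
    then show ?thesis using an by (intro exI[of _ 1]) fastforce
  qed
qed

text \<open>A maximal family of hyperbolic pairs of weight vectors leaves an anisotropic complement. There every weight is its own inverse, hence trivial, and any orthogonal basis of it consists of weight vectors.\<close>

theorem weight_frame:
  "\<exists>m \<epsilon> e. normal_frame m \<epsilon> e & (\<forall>k<CARD('n). \<exists>u. weight_vector U u (e k)) &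
     (\<forall>k<CARD('n). 2 * m \<le> k --> weight_vector U (\<lambda>_. 1) (e k))"
proof -
  define P where "P m \<longleftrightarrow> (\<exists>e. frame S m (2 * m) (\<lambda>_. 1) e & (\<forall>k<2 * m. \<exists>u. weight_vector U u (e k)))" for m
  have P0: "P 0" by (simp add: P_def frame_def)
  have bound: "m \<le> CARD('n)" if "P m" for m using that frame_le[of m "2 * m"] by (fastforce simp: P_def)
  define m where "m = (GREATEST m. P m)"
  have Pm: "P m" unfolding m_def by (rule GreatestI_nat[of P, OF P0 bound])
  have max: "\<not> P (Suc m)"
  proof
    assume "P (Suc m)"
    then have "Suc m \<le> m" unfolding m_def by (rule Greatest_le_nat[of P _ "CARD('n)"]) (rule bound)
    then show False by simp
  qed
  obtain e where fr: "frame S m (2 * m) (\<lambda>_. 1) e" and e: "!!k. k < 2 * m ==> \<exists>u. weight_vector U u (e k)"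
    using Pm by (auto simp: P_def)
  define V where "V = {x. \<forall>j<2 * m. B x (e j) = 0}"
  have V: "subspace V" by (simp add: V_def subspace_def B_simps)
  have an0: "B x x ~= 0" if "x \<in> V" "x ~= 0" "weight_vector U u x" for x u
  proof
    assume z: "B x x = 0"
    have "P (Suc m)" unfolding P_def
     by (rule hyperbolic_extension[OF fr e that(3,2) z]) (use that(1) in \<open>auto simp: V_def\<close>)
    then show False using max by simp
  qed
  define R where "R = rest m (2 * m) (\<lambda>_. 1) e"
  have R: "linear R" unfolding R_def by (rule rest_linear)
  have RV: "R x \<in> V" for x unfolding V_def R_def using rest_orthogonal(1)[OF fr] by blast
  have w1v: "weight_vector U (\<lambda>_. 1) (R (v j))" for j
  proof (cases "R (v j) = 0")
    case True
    then show ?thesis by (simp add: weight_0)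
  next
    case False
    have w: "weight_vector U (chr j) (R (v j))" unfolding R_def by (rule rest_weight[OF fr e weight_v])
    have b: "B (R (v j)) (R (v j)) ~= 0" by (rule an0[OF RV False w])
    have "chr j g = 1" if "g \<in> U" for g
     by (rule weight_square_one[OF w False _ that]) (rule weight_pair[OF w w b])
    from weight_cong[OF w this] show ?thesis .
  qed
  have w1: "weight_vector U (\<lambda>_. 1) x" if "x \<in> V" for x
  proof -
    have "subspace {y. weight_vector U (\<lambda>_. 1) (R y)}"
     using linear_0[OF R] linear_add[OF R] linear_scale[OF R]
     by (auto simp: subspace_def weight_0 intro: weight_add weight_scale)
    moreover have "range v \<subseteq> {y. weight_vector U (\<lambda>_. 1) (R y)}" using w1v by auto
    ultimately have "span (range v) \<subseteq> {y. weight_vector U (\<lambda>_. 1) (R y)}" by (metis span_minimal)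
    then have "weight_vector U (\<lambda>_. 1) (R x)" using span_v by auto
    moreover have "R x = x" unfolding R_def by (rule rest_id) (use that in \<open>auto simp: V_def\<close>)
    ultimately show ?thesis by simp
  qed
  have an: "B x x ~= 0" if "x \<in> V" "x ~= 0" for x using an0[OF that w1[OF that(1)]] .
  obtain \<epsilon> where eps: "\<bar>\<epsilon>\<bar> = 1" "!!x. x \<in> V ==> x ~= 0 ==> \<epsilon> * B x x > 0" using definite_sign[OF V an] by blast
  have ext: "\<exists>f. frame S m N (\<lambda>k. if k < 2 * m then 1 else \<epsilon>) f & (\<forall>k<2 * m. f k = e k)"
    if "2 * m \<le> N" "N \<le> CARD('n)" for N
    using that
  proof (induction N rule: dec_induct)
    case base
    have "frame S m (2 * m) (\<lambda>k. if k < 2 * m then 1 else \<epsilon>) e" using fr by (auto simp: frame_def)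
    then show ?case by blast
  next
    case (step N)
    then obtain f where f: "frame S m N (\<lambda>k. if k < 2 * m then 1 else \<epsilon>) f" "\<forall>k<2 * m. f k = e k" by auto
    have "N < CARD('n)" using step by simp
    from rest_nonzero_if_less[OF f(1) this]
    obtain i where i: "rest m N (\<lambda>k. if k < 2 * m then 1 else \<epsilon>) f (axis i 1) ~= 0" by blast
    define x where "x = rest m N (\<lambda>k. if k < 2 * m then 1 else \<epsilon>) f (axis i 1)"
    have xo: "B x (f j) = 0" if "j < N" for j unfolding x_def by (rule rest_orthogonal(1)[OF f(1) that])
    have "B x (e j) = 0" if "j < 2 * m" for j using xo[of j] f(2) that step(1) by simp
    then have xV: "x \<in> V" by (simp add: V_def)
    have pos: "\<epsilon> * B x x > 0" using eps(2)[OF xV] i by (simp add: x_def)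
    define r where "r = 1 / sqrt \<bar>B x x\<bar>"
    have "r * (r * B x x) = \<epsilon>"
    proof -
     have "r * (r * B x x) = B x x / \<bar>B x x\<bar>" by (simp add: r_def)
     also have "\<dots> = \<epsilon>" using eps(1) pos by (cases "B x x > 0") (auto simp: abs_if zero_less_mult_iff split: if_splits)
     finally show ?thesis .
    qed
    then have bx: "B (r *\<^sub>R x) (r *\<^sub>R x) = \<epsilon>" by (simp add: B_simps)
    have "frame S m (Suc N) ((\<lambda>k. if k < 2 * m then 1 else \<epsilon>)(N := B (r *\<^sub>R x) (r *\<^sub>R x))) (f(N := r *\<^sub>R x))"
     by (rule frame_append[OF f(1)]) (use xo bx eps(1) in \<open>auto simp: B_simps\<close>)
    moreover have "(\<lambda>k. if k < 2 * m then 1 else \<epsilon>)(N := \<epsilon>) = (\<lambda>k. if k < 2 * m then 1 else \<epsilon>)" using step(1) by auto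
    ultimately have "frame S m (Suc N) (\<lambda>k. if k < 2 * m then 1 else \<epsilon>) (f(N := r *\<^sub>R x))" unfolding bx by (simp only:)
    moreover have "\<forall>k<2 * m. (f(N := r *\<^sub>R x)) k = e k" using f(2) step(1) by simp
    ultimately show ?case by blast
  qed
  have "2 * m \<le> CARD('n)" by (rule frame_le[OF fr])
  from ext[OF this] obtain f where f: "frame S m CARD('n) (\<lambda>k. if k < 2 * m then 1 else \<epsilon>) f" "\<forall>k<2 * m. f k = e k" by auto
  have w: "weight_vector U (\<lambda>_. 1) (f k)" if "k < CARD('n)" "2 * m \<le> k" for k
  proof (rule w1)
    have "B (f k) (f j) = 0" if "j < 2 * m" for j
     using f(1) that \<open>k < CARD('n)\<close> \<open>2 * m \<le> k\<close> unfolding frame_def by (auto simp: partner_def)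
    then show "f k \<in> V" using f(2) by (simp add: V_def)
  qed
  have "\<exists>u. weight_vector U u (f k)" if "k < CARD('n)" for k
    using w[OF that] e[of k] f(2) by (cases "k < 2 * m") auto
  then show ?thesis using f(1) eps(1) w unfolding normal_frame_def by blast
qed

end

lemma diag_isometry_iff:
  fixes E S :: "'a::field^'n^'n"
  assumes E: "invertible E" and G: "!!i j. (transpose E ** S ** E) $ i $ j = (if j = \<kappa> i then c i else 0)" and c: "!!i. c i ~= 0"
  shows "transpose (E ** dmat l ** matrix_inv E) ** S ** (E ** dmat l ** matrix_inv E) = S \<longleftrightarrow> (\<forall>i. l i * l (\<kappa> i) = 1)"
proof -
  have t: "transpose (dmat l) = dmat l" by (simp add: vec_eq_iff transpose_def)
  have "(dmat l ** (transpose E ** S ** E) ** dmat l) $ i $ j = l i * l j * (if j = \<kappa> i then c i else 0)" for i j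
    unfolding mult_dmat_nth dmat_mult_nth G by simp
  then have "dmat l ** (transpose E ** S ** E) ** dmat l = transpose E ** S ** E \<longleftrightarrow> (\<forall>i. l i * l (\<kappa> i) = 1)"
    unfolding vec_eq_iff G using c by auto
  then show ?thesis unfolding isometry_conj_iff[OF E] t .
qed

text \<open>In a frame of weight vectors the torus is diagonal, with inverse entries on hyperbolic pairs and one elsewhere. All such matrices form a split torus, which by maximality is the given one.\<close>

theorem maximal_split_torus_SO:
  fixes A :: "rat^'n^'n" and T :: "(real^'n^'n) set"
  assumes nd: "sym_form (polar_matrix A :: real^'n^'n)" and T: "maximal_real_split_torus (SO A) T"
    and ix: "bij_betw ix (UNIV :: 'n set) {..<CARD('n)}"
  shows "\<exists>m \<epsilon> e. sym_form.normal_frame (polar_matrix A) m \<epsilon> e & T = pos_torus (isometries (polar_matrix A)) (cols ix e)"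
proof -
  define S :: "real^'n^'n" where "S = polar_matrix A"
  have pS: "polar_matrix A = cm S" unfolding S_def by (rule polar_matrix_complex)
  obtain U where U: "maximal_real_split_algebraic_torus (SO A) U" "T = connected_component_set (real_points U) (mat 1)"
    using T unfolding maximal_real_split_torus_def by blast
  have U2: "real_split_torus U" "U \<subseteq> SO A" using U(1) unfolding maximal_real_split_algebraic_torus_def by blast+
  have oneU: "mat 1 \<in> U" and conU: "connectedin zariski_topology U" and diU: "real_diagonalizable U"
    using U2(1) unfolding real_split_torus_def real_algebraic_group_def by blast+
  obtain q :: "real^'n^'n" where q: "invertible q" "!!g i j. g \<in> U ==> i ~= j ==> (cm q ** g ** cm (matrix_inv q)) $ i $ j = 0"
    using diU unfolding real_diagonalizable_def by auto
  define E0 where "E0 = matrix_inv q"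
  define v where "v j = (\<chi> a. E0 $ a $ j)" for j
  define chr where "chr j g = (cm q ** g ** cm E0) $ j $ j" for j g
  have q0: "cm E0 ** cm q = mat 1" unfolding E0_def cm_mult[symmetric] using q(1) by (simp add: group_simps)
  have wv: "weight_vector U (chr j) (v j)" for j
    unfolding weight_vector_def
  proof
    fix g assume g: "g \<in> U"
    have D: "cm q ** g ** cm E0 = dmat (\<lambda>i. chr i g)"
     using q(2)[OF g] by (auto simp: vec_eq_iff chr_def E0_def)
    have "g ** cm E0 = (cm E0 ** cm q) ** g ** cm E0" by (simp add: q0)
    also have "\<dots> = cm E0 ** (cm q ** g ** cm E0)" by (simp only: matrix_mul_assoc)
    finally have "(g ** cm E0) $ a $ j = cm E0 $ a $ j * chr j g" for a unfolding D by (simp only: mult_dmat_nth)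
    moreover have "(g *v cv (v j)) $ a = (g ** cm E0) $ a $ j" for a
     by (simp add: matrix_vector_mult_def matrix_matrix_mult_def v_def)
    ultimately show "g *v cv (v j) = chr j g *s cv (v j)" by (simp add: vec_eq_iff v_def)
  qed
  have sv: "span (range v) = UNIV"
  proof -
    have "x \<in> span (range v)" for x
    proof -
     have "x = E0 *v (q *v x)" using q(1) by (simp add: matrix_vector_mul_assoc E0_def group_simps)
     also have "\<dots> = (\<Sum>j\<in>UNIV. (q *v x) $ j *\<^sub>R v j)"
      by (simp add: vec_eq_iff matrix_vector_mult_def[of E0] v_def mult.commute)
     also have "\<dots> \<in> span (range v)" by (intro span_sum span_scale span_base) auto
     finally show ?thesis .
    qed
    then show ?thesis by auto
  qed
  interpret split_isometries S U v chr
  proof (intro split_isometries.intro split_isometries_axioms.intro)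
    show "sym_form S" using nd by (simp add: S_def)
    show "pol (cm S) (g *v a) (g *v b) = pol (cm S) a b" if "g \<in> U" for g a b
    proof -
     have "transpose g ** cm S ** g = cm S" using that U2(2) SO_iff[of g A] unfolding pS by blast
     then show ?thesis by (simp add: pol_isometry)
    qed
  qed (rule oneU conU wv sv)+
  obtain m \<epsilon> e where e: "normal_frame m \<epsilon> e" "!!k. k < CARD('n) ==> \<exists>u. weight_vector U u (e k)"
    "!!k. k < CARD('n) ==> 2 * m \<le> k ==> weight_vector U (\<lambda>_. 1) (e k)" using weight_frame by blast
  define wt where "wt k = (if k < 2 * m then 1 else \<epsilon>)" for k
  have fr: "frame S m CARD('n) wt e" using e(1) by (simp add: normal_frame_def wt_def[abs_def])
  have wt0: "wt k ~= 0" for k using e(1) by (auto simp: wt_def normal_frame_def)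
  have m: "2 * m \<le> CARD('n)" using fr by (simp add: frame_def)
  have lt: "ix i < CARD('n)" for i using ix by (auto simp: bij_betw_def)
  have inj: "ix i = ix j \<longleftrightarrow> i = j" for i j using ix by (auto simp: bij_betw_def inj_eq)
  define \<kappa> where "\<kappa> i = the_inv_into UNIV ix (partner m (ix i))" for i
  have k: "ix (\<kappa> i) = partner m (ix i)" for i
    unfolding \<kappa>_def by (rule f_the_inv_into_f_bij_betw[OF ix]) (use partner_less[OF m lt] in simp)
  have kk: "\<kappa> (\<kappa> i) = i" for i using inj k by (metis partner_partner)
  have kfix: "\<kappa> i = i" if "\<not> ix i < 2 * m" for i using that k[of i] inj by (simp add: partner_def)
  have klt: "ix (\<kappa> i) < 2 * m \<longleftrightarrow> ix i < 2 * m" for i using partner_lt kfix kk k by metis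
  define E where "E = cols ix e"
  have E: "invertible E" unfolding E_def by (rule cols_inverse(1)[OF ix fr])
  have G: "(transpose E ** S ** E) $ i $ j = (if j = \<kappa> i then wt (ix i) else 0)" for i j
    unfolding E_def gram_cols using fr lt k[of i] inj[of j "\<kappa> i"] by (auto simp: frame_def)
  define L where "L = {l :: 'n => complex. \<forall>i. l i ~= 0 & (if ix i < 2 * m then l i * l (\<kappa> i) else l i) = 1}"
  define Q where "Q = range (\<lambda>i g. (if ix i < 2 * m then g $ i $ i * g $ \<kappa> i $ \<kappa> i else g $ i $ i) - (1 :: complex))"
  have path: "\<exists>z. (\<forall>i. l i = exp (z i)) & (\<forall>i. z (\<kappa> i) = - z i) & (\<forall>i. \<not> ix i < 2 * m --> z i = 0)" if l: "l \<in> L" for l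
  proof -
    have l0: "l i ~= 0" for i using l by (simp add: L_def)
    have lc: "(if ix i < 2 * m then l i * l (\<kappa> i) else l i) = 1" for i using l unfolding L_def by blast
    have l1: "l i * l (\<kappa> i) = 1" if "ix i < 2 * m" for i using lc[of i] that by simp
    have l2: "l i = 1" if "\<not> ix i < 2 * m" for i using lc[of i] that by simp
    define z where "z i = (if ix i < 2 * m then (if even (ix i) then Ln (l i) else - Ln (l (\<kappa> i))) else 0)" for i
    have "l i = exp (z i)" for i
    proof -
     have "l i = inverse (l (\<kappa> i))" if "ix i < 2 * m" using l1[OF that] l0 by (metis inverse_unique mult.commute)
     then show ?thesis using l0 l2[of i] by (auto simp: z_def exp_minus)
    qed
    moreover have "z (\<kappa> i) = - z i" for i
    proof (cases "ix i < 2 * m")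
     case True
     then have "even (ix (\<kappa> i)) \<longleftrightarrow> odd (ix i)" unfolding k by (auto simp: partner_def elim!: oddE)
     then show ?thesis using True klt[of i] kk[of i] by (simp add: z_def)
    next
     case False
     then show ?thesis using kfix[OF False] by (simp add: z_def)
    qed
    ultimately show ?thesis by (intro exI[of _ z]) (simp add: z_def)
  qed
  have prodL: "(\<Prod>i\<in>UNIV. l i) = 1" if l: "l \<in> L" for l
  proof -
    obtain z where z: "\<forall>i. l i = exp (z i)" "\<forall>i. z (\<kappa> i) = - z i" using path[OF l] by blast
    have "bij \<kappa>" by (rule o_bij[of \<kappa>]) (auto simp: kk)
    then have "(\<Sum>i\<in>UNIV. z (\<kappa> i)) = (\<Sum>i\<in>UNIV. z i)" by (intro sum.reindex_bij_betw)
    then have "(\<Sum>i\<in>UNIV. z i) = 0" using z(2) by (simp add: sum_negf)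
    moreover have "(\<Prod>i\<in>UNIV. l i) = exp (\<Sum>i\<in>UNIV. z i)" using z(1) by (simp add: exp_sum)
    ultimately show ?thesis by simp
  qed
  interpret diagonal_torus E L Q
  proof
    show "invertible E" by (rule E)
    show "Q \<subseteq> matrix_poly \<real>"
     unfolding Q_def
    proof (intro subsetI, elim rangeE, hypsubst)
     fix i
     show "(\<lambda>g. (if ix i < 2 * m then g $ i $ i * g $ \<kappa> i $ \<kappa> i else g $ i $ i) - 1) \<in> matrix_poly \<real>"
      by (cases "ix i < 2 * m") (auto intro!: matrix_poly_minus_const matrix_poly.mult matrix_poly.entry)
    qed
    have "(\<forall>p\<in>Q. p (dmat l) = 0) \<longleftrightarrow> (\<forall>i. (if ix i < 2 * m then l i * l (\<kappa> i) else l i) = 1)" for l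
     unfolding Q_def by simp
    then show "L = {l. (\<forall>i. l i ~= 0) & (\<forall>p\<in>Q. p (dmat l) = 0)}" by (simp only: L_def all_conj_distrib)
    show "(\<lambda>_. 1) \<in> L" by (simp add: L_def)
    show "(\<lambda>i. l i * l' i) \<in> L" if ll: "l \<in> L" "l' \<in> L" for l l'
     unfolding L_def
    proof (intro CollectI allI conjI)
     fix i
     show "l i * l' i ~= 0" using ll by (simp add: L_def)
     have "(if ix i < 2 * m then l i * l (\<kappa> i) else l i) = 1" "(if ix i < 2 * m then l' i * l' (\<kappa> i) else l' i) = 1"
      using ll unfolding L_def by blast+
     then have "(if ix i < 2 * m then l i * l (\<kappa> i) else l i) * (if ix i < 2 * m then l' i * l' (\<kappa> i) else l' i) = 1" by simp
     then show "(if ix i < 2 * m then l i * l' i * (l (\<kappa> i) * l' (\<kappa> i)) else l i * l' i) = 1" by (auto simp: mult_ac split: if_splits)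
    qed
    show "(\<lambda>i. inverse (l i)) \<in> L" if l: "l \<in> L" for l
     unfolding L_def
    proof (intro CollectI allI conjI)
     fix i
     show "inverse (l i) ~= 0" using l by (simp add: L_def)
     have "(if ix i < 2 * m then l i * l (\<kappa> i) else l i) = 1" using l unfolding L_def by blast
     then show "(if ix i < 2 * m then inverse (l i) * inverse (l (\<kappa> i)) else inverse (l i)) = 1"
      by (cases "ix i < 2 * m") (simp_all flip: inverse_mult_distrib)
    qed
    show "\<exists>z. (\<forall>i. l i = exp (z i)) & (\<forall>t::real. (\<lambda>i. exp (of_real t * z i)) \<in> L)" if l: "l \<in> L" for l
    proof -
     obtain z where z: "\<forall>i. l i = exp (z i)" "\<forall>i. z (\<kappa> i) = - z i" "\<forall>i. \<not> ix i < 2 * m --> z i = 0" using path[OF l] by blast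
     have "(\<lambda>i. exp (of_real t * z i)) \<in> L" for t :: real using z(2,3) by (auto simp: L_def exp_minus)
     then show ?thesis using z(1) by blast
    qed
    show "(\<lambda>i. complex_of_real (x i powr t)) \<in> L" if x: "!!i. x i > 0" "(\<lambda>i. complex_of_real (x i)) \<in> L" for x t
     unfolding L_def
    proof (intro CollectI allI conjI)
     fix i
     show "complex_of_real (x i powr t) ~= 0" using x(1)[of i] by simp
     have "(if ix i < 2 * m then complex_of_real (x i) * complex_of_real (x (\<kappa> i)) else complex_of_real (x i)) = 1"
      using x(2) unfolding L_def by blast
     then have "complex_of_real (if ix i < 2 * m then x i * x (\<kappa> i) else x i) = 1"
      by (cases "ix i < 2 * m") (simp_all only: if_True if_False of_real_mult)
     then have "(if ix i < 2 * m then x i * x (\<kappa> i) else x i) = 1" by (metis of_real_eq_1_iff)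
     then have "(if ix i < 2 * m then x i * x (\<kappa> i) else x i) powr t = 1" by simp
     then have "(if ix i < 2 * m then x i powr t * x (\<kappa> i) powr t else x i powr t) = 1"
      using x(1) by (auto simp: powr_mult split: if_splits)
     then show "(if ix i < 2 * m then complex_of_real (x i powr t) * complex_of_real (x (\<kappa> i) powr t) else complex_of_real (x i powr t)) = 1"
      by (cases "ix i < 2 * m") (simp_all only: if_True if_False of_real_mult[symmetric] of_real_1)
    qed
  qed
  have sub1: "U \<subseteq> diag_group E L"
  proof
    fix g assume g: "g \<in> U"
    define u where "u i = (\<lambda>h. if ix i < 2 * m then (SOME u. weight_vector U u (e (ix i))) h else 1)" for i
    have wu: "weight_vector U (u i) (e (ix i))" for i
    proof (cases "ix i < 2 * m")
     case True
     then show ?thesis using someI_ex[OF e(2)[OF lt[of i]]] by (simp add: u_def)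
    next
     case False
     then show ?thesis using e(3)[OF lt[of i]] by (simp add: u_def)
    qed
    define l where "l i = u i g" for i
    have "(g ** cm E) $ a $ i = (cm E ** dmat l) $ a $ i" for a i
    proof -
     have "(g ** cm E) $ a $ i = (g *v cv (e (ix i))) $ a"
      by (simp add: matrix_matrix_mult_def matrix_vector_mult_def E_def cols_def)
     also have "g *v cv (e (ix i)) = l i *s cv (e (ix i))" using wu g by (simp add: weight_vector_def l_def)
     finally show ?thesis by (simp add: mult_dmat_nth E_def cols_def)
    qed
    then have "g ** cm E = cm E ** dmat l" by (simp add: vec_eq_iff)
    then have "g ** (cm E ** cm (matrix_inv E)) = cm E ** dmat l ** cm (matrix_inv E)" by (simp only: matrix_mul_assoc)
    then have ge: "g = cm E ** dmat l ** cm (matrix_inv E)" unfolding E_inv by simp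
    have ll: "l i * l (\<kappa> i) = 1" if "ix i < 2 * m" for i
    proof -
     have "B (e (ix i)) (e (ix (\<kappa> i))) = wt (ix i)" using fr lt k[of i] by (simp add: frame_def) (metis lt)
     then show ?thesis unfolding l_def using weight_pair[OF wu wu _ g, of i "\<kappa> i"] wt0 by simp
    qed
    have "l \<in> L" unfolding L_def
    proof (intro CollectI allI conjI)
     fix i
     have one: "l i = 1" if "\<not> ix i < 2 * m" using that by (simp add: l_def u_def)
     show "l i ~= 0" using ll[of i] one by (metis mult_zero_left zero_neq_one)
     show "(if ix i < 2 * m then l i * l (\<kappa> i) else l i) = 1" using ll[of i] one by simp
    qed
    then show "g \<in> diag_group E L" using ge unfolding diag_group_def by blast
  qed
  have dE: "det (cm E) * det (cm (matrix_inv E)) = 1" using E_inv(1) by (metis det_I det_mul)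
  have detd: "det (cm E ** dmat l ** cm (matrix_inv E)) = (\<Prod>i\<in>UNIV. l i)" for l
    unfolding det_mul det_dmat using dE by algebra
  have Gc: "(transpose (cm E) ** cm S ** cm E) $ i $ j = (if j = \<kappa> i then complex_of_real (wt (ix i)) else 0)" for i j
  proof -
    have "transpose (cm E) ** cm S ** cm E = cm (transpose E ** S ** E)"
     by (simp add: cm_mult) (simp add: vec_eq_iff matrix_matrix_mult_def transpose_def)
    then show ?thesis by (simp add: G)
  qed
  have sub2: "diag_group E L \<subseteq> SO A"
  proof
    fix g assume "g \<in> diag_group E L"
    then obtain l where l: "l \<in> L" "g = cm E ** dmat l ** cm (matrix_inv E)" unfolding diag_group_def by blast
    have ll: "\<forall>i. l i * l (\<kappa> i) = 1"
    proof
     fix i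
     have "l i ~= 0 & (if ix i < 2 * m then l i * l (\<kappa> i) else l i) = 1" using l(1) unfolding L_def by blast
     then show "l i * l (\<kappa> i) = 1" using kfix[of i] by (auto split: if_splits)
    qed
    have "transpose g ** cm S ** g = cm S" unfolding l(2) cm_inv(1)[OF E, symmetric]
     by (rule diag_isometry_iff[OF cm_inv(2)[OF E] Gc, THEN iffD2]) (use wt0 ll in auto)
    moreover have "det g = 1" unfolding l(2) detd by (rule prodL[OF l(1)])
    ultimately show "g \<in> SO A" unfolding SO_iff pS by blast
  qed
  have "T = {E ** dmat x ** matrix_inv E | x. (\<forall>i. x i > 0) & (\<lambda>i. complex_of_real (x i)) \<in> L}"
    unfolding U(2) by (rule maximal_torus_eq[OF U(1) sub1 sub2])
  also have "\<dots> = pos_torus (isometries S) E"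
  proof -
    have dE: "det E * det (matrix_inv E) = 1" using E by (metis det_I det_mul matrix_inv_mult_right)
    have "(\<lambda>i. complex_of_real (x i)) \<in> L \<longleftrightarrow> E ** dmat x ** matrix_inv E \<in> isometries S" if x: "\<forall>i. x i > 0" for x
    proof -
     have d: "det (E ** dmat x ** matrix_inv E) = (\<Prod>i\<in>UNIV. x i)"
      unfolding det_mul det_dmat using dE by algebra
     have iso: "E ** dmat x ** matrix_inv E \<in> isometries S \<longleftrightarrow> (\<Prod>i\<in>UNIV. x i) = 1 & (\<forall>i. x i * x (\<kappa> i) = 1)"
      unfolding isometries_def mem_Collect_eq d by (subst diag_isometry_iff[OF E G wt0]) (rule refl)
     have Lx: "(\<lambda>i. complex_of_real (x i)) \<in> L \<longleftrightarrow> (\<forall>i. x i * x (\<kappa> i) = 1)"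
     proof -
      have r: "complex_of_real a * complex_of_real b = 1 \<longleftrightarrow> a * b = 1" for a b
       by (metis of_real_eq_1_iff of_real_mult)
      have "(x i ~= 0 & (if ix i < 2 * m then x i * x (\<kappa> i) else x i) = 1) = (x i * x (\<kappa> i) = 1)" for i
      proof -
       have "x i > 0" using x by blast
       moreover have "x i * x i = 1 \<longleftrightarrow> x i = 1" using \<open>x i > 0\<close> by (metis mult_1 power2_eq_square power2_eq_1_iff less_asym less_numeral_extra(1) neg_less_0_iff_less)
       ultimately show ?thesis using kfix[of i] by auto
      qed
      moreover have "(complex_of_real (x i) ~= 0 & (if ix i < 2 * m then complex_of_real (x i) * complex_of_real (x (\<kappa> i)) else complex_of_real (x i)) = 1)
       = (x i ~= 0 & (if ix i < 2 * m then x i * x (\<kappa> i) else x i) = 1)" for i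
       using r[of "x i" "x (\<kappa> i)"] by simp
      ultimately show ?thesis unfolding L_def by simp
     qed
     have "(\<Prod>i\<in>UNIV. x i) = 1" if "(\<lambda>i. complex_of_real (x i)) \<in> L"
     proof -
      have "complex_of_real (\<Prod>i\<in>UNIV. x i) = 1" unfolding of_real_prod by (rule prodL[OF that])
      then show ?thesis by (metis of_real_eq_1_iff)
     qed
     then show ?thesis using iso Lx by blast
    qed
    then show ?thesis unfolding pos_torus_def by blast
  qed
  finally show ?thesis using e(1) unfolding E_def S_def by blast
qed

section \<open>Conjugating tori\<close>

lemma linear_left_mult: "linear (\<lambda>x. k ** x)" for k :: "real^'n^'n"
  by (rule linearI) (simp_all add: vec_eq_iff matrix_matrix_mult_def algebra_simps sum.distrib sum_distrib_left)

lemma inj_left_mult: "invertible k ==> inj (\<lambda>x. k ** x)" for k :: "real^'n^'n"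
  by (rule inj_on_inverseI[of _ "\<lambda>x. matrix_inv k ** x"]) (rule matrix_cancel(1))

text \<open>Left multiplication by \<open>k\<close> is a linear homeomorphism that carries double cosets of one torus to those of the conjugate torus.\<close>

lemma four_boundary_conj:
  fixes H :: "(real^'n^'n) set"
  assumes H: "matrix_group H" and k: "k \<in> H" and T: "T = (\<lambda>t. k ** t ** matrix_inv k) ` T'"
    and fb: "four_boundary_cosets H T' D"
  shows "four_boundary_cosets H T D"
proof -
  interpret matrix_group H by (rule H)
  have ik: "invertible k" by (rule invertible_H[OF k])
  define f where "f x = k ** x" for x :: "real^'n^'n"
  have lin: "linear f" and inj: "inj f"
    using linear_left_mult[of k] inj_left_mult[OF ik] by (simp_all add: f_def[abs_def])
  have e: "(k ** t ** matrix_inv k) ** f g ** \<delta> = f (t ** g ** \<delta>)" for t g \<delta>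
    unfolding f_def by (simp only: matrix_mul_assoc[symmetric] matrix_cancel(1)[OF ik])
  have dc: "double_coset T D (f g) = f ` double_coset T' D g" for g
  proof (intro set_eqI iffI)
    fix x assume "x \<in> double_coset T D (f g)"
    then obtain t \<delta> where t: "t \<in> T'" "\<delta> \<in> D" "x = (k ** t ** matrix_inv k) ** f g ** \<delta>"
     unfolding double_coset_def T by blast
    have "t ** g ** \<delta> \<in> double_coset T' D g" unfolding double_coset_def using t by blast
    then show "x \<in> f ` double_coset T' D g" unfolding t(3) e by (rule imageI)
  next
    fix x assume "x \<in> f ` double_coset T' D g"
    then obtain t \<delta> where t: "t \<in> T'" "\<delta> \<in> D" "x = f (t ** g ** \<delta>)" unfolding double_coset_def by blast
    then show "x \<in> double_coset T D (f g)" unfolding double_coset_def T t(3) e[symmetric] by blast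
  qed
  obtain g h where g: "g \<in> H"
    and h: "\<forall>i\<in>{1..4::nat}. h i \<in> H & closed (double_coset T' D (h i)) & (\<forall>K. compact K --> (\<exists>t\<in>T'. \<forall>\<delta>\<in>D. t ** h i ** \<delta> \<notin> K))"
    and d: "\<forall>i\<in>{1..4::nat}. \<forall>j\<in>{1..4}. i ~= j --> double_coset T' D (h i) ~= double_coset T' D (h j)"
    and dj: "\<forall>i\<in>{1..4::nat}. double_coset T' D (h i) \<inter> double_coset T' D g = {}"
    and cl: "closure (double_coset T' D g) = double_coset T' D g \<union> (\<Union>i\<in>{1..4::nat}. double_coset T' D (h i))"
    using fb unfolding four_boundary_cosets_def by (elim bexE exE conjE) (rule that; assumption)
  show ?thesis unfolding four_boundary_cosets_def
  proof (rule bexI[of _ "f g"], rule exI[of _ "\<lambda>i. f (h i)"], intro conjI ballI allI impI)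
    show "f g \<in> H" unfolding f_def by (rule mult_H[OF k g])
    show "closure (double_coset T D (f g)) = double_coset T D (f g) \<union> (\<Union>i\<in>{1..4::nat}. double_coset T D (f (h i)))"
     unfolding dc closure_injective_linear_image[OF lin inj, symmetric] cl by blast
    fix i assume i: "i \<in> {1..4::nat}"
    have hi: "h i \<in> H" "closed (double_coset T' D (h i))" using h i by blast+
    show "f (h i) \<in> H" unfolding f_def by (rule mult_H[OF k hi(1)])
    show "closed (double_coset T D (f (h i)))" unfolding dc by (rule closed_injective_linear_image[OF hi(2) lin inj])
    show "double_coset T D (f (h i)) \<inter> double_coset T D (f g) = {}"
     unfolding dc image_Int[OF inj, symmetric] using dj i by blast
    show "double_coset T D (f (h i)) ~= double_coset T D (f (h j))" if "j \<in> {1..4}" "i ~= j" for j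
     unfolding dc inj_image_eq_iff[OF inj] using d i that by blast
    fix K :: "(real^'n^'n) set" assume K: "compact K"
    have "compact ((\<lambda>x. matrix_inv k ** x) ` K)"
     by (rule compact_continuous_image[OF _ K]) (intro linear_continuous_on linear_left_mult[THEN linear_conv_bounded_linear[THEN iffD1]])
    then obtain t where t: "t \<in> T'" "\<forall>\<delta>\<in>D. t ** h i ** \<delta> \<notin> (\<lambda>x. matrix_inv k ** x) ` K" using h i by blast
    show "\<exists>t\<in>T. \<forall>\<delta>\<in>D. t ** f (h i) ** \<delta> \<notin> K"
    proof (intro bexI[of _ "k ** t ** matrix_inv k"] ballI notI)
     show "k ** t ** matrix_inv k \<in> T" unfolding T using t(1) by (rule imageI)
     fix \<delta> assume d: "\<delta> \<in> D" "(k ** t ** matrix_inv k) ** f (h i) ** \<delta> \<in> K"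
     have "matrix_inv k ** f (t ** h i ** \<delta>) = t ** h i ** \<delta>" unfolding f_def by (rule matrix_cancel(1)[OF ik])
     then show False using d t(2) unfolding e by (metis imageI)
    qed
  qed
qed

lemma pos_torus_conj:
  fixes H :: "(real^'n^'n) set"
  assumes H: "matrix_group H" and k: "k \<in> H" and E: "invertible E"
  shows "pos_torus H (k ** E) = (\<lambda>t. k ** t ** matrix_inv k) ` pos_torus H E"
proof -
  interpret matrix_group H by (rule H)
  have ik: "invertible k" by (rule invertible_H[OF k])
  have e: "(k ** E) ** dmat l ** matrix_inv (k ** E) = k ** (E ** dmat l ** matrix_inv E) ** matrix_inv k" for l
    unfolding matrix_inv_mult[OF ik E] by (simp only: matrix_mul_assoc)
  have inv: "matrix_inv k ** (k ** t ** matrix_inv k) ** k = t" for t :: "real^'n^'n"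
    by (simp only: matrix_mul_assoc[symmetric] matrix_cancel(1)[OF ik] matrix_inv_mult_left[OF ik] matrix_mul_rid)
  show ?thesis
  proof (intro set_eqI iffI)
    fix x assume "x \<in> pos_torus H (k ** E)"
    then obtain l where l: "x \<in> H" "!!i. l i > 0" "x = (k ** E) ** dmat l ** matrix_inv (k ** E)" unfolding pos_torus_def by blast
    have x: "x = k ** (E ** dmat l ** matrix_inv E) ** matrix_inv k" unfolding l(3) by (rule e)
    have "E ** dmat l ** matrix_inv E \<in> H" using mult_H[OF mult_H[OF inv_H[OF k] l(1)] k] unfolding x inv .
    then have "E ** dmat l ** matrix_inv E \<in> pos_torus H E" by (rule pos_torusI[OF _ l(2) refl])
    then show "x \<in> (\<lambda>t. k ** t ** matrix_inv k) ` pos_torus H E" unfolding x by (rule imageI)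
  next
    fix x assume "x \<in> (\<lambda>t. k ** t ** matrix_inv k) ` pos_torus H E"
    then obtain t where t: "t \<in> pos_torus H E" "x = k ** t ** matrix_inv k" by blast
    obtain l where l: "t \<in> H" "!!i. l i > 0" "t = E ** dmat l ** matrix_inv E" using t(1) unfolding pos_torus_def by blast
    have "x \<in> H" unfolding t(2) using mult_H[OF mult_H[OF k l(1)] inv_H[OF k]] .
    then show "x \<in> pos_torus H (k ** E)" by (rule pos_torusI[OF _ l(2)]) (unfold t(2) l(3) e, rule refl)
  qed
qed

lemma pos_torus_scale:
  assumes E: "invertible E" and c: "!!i. c i ~= 0"
  shows "pos_torus H (E ** dmat c) = pos_torus H E"
proof -
  have ic: "invertible (dmat c)" by (rule invertible_dmat[OF c])
  have "(E ** dmat c) ** dmat l ** matrix_inv (E ** dmat c) = E ** dmat l ** matrix_inv E" for l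
  proof -
    have "(E ** dmat c) ** dmat l ** matrix_inv (E ** dmat c) = E ** (dmat c ** dmat l) ** (matrix_inv (dmat c) ** matrix_inv E)"
     unfolding matrix_inv_mult[OF E ic] by (simp only: matrix_mul_assoc)
    also have "dmat c ** dmat l = dmat l ** dmat c" by (simp add: dmat_mult mult.commute)
    also have "E ** (dmat l ** dmat c) ** (matrix_inv (dmat c) ** matrix_inv E) = E ** dmat l ** matrix_inv E"
     by (simp only: matrix_mul_assoc[symmetric] matrix_cancel(2)[OF ic])
    finally show ?thesis .
  qed
  then show ?thesis unfolding pos_torus_def by simp
qed

lemma pos_torus_permute:
  fixes E :: "real^'n^'n"
  assumes E: "invertible E" and E': "invertible E'" and perm: "!!a i. E' $ a $ i = E $ a $ p i" and p: "!!i. p (p i) = i"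
  shows "pos_torus H E' = pos_torus H E"
proof -
  have e: "E' ** dmat l ** matrix_inv E' = E ** dmat (\<lambda>i. l (p i)) ** matrix_inv E" for l
  proof -
    define X where "X = E ** dmat (\<lambda>i. l (p i)) ** matrix_inv E"
    have XE: "X ** E = E ** dmat (\<lambda>i. l (p i))"
     unfolding X_def by (simp only: matrix_mul_assoc[symmetric] matrix_inv_mult_left[OF E] matrix_mul_rid)
    have "(X ** E') $ a $ i = (E' ** dmat l) $ a $ i" for a i
    proof -
     have "(X ** E') $ a $ i = (X ** E) $ a $ p i" by (simp add: matrix_matrix_mult_def perm)
     also have "\<dots> = (E' ** dmat l) $ a $ i" unfolding XE mult_dmat_nth perm p ..
     finally show ?thesis .
    qed
    then have "X ** E' = E' ** dmat l" by (simp add: vec_eq_iff)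
    then have "X ** (E' ** matrix_inv E') = E' ** dmat l ** matrix_inv E'" by (simp only: matrix_mul_assoc)
    then show ?thesis unfolding matrix_inv_mult_right[OF E'] X_def by simp
  qed
  show ?thesis
  proof (intro set_eqI iffI)
    fix x assume "x \<in> pos_torus H E'"
    then obtain l where l: "x \<in> H" "!!i. l i > 0" "x = E' ** dmat l ** matrix_inv E'" unfolding pos_torus_def by blast
    show "x \<in> pos_torus H E" by (rule pos_torusI[OF l(1), of "\<lambda>i. l (p i)"]) (rule l(2), unfold l(3) e, rule refl)
  next
    fix x assume "x \<in> pos_torus H E"
    then obtain l where l: "x \<in> H" "!!i. l i > 0" "x = E ** dmat l ** matrix_inv E" unfolding pos_torus_def by blast
    show "x \<in> pos_torus H E'" by (rule pos_torusI[OF l(1), of "\<lambda>i. l (p i)"]) (rule l(2), unfold l(3) e p, rule refl)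
  qed
qed

text \<open>Any two eigenbases differ by a matrix of determinant one after rescaling one eigenvector, which does not change the torus.\<close>

lemma SL_any_torus:
  assumes n: "CARD('n::finite) \<ge> 4" and T: "maximal_real_split_torus SL (T :: (real^'n^'n) set)"
  shows "four_boundary_cosets SL T (integer_points SL)"
proof -
  obtain E :: "real^'n^'n" where E: "invertible E" and fb: "four_boundary_cosets SL (pos_torus SL E) (integer_points SL)"
    using SL_four_boundary[OF n] by blast
  obtain E1 :: "real^'n^'n" where E1: "invertible E1" "T = pos_torus SL E1" using maximal_split_torus_SL[OF T] by blast
  have d: "det E ~= 0" "det E1 ~= 0" using E E1 by (simp_all add: invertible_det_nz)
  obtain i0 :: 'n where True by blast
  define c where "c i = (if i = i0 then det E / det E1 else 1)" for i
  have c: "c i ~= 0" for i using d by (simp add: c_def)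
  have pc: "(\<Prod>i\<in>UNIV. c i) = det E / det E1" by (simp add: c_def[abs_def])
  define k where "k = E1 ** dmat c ** matrix_inv E"
  have "det E * det (matrix_inv E) = 1" using E by (metis det_I det_mul matrix_inv_mult_right)
  then have "det k = 1" unfolding k_def det_mul det_dmat pc using d by (simp add: field_simps)
  then have k: "k \<in> SL" by (simp add: SL_def)
  have kE: "k ** E = E1 ** dmat c" unfolding k_def
    by (simp only: matrix_mul_assoc[symmetric] matrix_inv_mult_left[OF E] matrix_mul_rid)
  have "T = (\<lambda>t. k ** t ** matrix_inv k) ` pos_torus SL E"
    unfolding pos_torus_conj[OF matrix_group_SL k E, symmetric] kE pos_torus_scale[OF E1(1) c] by (rule E1(2))
  from four_boundary_conj[OF matrix_group_SL k this fb] show ?thesis .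
qed

context sym_form
begin

text \<open>Normal frames have the same Gram matrix by the law of inertia, so the matrix between them is an isometry.\<close>

lemma frame_isometry:
  assumes ix: "bij_betw ix (UNIV :: 'n set) {..<CARD('n)}" and e: "normal_frame m \<epsilon> e" and f: "normal_frame m' \<epsilon>' f"
  shows "transpose (cols ix e ** matrix_inv (cols ix f)) ** S ** (cols ix e ** matrix_inv (cols ix f)) = S"
proof -
  have fe: "frame S m CARD('n) (\<lambda>k. if k < 2 * m then 1 else \<epsilon>) e" and ff: "frame S m' CARD('n) (\<lambda>k. if k < 2 * m' then 1 else \<epsilon>') f"
    using e f by (simp_all add: normal_frame_def)
  have lt: "ix i < CARD('n)" for i using ix by (auto simp: bij_betw_def)
  have mm: "m = m'" "2 * m < CARD('n) ==> \<epsilon> = \<epsilon>'" using sylvester[OF e f] by blast+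
  define F where "F = cols ix f"
  define E where "E = cols ix e"
  have F: "invertible F" unfolding F_def by (rule cols_inverse(1)[OF ix ff])
  have "(transpose E ** S ** E) $ i $ j = (transpose F ** S ** F) $ i $ j" for i j
  proof -
    have "B (e (ix i)) (e (ix j)) = (if ix j = partner m (ix i) then if ix i < 2 * m then 1 else \<epsilon> else 0)"
     using fe lt by (simp add: frame_def)
    moreover have "B (f (ix i)) (f (ix j)) = (if ix j = partner m (ix i) then if ix i < 2 * m then 1 else \<epsilon>' else 0)"
     using ff lt mm(1) by (simp add: frame_def)
    moreover have "\<epsilon> = \<epsilon>'" if "\<not> ix i < 2 * m" using mm(2) lt[of i] that by linarith
    ultimately show ?thesis unfolding E_def F_def gram_cols by auto
  qed
  then have gram: "transpose E ** S ** E = transpose F ** S ** F" by (simp add: vec_eq_iff)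
  have t: "transpose (matrix_inv F) ** transpose F = mat 1"
    unfolding matrix_transpose_mul[symmetric] matrix_inv_mult_right[OF F] by (rule transpose_mat)
  have "transpose (E ** matrix_inv F) ** S ** (E ** matrix_inv F) = transpose (matrix_inv F) ** (transpose E ** S ** E) ** matrix_inv F"
    unfolding matrix_transpose_mul by (simp only: matrix_mul_assoc)
  also have "\<dots> = (transpose (matrix_inv F) ** transpose F) ** S ** (F ** matrix_inv F)"
    unfolding gram by (simp only: matrix_mul_assoc)
  also have "\<dots> = S" unfolding t matrix_inv_mult_right[OF F] by simp
  finally show ?thesis unfolding E_def F_def .
qed

text \<open>Exchanging the members of a hyperbolic pair changes the determinant of the basis but not the torus. This turns an isometry of determinant minus one into one of determinant one.\<close>

lemma frame_swap:
  assumes ix: "bij_betw ix (UNIV :: 'n set) {..<CARD('n)}" and e: "normal_frame m \<epsilon> e" and m: "m \<ge> 1"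
  shows "\<exists>e'. normal_frame m \<epsilon> e' & pos_torus H (cols ix e') = pos_torus H (cols ix e) & det (cols ix e') = - det (cols ix e)"
proof -
  have fe: "frame S m CARD('n) (\<lambda>k. if k < 2 * m then 1 else \<epsilon>) e" and eps: "\<bar>\<epsilon>\<bar> = 1"
    using e by (simp_all add: normal_frame_def)
  have mn: "2 * m \<le> CARD('n)" using fe by (simp add: frame_def)
  define \<sigma> :: "nat => nat" where "\<sigma> k = (if k = 0 then 1 else if k = 1 then 0 else k)" for k
  have ss: "\<sigma> (\<sigma> k) = k" for k by (simp add: \<sigma>_def)
  have slt: "\<sigma> k < N \<longleftrightarrow> k < N" if "2 \<le> N" for k N using that by (auto simp: \<sigma>_def)
  have ps: "partner m (\<sigma> k) = \<sigma> (partner m k)" for k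
    using m by (auto simp: partner_def \<sigma>_def elim!: oddE evenE)
  define e' where "e' k = e (\<sigma> k)" for k
  have "frame S m CARD('n) (\<lambda>k. if k < 2 * m then 1 else \<epsilon>) e'"
    unfolding frame_def
  proof (intro conjI allI impI)
    show "2 * m \<le> CARD('n)" by (rule mn)
    show "(if k < 2 * m then 1 else \<epsilon>) ~= 0" for k using eps by auto
    fix k k' assume k: "k < CARD('n)" "k' < CARD('n)"
    have l: "\<sigma> k < CARD('n)" "\<sigma> k' < CARD('n)" using k slt m mn by simp_all
    have "B (e (\<sigma> k)) (e (\<sigma> k')) = (if \<sigma> k' = partner m (\<sigma> k) then if \<sigma> k < 2 * m then 1 else \<epsilon> else 0)"
     using fe l by (simp add: frame_def)
    moreover have "\<sigma> k' = partner m (\<sigma> k) \<longleftrightarrow> k' = partner m k" unfolding ps by (metis ss)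
    moreover have "\<sigma> k < 2 * m \<longleftrightarrow> k < 2 * m" using slt m by simp
    ultimately show "B (e' k) (e' k') = (if k' = partner m k then if k < 2 * m then 1 else \<epsilon> else 0)"
     unfolding e'_def by simp
  qed
  then have ne: "normal_frame m \<epsilon> e'" and fe': "frame S m CARD('n) (\<lambda>k. if k < 2 * m then 1 else \<epsilon>) e'"
    using eps by (simp_all add: normal_frame_def)
  have "0 < CARD('n)" "1 < CARD('n)" using m mn by simp_all
  then obtain i0 i1 where i: "ix i0 = 0" "ix i1 = 1" using ix unfolding bij_betw_def by (metis imageE lessThan_iff)
  define p where "p = Transposition.transpose i0 i1"
  have inj: "ix i = ix j \<longleftrightarrow> i = j" for i j using ix by (auto simp: bij_betw_def inj_eq)
  have i01: "i0 ~= i1" using i by auto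
  have px: "ix (p j) = \<sigma> (ix j)" for j
    using i inj[of j i0] inj[of j i1] by (auto simp: p_def Transposition.transpose_def \<sigma>_def)
  have perm: "cols ix e' $ a $ j = cols ix e $ a $ p j" for a j by (simp add: cols_def e'_def px)
  have "pos_torus H (cols ix e') = pos_torus H (cols ix e)"
    by (rule pos_torus_permute[OF cols_inverse(1)[OF ix fe] cols_inverse(1)[OF ix fe'] perm]) (simp add: p_def)
  moreover have "det (cols ix e') = - det (cols ix e)"
  proof -
    have "cols ix e' = (\<chi> a j. cols ix e $ a $ p j)" by (simp add: vec_eq_iff perm)
    moreover have "p permutes UNIV" unfolding p_def by (rule permutes_swap_id) auto
    ultimately have "det (cols ix e') = of_int (sign p) * det (cols ix e)" by (simp add: det_permute_columns)
    then show ?thesis using i01 by (simp add: p_def sign_swap_id)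
  qed
  ultimately show ?thesis using ne by blast
qed

lemma isometries_any_torus:
  assumes rat: "rational_matrix S" and n: "CARD('n) \<ge> 5"
    and W: "subspace W" "!!x. x \<in> W ==> B x x = 0" "dim W \<ge> 2"
    and p: "ratvec p" "p ~= 0" "B p p = 0"
    and ix: "bij_betw ix (UNIV :: 'n set) {..<CARD('n)}"
    and e: "normal_frame m \<epsilon> e" and T: "T = pos_torus (isometries S) (cols ix e)"
  shows "four_boundary_cosets (isometries S) T (integer_points (isometries S))"
proof -
  obtain m' \<epsilon>' c f where m': "2 \<le> m'" and f: "normal_frame m' \<epsilon>' f" and c: "!!k. c k ~= 0"
    and fb: "four_boundary_cosets (isometries S) (pos_torus (isometries S) (cols ix (\<lambda>k. c k *\<^sub>R f k))) (integer_points (isometries S))"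
    using orthogonal_four_boundary[OF rat n W p ix] by blast
  have m1: "m \<ge> 1" using sylvester[OF e f] m' by simp
  define F where "F = cols ix f"
  have ff: "frame S m' CARD('n) (\<lambda>k. if k < 2 * m' then 1 else \<epsilon>') f" using f by (simp add: normal_frame_def)
  have F: "invertible F" unfolding F_def by (rule cols_inverse(1)[OF ix ff])
  have "cols ix (\<lambda>k. c k *\<^sub>R f k) = F ** dmat (\<lambda>i. c (ix i))"
    by (simp add: vec_eq_iff mult_dmat_nth F_def) (simp add: cols_def mult.commute)
  then have fbF: "four_boundary_cosets (isometries S) (pos_torus (isometries S) F) (integer_points (isometries S))"
    using fb pos_torus_scale[OF F, of "\<lambda>i. c (ix i)"] c by simp
  have main: "four_boundary_cosets (isometries S) (pos_torus (isometries S) (cols ix e')) (integer_points (isometries S))"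
    if e': "normal_frame m \<epsilon> e'" and d: "det (cols ix e' ** matrix_inv F) = 1" for e'
  proof -
    define k where "k = cols ix e' ** matrix_inv F"
    have k: "k \<in> isometries S" unfolding isometries_def k_def using d frame_isometry[OF ix e' f] by (simp add: F_def)
    have kF: "k ** F = cols ix e'" unfolding k_def
     by (simp only: matrix_mul_assoc[symmetric] matrix_inv_mult_left[OF F] matrix_mul_rid)
    show ?thesis
     by (rule four_boundary_conj[OF matrix_group_isometries k _ fbF]) (unfold pos_torus_conj[OF matrix_group_isometries k F, symmetric] kF, rule refl)
  qed
  define d where "d = det (cols ix e ** matrix_inv F)"
  have "det S = det (transpose (cols ix e ** matrix_inv F) ** S ** (cols ix e ** matrix_inv F))"
    unfolding F_def frame_isometry[OF ix e f] ..
  also have "\<dots> = d * det S * d" unfolding det_mul det_transpose d_def ..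
  finally have "d * d = 1" using nondegenerate by (simp add: mult.commute mult.left_commute)
  then have "d = 1 \<or> d = - 1" by (metis power2_eq_square power2_eq_1_iff)
  then show ?thesis
  proof
    assume "d = 1"
    then show ?thesis unfolding T using main[OF e] by (simp only: d_def)
  next
    assume d1: "d = - 1"
    obtain e' where e': "normal_frame m \<epsilon> e'" "pos_torus (isometries S) (cols ix e') = pos_torus (isometries S) (cols ix e)"
     "det (cols ix e') = - det (cols ix e)" using frame_swap[OF ix e m1] by blast
    have "det (cols ix e' ** matrix_inv F) = 1" using d1 e'(3) unfolding d_def det_mul by simp
    from main[OF e'(1) this] show ?thesis unfolding T e'(2) .
  qed
qed

end

section \<open>Orbits in the quotient\<close>

context matrix_group
begin

lemma coset_eq_iff: "coset \<Delta> a = coset \<Delta> b \<longleftrightarrow> (\<exists>\<delta>\<in>\<Delta>. a = b ** \<delta>)"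
proof
  assume "coset \<Delta> a = coset \<Delta> b"
  moreover have "a \<in> coset \<Delta> a"
    unfolding coset_def by (rule image_eqI[OF _ one_Delta]) simp
  ultimately show "\<exists>\<delta>\<in>\<Delta>. a = b ** \<delta>" unfolding coset_def by blast
next
  assume "\<exists>\<delta>\<in>\<Delta>. a = b ** \<delta>"
  then obtain \<delta> where d: "\<delta> \<in> \<Delta>" "a = b ** \<delta>" by blast
  show "coset \<Delta> a = coset \<Delta> b"
  proof (intro set_eqI iffI)
    fix x assume "x \<in> coset \<Delta> a"
    then obtain \<gamma> where g: "\<gamma> \<in> \<Delta>" "x = a ** \<gamma>" unfolding coset_def by blast
    have "x = b ** (\<delta> ** \<gamma>)" unfolding g(2) d(2) by (simp only: matrix_mul_assoc)
    then show "x \<in> coset \<Delta> b" unfolding coset_def using mult_Delta[OF d(1) g(1)] by blast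
  next
    fix x assume "x \<in> coset \<Delta> b"
    then obtain \<gamma> where g: "\<gamma> \<in> \<Delta>" "x = b ** \<gamma>" unfolding coset_def by blast
    have "x = a ** (matrix_inv \<delta> ** \<gamma>)" unfolding g(2) d(2)
     by (simp only: matrix_mul_assoc[symmetric] matrix_cancel(2)[OF invertible_Delta[OF d(1)]])
    then show "x \<in> coset \<Delta> a" unfolding coset_def using mult_Delta[OF inv_Delta[OF d(1)] g(1)] by blast
  qed
qed

lemma coset_in_orbit_iff: "coset \<Delta> x \<in> torus_orbit T \<Delta> g \<longleftrightarrow> x \<in> double_coset T \<Delta> g"
  unfolding torus_orbit_def double_coset_def mem_Collect_eq coset_eq_iff by blast

lemma closedin_quotient_iff:
  assumes "closed H"
  shows "closedin (quotient_space H \<Delta>) C \<longleftrightarrow> C \<subseteq> coset \<Delta> ` H & closed {x \<in> H. coset \<Delta> x \<in> C}"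
proof (cases "C \<subseteq> coset \<Delta> ` H")
  case True
  then have "closedin (quotient_space H \<Delta>) C = closedin (top_of_set H) {x \<in> H. coset \<Delta> x \<in> C}"
    using quotient_map_coset[of H \<Delta>] unfolding quotient_map_closedin topspace_quotient_space by simp
  also have "\<dots> = closed {x \<in> H. coset \<Delta> x \<in> C}" using closedin_closed_eq[OF assms] by auto
  finally show ?thesis using True by blast
next
  case False
  then show ?thesis using closedin_subset[of "quotient_space H \<Delta>" C] topspace_quotient_space by auto
qed

text \<open>The sets of bounded cosets are open and exhaust the quotient. They replace a quotient metric in the proof that an orbit is not compact.\<close>

lemma openin_bounded_cosets: "openin (quotient_space H \<Delta>) (coset \<Delta> ` {x \<in> H. norm x < r})"
  unfolding openin_quotient_space
proof
  have eq: "{g \<in> H. coset \<Delta> g \<in> coset \<Delta> ` {x \<in> H. norm x < r}} = H \<inter> (\<Union>\<delta>\<in>\<Delta>. {y. norm (y ** \<delta>) < r})"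
  proof (intro set_eqI iffI)
    fix y assume "y \<in> {g \<in> H. coset \<Delta> g \<in> coset \<Delta> ` {x \<in> H. norm x < r}}"
    then obtain x where x: "y \<in> H" "x \<in> H" "norm x < r" "coset \<Delta> x = coset \<Delta> y" by auto
    obtain \<delta> where "\<delta> \<in> \<Delta>" "x = y ** \<delta>" using x(4) coset_eq_iff by blast
    then show "y \<in> H \<inter> (\<Union>\<delta>\<in>\<Delta>. {y. norm (y ** \<delta>) < r})" using x by auto
  next
    fix y assume "y \<in> H \<inter> (\<Union>\<delta>\<in>\<Delta>. {y. norm (y ** \<delta>) < r})"
    then obtain \<delta> where d: "y \<in> H" "\<delta> \<in> \<Delta>" "norm (y ** \<delta>) < r" by blast
    have "coset \<Delta> (y ** \<delta>) = coset \<Delta> y" unfolding coset_eq_iff using d(2) by blast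
    then have c: "coset \<Delta> y = coset \<Delta> (y ** \<delta>)" by (rule sym)
    have m: "y ** \<delta> \<in> {x \<in> H. norm x < r}" using d mult_H Delta_H by simp
    have "coset \<Delta> y \<in> coset \<Delta> ` {x \<in> H. norm x < r}" unfolding c by (rule imageI[OF m])
    then show "y \<in> {g \<in> H. coset \<Delta> g \<in> coset \<Delta> ` {x \<in> H. norm x < r}}" using d(1) by blast
  qed
  have op: "open (\<Union>\<delta>\<in>\<Delta>. {y :: real^'n^'n. norm (y ** \<delta>) < r})"
    by (intro open_UN ballI open_Collect_less continuous_intros)
  show "openin (top_of_set H) {g \<in> H. coset \<Delta> g \<in> coset \<Delta> ` {x \<in> H. norm x < r}}"
    unfolding eq by (rule openin_open_Int[OF op])
qed auto

lemma compact_orbit_bounded: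
  assumes T: "T \<subseteq> H" and g: "g \<in> H" and c: "compactin (quotient_space H \<Delta>) (torus_orbit T \<Delta> g)"
  shows "\<exists>r. \<forall>t\<in>T. \<exists>\<delta>\<in>\<Delta>. norm (t ** g ** \<delta>) < r"
proof -
  define V where "V k = coset \<Delta> ` {x \<in> H. norm x < real k}" for k :: nat
  have "\<exists>k. coset \<Delta> (t ** g) \<in> V k" if "t \<in> T" for t
  proof -
    obtain k where "norm (t ** g) < real k" using reals_Archimedean2 by blast
    moreover have "t ** g \<in> H" using T g that mult_H by blast
    ultimately show ?thesis unfolding V_def by blast
  qed
  then have "torus_orbit T \<Delta> g \<subseteq> \<Union>(range V)" unfolding torus_orbit_def by blast
  moreover have "\<forall>U\<in>range V. openin (quotient_space H \<Delta>) U" unfolding V_def using openin_bounded_cosets by blast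
  ultimately obtain \<F> where F: "finite \<F>" "\<F> \<subseteq> range V" "torus_orbit T \<Delta> g \<subseteq> \<Union>\<F>"
    using c unfolding compactin_def by blast
  obtain N where N: "finite N" "\<F> = V ` N" using finite_subset_image[OF F(1,2)] by blast
  obtain M where M: "\<forall>k\<in>N. k \<le> M" using N(1) finite_nat_set_iff_bounded_le by blast
  have "\<exists>\<delta>\<in>\<Delta>. norm (t ** g ** \<delta>) < real M" if t: "t \<in> T" for t
  proof -
    have "coset \<Delta> (t ** g) \<in> torus_orbit T \<Delta> g" unfolding torus_orbit_def using t by blast
    then obtain k where k: "k \<in> N" "coset \<Delta> (t ** g) \<in> V k" using F(3) N(2) by blast
    then obtain x where x: "norm x < real k" "coset \<Delta> (t ** g) = coset \<Delta> x" unfolding V_def by blast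
    obtain \<delta> where d: "\<delta> \<in> \<Delta>" "x = t ** g ** \<delta>" using x(2)[symmetric] unfolding coset_eq_iff by blast
    have "real k \<le> real M" using M k(1) by simp
    then have "norm (t ** g ** \<delta>) < real M" using x(1) unfolding d(2) by linarith
    then show ?thesis using d(1) by blast
  qed
  then show ?thesis by blast
qed

theorem four_boundary_orbits_in_quotient:
  assumes cl: "closed H" and T: "T \<subseteq> H" and fb: "four_boundary_cosets H T \<Delta>"
  shows "\<exists>g\<in>H. \<exists>h :: nat => real^'n^'n.
       (\<forall>i\<in>{1..4}. h i \<in> H &
         closedin (quotient_space H \<Delta>) (torus_orbit T \<Delta> (h i)) &
         \<not> compactin (quotient_space H \<Delta>) (torus_orbit T \<Delta> (h i))) &
       (\<forall>i\<in>{1..4}. \<forall>j\<in>{1..4}. i ~= j --> torus_orbit T \<Delta> (h i) ~= torus_orbit T \<Delta> (h j)) &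
       (quotient_space H \<Delta>) closure_of (torus_orbit T \<Delta> g) - torus_orbit T \<Delta> g =
        (\<Union>i\<in>{1..4}. torus_orbit T \<Delta> (h i))"
proof -
  obtain g h where g: "g \<in> H"
    and h: "\<forall>i\<in>{1..4::nat}. h i \<in> H & closed (double_coset T \<Delta> (h i)) & (\<forall>K. compact K --> (\<exists>t\<in>T. \<forall>\<delta>\<in>\<Delta>. t ** h i ** \<delta> \<notin> K))"
    and d: "\<forall>i\<in>{1..4::nat}. \<forall>j\<in>{1..4}. i ~= j --> double_coset T \<Delta> (h i) ~= double_coset T \<Delta> (h j)"
    and dj: "\<forall>i\<in>{1..4::nat}. double_coset T \<Delta> (h i) \<inter> double_coset T \<Delta> g = {}"
    and clo: "closure (double_coset T \<Delta> g) = double_coset T \<Delta> g \<union> (\<Union>i\<in>{1..4::nat}. double_coset T \<Delta> (h i))"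
    using fb unfolding four_boundary_cosets_def by (elim bexE exE conjE) (rule that; assumption)
  have sub: "double_coset T \<Delta> x \<subseteq> H" if "x \<in> H" for x
    unfolding double_coset_def using T that mult_H Delta_H by blast
  have pre: "{y \<in> H. coset \<Delta> y \<in> torus_orbit T \<Delta> x} = double_coset T \<Delta> x" if "x \<in> H" for x
    unfolding coset_in_orbit_iff using sub[OF that] by blast
  have orb: "torus_orbit T \<Delta> x \<subseteq> coset \<Delta> ` H" if "x \<in> H" for x
    unfolding torus_orbit_def using T that mult_H by blast
  have mem: "t ** x \<in> double_coset T \<Delta> x" if "t \<in> T" for t x
  proof -
    have "t ** x = t ** x ** mat 1" by simp
    then show ?thesis unfolding double_coset_def using that one_Delta by blast
  qed
  have hH: "h i \<in> H" if "i \<in> {1..4}" for i using h that by blast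
  define O' where "O' = torus_orbit T \<Delta> g"
  define U where "U = (\<Union>i\<in>{1..4::nat}. torus_orbit T \<Delta> (h i))"
  have sub': "O' \<union> U \<subseteq> coset \<Delta> ` H" unfolding O'_def U_def using orb g hH by blast
  have "{y \<in> H. coset \<Delta> y \<in> O' \<union> U} = closure (double_coset T \<Delta> g)"
    unfolding clo O'_def U_def Un_iff UN_iff coset_in_orbit_iff using sub[OF g] sub[OF hH] by blast
  then have "closedin (quotient_space H \<Delta>) (O' \<union> U)" unfolding closedin_quotient_iff[OF cl] using sub' by simp
  then have c1: "(quotient_space H \<Delta>) closure_of O' \<subseteq> O' \<union> U" by (rule closure_of_minimal[rotated]) blast
  have O_sub: "O' \<subseteq> (quotient_space H \<Delta>) closure_of O'"
    by (rule closure_of_subset) (use orb[OF g] in \<open>simp add: topspace_quotient_space O'_def\<close>)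
  have c2: "U \<subseteq> (quotient_space H \<Delta>) closure_of O'"
  proof -
    let ?P = "{y \<in> H. coset \<Delta> y \<in> (quotient_space H \<Delta>) closure_of O'}"
    have "closed ?P"
     using closedin_closure_of[of "quotient_space H \<Delta>" O'] unfolding closedin_quotient_iff[OF cl] by blast
    moreover have "double_coset T \<Delta> g \<subseteq> ?P" using pre[OF g] O_sub unfolding O'_def by blast
    ultimately have "closure (double_coset T \<Delta> g) \<subseteq> ?P" by (rule closure_minimal[rotated])
    then have "double_coset T \<Delta> (h i) \<subseteq> ?P" if "i \<in> {1..4}" for i using clo that by blast
    then have "coset \<Delta> (t ** h i) \<in> (quotient_space H \<Delta>) closure_of O'" if "t \<in> T" "i \<in> {1..4}" for t i
     using mem[OF that(1), of "h i"] that(2) by blast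
    then show ?thesis unfolding U_def torus_orbit_def by blast
  qed
  have c3: "U \<inter> O' = {}"
  proof -
    have "coset \<Delta> (t ** h i) \<notin> O'" if "t \<in> T" "i \<in> {1..4}" for t i
     unfolding O'_def coset_in_orbit_iff using dj that mem by blast
    then show ?thesis unfolding U_def torus_orbit_def by blast
  qed
  show ?thesis
  proof (intro bexI[of _ g] exI[of _ h] conjI ballI impI)
    show "g \<in> H" by (rule g)
    show "(quotient_space H \<Delta>) closure_of (torus_orbit T \<Delta> g) - torus_orbit T \<Delta> g = (\<Union>i\<in>{1..4}. torus_orbit T \<Delta> (h i))"
     using c1 c2 c3 unfolding O'_def U_def by blast
    fix i assume i: "i \<in> {1..4::nat}"
    show "h i \<in> H" by (rule hH[OF i])
    show "closedin (quotient_space H \<Delta>) (torus_orbit T \<Delta> (h i))"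
     unfolding closedin_quotient_iff[OF cl] pre[OF hH[OF i]] using orb[OF hH[OF i]] h i by blast
    show "\<not> compactin (quotient_space H \<Delta>) (torus_orbit T \<Delta> (h i))"
    proof
     assume "compactin (quotient_space H \<Delta>) (torus_orbit T \<Delta> (h i))"
     from compact_orbit_bounded[OF T hH[OF i] this]
     obtain r where r: "\<forall>t\<in>T. \<exists>\<delta>\<in>\<Delta>. norm (t ** h i ** \<delta>) < r" by blast
     have "compact (cball (0 :: real^'n^'n) r)" by (rule compact_cball)
     then obtain t where t: "t \<in> T" "\<forall>\<delta>\<in>\<Delta>. t ** h i ** \<delta> \<notin> cball 0 r" using h i by blast
     obtain \<delta> where d: "\<delta> \<in> \<Delta>" "norm (t ** h i ** \<delta>) < r" using r t(1) by blast
     have "t ** h i ** \<delta> \<in> cball 0 r" using d(2) by simp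
     then show False using t(2) d(1) by blast
    qed
    show "torus_orbit T \<Delta> (h i) ~= torus_orbit T \<Delta> (h j)" if "j \<in> {1..4}" "i ~= j" for j
    proof
     assume eq: "torus_orbit T \<Delta> (h i) = torus_orbit T \<Delta> (h j)"
     have "double_coset T \<Delta> (h i) = double_coset T \<Delta> (h j)"
      unfolding pre[OF hH[OF i], symmetric] pre[OF hH[OF that(1)], symmetric] eq ..
     then show False using d i that by blast
    qed
  qed
qed

end

section \<open>Ranks of quadratic forms\<close>

text \<open>The maximum that defines the rank is over a finite nonempty set.\<close>

lemma form_rank_attained:
  fixes f :: "('a::field)^'n => 'a"
  assumes "f 0 = 0"
  shows "\<exists>W. totally_isotropic f W & vec.dim W = form_rank f"
proof -
  have "vec.dim ` {W. totally_isotropic f W} \<subseteq> {..CARD('n)}" by (auto simp: dim_subset_UNIV_cart_gen)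
  then have fin: "finite (vec.dim ` {W. totally_isotropic f W})" by (rule finite_subset) simp
  have "totally_isotropic f {0}" using assms by (simp add: totally_isotropic_def vec.subspace_single_0)
  then have ne: "vec.dim ` {W. totally_isotropic f W} ~= {}" by blast
  have "form_rank f \<in> vec.dim ` {W. totally_isotropic f W}"
    unfolding form_rank_def by (rule Max_in[OF fin ne])
  then show ?thesis by auto
qed

lemma of_rat_rat_id: "(of_rat q :: rat) = q"
  by (cases q) (simp add: of_rat_rat Fract_of_int_quotient)

lemma quad_form_0: "quad_form A 0 = 0"
  by (simp add: quad_form_def)

lemma SO_any_torus:
  fixes A :: "rat^'n^'n"
  assumes n: "CARD('n) \<ge> 5" and nd: "nondegenerate_form (quad_form A :: rat^'n => rat)"
    and rk: "form_rank (quad_form A :: real^'n => real) \<ge> 2" and rkq: "form_rank (quad_form A :: rat^'n => rat) \<ge> 1"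
    and T: "maximal_real_split_torus (SO A) T"
  shows "T \<subseteq> SO A & four_boundary_cosets (SO A) T (integer_points (SO A))"
proof -
  interpret sym_form "polar_matrix A :: real^'n^'n" by (rule nondegenerate_polar[OF nd])
  have B2: "B x x = 2 * quad_form A x" for x unfolding pol_real[symmetric] by (rule pol_self)
  obtain W :: "(real^'n) set" where W: "totally_isotropic (quad_form A) W" "vec.dim W = form_rank (quad_form A :: real^'n => real)"
    using form_rank_attained[of "quad_form A :: real^'n => real", OF quad_form_0] by blast
  have W1: "subspace W" "dim W \<ge> 2" "!!x. x \<in> W ==> B x x = 0"
    using W rk B2 by (simp_all add: totally_isotropic_def subspace_vec_eq dim_vec_eq)
  obtain W' :: "(rat^'n) set" where W': "totally_isotropic (quad_form A) W'" "vec.dim W' = form_rank (quad_form A :: rat^'n => rat)"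
    using form_rank_attained[of "quad_form A :: rat^'n => rat", OF quad_form_0] by blast
  have "\<exists>x\<in>W'. x ~= 0"
  proof (rule ccontr)
    assume "\<not> ?thesis"
    then have "W' \<subseteq> vec.span {}" by (auto simp: vec.span_empty)
    then have "vec.dim W' \<le> card ({} :: (rat^'n) set)" by (rule vec.dim_le_card) simp
    then show False using W'(2) rkq by simp
  qed
  then obtain x :: "rat^'n" where x: "x ~= 0" "quad_form A x = 0" using W'(1) unfolding totally_isotropic_def by blast
  define p :: "real^'n" where "p = (\<chi> i. of_rat (x $ i))"
  have p1: "ratvec p" by (simp add: ratvec_def p_def)
  have p2: "p ~= 0" using x(1) by (auto simp: p_def vec_eq_iff)
  have "quad_form A p = of_rat (quad_form A x)"
    unfolding quad_form_def of_rat_sum by (intro sum.cong refl) (simp add: p_def of_rat_mult of_rat_rat_id)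
  then have p3: "B p p = 0" using x(2) B2 by simp
  obtain ix :: "'n => nat" where ix: "bij_betw ix UNIV {..<CARD('n)}"
    using ex_bij_betw_finite_nat[of "UNIV :: 'n set"] by (auto simp: atLeast0LessThan)
  obtain m \<epsilon> e where e: "normal_frame m \<epsilon> e" and Te: "T = pos_torus (isometries (polar_matrix A)) (cols ix e)"
    using maximal_split_torus_SO[OF sym_form_axioms T ix] by blast
  have "four_boundary_cosets (isometries (polar_matrix A)) T (integer_points (isometries (polar_matrix A)))"
    by (rule isometries_any_torus[OF rational_polar_matrix n W1(1,3,2) p1 p2 p3 ix e Te])
  moreover have "T \<subseteq> isometries (polar_matrix A)" unfolding Te pos_torus_def by blast
  ultimately show ?thesis unfolding SO_real by blast
qed

section \<open>The orbit closures\<close>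

theorem corollary1p4:
  fixes G :: "(complex^'n^'n) set" and H \<Delta> T :: "(real^'n^'n) set"
  assumes cases:
    "(\<exists>A :: rat^'n^'n.
      CARD('n) \<ge> 5 &
      nondegenerate_form (quad_form A :: rat^'n => rat) &
      form_rank (quad_form A :: real^'n => real) \<ge> 2 &
      form_rank (quad_form A :: rat^'n => rat) \<ge> 1 &
      G = SO A & H = SO A & \<Delta> = integer_points (SO A)) \<or>
     (CARD('n) \<ge> 4 & G = SL & H = SL & \<Delta> = integer_points SL)"
    and torus: "maximal_real_split_torus G T"
  shows "\<exists>g\<in>H. \<exists>h :: nat => real^'n^'n.
       (\<forall>i\<in>{1..4}. h i \<in> H &
         closedin (quotient_space H \<Delta>) (torus_orbit T \<Delta> (h i)) &
         \<not> compactin (quotient_space H \<Delta>) (torus_orbit T \<Delta> (h i))) &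
       (\<forall>i\<in>{1..4}. \<forall>j\<in>{1..4}. i ~= j --> torus_orbit T \<Delta> (h i) ~= torus_orbit T \<Delta> (h j)) &
       (quotient_space H \<Delta>) closure_of (torus_orbit T \<Delta> g) - torus_orbit T \<Delta> g =
        (\<Union>i\<in>{1..4}. torus_orbit T \<Delta> (h i))"
proof -
  have all: "matrix_group H & closed H & T \<subseteq> H & \<Delta> = integer_points H & four_boundary_cosets H T \<Delta>"
    using cases
  proof (elim disjE exE conjE)
    fix A :: "rat^'n^'n"
    assume A: "CARD('n) \<ge> 5" "nondegenerate_form (quad_form A :: rat^'n => rat)"
     "form_rank (quad_form A :: real^'n => real) \<ge> 2" "form_rank (quad_form A :: rat^'n => rat) \<ge> 1"
     and G: "G = SO A" and H: "H = SO A" and D: "\<Delta> = integer_points (SO A)"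
    have "matrix_group (SO A :: (real^'n^'n) set)" "closed (SO A :: (real^'n^'n) set)"
     unfolding SO_real by (rule matrix_group_isometries closed_isometries)+
    then show ?thesis using SO_any_torus[OF A torus[unfolded G]] unfolding H D by blast
  next
    assume n: "CARD('n) \<ge> 4" and G: "G = SL" and H: "H = SL" and D: "\<Delta> = integer_points SL"
    obtain E where "T = pos_torus SL E" using maximal_split_torus_SL[OF torus[unfolded G]] by blast
    then have "T \<subseteq> SL" unfolding pos_torus_def by blast
    then show ?thesis
     using SL_any_torus[OF n torus[unfolded G]] matrix_group_SL closed_SL unfolding H D by blast
  qed
  have H: "matrix_group H" "closed H" "T \<subseteq> H" using all by blast+
  have D: "\<Delta> = integer_points H" using all by blast
  have "four_boundary_cosets H T \<Delta>" using all by blast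
  then have fb: "four_boundary_cosets H T (integer_points H)" unfolding D .
  show ?thesis unfolding D by (rule matrix_group.four_boundary_orbits_in_quotient[OF H fb])
qed

end
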